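(* There is a family of total functions $f\colon\{-1,1\}^n\to\{0,1\}$ (for infinitely many $n$) with $R_{1/3}(f)\geq Q_{1/3}(f)^{3-o(1)}$.
   Context: $R_{1/3}(f)$ denotes the minimum cost of a randomized query algorithm (a probability distribution over decision trees, cost being the maximum depth) that outputs $f(x)$ with probability at least $2/3$ on every input $x$; $Q_{1/3}(f)$ denotes the minimum worst-case number of queries of a quantum query algorithm that outputs $f(x)$ with probability at least $2/3$ on every input $x$. *)

theory Defs
  imports
    "HOL-Probability.Probability_Mass_Function"
    "HOL-Library.Landau_Symbols"
    "Jordan_Normal_Form.Schur_Decomposition"
begin

definition cube :: "nat \<Rightarrow> (nat \<Rightarrow> int) set" where
  "cube n = {..<n} \<rightarrow>\<^sub>E {-1, 1}"

section \<open>Randomized query complexity\<close>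

(* In Query i l r the algorithm reads x i and goes on with l if the answer is -1
   and with r if it is 1. *)
datatype dtree = Leaf nat | Query nat dtree dtree

fun dtree_eval :: "dtree \<Rightarrow> (nat \<Rightarrow> int) \<Rightarrow> nat" where
  "dtree_eval (Leaf b) x = b"
| "dtree_eval (Query i l r) x = (if x i = -1 then dtree_eval l x else dtree_eval r x)"

fun dtree_depth :: "dtree \<Rightarrow> nat" where
  "dtree_depth (Leaf b) = 0"
| "dtree_depth (Query i l r) = Suc (max (dtree_depth l) (dtree_depth r))"

fun dtree_vars :: "dtree \<Rightarrow> nat set" where
  "dtree_vars (Leaf b) = {}"
| "dtree_vars (Query i l r) = insert i (dtree_vars l \<union> dtree_vars r)"

definition randomized_computes :: "real \<Rightarrow> nat \<Rightarrow> ((nat \<Rightarrow> int) \<Rightarrow> nat) \<Rightarrow> nat \<Rightarrow> bool" where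
  "randomized_computes \<epsilon> n f T \<longleftrightarrow>
     (\<exists>p :: dtree pmf.
        (\<forall>t \<in> set_pmf p. dtree_vars t \<subseteq> {..<n} \<and> dtree_depth t \<le> T) \<and>
        (\<forall>x \<in> cube n. measure_pmf.prob p {t. dtree_eval t x = f x} \<ge> 1 - \<epsilon>))"

(* For error 0 <= \<epsilon> the minimum exists: querying every variable computes f exactly. *)
definition R_err :: "real \<Rightarrow> nat \<Rightarrow> ((nat \<Rightarrow> int) \<Rightarrow> nat) \<Rightarrow> nat" where
  "R_err \<epsilon> n f = (LEAST T. randomized_computes \<epsilon> n f T)"

section \<open>Quantum query complexity\<close>

definition unitary_mat :: "nat \<Rightarrow> complex mat \<Rightarrow> bool" where
  "unitary_mat d U \<longleftrightarrow> U \<in> carrier_mat d d \<and> mat_adjoint U * U = 1\<^sub>m d"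

(* The state space has the basis |i,w> with query register i in {0..n} and workspace
   register w < m; the pair (i,w) is encoded as the index i * m + w < (n+1) * m.
   The oracle is the phase oracle of x : |i,w> is sent to x_i |i,w> for i < n, and the
   additional value i = n is a null query, which leaves the state unchanged.  With the
   null query this has the same power, query for query, as the oracle
   |i,b> -> |i, b XOR y_i> for x_i = (-1)^(y_i): in the Hadamard basis of the target qubit,
   the latter is the phase query on |-> and the null query on |+>. *)
definition query_oracle :: "nat \<Rightarrow> nat \<Rightarrow> (nat \<Rightarrow> int) \<Rightarrow> complex mat" where
  "query_oracle n m x = mat ((n + 1) * m) ((n + 1) * m)
     (\<lambda>(j, k). if j = k then (if j div m < n then of_int (x (j div m)) else 1) else 0)"

(* State after t queries of the algorithm U_t O_x U_{t-1} O_x ... O_x U_0 |0>. *)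
primrec query_state ::
  "nat \<Rightarrow> nat \<Rightarrow> (nat \<Rightarrow> complex mat) \<Rightarrow> (nat \<Rightarrow> int) \<Rightarrow> nat \<Rightarrow> complex vec" where
  "query_state n m U x 0 = U 0 *\<^sub>v unit_vec ((n + 1) * m) 0"
| "query_state n m U x (Suc t) = U (Suc t) *\<^sub>v (query_oracle n m x *\<^sub>v query_state n m U x t)"

(* The final state is measured in the computational basis; outcome j yields the output g j. *)
definition quantum_computes :: "real \<Rightarrow> nat \<Rightarrow> ((nat \<Rightarrow> int) \<Rightarrow> nat) \<Rightarrow> nat \<Rightarrow> bool" where
  "quantum_computes \<epsilon> n f T \<longleftrightarrow>
     (\<exists>(m :: nat) (U :: nat \<Rightarrow> complex mat) (g :: nat \<Rightarrow> nat).
        m \<ge> 1 \<and> (\<forall>t \<le> T. unitary_mat ((n + 1) * m) (U t)) \<and>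
        (\<forall>x \<in> cube n.
           (\<Sum>j | j < (n + 1) * m \<and> g j = f x. (cmod (query_state n m U x T $ j))\<^sup>2) \<ge> 1 - \<epsilon>))"

(* For error 0 <= \<epsilon> the minimum exists: n queries determine the whole input. *)
definition Q_err :: "real \<Rightarrow> nat \<Rightarrow> ((nat \<Rightarrow> int) \<Rightarrow> nat) \<Rightarrow> nat" where
  "Q_err \<epsilon> n f = (LEAST T. quantum_computes \<epsilon> n f T)"

end

theory Submission
  imports Defs "HOL-Probability.Probability" "HOL-Real_Asymp.Real_Asymp"
begin

text \<open>The hard promise problem chains \<open>2 h\<close> noisy copies of a random sign matrix: a classical
  algorithm with nearly \<open>N\<close> queries cannot tell the chain from uniform bits, because the Fourier
  coefficients of the chain are small (hypercontractivity) and a decision tree of depth \<open>d\<close> has small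
  level-\<open>l\<close> Fourier weight, whereas the correlation along the chain is a product of contractions and
  therefore has a dual adversary solution of constant size.  Each input bit is composed with an AND
  of ORs of nearly \<open>N\<close> bits, which costs a classical algorithm a factor close to the square of
  \<open>N\<close> and a quantum one a factor close to \<open>N\<close>.  The cheat sheet construction makes the partial
  function total: an array of cells, addressed by the answers to several instances, holds
  certificates.  The dual adversary bound is turned into a quantum algorithm by a catalyst state
  spread over time slots, whose steps are orthogonal extensions of partial isometries.\<close>

section \<open>Hypercontractivity\<close>

text \<open>The costs balance at N, up to powers that vanish as h grows. A bit hidden in a grid of
  about N rows and N columns costs about N^2 classically and N by quantum search; the outer function
  costs nearly N classically and 1 over its gap quantumly. This is N^3 against N. The cheat sheet
  has to respect this balance: a certificate lists about N entries for each of about N outer bits,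
  and a quantum search for a false one among N^2 costs N once more. About 3 log N instances give N^3
  cells, too many to find the right one classically by trying.

  The outer function is the bottleneck. A link between two vectors has a nonzero Fourier coefficient
  only if the set on the target side is at least as large as that on the source side. All links
  point to the middle of the chain, so the outermost blocks, which belong to one link each, carry
  the smallest sets, and N is reduced only to the power h / (h + 1). The linear forms defining a
  link may exceed 1, which makes the product density negative; the Fourier argument is run on this
  signed density, and the true distribution is close to it.\<close>

definition signs :: "'a set \<Rightarrow> ('a \<Rightarrow> real) set" where
  "signs V = V \<rightarrow>\<^sub>E {-1, 1}"

definition av :: "'a set \<Rightarrow> (('a \<Rightarrow> real) \<Rightarrow> real) \<Rightarrow> real" where
  "av V f = (\<Sum>x\<in>signs V. f x) / 2 ^ card V"

text \<open>Positive linear functionals. The average over sign vectors and the average over answer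
  histories both need Minkowski's inequality, which is proved once for this class.\<close>

definition posfun :: "(('b \<Rightarrow> real) \<Rightarrow> real) \<Rightarrow> bool" where
  "posfun E \<longleftrightarrow> (\<forall>f g. (\<forall>x. f x \<le> g x) \<longrightarrow> E f \<le> E g) \<and>
     (\<forall>f g. E (\<lambda>x. f x + g x) = E f + E g) \<and> (\<forall>c f. E (\<lambda>x. c * f x) = c * E f)"

text \<open>With m = i + Suc d, passing from i to Suc i multiplies the binomial on the left by
  (2d+1)/(2i+1) times the factor gained by the binomial on the right, and this quotient is at most
  2m.\<close>

lemma binomial_even_le: "i \<le> m \<Longrightarrow> (2*m choose (2*i)) \<le> (m choose i) * (2*m)^i"
proof (induction i)
  case (Suc i)
  have s: "Suc k * (n choose Suc k) = (n - k) * (n choose k)" for n k :: nat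
    by (metis binomial_absorb_comp binomial_absorption)
  obtain d where m: "m = i + Suc d" using Suc.prems by (metis add_Suc_right less_iff_Suc_add Suc_le_eq)
  define M where "M = 2 * m"
  define A B C where "A = (M choose (2*i))" and "B = (M choose Suc (2*i))" and "C = (M choose Suc (Suc (2*i)))"
  define P Q where "P = (m choose i)" and "Q = (m choose Suc i)"
  have 1: "Suc (2*i) * B = (2*d+2) * A" using s[of "2*i" M] by (simp add: A_def B_def M_def m)
  have 2: "Suc (Suc (2*i)) * C = (2*d+1) * B"
    using s[of "Suc (2*i)" M] by (simp add: C_def B_def M_def m)
  have 3: "Suc i * Q = Suc d * P" using s[of i m] by (simp add: P_def Q_def m)
  have IH: "A \<le> P * M^i" using Suc unfolding A_def P_def M_def by simp
  have "(2*i+1) * (Suc i * C) = (2*i+1) * ((2*d+1) * B) div 2"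
    unfolding 2[symmetric] by simp
  also have "(2*i+1) * ((2*d+1) * B) = (2*d+1) * (Suc (2*i) * B)" by (simp only: Suc_eq_plus1 mult.left_commute[of "2*i+1"])
  also have "\<dots> = 2 * ((2*d+1) * (Suc d * A))" unfolding 1 by (simp add: algebra_simps)
  finally have 4: "(2*i+1) * (Suc i * C) = (2*d+1) * (Suc d * A)" by simp
  have "(2*d+1) * (Suc d * A) \<le> ((2*i+1) * M) * (Suc d * (P * M^i))"
    by (intro mult_le_mono IH order_refl) (auto simp: M_def m)
  also have "\<dots> = (2*i+1) * (Suc d * P * M ^ Suc i)" by (simp only: power_Suc ac_simps)
  also have "\<dots> = (2*i+1) * (Suc i * (Q * M ^ Suc i))" unfolding 3[symmetric] by (simp only: ac_simps)
  finally have "(2*i+1) * (Suc i * C) \<le> (2*i+1) * (Suc i * (Q * M ^ Suc i))" using 4 by simp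
  then have "C \<le> Q * M ^ Suc i" unfolding mult_le_cancel1 by simp
  then show ?case unfolding C_def Q_def M_def by simp
qed simp

text \<open>Hypercontractivity for a single bit: averaging over the sign of b removes the odd
  powers, and the even ones are dominated term by term by the binomial expansion of the right-hand
  side.\<close>

lemma two_point:
  fixes a b :: real
  shows "((a + b) ^ (2*m) + (a - b) ^ (2*m)) / 2 \<le> (a\<^sup>2 + real (2*m) * b\<^sup>2) ^ m"
proof -
  let ?t = "\<lambda>k. real (2*m choose k) * b^k * a^(2*m - k)"
  have 1: "(a + b)^(2*m) = (\<Sum>k\<le>2*m. ?t k)"
    using binomial_ring[of b a "2*m"] by (simp add: add.commute)
  have 2: "(a - b)^(2*m) = (\<Sum>k\<le>2*m. (-1)^k * ?t k)"
  proof -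
    have "(a - b)^(2*m) = ((-b) + a)^(2*m)" by simp
    also have "\<dots> = (\<Sum>k\<le>2*m. real (2*m choose k) * (-b)^k * a^(2*m - k))"
      by (rule binomial_ring)
    also have "\<dots> = (\<Sum>k\<le>2*m. (-1)^k * ?t k)"
      by (intro sum.cong refl) (simp add: power_minus[of b])
    finally show ?thesis .
  qed
  have "((a + b) ^ (2*m) + (a - b) ^ (2*m)) / 2 = (\<Sum>k\<le>2*m. if even k then ?t k else 0)"
    unfolding 1 2 sum.distrib[symmetric] sum_divide_distrib by (intro sum.cong refl) simp
  also have "\<dots> = (\<Sum>k<2*Suc m. if even k then ?t k else 0)"
    by (rule sum.mono_neutral_left) (auto simp: less_Suc_eq)
  also have "\<dots> = (\<Sum>i<Suc m. ?t (2*i))"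
    using sum_split_even_odd[of ?t "\<lambda>_. 0" "Suc m"] by simp
  also have "\<dots> \<le> (\<Sum>i<Suc m. real (m choose i) * (real (2*m) * b\<^sup>2)^i * (a\<^sup>2)^(m - i))"
  proof (intro sum_mono)
    fix i assume "i \<in> {..<Suc m}"
    then have i: "i \<le> m" by simp
    have "real (2*m choose (2*i)) \<le> real (m choose i) * real (2*m)^i"
      using binomial_even_le[OF i] by (metis of_nat_le_iff of_nat_mult of_nat_power)
    then have "real (2*m choose (2*i)) * ((b\<^sup>2)^i * (a\<^sup>2)^(m-i)) \<le> real (m choose i) * real (2*m)^i * ((b\<^sup>2)^i * (a\<^sup>2)^(m-i))"
      by (intro mult_right_mono) auto
    moreover have "2 * m - 2 * i = 2 * (m - i)" by simp
    ultimately show "?t (2*i) \<le> real (m choose i) * (real (2*m) * b\<^sup>2)^i * (a\<^sup>2)^(m - i)"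
      by (simp add: power_mult power_mult_distrib mult.assoc)
  qed
  also have "\<dots> = (real (2*m) * b\<^sup>2 + a\<^sup>2) ^ m"
    unfolding lessThan_Suc_atMost by (rule binomial_ring[symmetric])
  finally show ?thesis by (simp add: add.commute)
qed

lemma convex_power_nonneg: "convex_on {0..} (\<lambda>x::real. x ^ m)"
proof (induction m)
  case (Suc m)
  show ?case
  proof (cases "m = 0")
    case False
    show ?thesis
    proof (rule f''_ge0_imp_convex[where f' = "\<lambda>x. real (Suc m) * x^m" and f'' = "\<lambda>x. real (Suc m) * (real m * x^(m-1))"])
      show "convex {0::real..}" by simp
      show "((\<lambda>x. x ^ Suc m) has_real_derivative real (Suc m) * x ^ m) (at x)" for x :: real
        using DERIV_power_Suc[OF DERIV_ident, of m x] by (simp add: algebra_simps)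
      show "((\<lambda>x. real (Suc m) * x ^ m) has_real_derivative real (Suc m) * (real m * x ^ (m - 1))) (at x)" for x :: real
        using DERIV_cmult[OF DERIV_power[OF DERIV_ident, of m x], of "real (Suc m)"] by (simp add: algebra_simps)
    qed auto
  qed (auto simp: convex_on_def)
qed (auto simp: convex_on_def)

lemma posfun_mono: "posfun E \<Longrightarrow> (\<And>x. f x \<le> g x) \<Longrightarrow> E f \<le> E g"
  by (auto simp: posfun_def)

text \<open>Minkowski's inequality for the m-norm of E. Convexity of the m-th power is applied to X
  / \<alpha> and Y / \<beta> with the weights \<alpha> / (\<alpha> + \<beta>) and \<beta> /
  (\<alpha> + \<beta>), whose combination is (X + Y) / (\<alpha> + \<beta>).\<close>

lemma posfun_mix_pos:
  assumes E: "posfun E" and X: "\<And>x. 0 \<le> X x" and Y: "\<And>x. 0 \<le> Y x"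
    and EX: "E (\<lambda>x. X x ^ m) \<le> \<alpha> ^ m" and EY: "E (\<lambda>x. Y x ^ m) \<le> \<beta> ^ m"
    and pos: "\<alpha> > 0" "\<beta> > 0"
  shows "E (\<lambda>x. (X x + Y x) ^ m) \<le> (\<alpha> + \<beta>) ^ m"
proof -
  define c where "c = (\<alpha> + \<beta>) ^ m"
  define l where "l = \<alpha> / (\<alpha> + \<beta>)"
  have l: "0 \<le> l" "l \<le> 1" and l3: "1 - l = \<beta> / (\<alpha> + \<beta>)" using pos by (auto simp: l_def field_simps)
  have pt: "(X x + Y x) ^ m \<le> c * l / \<alpha>^m * X x ^ m + c * (1 - l) / \<beta>^m * Y x ^ m" for x
  proof -
    have "(l * (X x / \<alpha>) + (1 - l) * (Y x / \<beta>)) ^ m \<le> l * (X x / \<alpha>)^m + (1 - l) * (Y x / \<beta>)^m"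
      using convex_onD[OF convex_power_nonneg[of m], of "1-l" "X x / \<alpha>" "Y x / \<beta>"] l X[of x] Y[of x] pos
      by simp
    moreover have "l * (X x / \<alpha>) + (1 - l) * (Y x / \<beta>) = (X x + Y x) / (\<alpha> + \<beta>)"
      using pos unfolding l3 unfolding l_def by (simp add: add_divide_distrib)
    ultimately have "((X x + Y x) / (\<alpha> + \<beta>)) ^ m \<le> l * (X x / \<alpha>)^m + (1 - l) * (Y x / \<beta>)^m" by simp
    then have "c * ((X x + Y x) / (\<alpha> + \<beta>)) ^ m \<le> c * (l * (X x / \<alpha>)^m + (1 - l) * (Y x / \<beta>)^m)"
      using pos by (intro mult_left_mono) (auto simp: c_def)
    moreover have "c * ((X x + Y x) / (\<alpha> + \<beta>)) ^ m = (X x + Y x)^m"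
      using pos by (simp add: c_def power_divide)
    ultimately show ?thesis by (simp add: power_divide algebra_simps)
  qed
  have "E (\<lambda>x. (X x + Y x) ^ m) \<le> E (\<lambda>x. c * l / \<alpha>^m * X x ^ m + c * (1 - l) / \<beta>^m * Y x ^ m)"
    by (rule posfun_mono[OF E pt])
  also have "\<dots> = c * l / \<alpha>^m * E (\<lambda>x. X x ^ m) + c * (1 - l) / \<beta>^m * E (\<lambda>x. Y x ^ m)"
    using E unfolding posfun_def by (simp only:)
  also have "\<dots> \<le> c * l / \<alpha>^m * \<alpha>^m + c * (1 - l) / \<beta>^m * \<beta>^m"
    using l pos by (intro add_mono mult_left_mono EX EY) (auto simp: c_def)
  also have "\<dots> = c * l + c * (1 - l)" using pos by (simp)
  also have "\<dots> = c" by (simp add: algebra_simps)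
  finally show ?thesis unfolding c_def .
qed

text \<open>Raising both bounds by e and letting e tend to 0 admits bounds that are zero.\<close>

lemma posfun_mix:
  assumes E: "posfun E" and X: "\<And>x. 0 \<le> X x" and Y: "\<And>x. 0 \<le> Y x"
    and EX: "E (\<lambda>x. X x ^ m) \<le> \<alpha> ^ m" and EY: "E (\<lambda>x. Y x ^ m) \<le> \<beta> ^ m"
    and pos: "\<alpha> \<ge> 0" "\<beta> \<ge> 0"
  shows "E (\<lambda>x. (X x + Y x) ^ m) \<le> (\<alpha> + \<beta>) ^ m"
proof -
  have "E (\<lambda>x. (X x + Y x) ^ m) \<le> ((\<alpha> + e) + (\<beta> + e)) ^ m" if "e > 0" for e
  proof (rule posfun_mix_pos[OF E X Y])
    show "E (\<lambda>x. X x ^ m) \<le> (\<alpha> + e) ^ m"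
      by (rule order_trans[OF EX]) (use pos that in \<open>auto intro!: power_mono\<close>)
    show "E (\<lambda>x. Y x ^ m) \<le> (\<beta> + e) ^ m"
      by (rule order_trans[OF EY]) (use pos that in \<open>auto intro!: power_mono\<close>)
  qed (use pos that in auto)
  then have ev: "eventually (\<lambda>e. E (\<lambda>x. (X x + Y x) ^ m) \<le> ((\<alpha> + e) + (\<beta> + e)) ^ m) (at_right 0)"
    by (auto simp: eventually_at_filter)
  have "((\<lambda>e. ((\<alpha> + e) + (\<beta> + e)) ^ m) \<longlongrightarrow> ((\<alpha> + 0) + (\<beta> + 0)) ^ m) (at_right 0)"
    by (intro tendsto_intros)
  from tendsto_lowerbound[OF this ev] show ?thesis by simp
qed

section \<open>Averages over sign vectors\<close>

lemma finite_signs: "finite V \<Longrightarrow> finite (signs V)"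
  by (auto simp: signs_def intro: finite_PiE)

lemma signs_cases: "x \<in> signs V \<Longrightarrow> i \<in> V \<Longrightarrow> x i = 1 \<or> x i = -1"
  by (auto simp: signs_def PiE_def Pi_def)

lemma signs_restrictI: "(\<And>v. v \<in> V \<Longrightarrow> f v = 1 \<or> f v = -1) \<Longrightarrow> (\<lambda>v\<in>V. f v) \<in> signs V"
  by (auto simp: signs_def)

lemma card_signs: "finite V \<Longrightarrow> card (signs V) = 2 ^ card V"
  unfolding signs_def by (simp add: card_PiE prod_constant numeral_2_eq_2)

lemma signs_insert_sum:
  assumes "v \<notin> V"
  shows "(\<Sum>x\<in>signs (insert v V). f x) = (\<Sum>x\<in>signs V. f (x(v := 1)) + f (x(v := -1)))"
proof -
  have "(\<Sum>x\<in>signs (insert v V). f x) = (\<Sum>(y, g)\<in>{-1,1} \<times> signs V. f (g(v := y)))"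
    unfolding signs_def PiE_insert_eq
    by (subst sum.reindex) (use assms inj_combinator[of v V "\<lambda>_. {-1,1::real}"] in \<open>auto simp: case_prod_beta\<close>)
  also have "\<dots> = (\<Sum>g\<in>signs V. f (g(v := 1)) + f (g(v := -1)))"
    by (simp add: sum.cartesian_product[symmetric] sum.distrib add.commute)
  finally show ?thesis .
qed

lemma av_empty [simp]: "av {} f = f (\<lambda>_. undefined)"
  by (simp add: av_def signs_def)

lemma av_insert:
  assumes "finite V" "v \<notin> V"
  shows "av (insert v V) f = av V (\<lambda>x. (f (x(v := 1)) + f (x(v := -1))) / 2)"
  unfolding av_def signs_insert_sum[OF assms(2)] using assms
  by (simp add: sum_divide_distrib[symmetric])

lemma posfun_av: "posfun (av V)"
  by (auto simp: posfun_def av_def sum.distrib add_divide_distrib sum_distrib_left divide_right_mono sum_mono)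

lemma av_cong: "(\<And>x. x \<in> signs V \<Longrightarrow> f x = g x) \<Longrightarrow> av V f = av V g"
  by (simp add: av_def)

lemma av_mono: "(\<And>x. x \<in> signs V \<Longrightarrow> f x \<le> g x) \<Longrightarrow> av V f \<le> av V g"
  by (auto simp: av_def intro!: divide_right_mono sum_mono)

lemma av_const: "finite V \<Longrightarrow> av V (\<lambda>_. c) = c"
  by (simp add: av_def card_signs)

lemma av_sum: "av V (\<lambda>x. \<Sum>i\<in>I. f i x) = (\<Sum>i\<in>I. av V (f i))"
  unfolding av_def by (subst sum.swap) (simp add: sum_divide_distrib)

lemma av_add: "av V (\<lambda>x. f x + g x) = av V f + av V g"
  by (simp add: av_def sum.distrib add_divide_distrib)

lemma av_cmult: "av V (\<lambda>x. c * f x) = c * av V f"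
  by (simp add: av_def sum_distrib_left)

text \<open>The (2, 2m) hypercontractive inequality with the noise moved into the weights of the
  coefficients. One variable is split off; the two-point inequality averages over it, and
  Minkowski's inequality joins the induction hypotheses for the two halves.\<close>

theorem bonami:
  fixes g :: "'a set \<Rightarrow> real"
  assumes "finite V"
  shows "av V (\<lambda>x. (\<Sum>S\<in>Pow V. g S * (\<Prod>i\<in>S. x i)) ^ (2*m)) \<le> (\<Sum>S\<in>Pow V. real (2*m) ^ card S * (g S)\<^sup>2) ^ m"
  using assms
proof (induction V arbitrary: g rule: finite_induct)
  case empty
  then show ?case by (simp add: power_mult)
next
  case (insert v V)
  let ?G0 = "\<lambda>x. \<Sum>S\<in>Pow V. g S * (\<Prod>i\<in>S. x i)"
  let ?G1 = "\<lambda>x. \<Sum>S\<in>Pow V. g (insert v S) * (\<Prod>i\<in>S. x i)"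
  let ?a = "\<Sum>S\<in>Pow V. real (2*m) ^ card S * (g S)\<^sup>2"
  let ?b = "\<Sum>S\<in>Pow V. real (2*m) ^ card S * (g (insert v S))\<^sup>2"
  have split: "(\<Sum>S\<in>Pow (insert v V). h S) = (\<Sum>S\<in>Pow V. h S) + (\<Sum>S\<in>Pow V. h (insert v S))" for h :: "'a set \<Rightarrow> real"
  proof -
    have "inj_on (insert v) (Pow V)" using insert.hyps by (auto simp: inj_on_def)
    moreover have "Pow V \<inter> insert v ` Pow V = {}" using insert.hyps by auto
    ultimately show ?thesis unfolding Pow_insert
      by (subst sum.union_disjoint) (use insert.hyps in \<open>auto simp: sum.reindex\<close>)
  qed
  have eval: "(\<Sum>S\<in>Pow (insert v V). g S * (\<Prod>i\<in>S. (x(v := y)) i)) = ?G0 x + y * ?G1 x" for x y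
  proof -
    have 1: "(\<Prod>i\<in>S. (x(v := y)) i) = (\<Prod>i\<in>S. x i)" if "S \<in> Pow V" for S
      using that insert.hyps by (intro prod.cong) auto
    have 2: "(\<Prod>i\<in>insert v S. (x(v := y)) i) = y * (\<Prod>i\<in>S. x i)" if "S \<in> Pow V" for S
    proof -
      have "finite S" "v \<notin> S" using that insert.hyps finite_subset by auto
      then have "(\<Prod>i\<in>insert v S. (x(v := y)) i) = y * (\<Prod>i\<in>S. (x(v := y)) i)" by simp
      then show ?thesis using 1[OF that] by simp
    qed
    show ?thesis unfolding split using 1 2 by (simp add: sum_distrib_left algebra_simps del: fun_upd_apply)
  qed
  have "av (insert v V) (\<lambda>x. (\<Sum>S\<in>Pow (insert v V). g S * (\<Prod>i\<in>S. x i)) ^ (2*m))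
      = av V (\<lambda>x. ((?G0 x + ?G1 x)^(2*m) + (?G0 x - ?G1 x)^(2*m)) / 2)"
    unfolding av_insert[OF insert.hyps] eval by simp
  also have "\<dots> \<le> av V (\<lambda>x. ((?G0 x)\<^sup>2 + real (2*m) * (?G1 x)\<^sup>2) ^ m)"
    by (rule posfun_mono[OF posfun_av two_point])
  also have "\<dots> \<le> (?a + real (2*m) * ?b) ^ m"
  proof (rule posfun_mix[OF posfun_av])
    show "av V (\<lambda>x. (?G0 x)\<^sup>2 ^ m) \<le> ?a ^ m"
      using insert.IH[of g] by (simp add: power_mult)
    have "av V (\<lambda>x. (real (2*m) * (?G1 x)\<^sup>2) ^ m) = real (2*m)^m * av V (\<lambda>x. (?G1 x)^(2*m))"
      unfolding av_cmult[symmetric] by (simp add: power_mult power_mult_distrib)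
    also have "\<dots> \<le> real (2*m)^m * ?b^m"
      by (intro mult_left_mono insert.IH[of "\<lambda>S. g (insert v S)"]) auto
    finally show "av V (\<lambda>x. (real (2*m) * (?G1 x)\<^sup>2) ^ m) \<le> (real (2*m) * ?b)^m"
      by (simp add: power_mult_distrib)
  qed (auto intro!: sum_nonneg mult_nonneg_nonneg)
  also have "?a + real (2*m) * ?b = (\<Sum>S\<in>Pow (insert v V). real (2*m) ^ card S * (g S)\<^sup>2)"
  proof -
    have "card (insert v S) = Suc (card S)" if "S \<in> Pow V" for S
      using that insert.hyps finite_subset by (metis PowD card_insert_disjoint subsetD)
    then show ?thesis unfolding split by (simp add: sum_distrib_left algebra_simps)
  qed
  finally show ?case .
qed

section \<open>Decision trees and Fourier coefficients\<close>

text \<open>Trees over an arbitrary type of variables, since variables get hidden, substituted and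
  renamed; \<open>relabel\<close> translates a \<open>dtree\<close> into this form.\<close>

datatype 'v tr = Lf nat | Qr 'v "'v tr" "'v tr"

primrec ev :: "'v tr \<Rightarrow> ('v \<Rightarrow> real) \<Rightarrow> nat" where
  "ev (Lf b) x = b"
| "ev (Qr i l r) x = (if x i = -1 then ev l x else ev r x)"

primrec dep :: "'v tr \<Rightarrow> nat" where
  "dep (Lf b) = 0"
| "dep (Qr i l r) = Suc (max (dep l) (dep r))"

primrec trvars :: "'v tr \<Rightarrow> 'v set" where
  "trvars (Lf b) = {}"
| "trvars (Qr i l r) = insert i (trvars l \<union> trvars r)"

primrec read_once :: "'v tr \<Rightarrow> bool" where
  "read_once (Lf b) = True"
| "read_once (Qr i l r) = (i \<notin> trvars l \<union> trvars r \<and> read_once l \<and> read_once r)"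

text \<open>Histories list the answers in reverse order; the steps of a history that come after a leaf
  has been reached are ignored.\<close>

primrec node :: "'v tr \<Rightarrow> real list \<Rightarrow> 'v tr" where
  "node t [] = t"
| "node t (y # h) = (case node t h of Lf b \<Rightarrow> Lf b | Qr i l r \<Rightarrow> if y = -1 then l else r)"

primrec queried :: "'v tr \<Rightarrow> real list \<Rightarrow> 'v set" where
  "queried t [] = {}"
| "queried t (y # h) = (case node t h of Lf b \<Rightarrow> queried t h | Qr i l r \<Rightarrow> insert i (queried t h))"

text \<open>Expectation over d independent fair answers: the tree is run on coin flips instead of an
  input.\<close>

primrec hist_av :: "nat \<Rightarrow> (real list \<Rightarrow> real) \<Rightarrow> real" where
  "hist_av 0 f = f []"
| "hist_av (Suc d) f = hist_av d (\<lambda>h. (f (1 # h) + f (-1 # h)) / 2)"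

text \<open>The sum, over the sets S of l variables queried along h, of a S times the product of the
  answers to S. The recursion distinguishes whether the latest query belongs to S.\<close>

fun level_sum :: "'v tr \<Rightarrow> nat \<Rightarrow> ('v set \<Rightarrow> real) \<Rightarrow> real list \<Rightarrow> real" where
  "level_sum t 0 a h = a {}"
| "level_sum t (Suc l) a [] = 0"
| "level_sum t (Suc l) a (y # h) = level_sum t (Suc l) a h +
     (case node t h of Lf b \<Rightarrow> 0 | Qr i lt rt \<Rightarrow> y * level_sum t l (\<lambda>S. a (insert i S)) h)"

primrec total_sum :: "'v tr \<Rightarrow> ('v set \<Rightarrow> real) \<Rightarrow> real list \<Rightarrow> real" where
  "total_sum t a [] = a {}"
| "total_sum t a (y # h) = total_sum t a h +
     (case node t h of Lf b \<Rightarrow> 0 | Qr i lt rt \<Rightarrow> y * total_sum t (\<lambda>S. a (insert i S)) h)"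

text \<open>The density, relative to fair answers, of the histories that agree with x: for a sign x
  i the factor is 2 or 0.\<close>

primrec weight :: "'v tr \<Rightarrow> ('v \<Rightarrow> real) \<Rightarrow> real list \<Rightarrow> real" where
  "weight t x [] = 1"
| "weight t x (y # h) = weight t x h * (case node t h of Lf b \<Rightarrow> 1 | Qr i lt rt \<Rightarrow> 1 + y * x i)"

primrec step :: "('v \<Rightarrow> real) \<Rightarrow> 'v tr \<Rightarrow> 'v tr" where
  "step x (Lf b) = Lf b"
| "step x (Qr i l r) = (if x i = -1 then l else r)"

lemma hist_av_add: "hist_av d (\<lambda>h. f h + g h) = hist_av d f + hist_av d g"
proof (induction d arbitrary: f g)
  case (Suc d)
  have "(\<lambda>h. (f (1 # h) + g (1 # h) + (f (-1 # h) + g (-1 # h))) / 2) =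
     (\<lambda>h. (f (1 # h) + f (-1 # h)) / 2 + (g (1 # h) + g (-1 # h)) / 2)"
    by (simp add: add_divide_distrib[symmetric] algebra_simps)
  then show ?case using Suc by simp
qed simp

lemma hist_av_cmult: "hist_av d (\<lambda>h. c * f h) = c * hist_av d f"
proof (induction d arbitrary: f)
  case (Suc d)
  have "(\<lambda>h. (c * f (1 # h) + c * f (-1 # h)) / 2) = (\<lambda>h. c * ((f (1 # h) + f (-1 # h)) / 2))"
    by (simp add: field_simps)
  then show ?case using Suc[of "\<lambda>h. (f (1 # h) + f (-1 # h)) / 2"] by simp
qed simp

lemma hist_av_mono: "(\<And>h. f h \<le> g h) \<Longrightarrow> hist_av d f \<le> hist_av d g"
proof (induction d arbitrary: f g)
  case (Suc d)
  have "(f (1 # h) + f (-1 # h)) / 2 \<le> (g (1 # h) + g (-1 # h)) / 2" for h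
    by (intro divide_right_mono add_mono Suc.prems) simp
  then show ?case using Suc.IH by (simp only: hist_av.simps)
qed simp

lemma posfun_hist_av: "posfun (hist_av d)"
  by (auto simp: posfun_def hist_av_add hist_av_cmult hist_av_mono)

lemma hist_av_sum: "finite I \<Longrightarrow> hist_av d (\<lambda>h. \<Sum>i\<in>I. f i h) = (\<Sum>i\<in>I. hist_av d (f i))"
proof (induction I rule: finite_induct)
  case empty
  show ?case using hist_av_cmult[of d 0 "\<lambda>_. 0"] by simp
qed (simp add: hist_av_add)

lemma hist_av_const: "hist_av d (\<lambda>_. c) = c"
  by (induction d) auto

lemma hist_av_abs: "\<bar>hist_av d f\<bar> \<le> hist_av d (\<lambda>h. \<bar>f h\<bar>)"
proof -
  have "hist_av d f \<le> hist_av d (\<lambda>h. \<bar>f h\<bar>)" by (rule hist_av_mono) simp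
  moreover have "hist_av d (\<lambda>h. (-1) * f h) \<le> hist_av d (\<lambda>h. \<bar>f h\<bar>)" by (rule hist_av_mono) simp
  ultimately show ?thesis unfolding hist_av_cmult by linarith
qed

text \<open>The first moment is compared with the 2m-th through the tangent of u^(2m) at u = 1, that
  is, through Bernoulli's inequality, so that linearity and positivity of the average
  suffice.\<close>

lemma hist_av_L1:
  assumes "hist_av d (\<lambda>h. f h ^ (2*m)) \<le> K ^ m" "K > 0" "m > 0"
  shows "hist_av d (\<lambda>h. \<bar>f h\<bar>) \<le> sqrt K"
proof -
  have pt: "\<bar>f h\<bar> \<le> sqrt K * (1 - 1 / (2*m)) + sqrt K / (2 * m * K^m) * f h ^ (2*m)" for h
  proof -
    define u where "u = \<bar>f h\<bar> / sqrt K"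
    have u: "u \<ge> 0" "\<bar>f h\<bar> = sqrt K * u" using assms by (auto simp: u_def)
    have "1 + real (2*m) * (u - 1) \<le> (1 + (u - 1)) ^ (2*m)"
      by (rule Bernoulli_inequality) (use u in auto)
    then have "u \<le> (1 - 1 / (2*m)) + u^(2*m) / (2*m)" using assms by (simp add: field_simps)
    then have "sqrt K * u \<le> sqrt K * ((1 - 1 / (2*m)) + u^(2*m) / (2*m))"
      using assms by (intro mult_left_mono) auto
    moreover have "u^(2*m) = f h ^ (2*m) / K^m"
      using assms by (simp add: u_def power_divide power_mult)
    ultimately show ?thesis using u by (simp add: algebra_simps)
  qed
  have "hist_av d (\<lambda>h. \<bar>f h\<bar>) \<le> hist_av d (\<lambda>h. sqrt K * (1 - 1 / (2*m)) + sqrt K / (2 * m * K^m) * f h ^ (2*m))"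
    by (rule hist_av_mono[OF pt])
  also have "\<dots> = sqrt K * (1 - 1 / (2*m)) + sqrt K / (2 * m * K^m) * hist_av d (\<lambda>h. f h ^ (2*m))"
    by (simp only: hist_av_add hist_av_cmult hist_av_const)
  also have "\<dots> \<le> sqrt K * (1 - 1 / (2*m)) + sqrt K / (2 * m * K^m) * K^m"
    by (intro add_left_mono mult_left_mono assms) (use assms in auto)
  also have "\<dots> = sqrt K" using assms by (simp add: field_simps)
  finally show ?thesis .
qed

lemma finite_queried: "finite (queried t h)"
  by (induction h) (auto split: tr.split)

lemma read_once_node: "read_once t \<Longrightarrow> read_once (node t h) \<and> trvars (node t h) \<inter> queried t h = {}"
  by (induction h) (auto split: tr.split)

lemma trvars_node: "trvars (node t h) \<subseteq> trvars t"
  by (induction h) (auto split: tr.splits)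

lemma queried_trvars: "queried t h \<subseteq> trvars t"
proof (induction h)
  case (Cons y h)
  show ?case
  proof (cases "node t h")
    case (Qr i l r)
    then have "i \<in> trvars t" using trvars_node[of t h] by auto
    then show ?thesis using Cons Qr by simp
  qed (use Cons in simp)
qed simp

text \<open>Along a read-once path the queried variables are distinct, so level l reads a only at
  sets of exactly l queried variables. This allows cutting off and rescaling a separately for each
  level.\<close>

lemma level_sum_cong:
  assumes "read_once t" "\<And>S. S \<subseteq> queried t h \<Longrightarrow> card S = l \<Longrightarrow> a S = a' S"
  shows "level_sum t l a h = level_sum t l a' h"
  using assms(2)
proof (induction h arbitrary: l a a')
  case Nil
  then show ?case by (cases l) auto
next
  case (Cons y h)
  show ?case
  proof (cases l)
    case (Suc k)
    have 1: "level_sum t (Suc k) a h = level_sum t (Suc k) a' h"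
    proof (rule Cons.IH)
      fix S assume S: "S \<subseteq> queried t h" "card S = Suc k"
      then have "S \<subseteq> queried t (y # h)" by (auto split: tr.split)
      then show "a S = a' S" using S Suc Cons.prems by simp
    qed
    show ?thesis
    proof (cases "node t h")
      case (Qr i lt rt)
      then have i: "i \<notin> queried t h" using read_once_node[OF assms(1), of h] by auto
      have "level_sum t k (\<lambda>S. a (insert i S)) h = level_sum t k (\<lambda>S. a' (insert i S)) h"
      proof (rule Cons.IH)
        fix S assume S: "S \<subseteq> queried t h" "card S = k"
        then have "finite S" "i \<notin> S" using i finite_subset[OF _ finite_queried] by auto
        then show "a (insert i S) = a' (insert i S)"
          using S Suc Qr by (intro Cons.prems) auto
      qed
      then show ?thesis using 1 Suc Qr by simp
    qed (use 1 Suc in simp)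
  qed (use Cons.prems in simp)
qed

lemma level_sum_cmult: "level_sum t l (\<lambda>S. c * a S) h = c * level_sum t l a h"
  by (induction t l a h rule: level_sum.induct) (auto split: tr.split simp: algebra_simps)

lemma level_sum_eq_0: "length h < l \<Longrightarrow> level_sum t l a h = 0"
  by (induction t l a h rule: level_sum.induct) (auto split: tr.split)

lemma total_sum_level: "total_sum t a h = (\<Sum>l\<le>length h. level_sum t l a h)"
proof (induction h arbitrary: a)
  case (Cons y h)
  have "(\<Sum>l\<le>Suc (length h). level_sum t l a (y # h)) =
     a {} + (\<Sum>l\<le>length h. level_sum t (Suc l) a (y # h))"
    by (subst sum.atMost_Suc_shift) simp
  also have "(\<Sum>l\<le>length h. level_sum t (Suc l) a (y # h)) = (\<Sum>l\<le>length h. level_sum t (Suc l) a h) +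
      (case node t h of Lf b \<Rightarrow> 0 | Qr i lt rt \<Rightarrow> y * total_sum t (\<lambda>S. a (insert i S)) h)"
    by (simp add: sum.distrib Cons.IH sum_distrib_left split: tr.split)
  also have "a {} + ((\<Sum>l\<le>length h. level_sum t (Suc l) a h) +
      (case node t h of Lf b \<Rightarrow> 0 | Qr i lt rt \<Rightarrow> y * total_sum t (\<lambda>S. a (insert i S)) h)) =
      (\<Sum>l\<le>Suc (length h). level_sum t l a h) +
      (case node t h of Lf b \<Rightarrow> 0 | Qr i lt rt \<Rightarrow> y * total_sum t (\<lambda>S. a (insert i S)) h)"
    by (subst sum.atMost_Suc_shift) simp
  also have "(\<Sum>l\<le>Suc (length h). level_sum t l a h) = total_sum t a h"
    using level_sum_eq_0[of h "Suc (length h)" t a] Cons.IH by simp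
  finally show ?case by simp
qed simp

lemma total_sum_cong:
  assumes "read_once t" "\<And>S. S \<subseteq> queried t h \<Longrightarrow> a S = a' S"
  shows "total_sum t a h = total_sum t a' h"
  unfolding total_sum_level by (intro sum.cong refl level_sum_cong assms)

lemma total_sum_sum: "total_sum t (\<lambda>S. \<Sum>w\<in>\<Omega>. f w S) h = (\<Sum>w\<in>\<Omega>. total_sum t (f w) h)"
  by (induction h arbitrary: f) (auto split: tr.split simp: sum.distrib sum_distrib_left)

lemma total_sum_prod:
  assumes "read_once t"
  shows "total_sum t (\<lambda>S. c * (\<Prod>i\<in>S. x i)) h = c * weight t x h"
proof (induction h arbitrary: c)
  case (Cons y h)
  show ?case
  proof (cases "node t h")
    case (Qr i lt rt)
    then have i: "i \<notin> queried t h" using read_once_node[OF assms(1), of h] by auto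
    have "total_sum t (\<lambda>S. c * (\<Prod>j\<in>insert i S. x j)) h = total_sum t (\<lambda>S. (c * x i) * (\<Prod>i\<in>S. x i)) h"
    proof (rule total_sum_cong[OF assms])
      fix S assume S: "S \<subseteq> queried t h"
      then have "finite S" "i \<notin> S" using i finite_subset[OF _ finite_queried] by auto
      then show "c * (\<Prod>j\<in>insert i S. x j) = (c * x i) * (\<Prod>i\<in>S. x i)" by simp
    qed
    then show ?thesis using Cons.IH[of c] Cons.IH[of "c * x i"] Qr by (simp add: algebra_simps)
  qed (use Cons.IH in simp)
qed simp

text \<open>Averaging the last answer y against 1 + y * x i selects y = x i, so d fair answers
  weighted in this way amount to d steps of the tree on the input x.\<close>

lemma hist_av_weight:
  assumes "\<And>i. i \<in> trvars t \<Longrightarrow> x i = 1 \<or> x i = -1"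
  shows "hist_av d (\<lambda>h. G (node t h) * weight t x h) = G ((step x ^^ d) t)"
proof (induction d arbitrary: G)
  case (Suc d)
  have "(G (node t (1 # h)) * weight t x (1 # h) + G (node t (-1 # h)) * weight t x (-1 # h)) / 2
      = (G \<circ> step x) (node t h) * weight t x h" for h
  proof (cases "node t h")
    case (Qr i l r)
    then have "i \<in> trvars t" using trvars_node[of t h] by auto
    then show ?thesis using assms[of i] Qr by auto
  qed auto
  then have "hist_av (Suc d) (\<lambda>h. G (node t h) * weight t x h) = hist_av d (\<lambda>h. (G \<circ> step x) (node t h) * weight t x h)"
    by (simp only: hist_av.simps)
  then show ?case using Suc[of "G \<circ> step x"] by simp
qed simp

lemma step_ev: "dep t \<le> d \<Longrightarrow> (step x ^^ d) t = Lf (ev t x)"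
proof (induction d arbitrary: t)
  case 0
  then show ?case by (cases t) auto
next
  case (Suc d)
  have "dep (step x t) \<le> d" "ev (step x t) x = ev t x" using Suc.prems by (cases t; auto)+
  then show ?case using Suc.IH[of "step x t"] by (simp add: funpow_Suc_right del: funpow.simps)
qed

text \<open>The Fourier coefficients that enter are those of the input distribution and not of the
  tree: for a given history, the weights of the inputs add up to the coefficients of wt over all
  sets of queried variables. The weights wt may have either sign.\<close>

lemma tree_sum_expansion:
  assumes ro: "read_once t" and d: "dep t \<le> d" and fin: "finite \<Omega>"
    and X: "\<And>w i. w \<in> \<Omega> \<Longrightarrow> i \<in> trvars t \<Longrightarrow> X w i = 1 \<or> X w i = -1"
  shows "(\<Sum>w\<in>\<Omega>. wt w * g (Lf (ev t (X w)))) =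
     hist_av d (\<lambda>h. g (node t h) * total_sum t (\<lambda>S. \<Sum>w\<in>\<Omega>. wt w * (\<Prod>i\<in>S. X w i)) h)"
proof -
  have "(\<Sum>w\<in>\<Omega>. wt w * g (Lf (ev t (X w)))) = (\<Sum>w\<in>\<Omega>. wt w * hist_av d (\<lambda>h. g (node t h) * weight t (X w) h))"
    using X by (intro sum.cong refl) (simp add: hist_av_weight step_ev[OF d])
  also have "\<dots> = hist_av d (\<lambda>h. \<Sum>w\<in>\<Omega>. wt w * (g (node t h) * weight t (X w) h))"
    by (simp add: hist_av_sum[OF fin] hist_av_cmult)
  also have "\<dots> = hist_av d (\<lambda>h. g (node t h) * total_sum t (\<lambda>S. \<Sum>w\<in>\<Omega>. wt w * (\<Prod>i\<in>S. X w i)) h)"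
    unfolding total_sum_sum total_sum_prod[OF ro] by (simp add: sum_distrib_left mult.left_commute)
  finally show ?thesis .
qed

text \<open>The level sums form a martingale in the time variable, whose increment at each step is a
  level sum of the previous level; the union bound over the next query costs the factor
  \<open>card V\<close> inside the \<open>2m\<close>-th moment.\<close>

lemma level_sum_moment:
  assumes V: "finite V" "trvars t \<subseteq> V" and m: "m > 0"
    and c: "c \<ge> 0" "real (2*m) ^ m * real (card V) \<le> c ^ m"
    and a: "\<And>S. \<bar>a S\<bar> \<le> 1"
  shows "hist_av d (\<lambda>h. level_sum t l a h ^ (2*m)) \<le> (c ^ l * real (d choose l)) ^ m"
  using a
proof (induction d arbitrary: l a)
  case 0
  show ?case
  proof (cases l)
    case 0
    have "\<bar>a {}\<bar> ^ (2*m) \<le> 1" by (rule power_le_one) (use 0 "0.prems" in auto)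
    then show ?thesis using 0 by (simp add: power_mult)
  qed (use m c in \<open>auto simp: power_0_left\<close>)
next
  case (Suc d)
  note IH = Suc.IH and prems = Suc.prems
  show ?case
  proof (cases l)
    case 0
    have "\<bar>a {}\<bar> ^ (2*m) \<le> 1" by (rule power_le_one) (use prems in auto)
    then have "a {} ^ (2*m) \<le> 1" by (simp add: power_mult)
    then show ?thesis using 0 by (simp add: hist_av_const)
  next
    case (Suc k)
    define M where "M = level_sum t (Suc k) a"
    define b where "b = (\<lambda>h. case node t h of Lf b \<Rightarrow> 0 | Qr i lt rt \<Rightarrow> level_sum t k (\<lambda>S. a (insert i S)) h)"
    have "hist_av (Suc d) (\<lambda>h. level_sum t l a h ^ (2*m)) = hist_av d (\<lambda>h. ((M h + b h)^(2*m) + (M h - b h)^(2*m)) / 2)"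
    proof -
      have "level_sum t l a (1 # h) = M h + b h" "level_sum t l a (-1 # h) = M h - b h" for h
        by (auto simp: Suc M_def b_def split: tr.split)
      then show ?thesis by simp
    qed
    also have "\<dots> \<le> hist_av d (\<lambda>h. ((M h)\<^sup>2 + real (2*m) * (b h)\<^sup>2) ^ m)"
      by (rule hist_av_mono[OF two_point])
    also have "\<dots> \<le> (c ^ Suc k * real (d choose Suc k) + c ^ Suc k * real (d choose k)) ^ m"
    proof (rule posfun_mix[OF posfun_hist_av])
      show "hist_av d (\<lambda>h. (M h)\<^sup>2 ^ m) \<le> (c ^ Suc k * real (d choose Suc k)) ^ m"
        using IH[of a "Suc k"] prems unfolding M_def by (simp add: power_mult)
      have bb: "b h ^ (2*m) \<le> (\<Sum>j\<in>V. level_sum t k (\<lambda>S. a (insert j S)) h ^ (2*m))" for h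
      proof (cases "node t h")
        case (Lf x1)
        then have "b h ^ (2*m) = 0" using m by (simp add: b_def)
        moreover have "0 \<le> (\<Sum>j\<in>V. level_sum t k (\<lambda>S. a (insert j S)) h ^ (2*m))"
          by (intro sum_nonneg) simp
        ultimately show ?thesis by (simp only:)
      next
        case (Qr i lt rt)
        then have "i \<in> V" using trvars_node[of t h] V by auto
        then have "level_sum t k (\<lambda>S. a (insert i S)) h ^ (2*m) \<le> (\<Sum>j\<in>V. level_sum t k (\<lambda>S. a (insert j S)) h ^ (2*m))"
          by (intro member_le_sum V) auto
        then show ?thesis by (simp add: b_def Qr)
      qed
      have "hist_av d (\<lambda>h. (real (2*m) * (b h)\<^sup>2) ^ m) = real (2*m) ^ m * hist_av d (\<lambda>h. b h ^ (2*m))"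
        unfolding hist_av_cmult[symmetric] by (simp add: power_mult power_mult_distrib)
      also have "\<dots> \<le> real (2*m) ^ m * hist_av d (\<lambda>h. \<Sum>j\<in>V. level_sum t k (\<lambda>S. a (insert j S)) h ^ (2*m))"
        by (intro mult_left_mono hist_av_mono bb) auto
      also have "\<dots> = real (2*m) ^ m * (\<Sum>j\<in>V. hist_av d (\<lambda>h. level_sum t k (\<lambda>S. a (insert j S)) h ^ (2*m)))"
        by (simp add: hist_av_sum[OF V(1)])
      also have "\<dots> \<le> real (2*m) ^ m * (\<Sum>j\<in>V. (c ^ k * real (d choose k)) ^ m)"
        by (intro mult_left_mono sum_mono IH) (use prems in auto)
      also have "\<dots> = (real (2*m) ^ m * real (card V)) * (c ^ k * real (d choose k)) ^ m" by simp
      also have "\<dots> \<le> c ^ m * (c ^ k * real (d choose k)) ^ m"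
        by (intro mult_right_mono c) (use c in auto)
      finally show "hist_av d (\<lambda>h. (real (2*m) * (b h)\<^sup>2) ^ m) \<le> (c ^ Suc k * real (d choose k)) ^ m"
        by (simp add: power_mult_distrib mult.assoc)
    qed (use c in auto)
    \<comment> \<open>Pascal's rule: a set of Suc k queries either omits the last query or consists
      of it and k earlier ones.\<close>
    also have "c ^ Suc k * real (d choose Suc k) + c ^ Suc k * real (d choose k) = c ^ l * real (Suc d choose l)"
      by (simp add: Suc algebra_simps)
    finally show ?thesis .
  qed
qed

text \<open>The subtracted average is the expected output on independent fair answers, so the bound
  limits the bias due to the nonconstant Fourier coefficients. Level 0 is the total mass 1 and
  accounts for exactly this average; each other level is bounded in its first moment.\<close>

theorem tree_fourier_bound:
  fixes t :: "'a tr"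
  assumes V: "finite V" "trvars t \<subseteq> V" and m: "m > 0"
    and c: "c > 0" "real (2*m) ^ m * real (card V) \<le> c ^ m"
    and ro: "read_once t" and d: "dep t \<le> d" and fin: "finite \<Omega>"
    and X: "\<And>w i. w \<in> \<Omega> \<Longrightarrow> i \<in> V \<Longrightarrow> X w i = 1 \<or> X w i = -1"
    and g: "\<And>b. \<bar>g b\<bar> \<le> 1" and tot: "(\<Sum>w\<in>\<Omega>. wt w) = 1"
    and B: "\<And>S. S \<subseteq> V \<Longrightarrow> S \<noteq> {} \<Longrightarrow> card S \<le> d \<Longrightarrow> \<bar>\<Sum>w\<in>\<Omega>. wt w * (\<Prod>i\<in>S. X w i)\<bar> \<le> B (card S)"
    and Bpos: "\<And>l. B l > 0"
  shows "\<bar>(\<Sum>w\<in>\<Omega>. wt w * g (ev t (X w))) - hist_av d (\<lambda>h. case node t h of Lf b \<Rightarrow> g b | _ \<Rightarrow> 0)\<bar>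
    \<le> (\<Sum>l=1..d. B l * sqrt (c ^ l * real (d choose l)))"
proof -
  define D where "D = (\<lambda>S. \<Sum>w\<in>\<Omega>. wt w * (\<Prod>i\<in>S. X w i))"
  define G where "G = (\<lambda>n :: 'a tr. case n of Lf b \<Rightarrow> g b | Qr i l r \<Rightarrow> 0)"
  have G: "\<bar>G n\<bar> \<le> 1" for n using g by (auto simp: G_def split: tr.split)
  have "(\<Sum>w\<in>\<Omega>. wt w * g (ev t (X w))) = hist_av d (\<lambda>h. G (node t h) * total_sum t D h)"
    using tree_sum_expansion[OF ro d fin, of X wt G] X subsetD[OF V(2)] unfolding D_def
    by (simp add: G_def)
  moreover have "hist_av d (\<lambda>h. G (node t h) * total_sum t D h) - hist_av d (\<lambda>h. G (node t h)) =
    hist_av d (\<lambda>h. G (node t h) * (total_sum t D h - 1))"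
    using hist_av_add[of d "\<lambda>h. G (node t h) * (total_sum t D h - 1)" "\<lambda>h. G (node t h)"]
    by (simp add: algebra_simps)
  moreover have "\<bar>hist_av d (\<lambda>h. G (node t h) * (total_sum t D h - 1))\<bar> \<le> hist_av d (\<lambda>h. \<bar>total_sum t D h - 1\<bar>)"
    by (rule order_trans[OF hist_av_abs hist_av_mono])
       (use G in \<open>auto simp: abs_mult intro: mult_left_le_one_le\<close>)
  moreover have "hist_av d (\<lambda>h. \<bar>total_sum t D h - 1\<bar>) \<le> hist_av d (\<lambda>h. \<Sum>l=1..d. \<bar>level_sum t l D h\<bar>)"
  proof -
    \<comment> \<open>Only histories of full length d enter the average, and the number of levels in
      \<open>total_sum_level\<close> is the length of the history.\<close>
    have len: "hist_av d f \<le> hist_av d f'" if "\<And>h. length h = d \<Longrightarrow> f h \<le> f' h" for f f'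
      using that
    proof (induction d arbitrary: f f')
      case (Suc d)
      have "(f (1 # h) + f (-1 # h)) / 2 \<le> (f' (1 # h) + f' (-1 # h)) / 2" if "length h = d" for h
        by (intro divide_right_mono add_mono Suc.prems) (use that in auto)
      then show ?case using Suc.IH by (simp only: hist_av.simps)
    qed simp
    show ?thesis
    proof (rule len)
      fix h :: "real list" assume h: "length h = d"
      have "total_sum t D h = level_sum t 0 D h + (\<Sum>l=1..d. level_sum t l D h)"
        unfolding total_sum_level h using sum.atLeast_Suc_atMost[of 0 d "\<lambda>l. level_sum t l D h"]
        by (simp add: atMost_atLeast0)
      moreover have "level_sum t 0 D h = 1" using tot by (simp add: D_def)
      ultimately show "\<bar>total_sum t D h - 1\<bar> \<le> (\<Sum>l=1..d. \<bar>level_sum t l D h\<bar>)"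
        using sum_abs[of "\<lambda>l. level_sum t l D h" "{1..d}"] by simp
    qed
  qed
  moreover have "\<dots> = (\<Sum>l=1..d. hist_av d (\<lambda>h. \<bar>level_sum t l D h\<bar>))"
    by (rule hist_av_sum) simp
  moreover have "\<dots> \<le> (\<Sum>l=1..d. B l * sqrt (c ^ l * real (d choose l)))"
  proof (rule sum_mono)
    fix l assume l: "l \<in> {1..d}"
    \<comment> \<open>Normalized to absolute value at most 1, as the moment bound demands. Sets
      outside of level l may get 0 because level l never reads them.\<close>
    define a where "a = (\<lambda>S. if S \<subseteq> V \<and> card S = l then D S / B l else 0)"
    have "\<bar>a S\<bar> \<le> 1" for S
    proof (cases "S \<subseteq> V \<and> card S = l")
      case True
      then have "S \<noteq> {}" using l by auto
      then have "\<bar>D S\<bar> \<le> B l" using B[of S] True l by (auto simp: D_def)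
      then show ?thesis using True Bpos[of l] by (simp add: a_def)
    qed (auto simp: a_def)
    then have "hist_av d (\<lambda>h. level_sum t l a h ^ (2*m)) \<le> (c ^ l * real (d choose l)) ^ m"
      by (intro level_sum_moment[OF V m]) (use c in auto)
    then have 1: "hist_av d (\<lambda>h. \<bar>level_sum t l a h\<bar>) \<le> sqrt (c ^ l * real (d choose l))"
      by (rule hist_av_L1) (use c m l in auto)
    have "level_sum t l D h = B l * level_sum t l a h" for h
    proof -
      have "level_sum t l D h = level_sum t l (\<lambda>S. B l * a S) h"
      proof (rule level_sum_cong[OF ro])
        fix S assume S: "S \<subseteq> queried t h" "card S = l"
        then have "S \<subseteq> V" using queried_trvars[of t h] V by auto
        then show "D S = B l * a S" using S Bpos[of l] by (auto simp: a_def)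
      qed
      then show ?thesis by (simp add: level_sum_cmult)
    qed
    then have "hist_av d (\<lambda>h. \<bar>level_sum t l D h\<bar>) = B l * hist_av d (\<lambda>h. \<bar>level_sum t l a h\<bar>)"
      using Bpos[of l] by (simp add: abs_mult hist_av_cmult)
    then show "hist_av d (\<lambda>h. \<bar>level_sum t l D h\<bar>) \<le> B l * sqrt (c ^ l * real (d choose l))"
      using 1 Bpos[of l] by (simp add: mult_left_mono)
  qed
  ultimately show ?thesis unfolding G_def by linarith
qed

section \<open>Hiding bits at random positions\<close>

primrec subst_tr :: "('v \<Rightarrow> 'u + real) \<Rightarrow> 'v tr \<Rightarrow> 'u tr" where
  "subst_tr \<sigma> (Lf b) = Lf b"
| "subst_tr \<sigma> (Qr v l r) = (case \<sigma> v of Inl u \<Rightarrow> Qr u (subst_tr \<sigma> l) (subst_tr \<sigma> r)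
      | Inr c \<Rightarrow> if c = -1 then subst_tr \<sigma> l else subst_tr \<sigma> r)"

primrec asked :: "'v tr \<Rightarrow> ('v \<Rightarrow> real) \<Rightarrow> 'v set" where
  "asked (Lf b) x = {}"
| "asked (Qr v l r) x = insert v (if x v = -1 then asked l x else asked r x)"

text \<open>A records the answers received so far. A repeated query is answered from it, which makes
  the tree read-once.\<close>

primrec prune :: "'v tr \<Rightarrow> ('v \<Rightarrow> real option) \<Rightarrow> 'v tr" where
  "prune (Lf b) A = Lf b"
| "prune (Qr v l r) A = (case A v of Some c \<Rightarrow> if c = -1 then prune l A else prune r A
      | None \<Rightarrow> Qr v (prune l (A(v \<mapsto> -1))) (prune r (A(v \<mapsto> 1))))"

primrec trunc :: "'v tr \<Rightarrow> nat \<Rightarrow> 'v tr" where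
  "trunc (Lf b) d = Lf b"
| "trunc (Qr v l r) d = (case d of 0 \<Rightarrow> Lf 0 | Suc d' \<Rightarrow> Qr v (trunc l d') (trunc r d'))"

abbreviation subst_in :: "('v \<Rightarrow> 'u + real) \<Rightarrow> ('u \<Rightarrow> real) \<Rightarrow> 'v \<Rightarrow> real" where
  "subst_in \<sigma> y \<equiv> (\<lambda>v. case \<sigma> v of Inl u \<Rightarrow> y u | Inr c \<Rightarrow> c)"

lemma ev_subst: "ev (subst_tr \<sigma> t) y = ev t (subst_in \<sigma> y)"
  by (induction t) (auto split: sum.split)

lemma asked_subst: "asked (subst_tr \<sigma> t) y = {u. \<exists>v\<in>asked t (subst_in \<sigma> y). \<sigma> v = Inl u}"
  by (induction t) (auto split: sum.splits)

lemma trvars_subst: "trvars (subst_tr \<sigma> t) \<subseteq> {u. \<exists>v\<in>trvars t. \<sigma> v = Inl u}"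
  by (induction t) (auto split: sum.splits)

lemma dep_subst: "dep (subst_tr \<sigma> t) \<le> dep t"
  by (induction t) (auto split: sum.splits)

lemma ev_cong: "(\<And>v. v \<in> trvars t \<Longrightarrow> x v = y v) \<Longrightarrow> ev t x = ev t y"
  by (induction t) auto

lemma asked_cong: "(\<And>v. v \<in> trvars t \<Longrightarrow> x v = y v) \<Longrightarrow> asked t x = asked t y"
  by (induction t) auto

lemma finite_asked [simp]: "finite (asked t x)"
  by (induction t) auto

lemma card_asked: "card (asked t x) \<le> dep t"
proof (induction t)
  case (Qr v l r)
  have "card (asked (Qr v l r) x) \<le> Suc (card (if x v = -1 then asked l x else asked r x))"
    by (simp add: card_insert_if)
  then show ?case using Qr by (auto split: if_splits)
qed simp

lemma asked_trvars: "asked t x \<subseteq> trvars t"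
  by (induction t) auto

lemma ev_asked_cong: "(\<And>v. v \<in> asked t x \<Longrightarrow> x v = y v) \<Longrightarrow> ev t y = ev t x \<and> asked t y = asked t x"
  by (induction t) (auto split: if_splits)

lemma asked_upd: "a \<notin> asked t x \<Longrightarrow> asked t (x(a := c)) = asked t x"
  using ev_asked_cong[of t x "x(a := c)"] by (metis fun_upd_other)

lemma asked_upd_self: "a \<in> asked t x \<Longrightarrow> a \<in> asked t (x(a := c))"
  by (induction t) (auto split: if_splits)

text \<open>Of two asked variables one is asked first, and changing the other one does not affect this.\<close>
lemma asked_upd_pair:
  "a \<in> asked t x \<Longrightarrow> b \<in> asked t x \<Longrightarrow> b \<in> asked t (x(a := c)) \<or> a \<in> asked t (x(b := c'))"
  by (induction t) (auto split: if_splits)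

lemma prune_read_once: "read_once (prune t A) \<and> trvars (prune t A) \<subseteq> trvars t - dom A"
proof (induction t arbitrary: A)
  case (Qr v l r)
  show ?case
  proof (cases "A v")
    case None
    then show ?thesis using Qr(1)[of "A(v \<mapsto> -1)"] Qr(2)[of "A(v \<mapsto> 1)"] by (auto simp del: fun_upd_apply)
  next
    case (Some c)
    then show ?thesis using Qr(1)[of A] Qr(2)[of A] by auto
  qed
qed simp

lemma prune_ev:
  assumes "\<And>v c. A v = Some c \<Longrightarrow> x v = c" "\<And>v. v \<in> trvars t \<Longrightarrow> x v = 1 \<or> x v = -1"
  shows "ev (prune t A) x = ev t x \<and> asked (prune t A) x = asked t x - dom A"
  using assms
proof (induction t arbitrary: A)
  case (Qr v l r)
  show ?case
  proof (cases "A v")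
    case None
    have "ev (prune l (A(v \<mapsto> -1))) x = ev l x \<and> asked (prune l (A(v \<mapsto> -1))) x = asked l x - dom (A(v \<mapsto> -1))"
      if "x v = -1" using that Qr.prems by (intro Qr.IH) (auto split: if_splits)
    moreover have "ev (prune r (A(v \<mapsto> 1))) x = ev r x \<and> asked (prune r (A(v \<mapsto> 1))) x = asked r x - dom (A(v \<mapsto> 1))"
      if "x v = 1" using that Qr.prems by (intro Qr.IH) (auto split: if_splits)
    ultimately show ?thesis using None Qr.prems(2)[of v] by auto
  next
    case (Some c)
    then show ?thesis using Qr.IH[of A] Qr.prems by auto
  qed
qed simp

lemma dep_trunc: "dep (trunc t d) \<le> d"
  by (induction t arbitrary: d) (auto split: nat.split)

lemma trvars_trunc: "trvars (trunc t d) \<subseteq> trvars t"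
proof (induction t arbitrary: d)
  case (Qr v l r)
  then show ?case using Qr(1)[of "d - 1"] Qr(2)[of "d - 1"] by (cases d) auto
qed simp

text \<open>In a read-once tree the number of asked variables is the length of the path, so a run
  with at most d asked variables ends before the cut.\<close>

lemma ev_trunc: "read_once t \<Longrightarrow> card (asked t x) \<le> d \<Longrightarrow> ev (trunc t d) x = ev t x"
proof (induction t arbitrary: d)
  case (Qr v l r)
  let ?s = "if x v = -1 then asked l x else asked r x"
  have "v \<notin> ?s" using Qr.prems asked_trvars[of l x] asked_trvars[of r x] by auto
  then have c: "card (asked (Qr v l r) x) = Suc (card ?s)" by (simp split: if_splits)
  show ?case
  proof (cases d)
    case 0
    then show ?thesis using c Qr.prems by simp
  next
    case (Suc d')
    then have "card ?s \<le> d'" using c Qr.prems by simp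
    then show ?thesis using Qr.IH[of d'] Qr.prems Suc by (auto split: if_splits)
  qed
qed simp

definition accept :: "'v set \<Rightarrow> (('v \<Rightarrow> real) \<Rightarrow> real) \<Rightarrow> 'v tr \<Rightarrow> real" where
  "accept V \<mu> t = (\<Sum>x\<in>signs V. \<mu> x * of_bool (ev t x = 1))"

definition distr_on :: "'v set \<Rightarrow> (('v \<Rightarrow> real) \<Rightarrow> real) \<Rightarrow> bool" where
  "distr_on V \<mu> \<longleftrightarrow> (\<forall>x. 0 \<le> \<mu> x) \<and> (\<Sum>x\<in>signs V. \<mu> x) = 1"

definition indist :: "'v set \<Rightarrow> nat \<Rightarrow> real \<Rightarrow> (('v \<Rightarrow> real) \<Rightarrow> real) \<Rightarrow> (('v \<Rightarrow> real) \<Rightarrow> real) \<Rightarrow> bool" where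
  "indist V d \<delta> \<mu> \<nu> \<longleftrightarrow> (\<forall>t. trvars t \<subseteq> V \<longrightarrow> dep t \<le> d \<longrightarrow> \<bar>accept V \<mu> t - accept V \<nu> t\<bar> \<le> \<delta>)"

definition hide_in :: "'v set \<Rightarrow> 'j set \<Rightarrow> real \<Rightarrow> ('v \<Rightarrow> real) \<Rightarrow> ('v \<Rightarrow> 'j) \<Rightarrow> 'v \<times> 'j \<Rightarrow> real" where
  "hide_in V J f w p = (\<lambda>(v, j)\<in>V \<times> J. if j = p v then w v else f)"

definition hide_distr :: "'v set \<Rightarrow> 'j set \<Rightarrow> real \<Rightarrow> (('v \<Rightarrow> real) \<Rightarrow> real) \<Rightarrow> ('v \<times> 'j \<Rightarrow> real) \<Rightarrow> real" where
  "hide_distr V J f \<mu> z = (\<Sum>w\<in>signs V. \<Sum>p\<in>V \<rightarrow>\<^sub>E J. if hide_in V J f w p = z then \<mu> w else 0) / real (card J) ^ card V"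

lemma hide_in_signs: "w \<in> signs V \<Longrightarrow> f = 1 \<or> f = -1 \<Longrightarrow> hide_in V J f w p \<in> signs (V \<times> J)"
  by (fastforce simp: hide_in_def signs_def PiE_def Pi_def extensional_def)

lemma hide_distr_sum:
  assumes "finite V" "finite J" "f = 1 \<or> f = -1"
  shows "(\<Sum>z\<in>signs (V \<times> J). hide_distr V J f \<mu> z * g z) =
    (\<Sum>p\<in>V \<rightarrow>\<^sub>E J. \<Sum>w\<in>signs V. \<mu> w * g (hide_in V J f w p)) / real (card J) ^ card V"
proof -
  let ?K = "real (card J) ^ card V"
  have "(\<Sum>z\<in>signs (V \<times> J). hide_distr V J f \<mu> z * g z) =
     (\<Sum>z\<in>signs (V \<times> J). \<Sum>w\<in>signs V. \<Sum>p\<in>V \<rightarrow>\<^sub>E J. if hide_in V J f w p = z then \<mu> w * g z / ?K else 0)"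
    unfolding hide_distr_def by (simp add: sum_distrib_right sum_divide_distrib if_distrib[where f = "\<lambda>u. u / _"] if_distrib[where f = "\<lambda>u. u * _"] cong: if_cong)
  also have "\<dots> = (\<Sum>w\<in>signs V. \<Sum>p\<in>V \<rightarrow>\<^sub>E J. \<Sum>z\<in>signs (V \<times> J). if hide_in V J f w p = z then \<mu> w * g z / ?K else 0)"
    by (subst sum.swap, intro sum.cong refl, subst sum.swap) simp
  also have "\<dots> = (\<Sum>w\<in>signs V. \<Sum>p\<in>V \<rightarrow>\<^sub>E J. \<mu> w * g (hide_in V J f w p) / ?K)"
    using assms by (intro sum.cong refl) (simp add: finite_signs hide_in_signs)
  also have "\<dots> = (\<Sum>p\<in>V \<rightarrow>\<^sub>E J. \<Sum>w\<in>signs V. \<mu> w * g (hide_in V J f w p)) / ?K"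
    by (subst sum.swap) (simp add: sum_divide_distrib)
  finally show ?thesis .
qed

lemma distr_on_hide:
  assumes "finite V" "finite J" "J \<noteq> {}" "f = 1 \<or> f = -1" "distr_on V \<mu>"
  shows "distr_on (V \<times> J) (hide_distr V J f \<mu>)"
proof -
  have "(\<Sum>z\<in>signs (V \<times> J). hide_distr V J f \<mu> z) = (\<Sum>p\<in>V \<rightarrow>\<^sub>E J. 1) / real (card J) ^ card V"
    using hide_distr_sum[OF assms(1,2,4), of \<mu> "\<lambda>_. 1"] assms(5) by (simp add: distr_on_def)
  also have "\<dots> = 1" using assms by (simp add: card_PiE)
  finally show ?thesis using assms(5) by (auto simp: distr_on_def hide_distr_def intro!: divide_nonneg_nonneg sum_nonneg)
qed

text \<open>The hidden bit of one block is found, on average over its position, only after about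
  half of the block has been read. Let M be the positions that t reads if the block is as in x.
  Hiding the bit outside of M does not change the run. Of two positions in M, the one asked first is
  still read if the bit is hidden at the other one, so hiding inside M leaves (card M + 1) / 2
  positions of M read on average.\<close>

lemma hide_cost_single:
  fixes J :: "'j set" and v :: 'v and x :: "'v \<times> 'j \<Rightarrow> real" and c :: real
  assumes J: "finite J"
  defines "y \<equiv> \<lambda>j. x((v, j) := c)"
  shows "real (card J) * (\<Sum>j\<in>J. of_bool ((v, j) \<in> asked t (y j))) \<le> 2 * (\<Sum>j\<in>J. real (card {j'\<in>J. (v, j') \<in> asked t (y j)}))"
proof -
  define M where "M = {j\<in>J. (v, j) \<in> asked t x}"
  define r where "r = (\<lambda>j. real (card {j'\<in>J. (v, j') \<in> asked t (y j)}))"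
  have finM: "finite M" and MJ: "M \<subseteq> J" using J by (auto simp: M_def)
  have in_iff: "(v, j) \<in> asked t (y j) \<longleftrightarrow> (v, j) \<in> asked t x" for j
    unfolding y_def using asked_upd_self asked_upd by metis
  have lhs: "(\<Sum>j\<in>J. of_bool ((v, j) \<in> asked t (y j))) = real (card M)"
    unfolding in_iff M_def using J by (simp add: Int_def)
  have out: "r j = real (card M)" if "j \<in> J - M" for j
  proof -
    have "asked t (y j) = asked t x" unfolding y_def by (rule asked_upd) (use that in \<open>auto simp: M_def\<close>)
    then show ?thesis by (simp add: r_def M_def)
  qed
  have inn: "r j \<ge> (\<Sum>j'\<in>M. of_bool ((v, j') \<in> asked t (y j)))" if "j \<in> M" for j
  proof -
    have "(\<Sum>j'\<in>M. of_bool ((v, j') \<in> asked t (y j))) = real (card {j'\<in>M. (v, j') \<in> asked t (y j)})"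
      using finM by (simp add: Int_def)
    also have "\<dots> \<le> r j" unfolding r_def using MJ J by (auto intro!: card_mono)
    finally show ?thesis .
  qed
  have "real (card M)^2 + real (card M) \<le> 2 * (\<Sum>j\<in>M. \<Sum>j'\<in>M. of_bool ((v, j') \<in> asked t (y j)))"
  proof -
    have "real (card M)^2 + real (card M) = (\<Sum>j\<in>M. \<Sum>j'\<in>M. 1 + of_bool (j = j'))"
      using finM by (simp add: sum.distrib power2_eq_square Int_def of_bool_def distrib_left)
    also have "\<dots> \<le> (\<Sum>j\<in>M. \<Sum>j'\<in>M. of_bool ((v, j') \<in> asked t (y j)) + of_bool ((v, j) \<in> asked t (y j')))"
    proof (intro sum_mono)
      fix j j' assume jj: "j \<in> M" "j' \<in> M"
      then have "(v, j') \<in> asked t (y j) \<or> (v, j) \<in> asked t (y j')"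
        unfolding y_def by (intro asked_upd_pair) (auto simp: M_def)
      moreover have "(v, j) \<in> asked t (y j)" using jj in_iff by (auto simp: M_def)
      ultimately show "1 + of_bool (j = j') \<le> (of_bool ((v, j') \<in> asked t (y j)) + of_bool ((v, j) \<in> asked t (y j')) :: real)"
        by auto
    qed
    also have "\<dots> = (\<Sum>j\<in>M. \<Sum>j'\<in>M. of_bool ((v, j') \<in> asked t (y j))) + (\<Sum>j\<in>M. \<Sum>j'\<in>M. of_bool ((v, j) \<in> asked t (y j')))"
      by (simp only: sum.distrib)
    also have "(\<Sum>j\<in>M. \<Sum>j'\<in>M. of_bool ((v, j) \<in> asked t (y j'))) = (\<Sum>j\<in>M. \<Sum>j'\<in>M. (of_bool ((v, j') \<in> asked t (y j)) :: real))"
      by (rule sum.swap)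
    finally show ?thesis by simp
  qed
  also have "\<dots> \<le> 2 * (\<Sum>j\<in>M. r j)" using inn by (intro mult_left_mono sum_mono) auto
  finally have 1: "real (card M)^2 + real (card M) \<le> 2 * (\<Sum>j\<in>M. r j)" .
  have le: "card M \<le> card J" using J MJ by (rule card_mono)
  have "(\<Sum>j\<in>J. r j) = (\<Sum>j\<in>M. r j) + (\<Sum>j\<in>J - M. r j)"
    using sum.subset_diff[OF MJ J, of r] by simp
  also have "(\<Sum>j\<in>J - M. r j) = real (card J - card M) * real (card M)"
    using out finM MJ by (simp add: card_Diff_subset)
  finally have "2 * (\<Sum>j\<in>J. r j) \<ge> real (card M)^2 + real (card M) + 2 * (real (card J) - real (card M)) * real (card M)"
    using 1 le by (simp add: of_nat_diff mult.assoc left_diff_distrib right_diff_distrib)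
  moreover have "real (card M)^2 + real (card M) + 2 * (real (card J) - real (card M)) * real (card M) - real (card J) * real (card M)
     = real (card M) + (real (card J) - real (card M)) * real (card M)" by (simp add: power2_eq_square algebra_simps)
  moreover have "\<dots> \<ge> 0" using le by simp
  ultimately show ?thesis unfolding lhs r_def by linarith
qed

lemma sum_PiE_upd:
  assumes "v \<in> V"
  shows "(\<Sum>p\<in>V \<rightarrow>\<^sub>E J. g p) = (\<Sum>p\<in>(V - {v}) \<rightarrow>\<^sub>E J. \<Sum>j\<in>J. g (p(v := j)))"
proof -
  have V: "V = insert v (V - {v})" using assms by auto
  have "(\<Sum>p\<in>V \<rightarrow>\<^sub>E J. g p) = (\<Sum>(j, p)\<in>J \<times> ((V - {v}) \<rightarrow>\<^sub>E J). g (p(v := j)))"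
    by (subst V, subst PiE_insert_eq, subst sum.reindex)
       (use inj_combinator[of v "V - {v}" "\<lambda>_. J"] in \<open>auto simp: case_prod_beta\<close>)
  also have "\<dots> = (\<Sum>p\<in>(V - {v}) \<rightarrow>\<^sub>E J. \<Sum>j\<in>J. g (p(v := j)))"
    by (simp add: sum.cartesian_product[symmetric] sum.swap[of _ J])
  finally show ?thesis .
qed

text \<open>Summing the bound for one block over all blocks turns dep t queries into at most 2 * dep
  t / card J hidden bits found, in expectation over p.\<close>

lemma hide_cost:
  assumes V: "finite V" and J: "finite J" "J \<noteq> {}" and w: "w \<in> signs V" and t: "trvars t \<subseteq> V \<times> J"
  shows "(\<Sum>p\<in>V \<rightarrow>\<^sub>E J. real (card {v\<in>V. (v, p v) \<in> asked t (hide_in V J f w p)}))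
    \<le> 2 * real (dep t) / real (card J) * real (card J) ^ card V"
proof -
  define A where "A = (\<lambda>p. asked t (hide_in V J f w p))"
  define n where "n = (\<lambda>v p. real (card {j\<in>J. (v, j) \<in> A p}))"
  have one: "real (card J) * (\<Sum>p\<in>V \<rightarrow>\<^sub>E J. of_bool ((v, p v) \<in> A p)) \<le> 2 * (\<Sum>p\<in>V \<rightarrow>\<^sub>E J. n v p)"
    if v: "v \<in> V" for v
  proof -
    have "real (card J) * (\<Sum>j\<in>J. of_bool ((v, j) \<in> A (p(v := j)))) \<le> 2 * (\<Sum>j\<in>J. n v (p(v := j)))"
      if p: "p \<in> (V - {v}) \<rightarrow>\<^sub>E J" for p
    proof -
      \<comment> \<open>The input in which block v consists of fillers only; this base point does
        not depend on the position j of the hidden bit.\<close>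
      define x where "x = (\<lambda>(u, j)\<in>V \<times> J. if u \<noteq> v \<and> j = p u then w u else f)"
      have "hide_in V J f w (p(v := j)) = x((v, j) := w v)" if "j \<in> J" for j
        using v that by (auto simp: hide_in_def x_def fun_eq_iff)
      then have "A (p(v := j)) = asked t (x((v, j) := w v))" if "j \<in> J" for j
        using that by (simp add: A_def)
      then show ?thesis using hide_cost_single[OF J(1), of v t x "w v"] by (simp add: n_def)
    qed
    then have "(\<Sum>p\<in>(V - {v}) \<rightarrow>\<^sub>E J. real (card J) * (\<Sum>j\<in>J. of_bool ((v, j) \<in> A (p(v := j)))))
        \<le> (\<Sum>p\<in>(V - {v}) \<rightarrow>\<^sub>E J. 2 * (\<Sum>j\<in>J. n v (p(v := j))))"
      by (rule sum_mono)
    then show ?thesis unfolding sum_PiE_upd[OF v] by (simp add: sum_distrib_left[symmetric])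
  qed
  have n_le: "(\<Sum>v\<in>V. n v p) \<le> real (dep t)" for p
  proof -
    have "(\<Sum>v\<in>V. n v p) = real (card (SIGMA v:V. {j\<in>J. (v, j) \<in> A p}))"
      using V J by (simp add: n_def card_SigmaI)
    also have "\<dots> \<le> real (card (A p))" unfolding of_nat_le_iff
      by (rule card_mono) (auto simp: A_def)
    also have "\<dots> \<le> real (dep t)" using card_asked[of t] by (simp add: A_def)
    finally show ?thesis .
  qed
  have "real (card J) * (\<Sum>p\<in>V \<rightarrow>\<^sub>E J. real (card {v\<in>V. (v, p v) \<in> A p})) =
      real (card J) * (\<Sum>p\<in>V \<rightarrow>\<^sub>E J. \<Sum>v\<in>V. of_bool ((v, p v) \<in> A p))"
    using V by (simp add: Int_def)
  also have "\<dots> = (\<Sum>v\<in>V. real (card J) * (\<Sum>p\<in>V \<rightarrow>\<^sub>E J. of_bool ((v, p v) \<in> A p)))"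
    by (subst sum.swap) (simp add: sum_distrib_left)
  also have "\<dots> \<le> (\<Sum>v\<in>V. 2 * (\<Sum>p\<in>V \<rightarrow>\<^sub>E J. n v p))" by (intro sum_mono one)
  also have "\<dots> = 2 * (\<Sum>p\<in>V \<rightarrow>\<^sub>E J. \<Sum>v\<in>V. n v p)" by (subst sum.swap) (simp add: sum_distrib_left)
  also have "\<dots> \<le> 2 * (\<Sum>p\<in>V \<rightarrow>\<^sub>E J. real (dep t))" by (intro mult_left_mono sum_mono n_le) auto
  also have "\<dots> = 2 * real (dep t) * real (card J) ^ card V" using V J by (simp add: card_PiE)
  finally show ?thesis using J unfolding A_def by (simp add: field_simps card_gt_0_iff)
qed

text \<open>For fixed positions p, t becomes a tree on the unhidden bits that pays only for queries
  hitting a hidden bit. By Markov's inequality it makes more than d such queries with probability at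
  most 2 * T / (card J * (d + 1)), and cutting it at depth d changes each of the two acceptance
  probabilities by at most that much.\<close>

theorem hide_indist:
  assumes V: "finite V" and J: "finite J" "J \<noteq> {}" and f: "f = 1 \<or> f = -1"
    and \<mu>: "distr_on V \<mu>" and \<nu>: "distr_on V \<nu>" and ind: "indist V d \<delta> \<mu> \<nu>"
  shows "indist (V \<times> J) T (\<delta> + 4 * real T / (real (card J) * real (Suc d))) (hide_distr V J f \<mu>) (hide_distr V J f \<nu>)"
  unfolding indist_def
proof (intro allI impI)
  fix t assume t: "trvars t \<subseteq> V \<times> J" "dep t \<le> T"
  define K where "K = real (card J)"
  have K: "K > 0" using J by (simp add: K_def card_gt_0_iff)
  define \<sigma> :: "('a \<Rightarrow> 'b) \<Rightarrow> 'a \<times> 'b \<Rightarrow> 'a + real" where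
    "\<sigma> = (\<lambda>p (v, j). if j = p v then Inl v else Inr f)"
  define s where "s = (\<lambda>p. prune (subst_tr (\<sigma> p) t) Map.empty)"
  have s_ro: "read_once (s p)" and s_vars: "trvars (s p) \<subseteq> V" for p
  proof -
    have "trvars (subst_tr (\<sigma> p) t) \<subseteq> V"
      using trvars_subst[of "\<sigma> p" t] t(1) by (fastforce simp: \<sigma>_def split: if_splits)
    then show "read_once (s p)" "trvars (s p) \<subseteq> V"
      using prune_read_once[of "subst_tr (\<sigma> p) t" Map.empty] by (auto simp: s_def)
  qed
  have ev_s: "ev (s p) w = ev t (hide_in V J f w p)" and
    asked_s: "asked (s p) w = {v\<in>V. (v, p v) \<in> asked t (hide_in V J f w p)}"
    if w: "w \<in> signs V" and p: "p \<in> V \<rightarrow>\<^sub>E J" for w p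
  proof -
    have eq: "subst_in (\<sigma> p) w v = hide_in V J f w p v" if "v \<in> trvars t" for v
      using that t(1) by (auto simp: \<sigma>_def hide_in_def split: prod.split)
    have "w v = 1 \<or> w v = -1" if "v \<in> trvars (subst_tr (\<sigma> p) t)" for v
      using that trvars_subst[of "\<sigma> p" t] t(1) w by (fastforce simp: \<sigma>_def signs_def split: if_splits)
    then have *: "ev (s p) w = ev (subst_tr (\<sigma> p) t) w \<and> asked (s p) w = asked (subst_tr (\<sigma> p) t) w"
      unfolding s_def using prune_ev[of Map.empty w "subst_tr (\<sigma> p) t"] by auto
    show "ev (s p) w = ev t (hide_in V J f w p)"
      using * ev_subst[of "\<sigma> p" t w] ev_cong[OF eq, of t] by simp
    have "asked t (subst_in (\<sigma> p) w) = asked t (hide_in V J f w p)"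
      by (rule asked_cong) (rule eq)
    then show "asked (s p) w = {v\<in>V. (v, p v) \<in> asked t (hide_in V J f w p)}"
      using * asked_subst[of "\<sigma> p" t w] asked_trvars[of t "hide_in V J f w p"] t(1)
      by (fastforce simp: \<sigma>_def split: if_splits prod.splits)
  qed
  have acc: "accept (V \<times> J) (hide_distr V J f \<rho>) t = (\<Sum>p\<in>V \<rightarrow>\<^sub>E J. accept V \<rho> (s p)) / K ^ card V" for \<rho>
    unfolding accept_def hide_distr_sum[OF V J(1) f] K_def using ev_s by simp
  have tr: "\<bar>(\<Sum>p\<in>V \<rightarrow>\<^sub>E J. accept V \<rho> (s p)) - (\<Sum>p\<in>V \<rightarrow>\<^sub>E J. accept V \<rho> (trunc (s p) d))\<bar>
     \<le> 2 * real T / (K * real (Suc d)) * K ^ card V" if \<rho>: "distr_on V \<rho>" for \<rho>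
  proof -
    have pt: "\<bar>of_bool (ev (s p) w = 1) - of_bool (ev (trunc (s p) d) w = 1)\<bar> \<le> real (card (asked (s p) w)) / real (Suc d)" for p w
    proof (cases "card (asked (s p) w) \<le> d")
      case True
      then show ?thesis using ev_trunc[OF s_ro] by simp
    next
      case False
      then have "1 \<le> real (card (asked (s p) w)) / real (Suc d)" by (simp add: field_simps)
      then show ?thesis by (auto simp: of_bool_def)
    qed
    have "\<bar>(\<Sum>p\<in>V \<rightarrow>\<^sub>E J. accept V \<rho> (s p)) - (\<Sum>p\<in>V \<rightarrow>\<^sub>E J. accept V \<rho> (trunc (s p) d))\<bar>
      = \<bar>\<Sum>p\<in>V \<rightarrow>\<^sub>E J. \<Sum>w\<in>signs V. \<rho> w * (of_bool (ev (s p) w = 1) - of_bool (ev (trunc (s p) d) w = 1))\<bar>"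
      unfolding accept_def by (simp add: sum_subtractf right_diff_distrib)
    also have "\<dots> \<le> (\<Sum>p\<in>V \<rightarrow>\<^sub>E J. \<Sum>w\<in>signs V. \<rho> w * (real (card (asked (s p) w)) / real (Suc d)))"
    proof (intro order_trans[OF sum_abs] sum_mono)
      fix p w
      have "\<rho> w * \<bar>of_bool (ev (s p) w = 1) - of_bool (ev (trunc (s p) d) w = 1)\<bar> \<le> \<rho> w * (real (card (asked (s p) w)) / real (Suc d))"
        using \<rho> by (intro mult_left_mono pt) (auto simp: distr_on_def)
      then show "\<bar>\<rho> w * (of_bool (ev (s p) w = 1) - of_bool (ev (trunc (s p) d) w = 1))\<bar> \<le> \<rho> w * (real (card (asked (s p) w)) / real (Suc d))"
        using \<rho> by (simp only: abs_mult) (simp add: distr_on_def)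
    qed
    also have "\<dots> = (\<Sum>w\<in>signs V. \<rho> w * ((\<Sum>p\<in>V \<rightarrow>\<^sub>E J. real (card {v\<in>V. (v, p v) \<in> asked t (hide_in V J f w p)})) / real (Suc d)))"
      by (subst sum.swap) (simp add: asked_s sum_distrib_left sum_divide_distrib)
    also have "\<dots> \<le> (\<Sum>w\<in>signs V. \<rho> w * (2 * real T / K * K ^ card V / real (Suc d)))"
    proof (intro sum_mono mult_left_mono divide_right_mono)
      fix w assume "w \<in> signs V"
      from hide_cost[OF V J this t(1), of f]
      have "(\<Sum>p\<in>V \<rightarrow>\<^sub>E J. real (card {v\<in>V. (v, p v) \<in> asked t (hide_in V J f w p)})) \<le> 2 * real (dep t) / K * K ^ card V"
        by (simp add: K_def)
      also have "\<dots> \<le> 2 * real T / K * K ^ card V"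
        using t(2) K by (intro mult_right_mono divide_right_mono) auto
      finally show "(\<Sum>p\<in>V \<rightarrow>\<^sub>E J. real (card {v\<in>V. (v, p v) \<in> asked t (hide_in V J f w p)})) \<le> 2 * real T / K * K ^ card V" .
    qed (use \<rho> in \<open>auto simp: distr_on_def\<close>)
    also have "\<dots> = (2 * real T / K * K ^ card V / real (Suc d))"
      unfolding sum_distrib_right[symmetric] using \<rho> by (simp add: distr_on_def)
    finally show ?thesis by simp
  qed
  have "\<bar>(\<Sum>p\<in>V \<rightarrow>\<^sub>E J. accept V \<mu> (trunc (s p) d)) - (\<Sum>p\<in>V \<rightarrow>\<^sub>E J. accept V \<nu> (trunc (s p) d))\<bar> \<le> (\<Sum>p\<in>V \<rightarrow>\<^sub>E J. \<delta>)"
    unfolding sum_subtractf[symmetric]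
  proof (intro order_trans[OF sum_abs] sum_mono)
    fix p
    show "\<bar>accept V \<mu> (trunc (s p) d) - accept V \<nu> (trunc (s p) d)\<bar> \<le> \<delta>"
      using ind s_vars[of p] trvars_trunc[of "s p" d] dep_trunc[of "s p" d] unfolding indist_def by blast
  qed
  moreover have "(\<Sum>p\<in>V \<rightarrow>\<^sub>E J. \<delta>) = \<delta> * K ^ card V" using V by (simp add: card_PiE K_def)
  ultimately have "\<bar>(\<Sum>p\<in>V \<rightarrow>\<^sub>E J. accept V \<mu> (s p)) - (\<Sum>p\<in>V \<rightarrow>\<^sub>E J. accept V \<nu> (s p))\<bar>
     \<le> \<delta> * K ^ card V + 2 * (2 * real T / (K * real (Suc d)) * K ^ card V)"
    using tr[OF \<mu>] tr[OF \<nu>] by linarith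
  also have "\<dots> = (\<delta> + 4 * real T / (K * real (Suc d))) * K ^ card V" by (simp add: algebra_simps)
  finally show "\<bar>accept (V \<times> J) (hide_distr V J f \<mu>) t - accept (V \<times> J) (hide_distr V J f \<nu>) t\<bar>
      \<le> \<delta> + 4 * real T / (real (card J) * real (Suc d))"
    unfolding acc using K by (simp add: diff_divide_distrib[symmetric] abs_divide pos_divide_le_eq K_def[symmetric])
qed

section \<open>The cheat sheet construction\<close>

text \<open>An input entry belongs to instance \<tau>, outer bit i, row r and column j. A cell is
  named by an address e, the set of instances with answer 1; its claims are the outer bits, and the
  bits s of its pointers spell the grid positions that prove them.\<close>

datatype 'o var = Inp nat 'o "nat set" "nat set" | Flag "nat set" | Claim "nat set" nat 'o
  | Ptr "nat set" nat 'o "nat set" nat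

definition prod_expect :: "nat \<Rightarrow> 'z set \<Rightarrow> (nat \<Rightarrow> 'z \<Rightarrow> real) \<Rightarrow> ((nat \<Rightarrow> 'z) \<Rightarrow> real) \<Rightarrow> real" where
  "prod_expect c \<Omega> \<nu> g = (\<Sum>zs\<in>{..<c} \<rightarrow>\<^sub>E \<Omega>. (\<Prod>\<tau><c. \<nu> \<tau> (zs \<tau>)) * g zs)"

lemma prod_expect_coord:
  assumes "\<tau> < c"
  shows "prod_expect c \<Omega> \<nu> g = (\<Sum>zs\<in>({..<c} - {\<tau>}) \<rightarrow>\<^sub>E \<Omega>. (\<Prod>\<tau>'\<in>{..<c} - {\<tau>}. \<nu> \<tau>' (zs \<tau>')) * (\<Sum>z\<in>\<Omega>. \<nu> \<tau> z * g (zs(\<tau> := z))))"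
proof -
  have "(\<Prod>\<tau>'<c. \<nu> \<tau>' ((zs(\<tau> := z)) \<tau>')) = \<nu> \<tau> z * (\<Prod>\<tau>'\<in>{..<c} - {\<tau>}. \<nu> \<tau>' (zs \<tau>'))" for zs z
    using assms by (subst prod.remove[of _ \<tau>]) (auto intro!: arg_cong2[where f = "(*)"] prod.cong)
  then show ?thesis unfolding prod_expect_def using assms
    by (subst sum_PiE_upd[of \<tau>]) (auto simp: sum_distrib_left sum_distrib_right ac_simps)
qed

lemma prod_expect_const:
  assumes "finite \<Omega>" "\<And>\<tau>. \<tau> < c \<Longrightarrow> (\<Sum>z\<in>\<Omega>. \<nu> \<tau> z) = 1"
  shows "prod_expect c \<Omega> \<nu> (\<lambda>_. k) = k"
  using prod_sum_PiE[of "{..<c}" "\<lambda>_. \<Omega>" \<nu>] assms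
  by (simp add: prod_expect_def sum_distrib_right[symmetric])

lemma prod_expect_marginal:
  assumes "finite \<Omega>" "\<And>\<tau>. \<tau> < c \<Longrightarrow> (\<Sum>z\<in>\<Omega>. \<nu> \<tau> z) = 1" "\<tau> < c"
  shows "prod_expect c \<Omega> \<nu> (\<lambda>zs. g (zs \<tau>)) = (\<Sum>z\<in>\<Omega>. \<nu> \<tau> z * g z)"
proof -
  have "(\<Prod>\<tau>'\<in>{..<c} - {\<tau>}. \<Sum>z\<in>\<Omega>. \<nu> \<tau>' z) = 1" using assms by (intro prod.neutral) auto
  then have "(\<Sum>zs\<in>({..<c} - {\<tau>}) \<rightarrow>\<^sub>E \<Omega>. \<Prod>\<tau>'\<in>{..<c} - {\<tau>}. \<nu> \<tau>' (zs \<tau>')) = 1"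
    using prod_sum_PiE[of "{..<c} - {\<tau>}" "\<lambda>_. \<Omega>" \<nu>] assms(1) by simp
  then show ?thesis unfolding prod_expect_coord[OF assms(3)]
    by (simp add: sum_distrib_right[symmetric])
qed

text \<open>One step of a hybrid argument: only coordinate \<tau> changes its distribution, and the
  other coordinates are conditioned on.\<close>

lemma prod_expect_swap:
  assumes fin: "finite \<Omega>" and sum: "\<And>\<tau>. \<tau> < c \<Longrightarrow> (\<Sum>z\<in>\<Omega>. \<nu> \<tau> z) = 1" and nn: "\<And>\<tau> z. 0 \<le> \<nu> \<tau> z"
    and \<tau>: "\<tau> < c" and eq: "\<And>\<tau>'. \<tau>' \<noteq> \<tau> \<Longrightarrow> \<nu>' \<tau>' = \<nu> \<tau>'"
    and le: "\<And>zs. zs \<in> ({..<c} - {\<tau>}) \<rightarrow>\<^sub>E \<Omega> \<Longrightarrow> \<bar>(\<Sum>z\<in>\<Omega>. \<nu> \<tau> z * g (zs(\<tau> := z))) - (\<Sum>z\<in>\<Omega>. \<nu>' \<tau> z * g (zs(\<tau> := z)))\<bar> \<le> \<delta>"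
  shows "\<bar>prod_expect c \<Omega> \<nu> g - prod_expect c \<Omega> \<nu>' g\<bar> \<le> \<delta>"
proof -
  let ?P = "\<lambda>zs. \<Prod>\<tau>'\<in>{..<c} - {\<tau>}. \<nu> \<tau>' (zs \<tau>')"
  have "(\<Prod>\<tau>'\<in>{..<c} - {\<tau>}. \<Sum>z\<in>\<Omega>. \<nu> \<tau>' z) = 1" using sum by (intro prod.neutral) auto
  then have one: "(\<Sum>zs\<in>({..<c} - {\<tau>}) \<rightarrow>\<^sub>E \<Omega>. ?P zs) = 1"
    using prod_sum_PiE[of "{..<c} - {\<tau>}" "\<lambda>_. \<Omega>" \<nu>] fin by simp
  have P': "(\<Prod>\<tau>'\<in>{..<c} - {\<tau>}. \<nu>' \<tau>' (zs \<tau>')) = ?P zs" for zs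
    by (intro prod.cong refl) (simp add: eq)
  have "\<bar>prod_expect c \<Omega> \<nu> g - prod_expect c \<Omega> \<nu>' g\<bar> =
     \<bar>\<Sum>zs\<in>({..<c} - {\<tau>}) \<rightarrow>\<^sub>E \<Omega>. ?P zs * ((\<Sum>z\<in>\<Omega>. \<nu> \<tau> z * g (zs(\<tau> := z))) - (\<Sum>z\<in>\<Omega>. \<nu>' \<tau> z * g (zs(\<tau> := z))))\<bar>"
    unfolding prod_expect_coord[OF \<tau>] P' by (simp add: sum_subtractf right_diff_distrib)
  also have "\<dots> \<le> (\<Sum>zs\<in>({..<c} - {\<tau>}) \<rightarrow>\<^sub>E \<Omega>. ?P zs * \<delta>)"
    using nn le by (intro order_trans[OF sum_abs] sum_mono) (auto simp: abs_mult prod_nonneg intro!: mult_left_mono)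
  also have "\<dots> = \<delta>" using one by (simp add: sum_distrib_right[symmetric])
  finally show ?thesis .
qed

lemma prod_expect_mono:
  assumes "\<And>\<tau> z. 0 \<le> \<nu> \<tau> z" "\<And>zs. zs \<in> {..<c} \<rightarrow>\<^sub>E \<Omega> \<Longrightarrow> g zs \<le> g' zs"
  shows "prod_expect c \<Omega> \<nu> g \<le> prod_expect c \<Omega> \<nu> g'"
  unfolding prod_expect_def using assms by (intro sum_mono mult_left_mono prod_nonneg) auto

lemma prod_expect_sum: "prod_expect c \<Omega> \<nu> (\<lambda>zs. \<Sum>i\<in>I. g i zs) = (\<Sum>i\<in>I. prod_expect c \<Omega> \<nu> (g i))"
  unfolding prod_expect_def by (subst sum.swap) (simp add: sum_distrib_left)

text \<open>Reports whether t reads a variable of C, which makes this event an output to which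
  indistinguishability applies.\<close>

primrec touch :: "'v set \<Rightarrow> 'v tr \<Rightarrow> 'v tr" where
  "touch C (Lf b) = Lf 0"
| "touch C (Qr v l r) = (if v \<in> C then Lf 1 else Qr v (touch C l) (touch C r))"

lemma ev_touch: "ev (touch C t) x = (if asked t x \<inter> C = {} then 0 else 1)"
  by (induction t) auto

lemma trvars_touch: "trvars (touch C t) \<subseteq> trvars t"
  by (induction t) auto

lemma dep_touch: "dep (touch C t) \<le> dep t"
  by (induction t) auto

text \<open>The partial function to be made total compares \<Phi> with \<theta> under the promise
  that the two differ by at least \<gamma>. It is used in c instances with bits indexed by W, and a
  pointer has b bits.\<close>

locale cheat =
  fixes W :: "'o set" and c b :: nat and \<Phi> :: "('o \<Rightarrow> real) \<Rightarrow> real" and \<theta> \<gamma> :: real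
  assumes finW: "finite W" and gap: "\<gamma> > 0"
begin

text \<open>Rows and columns are indexed by sets of bit positions, so that the b bits of a pointer
  are an index as they stand and no pointer leads astray.\<close>

definition R :: "nat set set" where "R = Pow {..<b}"

definition VS :: "'o var set" where
  "VS = {Inp \<tau> i r j |\<tau> i r j. \<tau> < c \<and> i \<in> W \<and> r \<in> R \<and> j \<in> R} \<union> {Flag e |e. e \<subseteq> {..<c}}
    \<union> {Claim e \<tau> i |e \<tau> i. e \<subseteq> {..<c} \<and> \<tau> < c \<and> i \<in> W}
    \<union> {Ptr e \<tau> i r s |e \<tau> i r s. e \<subseteq> {..<c} \<and> \<tau> < c \<and> i \<in> W \<and> r \<in> R \<and> s < b}"

definition outer :: "('o var \<Rightarrow> real) \<Rightarrow> nat \<Rightarrow> 'o \<Rightarrow> real" where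
  "outer Z \<tau> = (\<lambda>i\<in>W. if \<forall>r\<in>R. \<exists>j\<in>R. Z (Inp \<tau> i r j) = 1 then 1 else -1)"

text \<open>The plain threshold ignores the promise, so that every input has an address.\<close>

definition address :: "('o var \<Rightarrow> real) \<Rightarrow> nat set" where
  "address Z = {\<tau>. \<tau> < c \<and> \<Phi> (outer Z \<tau>) \<ge> \<theta>}"

definition pointer :: "('o var \<Rightarrow> real) \<Rightarrow> nat set \<Rightarrow> nat \<Rightarrow> 'o \<Rightarrow> nat set \<Rightarrow> nat set" where
  "pointer Z e \<tau> i r = {s. s < b \<and> Z (Ptr e \<tau> i r s) = 1}"

definition promised :: "('o \<Rightarrow> real) \<Rightarrow> bool" where
  "promised w \<longleftrightarrow> \<Phi> w \<ge> \<theta> + \<gamma> \<or> \<Phi> w \<le> \<theta> - \<gamma>"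

text \<open>The claim 1 needs a pointer to an entry 1 in every row. The claim -1 needs only one row,
  all of whose entries are -1; its index is stored in the pointer of row \<open>{}\<close>.\<close>

definition certified :: "('o var \<Rightarrow> real) \<Rightarrow> nat set \<Rightarrow> nat \<Rightarrow> 'o \<Rightarrow> bool" where
  "certified Z e \<tau> i \<longleftrightarrow> (if Z (Claim e \<tau> i) = 1 then \<forall>r\<in>R. Z (Inp \<tau> i r (pointer Z e \<tau> i r)) = 1
     else \<forall>j\<in>R. Z (Inp \<tau> i (pointer Z e \<tau> i {}) j) = -1)"

text \<open>The promise is tested on the claims. As certificates prove the claims, every 1-input of
  \<open>total_fun\<close> then fulfils the promise on all instances, which the quantum algorithm
  exploits.\<close>

definition valid :: "('o var \<Rightarrow> real) \<Rightarrow> nat set \<Rightarrow> bool" where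
  "valid Z e \<longleftrightarrow> Z (Flag e) = 1 \<and> (\<forall>\<tau><c. promised (\<lambda>i\<in>W. Z (Claim e \<tau> i)) \<and> (\<forall>i\<in>W. certified Z e \<tau> i))"

definition total_fun :: "('o var \<Rightarrow> real) \<Rightarrow> nat" where
  "total_fun Z = (if valid Z (address Z) then 1 else 0)"

definition cell :: "nat set \<Rightarrow> 'o var set" where
  "cell e = {Flag e} \<union> {Claim e \<tau> i |\<tau> i. True} \<union> {Ptr e \<tau> i r s |\<tau> i r s. True}"

lemma finite_R: "finite R" and R_ne: "R \<noteq> {}" and card_R: "card R = 2 ^ b" and empty_R: "{} \<in> R"
  by (auto simp: R_def card_Pow)

lemma pointer_R: "pointer Z e \<tau> i r \<in> R"
  by (auto simp: R_def pointer_def)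

abbreviation V3 :: "(('o \<times> nat set) \<times> nat set) set" where "V3 \<equiv> (W \<times> R) \<times> R"

lemma finite_V3: "finite V3" using finW finite_R by auto

definition blank :: "(nat \<Rightarrow> ('o \<times> nat set) \<times> nat set \<Rightarrow> real) \<Rightarrow> 'o var \<Rightarrow> real" where
  "blank zs = (\<lambda>v\<in>VS. case v of Inp \<tau> i r j \<Rightarrow> zs \<tau> ((i, r), j) | _ \<Rightarrow> -1)"

definition decode :: "(('o \<times> nat set) \<times> nat set \<Rightarrow> real) \<Rightarrow> 'o \<Rightarrow> real" where
  "decode z = (\<lambda>i\<in>W. if \<forall>r\<in>R. \<exists>j\<in>R. z ((i, r), j) = 1 then 1 else -1)"

text \<open>Each fill value is neutral for its gate: 1 among the rows joined by AND, then -1 among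
  the entries of a row joined by OR.\<close>

definition bury :: "(('o \<Rightarrow> real) \<Rightarrow> real) \<Rightarrow> (('o \<times> nat set) \<times> nat set \<Rightarrow> real) \<Rightarrow> real" where
  "bury \<mu> = hide_distr (W \<times> R) R (-1) (hide_distr W R 1 \<mu>)"

lemma blank_signs:
  assumes "\<And>\<tau>. \<tau> < c \<Longrightarrow> zs \<tau> \<in> signs V3"
  shows "blank zs \<in> signs VS"
  unfolding blank_def
proof (rule signs_restrictI)
  fix v assume v: "v \<in> VS"
  show "(case v of Inp \<tau> i r j \<Rightarrow> zs \<tau> ((i, r), j) | _ \<Rightarrow> -1) = 1 \<or> (case v of Inp \<tau> i r j \<Rightarrow> zs \<tau> ((i, r), j) | _ \<Rightarrow> -1) = -1"
  proof (cases v)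
    case (Inp \<tau> i r j)
    then show ?thesis using v signs_cases[OF assms, of \<tau> "((i, r), j)"] by (auto simp: VS_def)
  qed auto
qed

lemma blank_Inp: "\<tau> < c \<Longrightarrow> i \<in> W \<Longrightarrow> r \<in> R \<Longrightarrow> j \<in> R \<Longrightarrow> blank zs (Inp \<tau> i r j) = zs \<tau> ((i, r), j)"
  by (auto simp: blank_def VS_def)

lemma outer_blank: "\<tau> < c \<Longrightarrow> outer (blank zs) \<tau> = decode (zs \<tau>)"
  unfolding outer_def decode_def by (intro restrict_ext) (simp add: blank_Inp)

text \<open>Every row has exactly one position that is not a filler -1. It carries w i in row
  \<open>p i\<close> and 1 in all other rows.\<close>

lemma decode_hide:
  assumes w: "w \<in> signs W" and p: "p \<in> W \<rightarrow>\<^sub>E R" and q: "q \<in> (W \<times> R) \<rightarrow>\<^sub>E R"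
  shows "decode (hide_in (W \<times> R) R (-1) (hide_in W R 1 w p) q) = w"
proof
  fix i
  show "decode (hide_in (W \<times> R) R (-1) (hide_in W R 1 w p) q) i = w i"
  proof (cases "i \<in> W")
    case True
    have qR: "q (i, r) \<in> R" if "r \<in> R" for r using q True that by (auto simp: PiE_def Pi_def)
    have pR: "p i \<in> R" using p True by auto
    have "(\<exists>j\<in>R. hide_in (W \<times> R) R (-1) (hide_in W R 1 w p) q ((i, r), j) = 1) \<longleftrightarrow> (r = p i \<longrightarrow> w i = 1)" if r: "r \<in> R" for r
    proof -
      have "hide_in (W \<times> R) R (-1) (hide_in W R 1 w p) q ((i, r), j) = (if j = q (i, r) then (if r = p i then w i else 1) else -1)"
        if "j \<in> R" for j
        using that r True by (simp add: hide_in_def)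
      then show ?thesis using qR[OF r] by auto
    qed
    then have "(\<forall>r\<in>R. \<exists>j\<in>R. hide_in (W \<times> R) R (-1) (hide_in W R 1 w p) q ((i, r), j) = 1) \<longleftrightarrow> w i = 1"
      using pR by auto
    then show ?thesis using True signs_cases[OF w True] by (auto simp: decode_def)
  next
    case False
    then show ?thesis using w by (auto simp: decode_def signs_def)
  qed
qed

lemma bury_sum:
  "(\<Sum>z\<in>signs V3. bury \<mu> z * g (decode z)) = (\<Sum>w\<in>signs W. \<mu> w * g w)"
proof -
  let ?K = "real (card R) ^ card (W \<times> R)" and ?L = "real (card R) ^ card W"
  have K: "?K > 0" "?L > 0" using R_ne finite_R by (simp_all add: card_gt_0_iff)
  have "(\<Sum>z\<in>signs V3. bury \<mu> z * g (decode z)) =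
    (\<Sum>q\<in>(W \<times> R) \<rightarrow>\<^sub>E R. \<Sum>y\<in>signs (W \<times> R). hide_distr W R 1 \<mu> y * g (decode (hide_in (W \<times> R) R (-1) y q))) / ?K"
    unfolding bury_def by (rule hide_distr_sum) (use finW finite_R in auto)
  also have "\<dots> = (\<Sum>q\<in>(W \<times> R) \<rightarrow>\<^sub>E R. (\<Sum>p\<in>W \<rightarrow>\<^sub>E R. \<Sum>w\<in>signs W. \<mu> w * g (decode (hide_in (W \<times> R) R (-1) (hide_in W R 1 w p) q))) / ?L) / ?K"
    using finW finite_R by (subst hide_distr_sum) auto
  also have "\<dots> = (\<Sum>q\<in>(W \<times> R) \<rightarrow>\<^sub>E R. (\<Sum>p\<in>W \<rightarrow>\<^sub>E R. \<Sum>w\<in>signs W. \<mu> w * g w) / ?L) / ?K"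
    by (simp add: decode_hide)
  also have "\<dots> = (\<Sum>w\<in>signs W. \<mu> w * g w)"
    using finW finite_R R_ne by (simp add: card_PiE)
  finally show ?thesis .
qed

lemma bury_distr: "distr_on W \<mu> \<Longrightarrow> distr_on V3 (bury \<mu>)"
  unfolding bury_def using finW finite_R R_ne by (intro distr_on_hide) auto

text \<open>T queries to grid entries are cut to d1 row bits, and these to d outer bits; each cut
  contributes one of the two error terms.\<close>

lemma bury_indist:
  assumes "distr_on W \<mu>" "distr_on W \<nu>" "indist W d \<delta> \<mu> \<nu>"
  shows "indist V3 T (\<delta> + 4 * real d1 / (2 ^ b * real (Suc d)) + 4 * real T / (2 ^ b * real (Suc d1))) (bury \<mu>) (bury \<nu>)"
proof -
  have "indist (W \<times> R) d1 (\<delta> + 4 * real d1 / (real (card R) * real (Suc d))) (hide_distr W R 1 \<mu>) (hide_distr W R 1 \<nu>)"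
    by (rule hide_indist) (use assms finW finite_R R_ne in auto)
  from hide_indist[OF _ finite_R R_ne _ _ _ this, of "-1" T]
  show ?thesis unfolding bury_def using assms finW finite_R R_ne by (simp add: card_R distr_on_hide)
qed

text \<open>The cell whose address is \<open>e\<close> is filled with a correct certificate.\<close>
definition filled :: "nat set \<Rightarrow> ('o var \<Rightarrow> real) \<Rightarrow> 'o var \<Rightarrow> real" where
  "filled e Z = (\<lambda>v\<in>VS. if v \<notin> cell e then Z v else (case v of Claim _ \<tau> i \<Rightarrow> outer Z \<tau> i
     | Ptr _ \<tau> i r s \<Rightarrow> if s \<in> (if outer Z \<tau> i = 1 then SOME j. j \<in> R \<and> Z (Inp \<tau> i r j) = 1
           else SOME r. r \<in> R \<and> (\<forall>j\<in>R. Z (Inp \<tau> i r j) \<noteq> 1)) then 1 else -1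
     | _ \<Rightarrow> 1))"

lemma filled_signs: "Z \<in> signs VS \<Longrightarrow> filled e Z \<in> signs VS"
  unfolding filled_def
proof (rule signs_restrictI, goal_cases)
  case (1 v)
  show ?case
  proof (cases "v \<in> cell e")
    case True
    show ?thesis
    proof (cases v)
      case (Claim e' \<tau> i)
      then have "i \<in> W" using 1 by (auto simp: VS_def)
      then show ?thesis using True Claim by (simp add: outer_def)
    qed (use True in simp_all)
  qed (use signs_cases[OF 1] in simp)
qed

lemma filled_other: "Z \<in> signs VS \<Longrightarrow> v \<notin> cell e \<Longrightarrow> filled e Z v = Z v"
  by (auto simp: filled_def signs_def PiE_def extensional_def)

lemma filled_valid:
  assumes Z: "Z \<in> signs VS" and e: "e \<subseteq> {..<c}" and pr: "\<And>\<tau>. \<tau> < c \<Longrightarrow> promised (outer Z \<tau>)"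
  shows "valid (filled e Z) e"
proof -
  have claim: "filled e Z (Claim e \<tau> i) = outer Z \<tau> i" if "\<tau> < c" "i \<in> W" for \<tau> i
    using that e by (auto simp: filled_def cell_def VS_def)
  have inp: "filled e Z (Inp \<tau> i r j) = Z (Inp \<tau> i r j)" for \<tau> i r j
    using filled_other[OF Z] by (auto simp: cell_def)
  have cert: "certified (filled e Z) e \<tau> i" if ti: "\<tau> < c" "i \<in> W" for \<tau> i
  proof -
    \<comment> \<open>The index that \<open>filled\<close> writes into the pointers of bit i; in the
      second case it is the same row for every r.\<close>
    define j where "j = (\<lambda>r. if outer Z \<tau> i = 1 then SOME j. j \<in> R \<and> Z (Inp \<tau> i r j) = 1
           else SOME r. r \<in> R \<and> (\<forall>j\<in>R. Z (Inp \<tau> i r j) \<noteq> 1))"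
    have ptr: "pointer (filled e Z) e \<tau> i r = j r" if "r \<in> R" "j r \<in> R" for r
    proof -
      have "filled e Z (Ptr e \<tau> i r s) = (if s \<in> j r then 1 else -1)" if "s < b" for s
        using \<open>r \<in> R\<close> that ti e unfolding filled_def by (simp add: VS_def cell_def j_def)
      then show ?thesis using \<open>j r \<in> R\<close> by (auto simp: pointer_def R_def split: if_splits)
    qed
    show ?thesis
    proof (cases "outer Z \<tau> i = 1")
      case True
      have jr: "j r \<in> R \<and> Z (Inp \<tau> i r (j r)) = 1" if "r \<in> R" for r
      proof -
        have "\<exists>j. j \<in> R \<and> Z (Inp \<tau> i r j) = 1" using True that ti by (auto simp: outer_def split: if_splits)
        from someI_ex[OF this] show ?thesis using True by (simp add: j_def)
      qed
      then show ?thesis unfolding certified_def using claim[OF ti] True ptr inp by simp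
    next
      case False
      then have "\<exists>r. r \<in> R \<and> (\<forall>j\<in>R. Z (Inp \<tau> i r j) \<noteq> 1)" using ti by (auto simp: outer_def split: if_splits)
      from someI_ex[OF this] have "j {} \<in> R \<and> (\<forall>j'\<in>R. Z (Inp \<tau> i (j {}) j') \<noteq> 1)" using False by (simp add: j_def)
      moreover have "Z (Inp \<tau> i r j') = 1 \<or> Z (Inp \<tau> i r j') = -1" if "r \<in> R" "j' \<in> R" for r j'
      proof -
        have "Inp \<tau> i r j' \<in> VS" using that ti by (auto simp: VS_def)
        then show ?thesis using Z by (auto simp: signs_def PiE_def Pi_def)
      qed
      ultimately have *: "j {} \<in> R" "\<forall>j'\<in>R. Z (Inp \<tau> i (j {}) j') = -1" by blast+
      have "pointer (filled e Z) e \<tau> i {} = j {}" by (rule ptr[OF empty_R *(1)])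
      then show ?thesis unfolding certified_def using claim[OF ti] False inp *(2) by simp
    qed
  qed
  have "(\<lambda>i\<in>W. filled e Z (Claim e \<tau> i)) = outer Z \<tau>" if "\<tau> < c" for \<tau>
    using claim[OF that] by (auto simp: outer_def fun_eq_iff)
  moreover have "filled e Z (Flag e) = 1" using e by (auto simp: filled_def VS_def cell_def)
  ultimately show ?thesis unfolding valid_def using pr cert by simp
qed

lemma outer_filled: "Z \<in> signs VS \<Longrightarrow> outer (filled e Z) = outer Z"
proof
  fix \<tau> assume Z: "Z \<in> signs VS"
  show "outer (filled e Z) \<tau> = outer Z \<tau>" unfolding outer_def
    by (intro restrict_ext) (simp add: filled_other[OF Z] cell_def)
qed

text \<open>Distinct cells are disjoint, so one query touches at most one of them.\<close>

lemma cells_touched: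
  "(\<Sum>e\<in>Pow {..<c}. of_bool (asked t x \<inter> cell e \<noteq> {})) \<le> real (dep t)"
proof -
  have "(\<Sum>e\<in>Pow {..<c}. of_bool (asked t x \<inter> cell e \<noteq> {})) \<le> (\<Sum>e\<in>Pow {..<c}. real (card (asked t x \<inter> cell e)))"
    by (intro sum_mono) (auto simp: of_bool_def Suc_le_eq card_gt_0_iff)
  also have "\<dots> = real (\<Sum>e\<in>Pow {..<c}. card (asked t x \<inter> cell e))" by simp
  also have "(\<Sum>e\<in>Pow {..<c}. card (asked t x \<inter> cell e)) = card (\<Union>e\<in>Pow {..<c}. asked t x \<inter> cell e)"
    by (rule card_UN_disjoint[symmetric]) (auto simp: cell_def)
  also have "\<dots> \<le> card (asked t x)" by (intro card_mono) auto
  finally show ?thesis using card_asked[of t x] by linarith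
qed

text \<open>A hybrid argument over the instances in B: the other instances and the blank cells are
  hardwired into t, which turns it into a tree for a single instance.\<close>

lemma touch_indist:
  assumes \<mu>: "distr_on V3 \<mu>" and \<nu>: "distr_on V3 \<nu>" and ind: "indist V3 T \<delta> \<mu> \<nu>" and t: "dep t \<le> T" "trvars t \<subseteq> VS"
    and B: "B \<subseteq> {..<c}"
  shows "\<bar>prod_expect c (signs V3) (\<lambda>\<tau>. if \<tau> \<in> B then \<mu> else \<nu>) (\<lambda>zs. of_bool (ev t (blank zs) = 1))
     - prod_expect c (signs V3) (\<lambda>\<tau>. \<nu>) (\<lambda>zs. of_bool (ev t (blank zs) = 1))\<bar> \<le> real (card B) * \<delta>"
proof -
  have "finite B" using B finite_subset by auto
  then show ?thesis using B
  proof (induction B rule: finite_induct)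
    case (insert \<tau> B)
    let ?P = "\<lambda>B. prod_expect c (signs V3) (\<lambda>\<tau>. if \<tau> \<in> B then \<mu> else \<nu>) (\<lambda>zs. of_bool (ev t (blank zs) = 1))"
    have "\<bar>?P (insert \<tau> B) - ?P B\<bar> \<le> \<delta>"
    proof (rule prod_expect_swap[where \<tau> = \<tau>])
      fix zs assume zs: "zs \<in> ({..<c} - {\<tau>}) \<rightarrow>\<^sub>E signs V3"
      define \<sigma> where "\<sigma> = (\<lambda>v :: 'o var. case v of Inp \<tau>' i r j \<Rightarrow> if \<tau>' = \<tau> then Inl ((i, r), j) else Inr (zs \<tau>' ((i, r), j)) | _ \<Rightarrow> Inr (-1))"
      have "ev (subst_tr \<sigma> t) z = ev t (blank (zs(\<tau> := z)))" for z
        unfolding ev_subst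
      proof (rule ev_cong)
        fix v assume "v \<in> trvars t"
        then have "v \<in> VS" using t(2) by auto
        then show "subst_in \<sigma> z v = blank (zs(\<tau> := z)) v"
          by (cases v) (simp_all add: \<sigma>_def blank_def)
      qed
      then have "(\<Sum>z\<in>signs V3. \<rho> z * of_bool (ev t (blank (zs(\<tau> := z))) = 1)) = accept V3 \<rho> (subst_tr \<sigma> t)" for \<rho>
        by (simp add: accept_def)
      moreover have "trvars (subst_tr \<sigma> t) \<subseteq> V3"
      proof
        fix u assume "u \<in> trvars (subst_tr \<sigma> t)"
        then obtain v where v: "v \<in> VS" "\<sigma> v = Inl u" using trvars_subst[of \<sigma> t] t(2) by blast
        then show "u \<in> V3" by (cases v) (auto simp: \<sigma>_def VS_def split: if_splits)
      qed
      moreover have "dep (subst_tr \<sigma> t) \<le> T" using dep_subst[of \<sigma> t] t(1) by simp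
      ultimately show "\<bar>(\<Sum>z\<in>signs V3. (if \<tau> \<in> insert \<tau> B then \<mu> else \<nu>) z * of_bool (ev t (blank (zs(\<tau> := z))) = 1))
         - (\<Sum>z\<in>signs V3. (if \<tau> \<in> B then \<mu> else \<nu>) z * of_bool (ev t (blank (zs(\<tau> := z))) = 1))\<bar> \<le> \<delta>"
        using ind insert.hyps unfolding indist_def by simp
    next
      show "finite (signs V3)" by (rule finite_signs[OF finite_V3])
      show "\<tau> < c" using insert.prems by simp
    qed (use \<mu> \<nu> in \<open>simp_all add: distr_on_def\<close>)
    moreover have "\<bar>?P B - prod_expect c (signs V3) (\<lambda>\<tau>. \<nu>) (\<lambda>zs. of_bool (ev t (blank zs) = 1))\<bar> \<le> real (card B) * \<delta>"
      using insert by auto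
    ultimately show ?case using insert.hyps by (simp add: algebra_simps)
  qed simp
qed

text \<open>Draw the instances in B from \<mu> and the others from \<nu>, and leave all cells blank.
  The value is 0, but filling cell B makes it 1, so a correct algorithm reads cell B with
  probability at least 1/3. It does so almost as often if all instances come from \<nu>, where the
  input carries no information on B; but a run reads at most T of the 2 ^ c cells.\<close>

theorem randomized_lower:
  fixes p :: "'o var tr pmf"
  assumes \<mu>: "distr_on W \<mu>" and \<nu>: "distr_on W \<nu>" and ind: "indist V3 T \<delta> (bury \<mu>) (bury \<nu>)"
    and \<eta>1: "(\<Sum>w\<in>signs W. \<mu> w * of_bool (\<not> \<Phi> w \<ge> \<theta> + \<gamma>)) \<le> \<eta>"
    and \<eta>0: "(\<Sum>w\<in>signs W. \<nu> w * of_bool (\<not> \<Phi> w \<le> \<theta> - \<gamma>)) \<le> \<eta>"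
    and \<delta>: "\<delta> \<ge> 0"
    and p: "\<And>t. t \<in> set_pmf p \<Longrightarrow> trvars t \<subseteq> VS \<and> dep t \<le> T"
    and corr: "\<And>Z. Z \<in> signs VS \<Longrightarrow> measure_pmf.prob p {t. ev t Z = total_fun Z} \<ge> 2/3"
  shows "2 ^ c * (1 - real c * \<eta>) / 3 \<le> real T + 2 ^ c * real c * \<delta>"
proof -
  define \<rho> where "\<rho> = (\<lambda>(B :: nat set) \<tau>. if \<tau> \<in> B then bury \<mu> else bury \<nu>)"
  have \<rho>: "distr_on V3 (\<rho> B \<tau>)" for B \<tau> using bury_distr \<mu> \<nu> by (simp add: \<rho>_def)
  then have \<rho>1: "(\<Sum>z\<in>signs V3. \<rho> B \<tau> z) = 1" and \<rho>0: "0 \<le> \<rho> B \<tau> z" for B \<tau> z by (auto simp: distr_on_def)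
  have finS: "finite (signs V3)" by (rule finite_signs[OF finite_V3])
  define hit where "hit = (\<lambda>B zs t. asked t (blank zs) \<inter> cell B \<noteq> {})"
  define typic where "typic = (\<lambda>B zs. \<forall>\<tau><c. if \<tau> \<in> B then \<Phi> (decode (zs \<tau>)) \<ge> \<theta> + \<gamma> else \<Phi> (decode (zs \<tau>)) \<le> \<theta> - \<gamma>)"
  have hit_prob: "measure_pmf.prob p {t. hit B zs t} \<ge> 1/3 * of_bool (typic B zs)"
    if zs: "zs \<in> {..<c} \<rightarrow>\<^sub>E signs V3" and B: "B \<in> Pow {..<c}" for B zs
  proof (cases "typic B zs")
    case True
    define Z where "Z = blank zs"
    have Z: "Z \<in> signs VS" unfolding Z_def by (rule blank_signs) (use zs in auto)
    have out: "outer Z \<tau> = decode (zs \<tau>)" if "\<tau> < c" for \<tau> using outer_blank[OF that] by (simp add: Z_def)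
    have adr: "address Z = B" using True B out gap by (force simp: address_def typic_def split: if_splits)
    have "promised (outer Z \<tau>)" if "\<tau> < c" for \<tau> using True that out by (auto simp: promised_def typic_def split: if_splits)
    then have "valid (filled B Z) B" using filled_valid[OF Z] B by auto
    moreover have "address (filled B Z) = B" using adr by (simp add: address_def outer_filled[OF Z])
    ultimately have one: "total_fun (filled B Z) = 1" by (simp add: total_fun_def)
    have "Z (Flag B) \<noteq> 1" using B by (auto simp: Z_def blank_def VS_def)
    then have zero: "total_fun Z = 0" by (simp add: total_fun_def adr valid_def)
    let ?A0 = "{t. ev t Z = 0}" and ?A1 = "{t. ev t (filled B Z) = 1}"
    have 1: "measure_pmf.prob p ?A0 \<ge> 2/3" using corr[OF Z] zero by simp
    have 2: "measure_pmf.prob p ?A1 \<ge> 2/3" using corr[OF filled_signs[OF Z], of B] one by simp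
    \<comment> \<open>The two inputs differ in cell B only, so a tree that is right on both has read
      it. Two events of probability 2/3 overlap with probability at least 1/3.\<close>
    have "?A0 \<inter> ?A1 \<subseteq> {t. hit B zs t}"
    proof safe
      fix t assume *: "ev t Z = 0" "ev t (filled B Z) = 1"
      show "hit B zs t"
      proof (rule ccontr)
        assume "\<not> hit B zs t"
        then have "asked t Z \<inter> cell B = {}" by (simp add: hit_def Z_def)
        then have "ev t (filled B Z) = ev t Z"
          using ev_asked_cong[of t Z "filled B Z"] filled_other[OF Z, of _ B] by (metis disjoint_iff)
        then show False using * by simp
      qed
    qed
    then have "measure_pmf.prob p (?A0 \<inter> ?A1) \<le> measure_pmf.prob p {t. hit B zs t}"
      by (intro measure_pmf.finite_measure_mono) auto
    moreover have "measure_pmf.prob p (?A0 \<union> ?A1) = measure_pmf.prob p ?A0 + measure_pmf.prob p ?A1 - measure_pmf.prob p (?A0 \<inter> ?A1)"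
      by (rule measure_Un3) (auto simp: measure_pmf.fmeasurable_eq_sets)
    moreover have "measure_pmf.prob p (?A0 \<union> ?A1) \<le> 1" by (rule measure_pmf.prob_le_1)
    ultimately show ?thesis using 1 2 True by simp
  qed simp
  have typic_prob: "prod_expect c (signs V3) (\<rho> B) (\<lambda>zs. of_bool (typic B zs)) \<ge> 1 - real c * \<eta>" for B
  proof -
    define bad where "bad = (\<lambda>\<tau> z. of_bool (\<not> (if \<tau> \<in> B then \<Phi> (decode z) \<ge> \<theta> + \<gamma> else \<Phi> (decode z) \<le> \<theta> - \<gamma>)) :: real)"
    have bad_le: "(\<Sum>z\<in>signs V3. \<rho> B \<tau> z * bad \<tau> z) \<le> \<eta>" for \<tau>
      using bury_sum[of \<mu> "\<lambda>w. of_bool (\<not> \<Phi> w \<ge> \<theta> + \<gamma>)"] bury_sum[of \<nu> "\<lambda>w. of_bool (\<not> \<Phi> w \<le> \<theta> - \<gamma>)"] \<eta>1 \<eta>0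
      by (cases "\<tau> \<in> B") (auto simp: bad_def \<rho>_def)
    have "1 = prod_expect c (signs V3) (\<rho> B) (\<lambda>zs. 1)"
      using prod_expect_const[OF finS, of c "\<rho> B" 1] \<rho>1 by simp
    also have "\<dots> \<le> prod_expect c (signs V3) (\<rho> B) (\<lambda>zs. of_bool (typic B zs) + (\<Sum>\<tau><c. bad \<tau> (zs \<tau>)))"
    proof (intro prod_expect_mono \<rho>0)
      fix zs
      show "1 \<le> of_bool (typic B zs) + (\<Sum>\<tau><c. bad \<tau> (zs \<tau>))"
      proof (cases "typic B zs")
        case False
        then obtain \<tau> where \<tau>: "\<tau> < c" "bad \<tau> (zs \<tau>) = 1" by (auto simp: typic_def bad_def)
        then have "1 \<le> (\<Sum>\<tau><c. bad \<tau> (zs \<tau>))"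
          using member_le_sum[of \<tau> "{..<c}" "\<lambda>\<tau>. bad \<tau> (zs \<tau>)"] by (auto simp: bad_def)
        then show ?thesis by simp
      next
        case True
        have "0 \<le> (\<Sum>\<tau><c. bad \<tau> (zs \<tau>))" by (intro sum_nonneg) (simp add: bad_def)
        then show ?thesis using True by simp
      qed
    qed
    also have "\<dots> = prod_expect c (signs V3) (\<rho> B) (\<lambda>zs. of_bool (typic B zs)) + prod_expect c (signs V3) (\<rho> B) (\<lambda>zs. \<Sum>\<tau><c. bad \<tau> (zs \<tau>))"
      by (simp add: prod_expect_def sum.distrib distrib_left)
    also have "prod_expect c (signs V3) (\<rho> B) (\<lambda>zs. \<Sum>\<tau><c. bad \<tau> (zs \<tau>)) = (\<Sum>\<tau><c. \<Sum>z\<in>signs V3. \<rho> B \<tau> z * bad \<tau> z)"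
      unfolding prod_expect_sum by (intro sum.cong refl prod_expect_marginal finS \<rho>1) simp
    also have "\<dots> \<le> (\<Sum>\<tau><c. \<eta>)" by (intro sum_mono bad_le)
    finally show ?thesis by simp
  qed
  have per_tree: "(\<Sum>B\<in>Pow {..<c}. prod_expect c (signs V3) (\<rho> B) (\<lambda>zs. of_bool (hit B zs t))) \<le> real T + 2 ^ c * real c * \<delta>"
    if t: "trvars t \<subseteq> VS" "dep t \<le> T" for t
  proof -
    have hit_ev: "hit B zs t \<longleftrightarrow> ev (touch (cell B) t) (blank zs) = 1" for B zs by (simp add: hit_def ev_touch)
    have "prod_expect c (signs V3) (\<rho> B) (\<lambda>zs. of_bool (hit B zs t)) \<le> prod_expect c (signs V3) (\<rho> {}) (\<lambda>zs. of_bool (hit B zs t)) + real c * \<delta>"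
      if B: "B \<in> Pow {..<c}" for B
    proof -
      have "\<bar>prod_expect c (signs V3) (\<rho> B) (\<lambda>zs. of_bool (hit B zs t)) - prod_expect c (signs V3) (\<rho> {}) (\<lambda>zs. of_bool (hit B zs t))\<bar> \<le> real (card B) * \<delta>"
        unfolding hit_ev \<rho>_def
        using touch_indist[OF bury_distr[OF \<mu>] bury_distr[OF \<nu>] ind, of "touch (cell B) t" B] dep_touch[of "cell B" t] trvars_touch[of "cell B" t] t B
        by simp
      moreover have "real (card B) * \<delta> \<le> real c * \<delta>"
        using B card_mono[of "{..<c}" B] \<delta> by (intro mult_right_mono) auto
      ultimately show ?thesis by linarith
    qed
    then have "(\<Sum>B\<in>Pow {..<c}. prod_expect c (signs V3) (\<rho> B) (\<lambda>zs. of_bool (hit B zs t))) \<le>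
        (\<Sum>B\<in>Pow {..<c}. prod_expect c (signs V3) (\<rho> {}) (\<lambda>zs. of_bool (hit B zs t)) + real c * \<delta>)"
      by (rule sum_mono)
    also have "\<dots> = prod_expect c (signs V3) (\<rho> {}) (\<lambda>zs. \<Sum>B\<in>Pow {..<c}. of_bool (hit B zs t)) + 2 ^ c * real c * \<delta>"
      by (simp add: sum.distrib prod_expect_sum card_Pow del: sum_of_bool_eq)
    also have "prod_expect c (signs V3) (\<rho> {}) (\<lambda>zs. \<Sum>B\<in>Pow {..<c}. of_bool (hit B zs t)) \<le> prod_expect c (signs V3) (\<rho> {}) (\<lambda>zs. real T)"
    proof (intro prod_expect_mono \<rho>0)
      fix zs show "(\<Sum>B\<in>Pow {..<c}. of_bool (hit B zs t)) \<le> real T"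
        using cells_touched[of t "blank zs"] t unfolding hit_def by linarith
    qed
    also have "\<dots> = real T" using prod_expect_const[OF finS, of c "\<rho> {}"] \<rho>1 by simp
    finally show ?thesis by simp
  qed
  define S where "S = (\<lambda>t. \<Sum>B\<in>Pow {..<c}. \<Sum>zs\<in>{..<c} \<rightarrow>\<^sub>E signs V3. (\<Prod>\<tau><c. \<rho> B \<tau> (zs \<tau>)) * indicator {t. hit B zs t} t)"
  have S_le: "S t \<le> real T + 2 ^ c * real c * \<delta>" if "t \<in> set_pmf p" for t
  proof -
    have "S t = (\<Sum>B\<in>Pow {..<c}. prod_expect c (signs V3) (\<rho> B) (\<lambda>zs. of_bool (hit B zs t)))"
      by (simp add: S_def prod_expect_def indicator_def)
    then show ?thesis using per_tree p[OF that] by simp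
  qed
  have int: "integrable (measure_pmf p) (\<lambda>t. a * indicator A t :: real)" for a A
    by (intro integrable_mult_right) (simp add: measure_pmf.emeasure_eq_measure less_top[symmetric])
  have "2 ^ c * (1 - real c * \<eta>) / 3 = (\<Sum>B\<in>Pow {..<c}. 1/3 * (1 - real c * \<eta>))"
    by (simp add: card_Pow)
  also have "\<dots> \<le> (\<Sum>B\<in>Pow {..<c}. 1/3 * prod_expect c (signs V3) (\<rho> B) (\<lambda>zs. of_bool (typic B zs)))"
    by (intro sum_mono mult_left_mono typic_prob) auto
  also have "\<dots> \<le> (\<Sum>B\<in>Pow {..<c}. \<Sum>zs\<in>{..<c} \<rightarrow>\<^sub>E signs V3. (\<Prod>\<tau><c. \<rho> B \<tau> (zs \<tau>)) * measure_pmf.prob p {t. hit B zs t})"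
  proof (intro sum_mono)
    fix B assume B: "B \<in> Pow {..<c}"
    have "1/3 * prod_expect c (signs V3) (\<rho> B) (\<lambda>zs. of_bool (typic B zs)) = (\<Sum>zs\<in>{..<c} \<rightarrow>\<^sub>E signs V3. (\<Prod>\<tau><c. \<rho> B \<tau> (zs \<tau>)) * (1/3 * of_bool (typic B zs)))"
      unfolding prod_expect_def by (simp add: sum_distrib_left mult.left_commute sum_divide_distrib)
    also have "\<dots> \<le> (\<Sum>zs\<in>{..<c} \<rightarrow>\<^sub>E signs V3. (\<Prod>\<tau><c. \<rho> B \<tau> (zs \<tau>)) * measure_pmf.prob p {t. hit B zs t})"
      by (intro sum_mono mult_left_mono hit_prob B prod_nonneg \<rho>0) auto
    finally show "1/3 * prod_expect c (signs V3) (\<rho> B) (\<lambda>zs. of_bool (typic B zs)) \<le> \<dots>" .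
  qed
  also have "\<dots> = measure_pmf.expectation p S"
  proof -
    have "measure_pmf.expectation p (\<lambda>t. \<Sum>zs\<in>{..<c} \<rightarrow>\<^sub>E signs V3. (\<Prod>\<tau><c. \<rho> B \<tau> (zs \<tau>)) * indicator {t. hit B zs t} t)
       = (\<Sum>zs\<in>{..<c} \<rightarrow>\<^sub>E signs V3. (\<Prod>\<tau><c. \<rho> B \<tau> (zs \<tau>)) * measure_pmf.prob p {t. hit B zs t})" for B
      by (subst Bochner_Integration.integral_sum[OF int]) simp
    then show ?thesis unfolding S_def
      by (subst Bochner_Integration.integral_sum) (auto intro: Bochner_Integration.integrable_sum int)
  qed
  also have "\<dots> \<le> real T + 2 ^ c * real c * \<delta>"
  proof (rule measure_pmf.integral_le_const)
    show "integrable (measure_pmf p) S" unfolding S_def by (intro Bochner_Integration.integrable_sum int)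
    show "AE t in measure_pmf p. S t \<le> real T + 2 ^ c * real c * \<delta>"
      using S_le by (simp add: AE_measure_pmf_iff)
  qed
  finally show ?thesis .
qed

end

section \<open>Dual adversary solutions\<close>

definition dif :: "('v \<Rightarrow> real) \<Rightarrow> ('v \<Rightarrow> real) \<Rightarrow> 'v \<Rightarrow> real" where
  "dif x y i = of_bool (x i \<noteq> y i)"

text \<open>A matrix on \<open>X \<times> Y\<close> with a feasible solution of the dual adversary program: the two bounds
  are kept separate so that they can be rebalanced.\<close>
definition gam :: "'v set \<Rightarrow> ('v \<Rightarrow> real) set \<Rightarrow> ('v \<Rightarrow> real) set \<Rightarrow> real \<Rightarrow> real \<Rightarrow> (('v \<Rightarrow> real) \<Rightarrow> ('v \<Rightarrow> real) \<Rightarrow> real) \<Rightarrow> bool" where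
  "gam V X Y A B M \<longleftrightarrow> (\<exists>(d::nat) u v. (\<forall>x\<in>X. (\<Sum>i\<in>V. \<Sum>a<d. (u x i a)\<^sup>2) \<le> A) \<and> (\<forall>y\<in>Y. (\<Sum>i\<in>V. \<Sum>a<d. (v y i a)\<^sup>2) \<le> B) \<and>
     (\<forall>x\<in>X. \<forall>y\<in>Y. M x y = (\<Sum>i\<in>V. \<Sum>a<d. dif x y i * (u x i a * v y i a))))"

lemma gamI:
  assumes "finite D"
    and "\<And>x. x \<in> X \<Longrightarrow> (\<Sum>i\<in>V. \<Sum>a\<in>D. (u x i a)\<^sup>2) \<le> A"
    and "\<And>y. y \<in> Y \<Longrightarrow> (\<Sum>i\<in>V. \<Sum>a\<in>D. (v y i a)\<^sup>2) \<le> B"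
    and "\<And>x y. x \<in> X \<Longrightarrow> y \<in> Y \<Longrightarrow> M x y = (\<Sum>i\<in>V. \<Sum>a\<in>D. dif x y i * (u x i a * v y i a))"
  shows "gam V X Y A B M"
proof -
  obtain h where h: "bij_betw h {..<card D} D" using ex_bij_betw_nat_finite[OF assms(1)] by (auto simp: atLeast0LessThan)
  have re: "(\<Sum>a<card D. F (h a)) = (\<Sum>a\<in>D. F a)" for F :: "_ \<Rightarrow> real" by (rule sum.reindex_bij_betw[OF h])
  show ?thesis unfolding gam_def
    by (intro exI[of _ "card D"] exI[of _ "\<lambda>x i a. u x i (h a)"] exI[of _ "\<lambda>x i a. v x i (h a)"])
       (use assms(2-4) in \<open>simp add: re[of "\<lambda>a. (u _ _ a)\<^sup>2"] re[of "\<lambda>a. (v _ _ a)\<^sup>2"] re[of "\<lambda>a. dif _ _ _ * (u _ _ a * v _ _ a)"]\<close>)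
qed

lemma gam_mono:
  assumes "gam V X Y A B M" "X' \<subseteq> X" "Y' \<subseteq> Y" "A \<le> A'" "B \<le> B'" "\<And>x y. x \<in> X' \<Longrightarrow> y \<in> Y' \<Longrightarrow> M' x y = M x y"
  shows "gam V X' Y' A' B' M'"
proof -
  obtain d u v where "\<forall>x\<in>X. (\<Sum>i\<in>V. \<Sum>a<(d::nat). (u x i a)\<^sup>2) \<le> A" "\<forall>y\<in>Y. (\<Sum>i\<in>V. \<Sum>a<d. (v y i a)\<^sup>2) \<le> B"
     "\<forall>x\<in>X. \<forall>y\<in>Y. M x y = (\<Sum>i\<in>V. \<Sum>a<d. dif x y i * (u x i a * v y i a))"
    using assms(1) unfolding gam_def by blast
  then show ?thesis unfolding gam_def using assms(2-6)
    by (intro exI[of _ d] exI[of _ u] exI[of _ v]) (auto intro: order_trans simp: subset_iff)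
qed

lemma gam_scale:
  assumes "gam V X Y A B M" "s > 0"
  shows "gam V X Y (s * A) (B / s) M"
proof -
  obtain d u v where *: "\<forall>x\<in>X. (\<Sum>i\<in>V. \<Sum>a<(d::nat). (u x i a)\<^sup>2) \<le> A" "\<forall>y\<in>Y. (\<Sum>i\<in>V. \<Sum>a<d. (v y i a)\<^sup>2) \<le> B"
     "\<forall>x\<in>X. \<forall>y\<in>Y. M x y = (\<Sum>i\<in>V. \<Sum>a<d. dif x y i * (u x i a * v y i a))"
    using assms(1) unfolding gam_def by blast
  show ?thesis
  proof (rule gamI[where D = "{..<d}" and u = "\<lambda>x i a. sqrt s * u x i a" and v = "\<lambda>x i a. v x i a / sqrt s"])
    fix x assume "x \<in> X"
    then show "(\<Sum>i\<in>V. \<Sum>a<d. (sqrt s * u x i a)\<^sup>2) \<le> s * A"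
      using * assms(2) by (simp add: power_mult_distrib sum_distrib_left[symmetric])
  next
    fix y assume "y \<in> Y"
    then show "(\<Sum>i\<in>V. \<Sum>a<d. (v y i a / sqrt s)\<^sup>2) \<le> B / s"
      using * assms(2) by (simp add: power_divide sum_divide_distrib[symmetric] divide_right_mono)
  next
    fix x y assume "x \<in> X" "y \<in> Y"
    then show "M x y = (\<Sum>i\<in>V. \<Sum>a<d. dif x y i * (sqrt s * u x i a * (v y i a / sqrt s)))"
      using * assms(2) by simp
  qed simp
qed

lemma gam_uminus:
  assumes "gam V X Y A B M"
  shows "gam V X Y A B (\<lambda>x y. - M x y)"
proof -
  obtain d u v where *: "\<forall>x\<in>X. (\<Sum>i\<in>V. \<Sum>a<(d::nat). (u x i a)\<^sup>2) \<le> A" "\<forall>y\<in>Y. (\<Sum>i\<in>V. \<Sum>a<d. (v y i a)\<^sup>2) \<le> B"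
     "\<forall>x\<in>X. \<forall>y\<in>Y. M x y = (\<Sum>i\<in>V. \<Sum>a<d. dif x y i * (u x i a * v y i a))"
    using assms(1) unfolding gam_def by blast
  show ?thesis
    by (rule gamI[where D = "{..<d}" and u = "\<lambda>x i a. - u x i a" and v = v])
       (use * in \<open>simp_all add: sum_negf\<close>)
qed

text \<open>The scaling that replaces both bounds by their geometric mean. Bounds k and 1 for a
  search among k items become the square root of k, which is the quantum speedup.\<close>

lemma gam_balance:
  assumes "gam V X Y A B M" "A > 0" "B > 0"
  shows "gam V X Y (sqrt (A * B)) (sqrt (A * B)) M"
proof -
  have "sqrt (B / A) * A = sqrt (A * B)" "B / sqrt (B / A) = sqrt (A * B)"
    using assms(2,3) by (simp_all add: real_sqrt_divide real_sqrt_mult real_div_sqrt field_simps)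
  then show ?thesis using gam_scale[OF assms(1), of "sqrt (B / A)"] assms(2,3) by simp
qed

lemma sum_of_bool_sq [simp]:
  "finite V \<Longrightarrow> (\<Sum>j\<in>V. (of_bool (j = i))\<^sup>2 :: real) = of_bool (i \<in> V)"
  "finite V \<Longrightarrow> (\<Sum>j\<in>V. (of_bool (i = j))\<^sup>2 :: real) = of_bool (i \<in> V)"
proof -
  have "(of_bool P)\<^sup>2 = (of_bool P :: real)" for P by (cases P) auto
  then show "finite V \<Longrightarrow> (\<Sum>j\<in>V. (of_bool (j = i))\<^sup>2 :: real) = of_bool (i \<in> V)"
    "finite V \<Longrightarrow> (\<Sum>j\<in>V. (of_bool (i = j))\<^sup>2 :: real) = of_bool (i \<in> V)"
    by (simp_all add: of_bool_def)
qed

lemma gam_bit: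
  assumes "finite V" "i \<in> V"
  shows "gam V X Y 1 1 (\<lambda>x y. of_bool (x i \<noteq> y i))"
proof (rule gamI[where D = "{()}" and u = "\<lambda>x j a. of_bool (j = i)" and v = "\<lambda>x j a. of_bool (j = i)"])
  fix x y :: "'a \<Rightarrow> real"
  show "of_bool (x i \<noteq> y i) = (\<Sum>j\<in>V. \<Sum>a\<in>{()}. dif x y j * (of_bool (j = i) * of_bool (j = i) :: real))"
    using assms by (subst sum.mono_neutral_right[of V "{i}"]) (auto simp: dif_def)
qed (use assms in simp_all)

text \<open>The direct sum of the solutions for the matrices M i, scaled by p on the left and by q
  on the right. Zeros of p i and q i confine M i to the inputs for which it has a solution. Several
  combination rules below are instances.\<close>

lemma gam_wsum:
  fixes V :: "'a set" and I :: "'b set"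
  assumes I: "finite I" and AB: "A \<ge> 0" "B \<ge> 0"
    and g: "\<And>i. i \<in> I \<Longrightarrow> gam V {x\<in>X. p i x \<noteq> 0} {y\<in>Y. q i y \<noteq> 0} A B (M i)"
    and P: "\<And>x. x \<in> X \<Longrightarrow> (\<Sum>i\<in>I. (p i x)\<^sup>2) \<le> P" and Q: "\<And>y. y \<in> Y \<Longrightarrow> (\<Sum>i\<in>I. (q i y)\<^sup>2) \<le> Q"
    and M: "\<And>x y. x \<in> X \<Longrightarrow> y \<in> Y \<Longrightarrow> M' x y = (\<Sum>i\<in>I. p i x * q i y * M i x y)"
  shows "gam V X Y (P * A) (Q * B) M'"
proof -
  obtain d :: "'b \<Rightarrow> nat" and u v where
    u: "\<And>i x. i \<in> I \<Longrightarrow> x \<in> X \<Longrightarrow> p i x \<noteq> 0 \<Longrightarrow> (\<Sum>j\<in>V. \<Sum>a<d i. (u i x j a)\<^sup>2) \<le> A" and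
    v: "\<And>i y. i \<in> I \<Longrightarrow> y \<in> Y \<Longrightarrow> q i y \<noteq> 0 \<Longrightarrow> (\<Sum>j\<in>V. \<Sum>a<d i. (v i y j a)\<^sup>2) \<le> B" and
    m: "\<And>i x y. i \<in> I \<Longrightarrow> x \<in> X \<Longrightarrow> y \<in> Y \<Longrightarrow> p i x \<noteq> 0 \<Longrightarrow> q i y \<noteq> 0 \<Longrightarrow>
       M i x y = (\<Sum>j\<in>V. \<Sum>a<d i. dif x y j * (u i x j a * v i y j a))"
  proof -
    have "\<forall>i\<in>I. \<exists>d u v. (\<forall>x\<in>X. p i x \<noteq> 0 \<longrightarrow> (\<Sum>j\<in>V. \<Sum>a<(d::nat). (u x j a)\<^sup>2) \<le> A) \<and>
       (\<forall>y\<in>Y. q i y \<noteq> 0 \<longrightarrow> (\<Sum>j\<in>V. \<Sum>a<d. (v y j a)\<^sup>2) \<le> B) \<and>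
       (\<forall>x\<in>X. \<forall>y\<in>Y. p i x \<noteq> 0 \<longrightarrow> q i y \<noteq> 0 \<longrightarrow> M i x y = (\<Sum>j\<in>V. \<Sum>a<d. dif x y j * (u x j a * v y j a)))"
    proof
      fix i assume "i \<in> I"
      from g[OF this] obtain d u v where "\<forall>x\<in>{x\<in>X. p i x \<noteq> 0}. (\<Sum>j\<in>V. \<Sum>a<(d::nat). (u x j a)\<^sup>2) \<le> A"
        "\<forall>y\<in>{y\<in>Y. q i y \<noteq> 0}. (\<Sum>j\<in>V. \<Sum>a<d. (v y j a)\<^sup>2) \<le> B"
        "\<forall>x\<in>{x\<in>X. p i x \<noteq> 0}. \<forall>y\<in>{y\<in>Y. q i y \<noteq> 0}. M i x y = (\<Sum>j\<in>V. \<Sum>a<d. dif x y j * (u x j a * v y j a))"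
        unfolding gam_def by blast
      then show "\<exists>d u v. (\<forall>x\<in>X. p i x \<noteq> 0 \<longrightarrow> (\<Sum>j\<in>V. \<Sum>a<(d::nat). (u x j a)\<^sup>2) \<le> A) \<and>
       (\<forall>y\<in>Y. q i y \<noteq> 0 \<longrightarrow> (\<Sum>j\<in>V. \<Sum>a<d. (v y j a)\<^sup>2) \<le> B) \<and>
       (\<forall>x\<in>X. \<forall>y\<in>Y. p i x \<noteq> 0 \<longrightarrow> q i y \<noteq> 0 \<longrightarrow> M i x y = (\<Sum>j\<in>V. \<Sum>a<d. dif x y j * (u x j a * v y j a)))"
        by (intro exI[of _ d] exI[of _ u] exI[of _ v]) blast
    qed
    from bchoice[OF this] obtain d where "\<forall>i\<in>I. \<exists>u v. (\<forall>x\<in>X. p i x \<noteq> 0 \<longrightarrow> (\<Sum>j\<in>V. \<Sum>a<(d i::nat). (u x j a)\<^sup>2) \<le> A) \<and>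
       (\<forall>y\<in>Y. q i y \<noteq> 0 \<longrightarrow> (\<Sum>j\<in>V. \<Sum>a<d i. (v y j a)\<^sup>2) \<le> B) \<and>
       (\<forall>x\<in>X. \<forall>y\<in>Y. p i x \<noteq> 0 \<longrightarrow> q i y \<noteq> 0 \<longrightarrow> M i x y = (\<Sum>j\<in>V. \<Sum>a<d i. dif x y j * (u x j a * v y j a)))" ..
    from bchoice[OF this] obtain u where "\<forall>i\<in>I. \<exists>v. (\<forall>x\<in>X. p i x \<noteq> 0 \<longrightarrow> (\<Sum>j\<in>V. \<Sum>a<d i. (u i x j a)\<^sup>2) \<le> A) \<and>
       (\<forall>y\<in>Y. q i y \<noteq> 0 \<longrightarrow> (\<Sum>j\<in>V. \<Sum>a<d i. (v y j a)\<^sup>2) \<le> B) \<and>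
       (\<forall>x\<in>X. \<forall>y\<in>Y. p i x \<noteq> 0 \<longrightarrow> q i y \<noteq> 0 \<longrightarrow> M i x y = (\<Sum>j\<in>V. \<Sum>a<d i. dif x y j * (u i x j a * v y j a)))" ..
    from bchoice[OF this] obtain v where "\<forall>i\<in>I. (\<forall>x\<in>X. p i x \<noteq> 0 \<longrightarrow> (\<Sum>j\<in>V. \<Sum>a<d i. (u i x j a)\<^sup>2) \<le> A) \<and>
       (\<forall>y\<in>Y. q i y \<noteq> 0 \<longrightarrow> (\<Sum>j\<in>V. \<Sum>a<d i. (v i y j a)\<^sup>2) \<le> B) \<and>
       (\<forall>x\<in>X. \<forall>y\<in>Y. p i x \<noteq> 0 \<longrightarrow> q i y \<noteq> 0 \<longrightarrow> M i x y = (\<Sum>j\<in>V. \<Sum>a<d i. dif x y j * (u i x j a * v i y j a)))" ..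
    then show ?thesis using that[of u d v] by blast
  qed
  have split: "(\<Sum>j\<in>V. \<Sum>w\<in>(SIGMA i:I. {..<d i}). F (fst w) j (snd w)) = (\<Sum>i\<in>I. \<Sum>j\<in>V. \<Sum>a<d i. F i j a)" for F :: "'b \<Rightarrow> 'a \<Rightarrow> nat \<Rightarrow> real"
  proof -
    have "(\<Sum>w\<in>(SIGMA i:I. {..<d i}). F (fst w) j (snd w)) = (\<Sum>i\<in>I. \<Sum>a<d i. F i j a)" for j
      using sum.Sigma[of I "\<lambda>i. {..<d i}" "\<lambda>i a. F i j a"] I by (simp add: case_prod_beta)
    then have "(\<Sum>j\<in>V. \<Sum>w\<in>(SIGMA i:I. {..<d i}). F (fst w) j (snd w)) = (\<Sum>j\<in>V. \<Sum>i\<in>I. \<Sum>a<d i. F i j a)"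
      by (rule sum.cong[OF refl])
    also have "\<dots> = (\<Sum>i\<in>I. \<Sum>j\<in>V. \<Sum>a<d i. F i j a)" by (rule sum.swap)
    finally show ?thesis .
  qed
  show ?thesis
  proof (rule gamI[where D = "SIGMA i:I. {..<d i}" and u = "\<lambda>x j w. p (fst w) x * u (fst w) x j (snd w)" and v = "\<lambda>y j w. q (fst w) y * v (fst w) y j (snd w)"])
    show "finite (SIGMA i:I. {..<d i})" using I by simp
  next
    fix x assume x: "x \<in> X"
    have "(\<Sum>j\<in>V. \<Sum>w\<in>(SIGMA i:I. {..<d i}). (p (fst w) x * u (fst w) x j (snd w))\<^sup>2) = (\<Sum>i\<in>I. \<Sum>j\<in>V. \<Sum>a<d i. (p i x * u i x j a)\<^sup>2)"
      by (rule split)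
    also have "\<dots> = (\<Sum>i\<in>I. (p i x)\<^sup>2 * (\<Sum>j\<in>V. \<Sum>a<d i. (u i x j a)\<^sup>2))"
      by (simp add: power_mult_distrib sum_distrib_left)
    also have "\<dots> \<le> (\<Sum>i\<in>I. (p i x)\<^sup>2 * A)"
    proof (rule sum_mono)
      fix i assume "i \<in> I"
      then show "(p i x)\<^sup>2 * (\<Sum>j\<in>V. \<Sum>a<d i. (u i x j a)\<^sup>2) \<le> (p i x)\<^sup>2 * A"
        using u[of i x] x by (cases "p i x = 0") (auto intro!: mult_left_mono)
    qed
    also have "\<dots> \<le> P * A" using P[OF x] AB by (simp add: sum_distrib_right[symmetric] mult_right_mono)
    finally show "(\<Sum>j\<in>V. \<Sum>w\<in>(SIGMA i:I. {..<d i}). (p (fst w) x * u (fst w) x j (snd w))\<^sup>2) \<le> P * A" .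
  next
    fix y assume y: "y \<in> Y"
    have "(\<Sum>j\<in>V. \<Sum>w\<in>(SIGMA i:I. {..<d i}). (q (fst w) y * v (fst w) y j (snd w))\<^sup>2) = (\<Sum>i\<in>I. \<Sum>j\<in>V. \<Sum>a<d i. (q i y * v i y j a)\<^sup>2)"
      by (rule split)
    also have "\<dots> = (\<Sum>i\<in>I. (q i y)\<^sup>2 * (\<Sum>j\<in>V. \<Sum>a<d i. (v i y j a)\<^sup>2))"
      by (simp add: power_mult_distrib sum_distrib_left)
    also have "\<dots> \<le> (\<Sum>i\<in>I. (q i y)\<^sup>2 * B)"
    proof (rule sum_mono)
      fix i assume "i \<in> I"
      then show "(q i y)\<^sup>2 * (\<Sum>j\<in>V. \<Sum>a<d i. (v i y j a)\<^sup>2) \<le> (q i y)\<^sup>2 * B"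
        using v[of i y] y by (cases "q i y = 0") (auto intro!: mult_left_mono)
    qed
    also have "\<dots> \<le> Q * B" using Q[OF y] AB by (simp add: sum_distrib_right[symmetric] mult_right_mono)
    finally show "(\<Sum>j\<in>V. \<Sum>w\<in>(SIGMA i:I. {..<d i}). (q (fst w) y * v (fst w) y j (snd w))\<^sup>2) \<le> Q * B" .
  next
    fix x y assume x: "x \<in> X" and y: "y \<in> Y"
    have "M' x y = (\<Sum>i\<in>I. p i x * q i y * M i x y)" by (rule M[OF x y])
    also have "\<dots> = (\<Sum>i\<in>I. p i x * q i y * (\<Sum>j\<in>V. \<Sum>a<d i. dif x y j * (u i x j a * v i y j a)))"
    proof (rule sum.cong[OF refl])
      fix i assume "i \<in> I"
      then show "p i x * q i y * M i x y = p i x * q i y * (\<Sum>j\<in>V. \<Sum>a<d i. dif x y j * (u i x j a * v i y j a))"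
        using m[of i x y] x y by (cases "p i x = 0 \<or> q i y = 0") auto
    qed
    also have "\<dots> = (\<Sum>i\<in>I. \<Sum>j\<in>V. \<Sum>a<d i. dif x y j * (p i x * u i x j a * (q i y * v i y j a)))"
      by (simp only: sum_distrib_left ac_simps)
    also have "\<dots> = (\<Sum>j\<in>V. \<Sum>w\<in>(SIGMA i:I. {..<d i}). dif x y j * (p (fst w) x * u (fst w) x j (snd w) * (q (fst w) y * v (fst w) y j (snd w))))"
      by (rule split[symmetric])
    finally show "M' x y = \<dots>" .
  qed
qed

lemma gam_zero: "gam V X Y 0 0 (\<lambda>_ _. 0)"
  by (rule gamI[where D = "{}"]) auto

lemma gam_add:
  assumes "gam V X Y A B M" "gam V X Y A' B' M'"
  shows "gam V X Y (A + A') (B + B') (\<lambda>x y. M x y + M' x y)"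
proof -
  obtain d u v where 1: "\<forall>x\<in>X. (\<Sum>i\<in>V. \<Sum>a<(d::nat). (u x i a)\<^sup>2) \<le> A" "\<forall>y\<in>Y. (\<Sum>i\<in>V. \<Sum>a<d. (v y i a)\<^sup>2) \<le> B"
     "\<forall>x\<in>X. \<forall>y\<in>Y. M x y = (\<Sum>i\<in>V. \<Sum>a<(d::nat). dif x y i * (u x i a * v y i a))"
    using assms(1) unfolding gam_def by blast
  obtain d' u' v' where 2: "\<forall>x\<in>X. (\<Sum>i\<in>V. \<Sum>a<(d'::nat). (u' x i a)\<^sup>2) \<le> A'" "\<forall>y\<in>Y. (\<Sum>i\<in>V. \<Sum>a<d'. (v' y i a)\<^sup>2) \<le> B'"
     "\<forall>x\<in>X. \<forall>y\<in>Y. M' x y = (\<Sum>i\<in>V. \<Sum>a<(d'::nat). dif x y i * (u' x i a * v' y i a))"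
    using assms(2) unfolding gam_def by blast
  have plus: "(\<Sum>w\<in>{..<d} <+> {..<d'}. F w) = (\<Sum>a<d. F (Inl a)) + (\<Sum>a<d'. F (Inr a))" for F :: "_ \<Rightarrow> real"
    by (simp add: sum.Plus)
  show ?thesis
    by (rule gamI[where D = "{..<d} <+> {..<d'}" and u = "\<lambda>x i w. case w of Inl a \<Rightarrow> u x i a | Inr a \<Rightarrow> u' x i a" and
          v = "\<lambda>x i w. case w of Inl a \<Rightarrow> v x i a | Inr a \<Rightarrow> v' x i a"])
       (use 1 2 in \<open>auto simp: plus sum.distrib add_mono\<close>)
qed

lemma gam_restrict:
  assumes "gam V {x\<in>X. P x} {y\<in>Y. Q y} A B M" "A \<ge> 0" "B \<ge> 0"
  shows "gam V X Y A B (\<lambda>x y. of_bool (P x \<and> Q y) * M x y)"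
  using gam_wsum[of "{()}" A B V X "\<lambda>_ x. of_bool (P x)" Y "\<lambda>_ y. of_bool (Q y)" "\<lambda>_. M" 1 1 "\<lambda>x y. of_bool (P x \<and> Q y) * M x y"]
    assms by (auto simp: of_bool_conj)

text \<open>Each y names a witness \<open>sel y\<close>. On the right only the summand of this
  witness is present, so B stays; on the left all summands are present. After balancing, the cost of
  the search is a square root.\<close>

lemma gam_search_right:
  assumes "finite I" "\<And>y. y \<in> Y \<Longrightarrow> sel y \<in> I" "A \<ge> 0" "B \<ge> 0"
    and "\<And>i. i \<in> I \<Longrightarrow> gam V X {y\<in>Y. sel y = i} A B (\<lambda>_ _. 1)"
  shows "gam V X Y (real (card I) * A) B (\<lambda>_ _. 1)"
proof -
  have "gam V X Y (real (card I) * A) (1 * B) (\<lambda>_ _. 1)"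
  proof (rule gam_wsum[where p = "\<lambda>_ _. 1" and q = "\<lambda>i y. of_bool (sel y = i)" and M = "\<lambda>_ _ _. 1" and I = I])
    fix i assume "i \<in> I"
    then show "gam V {x \<in> X. 1 \<noteq> (0::real)} {y \<in> Y. of_bool (sel y = i) \<noteq> (0::real)} A B (\<lambda>_ _. 1)"
      by (intro gam_mono[OF assms(5)]) auto
  qed (use assms in simp_all)
  then show ?thesis by simp
qed

lemma gam_search_left:
  assumes "finite I" "\<And>x. x \<in> X \<Longrightarrow> sel x \<in> I" "A \<ge> 0" "B \<ge> 0"
    and "\<And>i. i \<in> I \<Longrightarrow> gam V {x\<in>X. sel x = i} Y A B (\<lambda>_ _. 1)"
  shows "gam V X Y A (real (card I) * B) (\<lambda>_ _. 1)"
proof -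
  have "gam V X Y (1 * A) (real (card I) * B) (\<lambda>_ _. 1)"
  proof (rule gam_wsum[where q = "\<lambda>_ _. 1" and p = "\<lambda>i y. of_bool (sel y = i)" and M = "\<lambda>_ _ _. 1" and I = I])
    fix i assume "i \<in> I"
    then show "gam V {x \<in> X. of_bool (sel x = i) \<noteq> (0::real)} {y \<in> Y. 1 \<noteq> (0::real)} A B (\<lambda>_ _. 1)"
      by (intro gam_mono[OF assms(5)]) auto
  qed (use assms in simp_all)
  then show ?thesis by simp
qed

text \<open>Sequential composition: \<phi> is compared first, and where it agrees the solution for
  the common value takes over. The costs add.\<close>

lemma gam_branch:
  fixes \<phi> :: "('v \<Rightarrow> real) \<Rightarrow> 's"
  assumes X: "finite X" and AB: "A' \<ge> 0" "B' \<ge> 0"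
    and d: "gam V X Y A B (\<lambda>x y. of_bool (\<phi> x \<noteq> \<phi> y))"
    and e: "\<And>s. s \<in> \<phi> ` X \<Longrightarrow> gam V {x\<in>X. \<phi> x = s} {y\<in>Y. \<phi> y = s} A' B' (M s)"
    and M': "\<And>x y. x \<in> X \<Longrightarrow> y \<in> Y \<Longrightarrow> M' x y = of_bool (\<phi> x \<noteq> \<phi> y) + of_bool (\<phi> x = \<phi> y) * M (\<phi> x) x y"
  shows "gam V X Y (A + A') (B + B') M'"
proof -
  have "gam V X Y (1 * A') (1 * B') (\<lambda>x y. of_bool (\<phi> x = \<phi> y) * M (\<phi> x) x y)"
  proof (rule gam_wsum[where p = "\<lambda>s x. of_bool (\<phi> x = s)" and q = "\<lambda>s y. of_bool (\<phi> y = s)" and I = "\<phi> ` X" and M = M])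
    fix y
    have "(\<Sum>s\<in>\<phi> ` X. (of_bool (\<phi> y = s))\<^sup>2) = (of_bool (\<phi> y \<in> \<phi> ` X) :: real)"
      using X by (auto simp: of_bool_def if_distrib[where f = "\<lambda>z. z\<^sup>2"] cong: if_cong)
    then show "(\<Sum>s\<in>\<phi> ` X. (of_bool (\<phi> y = s))\<^sup>2) \<le> (1 :: real)" by simp
    then show "(\<Sum>s\<in>\<phi> ` X. (of_bool (\<phi> y = s))\<^sup>2) \<le> (1 :: real)" .
  next
    fix x y assume x: "x \<in> X"
    have "(\<Sum>s\<in>\<phi> ` X. of_bool (\<phi> x = s) * of_bool (\<phi> y = s) * M s x y) = (\<Sum>s\<in>{\<phi> x}. of_bool (\<phi> x = s) * of_bool (\<phi> y = s) * M s x y)"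
      by (rule sum.mono_neutral_right) (use x X in auto)
    then show "of_bool (\<phi> x = \<phi> y) * M (\<phi> x) x y = (\<Sum>s\<in>\<phi> ` X. of_bool (\<phi> x = s) * of_bool (\<phi> y = s) * M s x y)"
      by (simp add: of_bool_def)
  qed (use X AB e in auto)
  from gam_add[OF d this] show ?thesis by (rule gam_mono) (use M' in auto)
qed

lemma gam_tuple:
  fixes \<phi> :: "nat \<Rightarrow> ('v \<Rightarrow> real) \<Rightarrow> 's"
  assumes X: "finite X" and AB: "A \<ge> 0" "B \<ge> 0"
    and d: "\<And>\<tau>. \<tau> < c \<Longrightarrow> gam V X Y A B (\<lambda>x y. of_bool (\<phi> \<tau> x \<noteq> \<phi> \<tau> y))"
  shows "gam V X Y (real c * A) (real c * B) (\<lambda>x y. of_bool (\<exists>\<tau><c. \<phi> \<tau> x \<noteq> \<phi> \<tau> y))"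
  using d
proof (induction c)
  case 0
  show ?case by (simp add: gam_zero)
next
  case (Suc c)
  let ?\<psi> = "\<lambda>x. \<lambda>\<tau>\<in>{..<c}. \<phi> \<tau> x"
  have eq: "?\<psi> x \<noteq> ?\<psi> y \<longleftrightarrow> (\<exists>\<tau><c. \<phi> \<tau> x \<noteq> \<phi> \<tau> y)" for x y
    by (auto simp: fun_eq_iff restrict_def)
  have "gam V X Y (real c * A + A) (real c * B + B) (\<lambda>x y. of_bool (\<exists>\<tau><Suc c. \<phi> \<tau> x \<noteq> \<phi> \<tau> y))"
  proof (rule gam_branch[where \<phi> = ?\<psi> and M = "\<lambda>_ x y. of_bool (\<phi> c x \<noteq> \<phi> c y)"])
    show "gam V X Y (real c * A) (real c * B) (\<lambda>x y. of_bool (?\<psi> x \<noteq> ?\<psi> y))"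
      unfolding eq using Suc by simp
    show "gam V {x \<in> X. ?\<psi> x = s} {y \<in> Y. ?\<psi> y = s} A B (\<lambda>x y. of_bool (\<phi> c x \<noteq> \<phi> c y))" for s
      by (rule gam_mono[OF Suc.prems[of c]]) auto
    show "of_bool (\<exists>\<tau><Suc c. \<phi> \<tau> x \<noteq> \<phi> \<tau> y) = of_bool (?\<psi> x \<noteq> ?\<psi> y) + of_bool (?\<psi> x = ?\<psi> y) * (of_bool (\<phi> c x \<noteq> \<phi> c y) :: real)" for x y
      using eq[of x y] by (auto simp: less_Suc_eq of_bool_def)
  qed (use X AB in auto)
  then show ?case by (simp add: algebra_simps)
qed

lemma gam_vars:
  assumes "finite X" "finite V" "D \<subseteq> V"
  shows "gam V X Y (real (card D)) (real (card D)) (\<lambda>x y. of_bool (\<exists>v\<in>D. x v \<noteq> y v))"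
proof -
  have "finite D" using assms finite_subset by auto
  then obtain h where h: "bij_betw h {..<card D} D" using ex_bij_betw_nat_finite by (auto simp: atLeast0LessThan)
  then have hD: "h \<tau> \<in> V" if "\<tau> < card D" for \<tau> using that assms(3) by (auto simp: bij_betw_def)
  have "gam V X Y (real (card D) * 1) (real (card D) * 1) (\<lambda>x y. of_bool (\<exists>\<tau><card D. x (h \<tau>) \<noteq> y (h \<tau>)))"
    by (rule gam_tuple[OF assms(1)]) (use gam_bit[OF assms(2) hD] in auto)
  moreover have "(\<exists>\<tau><card D. x (h \<tau>) \<noteq> y (h \<tau>)) \<longleftrightarrow> (\<exists>v\<in>D. x v \<noteq> y v)" for x y :: "'a \<Rightarrow> real"
    using h unfolding bij_betw_def by (metis (no_types, lifting) imageE imageI lessThan_iff)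
  ultimately show ?thesis by simp
qed

text \<open>In the solution for the outer matrix, the entry that says whether bit i differs is
  itself replaced by a solution for the i-th bit of g, so the costs multiply.\<close>

lemma gam_compose:
  assumes W: "finite W" and AB: "A' \<ge> 0" "B' \<ge> 0"
    and M: "gam W X' Y' A B M" and g: "\<And>x. x \<in> X \<Longrightarrow> g x \<in> X'" "\<And>y. y \<in> Y \<Longrightarrow> g y \<in> Y'"
    and d: "\<And>i. i \<in> W \<Longrightarrow> gam V X Y A' B' (\<lambda>x y. of_bool (g x i \<noteq> g y i))"
  shows "gam V X Y (A * A') (B * B') (\<lambda>x y. M (g x) (g y))"
proof -
  obtain d u v where *: "\<forall>x\<in>X'. (\<Sum>i\<in>W. \<Sum>a<(d::nat). (u x i a)\<^sup>2) \<le> A" "\<forall>y\<in>Y'. (\<Sum>i\<in>W. \<Sum>a<d. (v y i a)\<^sup>2) \<le> B"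
     "\<forall>x\<in>X'. \<forall>y\<in>Y'. M x y = (\<Sum>i\<in>W. \<Sum>a<d. dif x y i * (u x i a * v y i a))"
    using M unfolding gam_def by blast
  show ?thesis
  proof (rule gam_wsum[where I = "W \<times> {..<d}" and p = "\<lambda>w x. u (g x) (fst w) (snd w)" and q = "\<lambda>w y. v (g y) (fst w) (snd w)" and M = "\<lambda>w x y. of_bool (g x (fst w) \<noteq> g y (fst w))"])
    fix w assume "w \<in> W \<times> {..<d}"
    then show "gam V {x \<in> X. u (g x) (fst w) (snd w) \<noteq> 0} {y \<in> Y. v (g y) (fst w) (snd w) \<noteq> 0} A' B' (\<lambda>x y. of_bool (g x (fst w) \<noteq> g y (fst w)))"
      by (intro gam_mono[OF d[of "fst w"]]) auto
  qed (use W AB * g in \<open>simp_all add: sum.cartesian_product' ac_simps dif_def\<close>)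
qed

text \<open>Positivity of the Cauchy matrix through Schur complements: after subtracting the
  rank-one part 2 * z / ((a + z) * (a' + z)) from 1 / (a + a'), what remains is the same matrix
  scaled by (a - z) / (a + z) on both sides, which vanishes in row z.\<close>

lemma cauchy_gram:
  assumes "finite S" "\<And>a. a \<in> S \<Longrightarrow> a > 0"
  shows "\<exists>(d::nat) e. \<forall>a\<in>S. \<forall>a'\<in>S. (\<Sum>j<d. e a j * e a' j) = 1 / (a + a' :: real)"
  using assms
proof (induction S rule: finite_induct)
  case (insert z S)
  then obtain d e where e: "\<forall>a\<in>S. \<forall>a'\<in>S. (\<Sum>j<(d::nat). e a j * e a' j) = 1 / (a + a')" by auto
  have z: "z > 0" using insert.prems by auto
  define f where "f = (\<lambda>a j. case j of 0 \<Rightarrow> sqrt (2 * z) / (a + z) | Suc j \<Rightarrow> (a - z) / (a + z) * e a j)"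
  have "(\<Sum>j<Suc d. f a j * f a' j) = 1 / (a + a')" if a: "a \<in> insert z S" "a' \<in> insert z S" for a a'
  proof -
    have pos: "a > 0" "a' > 0" using a insert.prems by auto
    have "(\<Sum>j<Suc d. f a j * f a' j) = 2 * z / ((a + z) * (a' + z)) + (\<Sum>j<d. (a - z) / (a + z) * e a j * ((a' - z) / (a' + z) * e a' j))"
      by (subst sum.lessThan_Suc_shift) (use z in \<open>simp add: f_def power2_eq_square[symmetric]\<close>)
    also have "(\<Sum>j<d. (a - z) / (a + z) * e a j * ((a' - z) / (a' + z) * e a' j)) = (a - z) * (a' - z) / ((a + z) * (a' + z)) * (\<Sum>j<d. e a j * e a' j)"
      by (simp add: sum_distrib_left mult.assoc mult.left_commute)
    also have "\<dots> = (a - z) * (a' - z) / ((a + z) * (a' + z)) * (1 / (a + a'))"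
      using a e by (cases "a = z \<or> a' = z") auto
    also have "2 * z / ((a + z) * (a' + z)) + (a - z) * (a' - z) / ((a + z) * (a' + z)) * (1 / (a + a')) = 1 / (a + a')"
      using pos z by (simp add: divide_simps) (simp add: algebra_simps)
    finally show ?thesis .
  qed
  then show ?case by blast
qed auto

text \<open>Dividing F x - F y entrywise by itself is a Hadamard product with a Cauchy matrix, since
  F x - F y = s x + t y for the distances s and t from the middle of the gap. These are at least g /
  2, so the Cauchy matrix has diagonal at most 1 / g.\<close>

lemma gam_gap:
  assumes X: "finite X" "finite Y" and AB: "A \<ge> 0" "B \<ge> 0" and g: "g > 0"
    and d: "gam V X Y A B (\<lambda>x y. F x - F y)"
    and FX: "\<And>x. x \<in> X \<Longrightarrow> F x \<ge> \<theta> + g" and FY: "\<And>y. y \<in> Y \<Longrightarrow> F y \<le> \<theta>"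
  shows "gam V X Y (1 / g * A) (1 / g * B) (\<lambda>_ _. 1)"
proof -
  define s where "s = (\<lambda>x. F x - (\<theta> + g / 2))"
  define t where "t = (\<lambda>y. (\<theta> + g / 2) - F y)"
  have s: "s x \<ge> g / 2" if "x \<in> X" for x using FX[OF that] by (simp add: s_def)
  have t: "t y \<ge> g / 2" if "y \<in> Y" for y using FY[OF that] by (simp add: t_def)
  have "finite (s ` X \<union> t ` Y)" "\<And>a. a \<in> s ` X \<union> t ` Y \<Longrightarrow> a > 0" using X s t g by fastforce+
  from cauchy_gram[OF this] obtain k e where
    e: "\<forall>a\<in>s ` X \<union> t ` Y. \<forall>a'\<in>s ` X \<union> t ` Y. (\<Sum>j<(k::nat). e a j * e a' j) = 1 / (a + a')" by blast
  show ?thesis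
  proof (rule gam_wsum[where I = "{..<k}" and p = "\<lambda>j x. e (s x) j" and q = "\<lambda>j y. e (t y) j" and M = "\<lambda>_ x y. F x - F y"])
    fix x assume x: "x \<in> X"
    have "(\<Sum>j<k. (e (s x) j)\<^sup>2) = 1 / (s x + s x)" using e x by (simp add: power2_eq_square)
    also have "\<dots> \<le> 1 / g" using s[OF x] g by (intro divide_left_mono) auto
    finally show "(\<Sum>j<k. (e (s x) j)\<^sup>2) \<le> 1 / g" .
  next
    fix x assume x: "x \<in> Y"
    have "(\<Sum>j<k. (e (t x) j)\<^sup>2) = 1 / (t x + t x)" using e x by (simp add: power2_eq_square)
    also have "\<dots> \<le> 1 / g" using t[OF x] g by (intro divide_left_mono) auto
    finally show "(\<Sum>j<k. (e (t x) j)\<^sup>2) \<le> 1 / g" .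
  next
    fix x y assume x: "x \<in> X" and y: "y \<in> Y"
    have "(\<Sum>j<k. e (s x) j * e (t y) j) = 1 / (s x + t y)" using e x y by simp
    moreover have "s x + t y = F x - F y" by (simp add: s_def t_def)
    moreover have "s x + t y > 0" using s[OF x] t[OF y] g by simp
    ultimately show "1 = (\<Sum>j<k. e (s x) j * e (t y) j * (F x - F y))"
      by (simp add: sum_distrib_right[symmetric])
  qed (use AB in \<open>auto intro: gam_mono[OF d]\<close>)
qed

section \<open>Dual adversary solution for the cheat sheet function\<close>

context cheat
begin

definition ones :: "('o var \<Rightarrow> real) set" where "ones = {Z\<in>signs VS. total_fun Z = 1}"
definition zeros :: "('o var \<Rightarrow> real) set" where "zeros = {Z\<in>signs VS. total_fun Z \<noteq> 1}"

lemma finite_VS: "finite VS"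
proof -
  have "VS = (\<lambda>(\<tau>, i, r, j). Inp \<tau> i r j) ` ({..<c} \<times> W \<times> R \<times> R) \<union> Flag ` Pow {..<c}
     \<union> (\<lambda>(e, \<tau>, i). Claim e \<tau> i) ` (Pow {..<c} \<times> {..<c} \<times> W)
     \<union> (\<lambda>(e, \<tau>, i, r, s). Ptr e \<tau> i r s) ` (Pow {..<c} \<times> {..<c} \<times> W \<times> R \<times> {..<b})"
    unfolding VS_def by (auto simp: image_iff)
  then show ?thesis using finW finite_R by simp
qed

lemma finite_ones: "finite ones" and finite_zeros: "finite zeros"
  using finite_signs[OF finite_VS] by (simp_all add: ones_def zeros_def)

text \<open>Telling an AND of ORs with value 1 from one with value -1 takes two nested searches: for
  the row where the latter fails, and within it for the column where the former succeeds. They load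
  opposite bounds, so the result is balanced at 2 ^ b, the square root of the grid size. The factor
  2 adds up the two directions.\<close>

lemma gam_outer:
  assumes X: "X \<subseteq> signs VS" and Y: "Y \<subseteq> signs VS" and \<tau>: "\<tau> < c" and i: "i \<in> W"
  shows "gam VS X Y (2 * 2 ^ b) (2 * 2 ^ b) (\<lambda>x y. of_bool (outer x \<tau> i \<noteq> outer y \<tau> i))"
proof -
  have inp: "Inp \<tau> i r j \<in> VS" if "r \<in> R" "j \<in> R" for r j using that \<tau> i by (auto simp: VS_def)
  have oc: "outer x \<tau> i = 1 \<or> outer x \<tau> i = -1" for x using i by (simp add: outer_def)
  define row where "row = (\<lambda>y :: 'o var \<Rightarrow> real. SOME r. r \<in> R \<and> (\<forall>j\<in>R. y (Inp \<tau> i r j) \<noteq> 1))"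
  define col where "col = (\<lambda>(x :: 'o var \<Rightarrow> real) r. SOME j. j \<in> R \<and> x (Inp \<tau> i r j) = 1)"
  have row: "row y \<in> R \<and> (\<forall>j\<in>R. y (Inp \<tau> i (row y) j) \<noteq> 1)" if "outer y \<tau> i = -1" for y
  proof -
    have "\<exists>r. r \<in> R \<and> (\<forall>j\<in>R. y (Inp \<tau> i r j) \<noteq> 1)" using that i by (auto simp: outer_def split: if_splits)
    from someI_ex[OF this] show ?thesis by (simp add: row_def)
  qed
  have col: "col x r \<in> R \<and> x (Inp \<tau> i r (col x r)) = 1" if "outer x \<tau> i = 1" "r \<in> R" for x r
  proof -
    have "\<exists>j. j \<in> R \<and> x (Inp \<tau> i r j) = 1" using that i by (auto simp: outer_def split: if_splits)
    from someI_ex[OF this] show ?thesis by (simp add: col_def)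
  qed
  have bit: "gam VS X' Y' 1 1 (\<lambda>_ _. 1)" if "r \<in> R" "j \<in> R" "\<And>x y. x \<in> X' \<Longrightarrow> y \<in> Y' \<Longrightarrow> x (Inp \<tau> i r j) \<noteq> y (Inp \<tau> i r j)" for X' Y' r j
    by (rule gam_mono[OF gam_bit[OF finite_VS inp[OF that(1,2)]]]) (use that(3) in auto)
  have A: "gam VS {x\<in>X. outer x \<tau> i = 1} {y\<in>Y. outer y \<tau> i = -1} (2 ^ b) (2 ^ b) (\<lambda>_ _. 1)"
  proof -
    have "gam VS {x\<in>X. outer x \<tau> i = 1} {y\<in>Y. outer y \<tau> i = -1} (real (card R) * 1) (real (card R) * 1) (\<lambda>_ _. 1)"
    proof (rule gam_search_right[where sel = row, OF finite_R])
      fix r assume r: "r \<in> R"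
      show "gam VS {x\<in>X. outer x \<tau> i = 1} {y \<in> {y\<in>Y. outer y \<tau> i = -1}. row y = r} 1 (real (card R) * 1) (\<lambda>_ _. 1)"
      proof (rule gam_search_left[where sel = "\<lambda>x. col x r", OF finite_R])
        fix j assume j: "j \<in> R"
        show "gam VS {x \<in> {x \<in> X. outer x \<tau> i = 1}. col x r = j} {y \<in> {y \<in> Y. outer y \<tau> i = -1}. row y = r} 1 1 (\<lambda>_ _. 1)"
          by (rule bit[OF r j]) (use col[OF _ r] row j in fastforce)
      qed (use col r in auto)
    qed (use row in auto)
    then show ?thesis by (simp add: card_R)
  qed
  have B: "gam VS {x\<in>X. outer x \<tau> i = -1} {y\<in>Y. outer y \<tau> i = 1} (2 ^ b) (2 ^ b) (\<lambda>_ _. 1)"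
  proof -
    have "gam VS {x\<in>X. outer x \<tau> i = -1} {y\<in>Y. outer y \<tau> i = 1} (real (card R) * 1) (real (card R) * 1) (\<lambda>_ _. 1)"
    proof (rule gam_search_left[where sel = row, OF finite_R])
      fix r assume r: "r \<in> R"
      show "gam VS {x \<in> {x\<in>X. outer x \<tau> i = -1}. row x = r} {y\<in>Y. outer y \<tau> i = 1} (real (card R) * 1) 1 (\<lambda>_ _. 1)"
      proof (rule gam_search_right[where sel = "\<lambda>x. col x r", OF finite_R])
        fix j assume j: "j \<in> R"
        show "gam VS {x \<in> {x\<in>X. outer x \<tau> i = -1}. row x = r} {y \<in> {y\<in>Y. outer y \<tau> i = 1}. col y r = j} 1 1 (\<lambda>_ _. 1)"
          by (rule bit[OF r j]) (use col[OF _ r] row j in fastforce)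
      qed (use col r in auto)
    qed (use row in auto)
    then show ?thesis by (simp add: card_R)
  qed
  from gam_add[OF gam_restrict[OF A] gam_restrict[OF B]]
  have "gam VS X Y (2 ^ b + 2 ^ b) (2 ^ b + 2 ^ b) (\<lambda>x y. of_bool (outer x \<tau> i = 1 \<and> outer y \<tau> i = -1) * 1 + of_bool (outer x \<tau> i = -1 \<and> outer y \<tau> i = 1) * 1)"
    by simp
  then show ?thesis
  proof (rule gam_mono)
    fix x y
    show "of_bool (outer x \<tau> i \<noteq> outer y \<tau> i) = of_bool (outer x \<tau> i = 1 \<and> outer y \<tau> i = -1) * 1 + of_bool (outer x \<tau> i = -1 \<and> outer y \<tau> i = 1) * (1 :: real)"
      using oc[of x] oc[of y] by auto
  qed auto
qed

text \<open>A pointer always denotes an index in R, so the entries that it exhibits really occur in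
  the grid and force the value of the bit.\<close>

lemma valid_claim:
  assumes "valid Z e" "\<tau> < c" "i \<in> W" "Z \<in> signs VS" "e \<subseteq> {..<c}"
  shows "outer Z \<tau> i = Z (Claim e \<tau> i)"
proof -
  have cert: "certified Z e \<tau> i" using assms by (simp add: valid_def)
  have "Claim e \<tau> i \<in> VS" using assms by (auto simp: VS_def)
  then consider "Z (Claim e \<tau> i) = 1" | "Z (Claim e \<tau> i) = -1" using signs_cases[OF assms(4)] by blast
  then show ?thesis
  proof cases
    case 1
    then show ?thesis using cert pointer_R assms(3) by (auto simp: certified_def outer_def)
  next
    case 2
    then have "\<forall>j\<in>R. Z (Inp \<tau> i (pointer Z e \<tau> i {}) j) = -1" using cert by (simp add: certified_def)
    then have "\<not> (\<forall>r\<in>R. \<exists>j\<in>R. Z (Inp \<tau> i r j) = 1)"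
      using pointer_R[of Z e \<tau> i "{}"] by (metis one_neq_neg_one)
    then show ?thesis using 2 assms(3) by (auto simp: outer_def)
  qed
qed

lemma outer_signs: "outer Z \<tau> \<in> signs W"
  unfolding outer_def by (rule signs_restrictI) auto

text \<open>Only the 1-inputs are known to fulfil the promise, and this is enough: if the addresses
  of x and y differ at \<tau>, then x is at distance \<gamma> from the threshold on its side and y
  is on the other side of it.\<close>

lemma gam_address:
  assumes A: "A > 0" and dec: "gam W (signs W) (signs W) A A (\<lambda>x y. \<Phi> x - \<Phi> y)"
  shows "gam VS ones zeros (real c * (2 * (A * (2 * 2 ^ b) / \<gamma>))) (real c * (2 * (A * (2 * 2 ^ b) / \<gamma>))) (\<lambda>x y. of_bool (address x \<noteq> address y))"
proof -
  define D where "D = A * (2 * 2 ^ b) / \<gamma>"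
  have D: "D \<ge> 0" using A gap by (simp add: D_def)
  have diffs: "gam VS X Y (A * (2 * 2 ^ b)) (A * (2 * 2 ^ b)) (\<lambda>x y. \<Phi> (outer x \<tau>) - \<Phi> (outer y \<tau>))"
    if "\<tau> < c" "X \<subseteq> signs VS" "Y \<subseteq> signs VS" for \<tau> X Y
    by (rule gam_compose[OF finW _ _ dec, where g = "\<lambda>x. outer x \<tau>"])
       (use that gam_outer outer_signs in auto)
  have one: "gam VS ones zeros (2 * D) (2 * D) (\<lambda>x y. of_bool ((\<tau> \<in> address x) \<noteq> (\<tau> \<in> address y)))" if \<tau>: "\<tau> < c" for \<tau>
  proof -
    have pr: "promised (outer x \<tau>)" if "x \<in> ones" for x
    proof -
      have x: "x \<in> signs VS" "valid x (address x)" using that by (auto simp: ones_def total_fun_def split: if_splits)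
      have "address x \<subseteq> {..<c}" by (auto simp: address_def)
      then have "(\<lambda>i\<in>W. x (Claim (address x) \<tau> i)) = (\<lambda>i\<in>W. outer x \<tau> i)"
        using valid_claim[OF x(2) \<tau> _ x(1)] by (intro restrict_ext) simp
      also have "\<dots> = outer x \<tau>" by (auto simp: outer_def restrict_def)
      finally show ?thesis using x(2) \<tau> unfolding valid_def by metis
    qed
    have sub: "ones \<subseteq> signs VS" "zeros \<subseteq> signs VS" by (auto simp: ones_def zeros_def)
    have "gam VS {x\<in>ones. \<tau> \<in> address x} {y\<in>zeros. \<tau> \<notin> address y} (1 / \<gamma> * (A * (2 * 2 ^ b))) (1 / \<gamma> * (A * (2 * 2 ^ b))) (\<lambda>_ _. 1)"
    proof (rule gam_gap[where F = "\<lambda>x. \<Phi> (outer x \<tau>)" and \<theta> = \<theta>])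
      show "gam VS {x\<in>ones. \<tau> \<in> address x} {y\<in>zeros. \<tau> \<notin> address y} (A * (2 * 2 ^ b)) (A * (2 * 2 ^ b)) (\<lambda>x y. \<Phi> (outer x \<tau>) - \<Phi> (outer y \<tau>))"
        by (rule diffs[OF \<tau>]) (use sub in auto)
      show "\<theta> + \<gamma> \<le> \<Phi> (outer x \<tau>)" if "x \<in> {x\<in>ones. \<tau> \<in> address x}" for x
        using pr[of x] that gap by (auto simp: promised_def address_def)
    qed (use finite_ones finite_zeros A gap \<tau> in \<open>auto simp: address_def\<close>)
    then have 1: "gam VS {x\<in>ones. \<tau> \<in> address x} {y\<in>zeros. \<tau> \<notin> address y} D D (\<lambda>_ _. 1)" by (simp add: D_def)
    \<comment> \<open>The opposite direction is the same argument for - \<Phi> and -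
      \<theta>.\<close>
    have "gam VS {x\<in>ones. \<tau> \<notin> address x} {y\<in>zeros. \<tau> \<in> address y} (1 / \<gamma> * (A * (2 * 2 ^ b))) (1 / \<gamma> * (A * (2 * 2 ^ b))) (\<lambda>_ _. 1)"
    proof (rule gam_gap[where F = "\<lambda>x. - \<Phi> (outer x \<tau>)" and \<theta> = "- \<theta>"])
      have "gam VS {x\<in>ones. \<tau> \<notin> address x} {y\<in>zeros. \<tau> \<in> address y} (A * (2 * 2 ^ b)) (A * (2 * 2 ^ b)) (\<lambda>x y. \<Phi> (outer x \<tau>) - \<Phi> (outer y \<tau>))"
        by (rule diffs[OF \<tau>]) (use sub in auto)
      from gam_uminus[OF this]
      show "gam VS {x\<in>ones. \<tau> \<notin> address x} {y\<in>zeros. \<tau> \<in> address y} (A * (2 * 2 ^ b)) (A * (2 * 2 ^ b)) (\<lambda>x y. - \<Phi> (outer x \<tau>) - - \<Phi> (outer y \<tau>))"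
        by (rule gam_mono) auto
      show "- \<theta> + \<gamma> \<le> - \<Phi> (outer x \<tau>)" if "x \<in> {x\<in>ones. \<tau> \<notin> address x}" for x
        using pr[of x] that gap \<tau> by (auto simp: promised_def address_def)
    qed (use finite_ones finite_zeros A gap \<tau> in \<open>auto simp: address_def\<close>)
    then have 2: "gam VS {x\<in>ones. \<tau> \<notin> address x} {y\<in>zeros. \<tau> \<in> address y} D D (\<lambda>_ _. 1)" by (simp add: D_def)
    from gam_add[OF gam_restrict[OF 1 D D] gam_restrict[OF 2 D D]]
    show ?thesis by (rule gam_mono) (auto simp: of_bool_def)
  qed
  have "gam VS ones zeros (real c * (2 * D)) (real c * (2 * D)) (\<lambda>x y. of_bool (\<exists>\<tau><c. (\<tau> \<in> address x) \<noteq> (\<tau> \<in> address y)))"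
    by (rule gam_tuple) (use finite_ones D one in auto)
  moreover have "(\<exists>\<tau><c. (\<tau> \<in> address x) \<noteq> (\<tau> \<in> address y)) \<longleftrightarrow> address x \<noteq> address y" for x y
    by (auto simp: address_def)
  ultimately show ?thesis unfolding D_def by simp
qed

lemma gam_pointer:
  assumes X: "X \<subseteq> signs VS" "Y \<subseteq> signs VS" and "e \<subseteq> {..<c}" "\<tau> < c" "i \<in> W" "r \<in> R"
  shows "gam VS X Y (real b) (real b) (\<lambda>x y. of_bool (pointer x e \<tau> i r \<noteq> pointer y e \<tau> i r))"
proof -
  have "gam VS X Y (real b * 1) (real b * 1) (\<lambda>x y. of_bool (\<exists>s<b. (x (Ptr e \<tau> i r s) = 1) \<noteq> (y (Ptr e \<tau> i r s) = 1)))"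
  proof (rule gam_tuple[where \<phi> = "\<lambda>s x. x (Ptr e \<tau> i r s) = 1"])
    fix s assume "s < b"
    then have "Ptr e \<tau> i r s \<in> VS" using assms by (auto simp: VS_def)
    then have v: "x (Ptr e \<tau> i r s) = 1 \<or> x (Ptr e \<tau> i r s) = -1" if "x \<in> signs VS" for x
      using signs_cases[OF that] by blast
    show "gam VS X Y 1 1 (\<lambda>x y. of_bool ((x (Ptr e \<tau> i r s) = 1) \<noteq> (y (Ptr e \<tau> i r s) = 1)))"
    proof (rule gam_mono[OF gam_bit[OF finite_VS \<open>Ptr e \<tau> i r s \<in> VS\<close>]])
      fix x y assume "x \<in> X" "y \<in> Y"
      then have "x (Ptr e \<tau> i r s) = 1 \<or> x (Ptr e \<tau> i r s) = -1" "y (Ptr e \<tau> i r s) = 1 \<or> y (Ptr e \<tau> i r s) = -1"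
        using v X by blast+
      then show "of_bool ((x (Ptr e \<tau> i r s) = 1) \<noteq> (y (Ptr e \<tau> i r s) = 1)) = (of_bool (x (Ptr e \<tau> i r s) \<noteq> y (Ptr e \<tau> i r s)) :: real)"
        by auto
    qed auto
  next
    show "finite X" using X finite_signs[OF finite_VS] finite_subset by auto
  qed auto
  moreover have "(\<exists>s<b. (x (Ptr e \<tau> i r s) = 1) \<noteq> (y (Ptr e \<tau> i r s) = 1)) \<longleftrightarrow> pointer x e \<tau> i r \<noteq> pointer y e \<tau> i r" for x y
    by (auto simp: pointer_def)
  ultimately show ?thesis by simp
qed

text \<open>The bounds stay unbalanced on purpose. The search over all certificates will multiply
  the first one again, and balancing once at the end gives the square root of the product of all
  list lengths, up to the cost of reading pointers.\<close>

lemma gam_certificate: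
  assumes X: "X \<subseteq> signs VS" "Y \<subseteq> signs VS" and e: "e \<subseteq> {..<c}" and \<tau>: "\<tau> < c" and i: "i \<in> W"
    and cx: "\<And>x. x \<in> X \<Longrightarrow> certified x e \<tau> i" and cy: "\<And>y. y \<in> Y \<Longrightarrow> \<not> certified y e \<tau> i"
    and claim: "\<And>x. x \<in> X \<union> Y \<Longrightarrow> x (Claim e \<tau> i) = k"
  shows "gam VS X Y (2 ^ b * (real b + 1)) (real b + 1) (\<lambda>_ _. 1)"
proof -
  have finX: "finite X" using X finite_signs[OF finite_VS] finite_subset by auto
  have inp: "Inp \<tau> i r j \<in> VS" if "r \<in> R" "j \<in> R" for r j using that \<tau> i by (auto simp: VS_def)
  have bit: "gam VS X' Y' 1 1 (\<lambda>_ _. 1)" if "r \<in> R" "j \<in> R" "\<And>x y. x \<in> X' \<Longrightarrow> y \<in> Y' \<Longrightarrow> x (Inp \<tau> i r j) \<noteq> y (Inp \<tau> i r j)" for X' Y' r j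
    by (rule gam_mono[OF gam_bit[OF finite_VS inp[OF that(1,2)]]]) (use that(3) in auto)
  show ?thesis
  proof (cases "k = 1")
    case True
    define row where "row = (\<lambda>y :: 'o var \<Rightarrow> real. SOME r. r \<in> R \<and> y (Inp \<tau> i r (pointer y e \<tau> i r)) \<noteq> 1)"
    have row: "row y \<in> R \<and> y (Inp \<tau> i (row y) (pointer y e \<tau> i (row y))) \<noteq> 1" if "y \<in> Y" for y
    proof -
      have "\<exists>r. r \<in> R \<and> y (Inp \<tau> i r (pointer y e \<tau> i r)) \<noteq> 1" using that cy[OF that] claim[of y] True by (auto simp: certified_def)
      from someI_ex[OF this] show ?thesis by (simp add: row_def)
    qed
    have xr: "x (Inp \<tau> i r (pointer x e \<tau> i r)) = 1" if "x \<in> X" "r \<in> R" for x r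
      using that cx[OF that(1)] claim[of x] True by (auto simp: certified_def)
    have "gam VS X Y (real (card R) * (real b + 1)) (real b + 1) (\<lambda>_ _. 1)"
    proof (rule gam_search_right[where sel = row, OF finite_R])
      fix r assume r: "r \<in> R"
      show "gam VS X {y \<in> Y. row y = r} (real b + 1) (real b + 1) (\<lambda>_ _. 1)"
      proof (rule gam_branch[where \<phi> = "\<lambda>x. pointer x e \<tau> i r" and M = "\<lambda>_ _ _. 1", OF finX])
        show "gam VS X {y \<in> Y. row y = r} (real b) (real b) (\<lambda>x y. of_bool (pointer x e \<tau> i r \<noteq> pointer y e \<tau> i r))"
          by (rule gam_pointer) (use X e \<tau> i r in auto)
        fix j assume "j \<in> (\<lambda>x. pointer x e \<tau> i r) ` X"
        then have "j \<in> R" by (auto simp: pointer_R)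
        show "gam VS {x \<in> X. pointer x e \<tau> i r = j} {y \<in> {y \<in> Y. row y = r}. pointer y e \<tau> i r = j} 1 1 (\<lambda>_ _. 1)"
        proof (rule bit[OF r \<open>j \<in> R\<close>])
          fix x y assume x: "x \<in> {x \<in> X. pointer x e \<tau> i r = j}" and y: "y \<in> {y \<in> {y \<in> Y. row y = r}. pointer y e \<tau> i r = j}"
          have "x (Inp \<tau> i r j) = 1" using xr[of x r] x r by auto
          moreover have "y (Inp \<tau> i r j) \<noteq> 1" using row[of y] y by auto
          ultimately show "x (Inp \<tau> i r j) \<noteq> y (Inp \<tau> i r j)" by simp
        qed
      qed auto
    qed (use row in auto)
    then show ?thesis by (simp add: card_R)
  next
    case False
    have "gam VS X Y (real b + 2 ^ b) (real b + 1) (\<lambda>_ _. 1)"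
    proof (rule gam_branch[where \<phi> = "\<lambda>x. pointer x e \<tau> i {}" and M = "\<lambda>_ _ _. 1", OF finX])
      show "gam VS X Y (real b) (real b) (\<lambda>x y. of_bool (pointer x e \<tau> i {} \<noteq> pointer y e \<tau> i {}))"
        by (rule gam_pointer) (use X e \<tau> i empty_R in auto)
      fix r assume "r \<in> (\<lambda>x. pointer x e \<tau> i {}) ` X"
      then have r: "r \<in> R" by (auto simp: pointer_R)
      define col where "col = (\<lambda>y :: 'o var \<Rightarrow> real. SOME j. j \<in> R \<and> y (Inp \<tau> i r j) \<noteq> -1)"
      have col: "col y \<in> R \<and> y (Inp \<tau> i r (col y)) \<noteq> -1" if "y \<in> Y" "pointer y e \<tau> i {} = r" for y
      proof -
        have "\<exists>j. j \<in> R \<and> y (Inp \<tau> i r j) \<noteq> -1" using that cy[OF that(1)] claim[of y] False by (auto simp: certified_def)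
        from someI_ex[OF this] show ?thesis by (simp add: col_def)
      qed
      have xr: "x (Inp \<tau> i r j) = -1" if "x \<in> X" "pointer x e \<tau> i {} = r" "j \<in> R" for x j
        using that cx[OF that(1)] claim[of x] False by (auto simp: certified_def)
      have "gam VS {x \<in> X. pointer x e \<tau> i {} = r} {y \<in> Y. pointer y e \<tau> i {} = r} (real (card R) * 1) 1 (\<lambda>_ _. 1)"
      proof (rule gam_search_right[where sel = col, OF finite_R])
        fix j assume j: "j \<in> R"
        show "gam VS {x \<in> X. pointer x e \<tau> i {} = r} {y \<in> {y \<in> Y. pointer y e \<tau> i {} = r}. col y = j} 1 1 (\<lambda>_ _. 1)"
        proof (rule bit[OF r j])
          fix x y assume x: "x \<in> {x \<in> X. pointer x e \<tau> i {} = r}" and y: "y \<in> {y \<in> {y \<in> Y. pointer y e \<tau> i {} = r}. col y = j}"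
          have "x (Inp \<tau> i r j) = -1" using xr[of x j] x j by auto
          moreover have "y (Inp \<tau> i r j) \<noteq> -1" using col[of y] y by auto
          ultimately show "x (Inp \<tau> i r j) \<noteq> y (Inp \<tau> i r j)" by simp
        qed
      qed (use col in auto)
      then show "gam VS {x \<in> X. pointer x e \<tau> i {} = r} {y \<in> Y. pointer y e \<tau> i {} = r} (2 ^ b) 1 (\<lambda>_ _. 1)"
        by (simp add: card_R)
    qed auto
    then show ?thesis
    proof (rule gam_mono)
      show "real b + 2 ^ b \<le> 2 ^ b * (real b + 1)"
        using mult_right_mono[of 1 "2 ^ b" "real b"] by (simp add: algebra_simps)
    qed auto
  qed
qed

text \<open>Three stages: compare the address, then the flag and all claims of that cell, then
  search for a false certificate. If y agrees with some 1-input in the first two stages, only a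
  false certificate can make it a 0-input. There are few enough claims to read them all, whereas the
  2 ^ b entries behind each claim have to be searched.\<close>

theorem gam_total:
  assumes A: "A > 0" and dec: "gam W (signs W) (signs W) A A (\<lambda>x y. \<Phi> x - \<Phi> y)"
    and c: "c > 0" and W: "W \<noteq> {}"
  defines "n \<equiv> real (card W)"
  defines "Q \<equiv> real c * (2 * (A * (2 * 2 ^ b) / \<gamma>)) + ((1 + real c * n) + sqrt (real c * n * 2 ^ b * (real b + 1) * (real b + 1)))"
  shows "gam VS ones zeros Q Q (\<lambda>_ _. 1)"
proof -
  have n: "n > 0" using W finW by (simp add: n_def card_gt_0_iff)
  have S: "ones \<subseteq> signs VS" "zeros \<subseteq> signs VS" by (auto simp: ones_def zeros_def)
  define E where "E = sqrt (real c * n * 2 ^ b * (real b + 1) * (real b + 1))"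
  have E0: "E \<ge> 0" using n by (simp add: E_def)
  show ?thesis unfolding Q_def
  proof (rule gam_branch[where M = "\<lambda>_ _ _. 1", OF finite_ones _ _ gam_address[OF A dec]])
    fix e assume "e \<in> address ` ones"
    then have e: "e \<subseteq> {..<c}" by (auto simp: address_def)
    define D where "D = insert (Flag e) ((\<lambda>(\<tau>, i). Claim e \<tau> i) ` ({..<c} \<times> W))"
    have D: "D \<subseteq> VS" using e by (auto simp: D_def VS_def)
    have "card D \<le> Suc (card ((\<lambda>(\<tau>, i). Claim e \<tau> i) ` ({..<c} \<times> W)))"
      unfolding D_def by (rule card_insert_le_m1[THEN order_trans]) (use finW in auto)
    also have "card ((\<lambda>(\<tau>, i). Claim e \<tau> i) ` ({..<c} \<times> W)) \<le> card ({..<c} \<times> W)"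
      by (rule card_image_le) (use finW in auto)
    finally have cD: "real (card D) \<le> 1 + real c * n"
      by (simp add: n_def card_cartesian_product flip: of_nat_mult of_nat_Suc)
    let ?X = "{x\<in>ones. address x = e}" and ?Y = "{y\<in>zeros. address y = e}"
    let ?\<phi> = "\<lambda>x. \<lambda>v\<in>D. x v"
    show "gam VS ?X ?Y (1 + real c * n + sqrt (real c * n * 2 ^ b * (real b + 1) * (real b + 1))) (1 + real c * n + sqrt (real c * n * 2 ^ b * (real b + 1) * (real b + 1))) (\<lambda>_ _. 1)"
      unfolding E_def[symmetric]
    proof (rule gam_branch[where \<phi> = ?\<phi> and M = "\<lambda>_ _ _. 1"])
      have "?\<phi> x \<noteq> ?\<phi> y \<longleftrightarrow> (\<exists>v\<in>D. x v \<noteq> y v)" for x y :: "'o var \<Rightarrow> real"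
        by (auto simp: fun_eq_iff restrict_def)
      then show "gam VS ?X ?Y (1 + real c * n) (1 + real c * n) (\<lambda>x y. of_bool (?\<phi> x \<noteq> ?\<phi> y))"
        using finite_ones by (intro gam_mono[OF gam_vars[OF _ finite_VS D, of ?X ?Y]]) (use cD in auto)
      fix s assume "s \<in> ?\<phi> ` ?X"
      then obtain x0 where x0: "x0 \<in> ones" "address x0 = e" "?\<phi> x0 = s" by auto
      let ?X' = "{x\<in>?X. ?\<phi> x = s}" and ?Y' = "{y\<in>?Y. ?\<phi> y = s}"
      have agree: "z v = x0 v" if "z \<in> ?X' \<union> ?Y'" "v \<in> D" for z v
        using that x0(3) by (auto simp: fun_eq_iff restrict_def split: if_splits)
      have vx: "valid x e" if "x \<in> ?X'" for x using that by (auto simp: ones_def total_fun_def split: if_splits)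
      have "valid x0 e" using x0 by (auto simp: ones_def total_fun_def split: if_splits)
      have viol: "\<exists>w. w \<in> {..<c} \<times> W \<and> \<not> certified y e (fst w) (snd w)" if y: "y \<in> ?Y'" for y
      proof -
        have inv: "\<not> valid y e" using y by (auto simp: zeros_def total_fun_def split: if_splits)
        have "y (Flag e) = 1" using agree[of y "Flag e"] y \<open>valid x0 e\<close> by (auto simp: D_def valid_def)
        moreover have "(\<lambda>i\<in>W. y (Claim e \<tau> i)) = (\<lambda>i\<in>W. x0 (Claim e \<tau> i))" if "\<tau> < c" for \<tau>
          by (rule restrict_ext) (use agree[of y "Claim e \<tau> _"] y that in \<open>auto simp: D_def\<close>)
        ultimately show ?thesis using inv \<open>valid x0 e\<close> unfolding valid_def by auto
      qed
      define sel where "sel = (\<lambda>y. SOME w. w \<in> {..<c} \<times> W \<and> \<not> certified y e (fst w) (snd w))"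
      have sel: "sel y \<in> {..<c} \<times> W \<and> \<not> certified y e (fst (sel y)) (snd (sel y))" if "y \<in> ?Y'" for y
        unfolding sel_def by (rule someI_ex) (rule viol[OF that])
      have "gam VS ?X' ?Y' (real (card ({..<c} \<times> W)) * (2 ^ b * (real b + 1))) (real b + 1) (\<lambda>_ _. 1)"
      proof (rule gam_search_right[where sel = sel])
        fix w assume w: "w \<in> {..<c} \<times> W"
        show "gam VS ?X' {y \<in> ?Y'. sel y = w} (2 ^ b * (real b + 1)) (real b + 1) (\<lambda>_ _. 1)"
        proof (rule gam_certificate[where e = e and \<tau> = "fst w" and i = "snd w" and k = "x0 (Claim e (fst w) (snd w))"])
          show "certified x e (fst w) (snd w)" if "x \<in> ?X'" for x
            using vx[OF that] w by (auto simp: valid_def)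
          show "\<not> certified y e (fst w) (snd w)" if "y \<in> {y \<in> ?Y'. sel y = w}" for y
            using sel[of y] that by auto
          show "x (Claim e (fst w) (snd w)) = x0 (Claim e (fst w) (snd w))"
            if "x \<in> ?X' \<union> {y \<in> ?Y'. sel y = w}" for x
            by (rule agree) (use that w in \<open>auto simp: D_def\<close>)
        qed (use S e w in auto)
      qed (use sel finW in auto)
      then have "gam VS ?X' ?Y' (real c * n * 2 ^ b * (real b + 1)) (real b + 1) (\<lambda>_ _. 1)"
        by (simp add: card_cartesian_product n_def mult.assoc)
      from gam_balance[OF this] show "gam VS ?X' ?Y' E E (\<lambda>_ _. 1)"
        using c n by (simp add: E_def)
    qed (use finite_ones E0 in auto)
  qed (use n E0 in \<open>auto simp: E_def\<close>)
qed

end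

section \<open>Quantum algorithms from dual adversary solutions\<close>

definition rip :: "nat \<Rightarrow> (nat \<Rightarrow> real) \<Rightarrow> (nat \<Rightarrow> real) \<Rightarrow> real" where
  "rip D x y = (\<Sum>a<D. x a * y a)"

definition rmv :: "nat \<Rightarrow> (nat \<Rightarrow> nat \<Rightarrow> real) \<Rightarrow> (nat \<Rightarrow> real) \<Rightarrow> nat \<Rightarrow> real" where
  "rmv D W x j = (\<Sum>a<D. W j a * x a)"

definition orth :: "nat \<Rightarrow> (nat \<Rightarrow> nat \<Rightarrow> real) \<Rightarrow> bool" where
  "orth D W \<longleftrightarrow> (\<forall>a<D. \<forall>b<D. (\<Sum>j<D. W j a * W j b) = of_bool (a = b))"

lemma rip_sym: "rip D x y = rip D y x"
  by (simp add: rip_def mult.commute)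

lemma rip_add_left: "rip D (\<lambda>j. x j + y j) z = rip D x z + rip D y z"
  and rip_diff_left: "rip D (\<lambda>j. x j - y j) z = rip D x z - rip D y z"
  and rip_scale_left: "rip D (\<lambda>j. c * x j) z = c * rip D x z"
  by (simp_all add: rip_def sum.distrib sum_subtractf sum_distrib_left algebra_simps)

lemma rip_diff_right: "rip D z (\<lambda>j. x j - y j) = rip D z x - rip D z y"
  using rip_diff_left[of D x y z] by (simp add: rip_sym)

lemma rip_add_right: "rip D z (\<lambda>j. x j + y j) = rip D z x + rip D z y"
  using rip_add_left[of D x y z] by (simp add: rip_sym)

lemma rip_scale_right: "rip D z (\<lambda>j. c * x j) = c * rip D z x"
  using rip_scale_left[of D c x z] by (simp add: rip_sym)

lemma rip_cong: "(\<And>j. j < D \<Longrightarrow> x j = x' j) \<Longrightarrow> (\<And>j. j < D \<Longrightarrow> y j = y' j) \<Longrightarrow> rip D x y = rip D x' y'"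
  by (simp add: rip_def)

lemma rmv_add: "rmv D W (\<lambda>j. x j + y j) i = rmv D W x i + rmv D W y i"
  and rmv_scale: "rmv D W (\<lambda>j. c * x j) i = c * rmv D W x i"
  by (simp_all add: rmv_def sum.distrib sum_distrib_left algebra_simps)

lemma rmv_diff: "rmv D W (\<lambda>j. x j - y j) i = rmv D W x i - rmv D W y i"
  by (simp add: rmv_def sum_subtractf algebra_simps)

lemma rmv_sum: "rmv D W (\<lambda>j. \<Sum>t\<in>T. x t j) i = (\<Sum>t\<in>T. rmv D W (x t) i)"
  unfolding rmv_def by (subst sum.swap) (simp add: sum_distrib_left)

lemma orth_rip:
  assumes "orth D W"
  shows "rip D (rmv D W x) (rmv D W y) = rip D x y"
proof -
  have "rip D (rmv D W x) (rmv D W y) = (\<Sum>j<D. \<Sum>a<D. \<Sum>b<D. (W j a * W j b) * (x a * y b))"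
    by (simp add: rip_def rmv_def sum_product ac_simps)
  also have "\<dots> = (\<Sum>a<D. \<Sum>b<D. \<Sum>j<D. (W j a * W j b) * (x a * y b))"
    by (subst sum.swap) (rule sum.cong[OF refl], rule sum.swap)
  also have "\<dots> = (\<Sum>a<D. \<Sum>b<D. of_bool (a = b) * (x a * y b))"
    using assms by (simp add: orth_def sum_distrib_right[symmetric])
  also have "\<dots> = (\<Sum>a<D. x a * y a)"
    by (intro sum.cong refl, subst sum.mono_neutral_right[of _ "{_}"]) auto
  finally show ?thesis by (simp add: rip_def)
qed

text \<open>Householder reflections move the given vectors to their images one at a time; a reflection
  along \<open>U p - q\<close> fixes the images that have already been reached.\<close>

lemma orth_extension:
  assumes "finite I"
    and "\<And>k l. k \<in> I \<Longrightarrow> l \<in> I \<Longrightarrow> rip D (p k) (p l) = rip D (q k) (q l)"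
  shows "\<exists>W. orth D W \<and> (\<forall>k\<in>I. \<forall>j<D. rmv D W (p k) j = q k j)"
  using assms
proof (induction I rule: finite_induct)
  case empty
  have "orth D (\<lambda>j a. of_bool (j = a))"
    unfolding orth_def
  proof (intro allI impI)
    fix a b assume "a < D" "b < D"
    have "(\<Sum>j<D. of_bool (j = a) * of_bool (j = b) :: real) = (\<Sum>j\<in>{a}. of_bool (j = a) * of_bool (j = b))"
      using \<open>a < D\<close> by (intro sum.mono_neutral_right) auto
    then show "(\<Sum>j<D. of_bool (j = a) * of_bool (j = b) :: real) = of_bool (a = b)" by simp
  qed
  then show ?case by blast
next
  case (insert k I)
  then obtain U where U: "orth D U" "\<forall>l\<in>I. \<forall>j<D. rmv D U (p l) j = q l j" by auto
  define p' where "p' = rmv D U (p k)"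
  define v where "v = (\<lambda>j. p' j - q k j)"
  define s where "s = rip D v v"
  have pp: "rip D p' p' = rip D (q k) (q k)" using orth_rip[OF U(1)] insert.prems by (simp add: p'_def)
  have vq: "rip D v (q l) = 0" if "l \<in> I" for l
  proof -
    have "rip D p' (q l) = rip D p' (rmv D U (p l))" using U(2) that by (intro rip_cong) auto
    also have "\<dots> = rip D (q k) (q l)" using orth_rip[OF U(1)] insert.prems that by (simp add: p'_def)
    finally show ?thesis by (simp add: v_def rip_diff_left)
  qed
  \<comment> \<open>As p' and q k have the same norm, the reflection along their difference v
    exchanges them.\<close>
  have s2: "s = 2 * rip D v p'"
    unfolding s_def v_def by (simp add: rip_diff_left rip_diff_right pp rip_sym[of D p' "q k"])
  show ?case
  proof (cases "s = 0")
    case True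
    then have "\<forall>j<D. v j = 0" unfolding s_def rip_def by (subst (asm) sum_nonneg_eq_0_iff) auto
    then show ?thesis using U by (intro exI[of _ U]) (auto simp: v_def p'_def)
  next
    case False
    \<comment> \<open>The transpose of U applied to v, so that W is U followed by the reflection
      along v.\<close>
    define y where "y = (\<lambda>a. \<Sum>i<D. v i * U i a)"
    define W where "W = (\<lambda>j a. U j a - 2 / s * v j * y a)"
    have W: "rmv D W x j = rmv D U x j - 2 / s * rip D v (rmv D U x) * v j" for x j
    proof -
      have "rip D v (rmv D U x) = (\<Sum>i<D. \<Sum>a<D. v i * U i a * x a)"
        by (simp add: rip_def rmv_def sum_distrib_left mult.assoc)
      also have "\<dots> = (\<Sum>a<D. y a * x a)"
        by (subst sum.swap) (simp add: y_def sum_distrib_right)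
      finally have "2 / s * rip D v (rmv D U x) * v j = (\<Sum>a<D. 2 / s * v j * y a * x a)"
        by (simp add: sum_distrib_left mult.assoc mult.left_commute mult.commute)
      then show ?thesis unfolding rmv_def W_def by (simp add: left_diff_distrib sum_subtractf)
    qed
    have "orth D W" unfolding orth_def
    proof (intro allI impI)
      fix a b assume ab: "a < D" "b < D"
      have "(\<Sum>j<D. W j a * W j b) = (\<Sum>j<D. U j a * U j b - 2 / s * y b * (v j * U j a) - 2 / s * y a * (v j * U j b) + (2 / s)\<^sup>2 * (y a * y b) * (v j * v j))"
        by (intro sum.cong refl) (simp add: W_def power2_eq_square algebra_simps)
      also have "\<dots> = (\<Sum>j<D. U j a * U j b) - 2 / s * y b * (\<Sum>j<D. v j * U j a) - 2 / s * y a * (\<Sum>j<D. v j * U j b) + (2 / s)\<^sup>2 * (y a * y b) * (\<Sum>j<D. v j * v j)"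
        by (simp only: sum.distrib sum_subtractf sum_distrib_left)
      also have "\<dots> = (\<Sum>j<D. U j a * U j b) - 2 / s * y b * y a - 2 / s * y a * y b + (2 / s)\<^sup>2 * (y a * y b) * s"
        by (simp only: y_def s_def rip_def)
      also have "\<dots> = (\<Sum>j<D. U j a * U j b)" using False by (simp add: power2_eq_square field_simps)
      finally show "(\<Sum>j<D. W j a * W j b) = of_bool (a = b)" using U(1) ab by (simp add: orth_def)
    qed
    moreover have "rmv D W (p l) j = q l j" if "l \<in> I" "j < D" for l j
    proof -
      have "rip D v (rmv D U (p l)) = rip D v (q l)" using U(2) that by (intro rip_cong) auto
      then show ?thesis using vq[OF that(1)] U(2) that by (simp add: W)
    qed
    moreover have "rmv D W (p k) j = q k j" if "j < D" for j
    proof -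
      have "2 / s * rip D v p' = 1" using s2 False by (simp add: field_simps)
      then have "rmv D W (p k) j = p' j - 1 * v j" unfolding W p'_def[symmetric] by simp
      then show ?thesis by (simp add: v_def)
    qed
    ultimately show ?thesis by (intro exI[of _ W]) auto
  qed
qed

section \<open>Real orthogonal matrices as steps of a query algorithm\<close>

definition cmat :: "nat \<Rightarrow> (nat \<Rightarrow> nat \<Rightarrow> real) \<Rightarrow> complex mat" where
  "cmat D W = mat D D (\<lambda>(j, k). complex_of_real (W j k))"

definition cvec :: "nat \<Rightarrow> (nat \<Rightarrow> real) \<Rightarrow> complex vec" where
  "cvec D x = vec D (\<lambda>j. complex_of_real (x j))"

lemma cmat_unitary: "orth D W \<Longrightarrow> unitary_mat D (cmat D W)"
  unfolding unitary_mat_def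
proof
  assume W: "orth D W"
  show "cmat D W \<in> carrier_mat D D" by (simp add: cmat_def)
  show "mat_adjoint (cmat D W) * cmat D W = 1\<^sub>m D"
  proof (rule eq_matI)
    fix a b assume ab: "a < dim_row (1\<^sub>m D :: complex mat)" "b < dim_col (1\<^sub>m D :: complex mat)"
    then have ab: "a < D" "b < D" by auto
    have "(mat_adjoint (cmat D W) * cmat D W) $$ (a, b) = (\<Sum>j<D. complex_of_real (W j a * W j b))"
      using ab by (simp add: mat_adjoint_def cmat_def mat_of_rows_def scalar_prod_def lessThan_atLeast0)
    also have "\<dots> = complex_of_real (\<Sum>j<D. W j a * W j b)" by simp
    also have "\<dots> = 1\<^sub>m D $$ (a, b)" using W ab by (auto simp: orth_def)
    finally show "(mat_adjoint (cmat D W) * cmat D W) $$ (a, b) = 1\<^sub>m D $$ (a, b)" .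
  qed (auto simp: cmat_def mat_adjoint_def)
qed

lemma cmat_mult: "cmat D W *\<^sub>v cvec D x = cvec D (rmv D W x)"
  by (rule eq_vecI) (auto simp: cmat_def cvec_def rmv_def scalar_prod_def lessThan_atLeast0)

definition phase :: "nat \<Rightarrow> nat \<Rightarrow> (nat \<Rightarrow> int) \<Rightarrow> nat \<Rightarrow> real" where
  "phase n m x j = (if j div m < n then real_of_int (x (j div m)) else 1)"

lemma query_oracle_cvec:
  assumes "D = (n + 1) * m"
  shows "query_oracle n m x *\<^sub>v cvec D y = cvec D (\<lambda>j. phase n m x j * y j)"
proof (rule eq_vecI)
  fix j assume "j < dim_vec (cvec D (\<lambda>j. phase n m x j * y j))"
  then have j: "j < D" by (simp add: cvec_def)
  have "(query_oracle n m x *\<^sub>v cvec D y) $ j = (\<Sum>k<D. query_oracle n m x $$ (j, k) * cvec D y $ k)"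
    using j assms by (simp add: scalar_prod_def lessThan_atLeast0 query_oracle_def cvec_def)
  also have "\<dots> = (\<Sum>k<D. (if j = k then complex_of_real (phase n m x j) else 0) * complex_of_real (y k))"
    using j assms by (intro sum.cong refl) (auto simp: query_oracle_def cvec_def phase_def)
  also have "\<dots> = (\<Sum>k\<in>{j}. (if j = k then complex_of_real (phase n m x j) else 0) * complex_of_real (y k))"
    using j by (intro sum.mono_neutral_right) auto
  finally show "(query_oracle n m x *\<^sub>v cvec D y) $ j = cvec D (\<lambda>j. phase n m x j * y j) $ j"
    using j by (simp add: cvec_def)
qed (use assms in \<open>auto simp: query_oracle_def cvec_def\<close>)

primrec rstate :: "nat \<Rightarrow> nat \<Rightarrow> (nat \<Rightarrow> nat \<Rightarrow> nat \<Rightarrow> real) \<Rightarrow> (nat \<Rightarrow> int) \<Rightarrow> nat \<Rightarrow> nat \<Rightarrow> real" where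
  "rstate n m W x 0 = rmv ((n + 1) * m) (W 0) (\<lambda>j. of_bool (j = 0))"
| "rstate n m W x (Suc t) = rmv ((n + 1) * m) (W (Suc t)) (\<lambda>j. phase n m x j * rstate n m W x t j)"

lemma query_state_cvec:
  assumes "m \<ge> 1"
  shows "query_state n m (\<lambda>t. cmat ((n + 1) * m) (W t)) x t = cvec ((n + 1) * m) (rstate n m W x t)"
proof (induction t)
  case 0
  have "unit_vec ((n + 1) * m) 0 = cvec ((n + 1) * m) (\<lambda>j. of_bool (j = 0))"
    by (rule eq_vecI) (auto simp: cvec_def unit_vec_def)
  then show ?case by (simp add: cmat_mult del: mult_Suc)
next
  case (Suc t)
  show ?case unfolding query_state.simps Suc query_oracle_cvec[OF refl] cmat_mult rstate.simps by (rule refl)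
qed

definition sgn_of :: "nat \<Rightarrow> (nat \<Rightarrow> int) \<Rightarrow> nat \<Rightarrow> real" where
  "sgn_of n x = (\<lambda>i\<in>{..<n}. real_of_int (x i))"

lemma cube_cases: "x \<in> cube n \<Longrightarrow> i < n \<Longrightarrow> x i = 1 \<or> x i = -1"
  by (auto simp: cube_def PiE_def Pi_def)

lemma finite_cube: "finite (cube n)"
  unfolding cube_def by (intro finite_PiE) auto

text \<open>Basis states: \<open>(i, w)\<close> with \<open>i < n\<close> carries the catalyst, \<open>(n, 2 t + \<beta>)\<close> is the answer \<open>\<beta>\<close> in
  the time slot \<open>t\<close>.\<close>

theorem quantum_of_gam:
  fixes f :: "(nat \<Rightarrow> int) \<Rightarrow> nat"
  assumes f: "f \<in> cube n \<rightarrow> {0, 1}"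
    and g: "gam {..<n} (sgn_of n ` {x\<in>cube n. f x = 1}) (sgn_of n ` {x\<in>cube n. f x = 0}) A A (\<lambda>_ _. 1)"
    and K: "real K \<ge> 6 * A" "K > 0"
  shows "quantum_computes (1/3) n f K"
proof -
  obtain d :: nat and u v where
    uvs: "\<forall>x\<in>sgn_of n ` {x\<in>cube n. f x = 1}. (\<Sum>i<n. \<Sum>a<d. (u x i a)\<^sup>2) \<le> A"
      "\<forall>y\<in>sgn_of n ` {x\<in>cube n. f x = 0}. (\<Sum>i<n. \<Sum>a<d. (v y i a)\<^sup>2) \<le> A"
      "\<forall>x\<in>sgn_of n ` {x\<in>cube n. f x = 1}. \<forall>y\<in>sgn_of n ` {x\<in>cube n. f x = 0}. 1 = (\<Sum>i<n. \<Sum>a<d. dif x y i * (u x i a * v y i a))"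
    using g unfolding gam_def by (elim exE conjE) rule
  have u: "(\<Sum>i<n. \<Sum>a<d. (u (sgn_of n x) i a)\<^sup>2) \<le> A" if "x \<in> cube n" "f x = 1" for x
    using uvs(1) that by blast
  have v: "(\<Sum>i<n. \<Sum>a<d. (v (sgn_of n x) i a)\<^sup>2) \<le> A" if "x \<in> cube n" "f x = 0" for x
    using uvs(2) that by blast
  have uv: "(\<Sum>i<n. \<Sum>a<d. dif (sgn_of n x) (sgn_of n y) i * (u (sgn_of n x) i a * v (sgn_of n y) i a)) = 1"
    if "x \<in> cube n" "f x = 1" "y \<in> cube n" "f y = 0" for x y
    using bspec[OF bspec[OF uvs(3)], of "sgn_of n x" "sgn_of n y"] that by simp
  define m where "m = 2 * (K + d + 1)"
  define D where "D = (n + 1) * m"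
  have m: "m \<ge> 1" by (simp add: m_def)
  \<comment> \<open>The phase turns 1 into -1 and so changes an inner product by twice its size; the
    factor 1 / sqrt 2 on both vectors compensates for this.\<close>
  define w where "w = (\<lambda>x i a. (if f x = 1 then u (sgn_of n x) i a else v (sgn_of n x) i a) / sqrt 2)"
  \<comment> \<open>The side depends on x i and on f x. Inputs with different values meet on the
    same side exactly where their bits differ, and inputs with equal values exactly where their bits
    agree, where the query leaves the inner product alone.\<close>
  define side where "side = (\<lambda>x i. if x i = (if f x = 1 then 1 else -1 :: int) then 1 else 0 :: nat)"
  define \<phi> where "\<phi> = (\<lambda>x j. if j div m < n \<and> (j mod m) div 2 < d \<and> (j mod m) mod 2 = side x (j div m)
     then w x (j div m) ((j mod m) div 2) else 0)"
  define e where "e = (\<lambda>(t, \<beta>) j. of_bool (j = n * m + (2 * t + \<beta>)) :: real)"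
  have f01: "f x = 0 \<or> f x = 1" if "x \<in> cube n" for x using f that by auto
  have split: "(\<Sum>j<D. F j) = (\<Sum>i<n+1. \<Sum>l<m. F (i * m + l))" for F :: "nat \<Rightarrow> real"
    unfolding D_def sum.nat_group[symmetric]
    by (rule sum.cong[OF refl], subst sum.atLeastLessThan_shift_0) (simp add: lessThan_atLeast0)
  have idx: "(i * m + l) div m = i" "(i * m + l) mod m = l" if "l < m" for i l using that m by auto
  have blk: "(\<Sum>l<m. of_bool (l div 2 < d) * (F (l div 2) (l mod 2))) = (\<Sum>a<d. F a 0 + F a 1)" for F :: "nat \<Rightarrow> nat \<Rightarrow> real"
  proof -
    have "(\<Sum>l<m. of_bool (l div 2 < d) * F (l div 2) (l mod 2)) = (\<Sum>l<2 * d. of_bool (l div 2 < d) * F (l div 2) (l mod 2))"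
      by (rule sum.mono_neutral_right) (auto simp: m_def)
    also have "\<dots> = (\<Sum>a<d. F a 0 + F a 1)"
    proof -
      have m2: "Suc (d' * 2) mod 2 = Suc 0" for d' by presburger
      have "(\<Sum>l<2 * d. F (l div 2) (l mod 2)) = (\<Sum>a<d. F a 0 + F a 1)"
        by (induction d) (auto simp: algebra_simps m2)
      moreover have "(\<Sum>l<2 * d. of_bool (l div 2 < d) * F (l div 2) (l mod 2)) = (\<Sum>l<2 * d. F (l div 2) (l mod 2))"
        by (intro sum.cong refl) auto
      ultimately show ?thesis by simp
    qed
    finally show ?thesis .
  qed
  have ip_gen: "(\<Sum>j<D. c (j div m) * (\<phi> x j * \<phi> y j)) = (\<Sum>i<n. c i * of_bool (side x i = side y i) * (\<Sum>a<d. w x i a * w y i a))" for c :: "nat \<Rightarrow> real" and x y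
  proof -
    have "(\<Sum>j<D. c (j div m) * (\<phi> x j * \<phi> y j)) = (\<Sum>i<n+1. \<Sum>l<m. c i * (\<phi> x (i * m + l) * \<phi> y (i * m + l)))"
      unfolding split by (intro sum.cong refl) (simp add: idx)
    also have "\<dots> = (\<Sum>i<n. \<Sum>l<m. c i * (\<phi> x (i * m + l) * \<phi> y (i * m + l)))"
    proof -
      have "\<phi> x (n * m + l) = 0" if "l < m" for l using that by (simp add: \<phi>_def idx)
      then have "(\<Sum>l<m. c n * (\<phi> x (n * m + l) * \<phi> y (n * m + l))) = 0" by (intro sum.neutral) auto
      then show ?thesis by simp
    qed
    also have "\<dots> = (\<Sum>i<n. c i * of_bool (side x i = side y i) * (\<Sum>a<d. w x i a * w y i a))"
    proof (rule sum.cong[OF refl])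
      fix i assume "i \<in> {..<n}"
      then have i: "i < n" by simp
      have "(\<Sum>l<m. c i * (\<phi> x (i * m + l) * \<phi> y (i * m + l))) =
         (\<Sum>l<m. of_bool (l div 2 < d) * (of_bool (l mod 2 = side x i \<and> l mod 2 = side y i) * (c i * (w x i (l div 2) * w y i (l div 2)))))"
        using i by (intro sum.cong refl) (auto simp: \<phi>_def idx)
      also have "\<dots> = (\<Sum>a<d. of_bool (0 = side x i \<and> 0 = side y i) * (c i * (w x i a * w y i a)) + of_bool (1 = side x i \<and> 1 = side y i) * (c i * (w x i a * w y i a)))"
        by (rule blk)
      also have "\<dots> = c i * of_bool (side x i = side y i) * (\<Sum>a<d. w x i a * w y i a)"
        unfolding sum_distrib_left by (intro sum.cong refl) (auto simp: side_def)
      finally show "(\<Sum>l<m. c i * (\<phi> x (i * m + l) * \<phi> y (i * m + l))) = c i * of_bool (side x i = side y i) * (\<Sum>a<d. w x i a * w y i a)" .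
    qed
    finally show ?thesis .
  qed
  \<comment> \<open>The query lowers the inner product of two catalysts by 1 exactly if f x and f y
    differ. The slot states lose the same amount when both move from answer 0 to their true answers,
    so the map of one step preserves all inner products.\<close>
  have gram: "rip D (\<phi> x) (\<phi> y) - rip D (\<lambda>j. phase n m x j * \<phi> x j) (\<lambda>j. phase n m y j * \<phi> y j) = of_bool (f x \<noteq> f y)"
    if x: "x \<in> cube n" and y: "y \<in> cube n" for x y
  proof -
    define h where "h = (\<lambda>i. real_of_int (if i < n then x i else 1) * real_of_int (if i < n then y i else 1))"
    have "rip D (\<phi> x) (\<phi> y) - rip D (\<lambda>j. phase n m x j * \<phi> x j) (\<lambda>j. phase n m y j * \<phi> y j) = (\<Sum>j<D. (1 - h (j div m)) * (\<phi> x j * \<phi> y j))"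
      unfolding rip_def sum_subtractf[symmetric] by (intro sum.cong refl) (simp add: phase_def h_def algebra_simps)
    also have "\<dots> = (\<Sum>i<n. (1 - h i) * of_bool (side x i = side y i) * (\<Sum>a<d. w x i a * w y i a))"
      by (rule ip_gen)
    also have "\<dots> = of_bool (f x \<noteq> f y)"
    proof (cases "f x = f y")
      case True
      have "(1 - h i) * of_bool (side x i = side y i) = 0" if "i < n" for i
        using cube_cases[OF x that] cube_cases[OF y that] that True by (auto simp: h_def side_def)
      then have "(\<Sum>i<n. (1 - h i) * of_bool (side x i = side y i) * (\<Sum>a<d. w x i a * w y i a)) = 0"
        by (intro sum.neutral ballI) (metis lessThan_iff mult_zero_left)
      then show ?thesis using True by simp
    next
      case False
      have eq: "(\<Sum>i<n. (1 - h i) * of_bool (side x i = side y i) * (\<Sum>a<d. w x i a * w y i a)) =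
         (\<Sum>i<n. \<Sum>a<d. dif (sgn_of n x) (sgn_of n y) i * (2 * (w x i a * w y i a)))"
      proof (rule sum.cong[OF refl])
        fix i assume "i \<in> {..<n}"
        then have "(1 - h i) * of_bool (side x i = side y i) = dif (sgn_of n x) (sgn_of n y) i * 2"
          using cube_cases[OF x, of i] cube_cases[OF y, of i] f01[OF x] f01[OF y] False
          by (auto simp: h_def side_def dif_def sgn_of_def)
        then show "(1 - h i) * of_bool (side x i = side y i) * (\<Sum>a<d. w x i a * w y i a) = (\<Sum>a<d. dif (sgn_of n x) (sgn_of n y) i * (2 * (w x i a * w y i a)))"
          by (simp add: sum_distrib_left mult.assoc)
      qed
      have dsym: "dif (sgn_of n x) (sgn_of n y) i = dif (sgn_of n y) (sgn_of n x) i" for i by (simp add: dif_def eq_commute)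
      from False f01[OF x] f01[OF y] consider "f x = 1" "f y = 0" | "f x = 0" "f y = 1" by auto
      then show ?thesis
      proof cases
        case 1
        then show ?thesis unfolding eq using uv[OF x _ y] by (simp add: w_def)
      next
        case 2
        then show ?thesis unfolding eq dsym using uv[OF y _ x] by (simp add: w_def mult.commute)
      qed
    qed
    finally show ?thesis .
  qed
  have norm_\<phi>: "rip D (\<phi> x) (\<phi> x) \<le> A / 2" if x: "x \<in> cube n" for x
  proof -
    have "rip D (\<phi> x) (\<phi> x) = (\<Sum>i<n. \<Sum>a<d. (w x i a)\<^sup>2)"
      using ip_gen[of "\<lambda>_. 1" x x] by (simp add: rip_def power2_eq_square)
    also have "\<dots> = (\<Sum>i<n. \<Sum>a<d. (if f x = 1 then u (sgn_of n x) i a else v (sgn_of n x) i a)\<^sup>2) / 2"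
      by (simp add: w_def power_divide sum_divide_distrib)
    also have "\<dots> \<le> A / 2" using u[OF x] v[OF x] f01[OF x] by auto
    finally show ?thesis .
  qed
  have e_idx: "n * m + (2 * t + \<beta>) < D" "(n * m + (2 * t + \<beta>)) div m = n" if "t < K" "\<beta> < 2" for t \<beta>
  proof -
    have l: "2 * t + \<beta> < m" using that by (simp add: m_def)
    then show "n * m + (2 * t + \<beta>) < D" by (simp add: D_def)
    show "(n * m + (2 * t + \<beta>)) div m = n" by (rule idx(1)[OF l])
  qed
  have e_e: "rip D (e (t, \<beta>)) (e (t', \<beta>')) = of_bool (t = t' \<and> \<beta> = \<beta>')" if "t < K" "\<beta> < 2" "t' < K" "\<beta>' < 2" for t \<beta> t' \<beta>'
  proof -
    have "rip D (e (t, \<beta>)) (e (t', \<beta>')) = (\<Sum>j\<in>{n * m + (2 * t + \<beta>)}. e (t, \<beta>) j * e (t', \<beta>') j)"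
      unfolding rip_def by (rule sum.mono_neutral_right) (use e_idx(1)[OF that(1,2)] in \<open>auto simp: e_def\<close>)
    moreover have "2 * t + \<beta> = 2 * t' + \<beta>' \<longleftrightarrow> t = t' \<and> \<beta> = \<beta>'" using that by presburger
    ultimately show ?thesis by (simp add: e_def)
  qed
  have e_\<phi>: "rip D (e (t, \<beta>)) (\<phi> x) = 0" "rip D (e (t, \<beta>)) (\<lambda>j. phase n m x j * \<phi> x j) = 0" if "t < K" "\<beta> < 2" for t \<beta> x
    unfolding rip_def using e_idx(2)[OF that] by (auto intro!: sum.neutral simp: e_def \<phi>_def)
  have fb: "f x < 2" if "x \<in> cube n" for x using f01[OF that] by auto
  \<comment> \<open>Step t writes the answer into slot t, turns the queried catalyst back into the
    catalyst, and fixes all other slots.\<close>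
  define good where "good = (\<lambda>t W. orth D W \<and> (\<forall>x\<in>cube n. \<forall>j<D. rmv D W (\<lambda>j. e (t, 0) j + phase n m x j * \<phi> x j) j = e (t, f x) j + \<phi> x j) \<and>
     (\<forall>t'<K. \<forall>\<beta><2. t' \<noteq> t \<longrightarrow> (\<forall>j<D. rmv D W (e (t', \<beta>)) j = e (t', \<beta>) j)))"
  have ex_good: "\<exists>W. good t W" if t: "t < K" for t
  proof -
    define I where "I = Inl ` cube n \<union> Inr ` (({..<K} - {t}) \<times> {..<2::nat})"
    define p where "p = (\<lambda>k. case k of Inl x \<Rightarrow> (\<lambda>j. e (t, 0) j + phase n m x j * \<phi> x j) | Inr w \<Rightarrow> e w)"
    define q where "q = (\<lambda>k. case k of Inl x \<Rightarrow> (\<lambda>j. e (t, f x) j + \<phi> x j) | Inr w \<Rightarrow> e w)"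
    have "\<exists>W. orth D W \<and> (\<forall>k\<in>I. \<forall>j<D. rmv D W (p k) j = q k j)"
    proof (rule orth_extension)
      show "finite I" using finite_cube by (simp add: I_def)
      fix k l assume kl: "k \<in> I" "l \<in> I"
      show "rip D (p k) (p l) = rip D (q k) (q l)"
      proof (cases k; cases l)
        fix x y assume k: "k = Inl x" and l: "l = Inl y"
        then have xy: "x \<in> cube n" "y \<in> cube n" using kl by (auto simp: I_def)
        show ?thesis using gram[OF xy] e_e[OF t _ t] e_\<phi>[OF t] fb[OF xy(1)] fb[OF xy(2)]
          unfolding p_def q_def k l
          by (cases "f x = f y") (simp_all add: rip_add_left rip_add_right rip_sym[of D "\<phi> _" "e _"] rip_sym[of D "\<lambda>j. phase n m _ j * \<phi> _ j" "e _"])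
      next
        fix x w assume k: "k = Inl x" and l: "l = Inr w"
        then have xw: "x \<in> cube n" "fst w < K" "fst w \<noteq> t" "snd w < 2" using kl by (auto simp: I_def)
        then show ?thesis using e_e[OF t _ xw(2,4)] e_\<phi>[OF xw(2,4)] fb[OF xw(1)] unfolding p_def q_def k l
          by (simp add: rip_add_left rip_add_right rip_sym[of D "\<phi> _" "e _"] rip_sym[of D "\<lambda>j. phase n m _ j * \<phi> _ j" "e _"])
      next
        fix x w assume l: "l = Inl x" and k: "k = Inr w"
        then have xw: "x \<in> cube n" "fst w < K" "fst w \<noteq> t" "snd w < 2" using kl by (auto simp: I_def)
        then show ?thesis using e_e[OF xw(2,4) t] e_\<phi>[OF xw(2,4)] fb[OF xw(1)] unfolding p_def q_def k l
          by (simp add: rip_add_left rip_add_right)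
      qed (simp add: p_def q_def)
    qed
    then obtain W where W: "orth D W" "\<And>k j. k \<in> I \<Longrightarrow> j < D \<Longrightarrow> rmv D W (p k) j = q k j" by blast
    have "rmv D W (\<lambda>j. e (t, 0) j + phase n m x j * \<phi> x j) j = e (t, f x) j + \<phi> x j" if "x \<in> cube n" "j < D" for x j
      using W(2)[of "Inl x" j] that by (simp add: I_def p_def q_def)
    moreover have "rmv D W (e (t', \<beta>)) j = e (t', \<beta>) j" if "t' < K" "\<beta> < 2" "t' \<noteq> t" "j < D" for t' \<beta> j
      using W(2)[of "Inr (t', \<beta>)" j] that by (simp add: I_def p_def q_def image_iff)
    ultimately have "good t W" using W(1) by (simp add: good_def)
    then show ?thesis by (rule exI[of "good t" W])
  qed
  define W where "W = (\<lambda>t. SOME W. good t W)"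
  have good: "good t (W t)" if "t < K" for t
    unfolding W_def by (rule someI_ex[OF ex_good[OF that]])
  have W: "orth D (W t)" if "t < K" for t using good[OF that] by (simp add: good_def)
  have Wx: "rmv D (W t) (\<lambda>j. e (t, 0) j + phase n m x j * \<phi> x j) j = e (t, f x) j + \<phi> x j" if "t < K" "x \<in> cube n" "j < D" for t x j
    using good[OF that(1)] that(2,3) by (simp add: good_def)
  have We: "rmv D (W t) (e (t', \<beta>)) j = e (t', \<beta>) j" if "t < K" "t' < K" "\<beta> < 2" "t' \<noteq> t" "j < D" for t t' \<beta> j
    using good[OF that(1)] that(2-) by (simp add: good_def)
  define r where "r = 1 / sqrt (real K)"
  have r: "r * r * real K = 1" using K(2) by (simp add: r_def)
  define start where "start = (\<lambda>j. r * (\<Sum>t<K. e (t, 0) j))"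
  have Dpos: "D > 0" using m by (simp add: D_def)
  have start_norm: "rip D start start = 1"
  proof -
    have "rip D start start = r * (r * (\<Sum>t<K. \<Sum>t'<K. rip D (e (t, 0)) (e (t', 0))))"
    proof -
      have "rip D (\<lambda>j. \<Sum>t<K. e (t, 0) j) (\<lambda>j. \<Sum>t<K. e (t, 0) j) = (\<Sum>t<K. \<Sum>t'<K. rip D (e (t, 0)) (e (t', 0)))"
        unfolding rip_def sum_product by (subst sum.swap) (rule sum.cong[OF refl], rule sum.swap)
      then show ?thesis unfolding start_def by (simp add: rip_scale_left rip_scale_right)
    qed
    also have "(\<Sum>t<K. \<Sum>t'<K. rip D (e (t, 0)) (e (t', 0))) = (\<Sum>t<K. \<Sum>t'<K. of_bool (t = t'))"
      by (intro sum.cong refl) (simp add: e_e)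
    also have "\<dots> = real K" by (simp add: of_bool_def)
    finally show ?thesis using r by simp
  qed
  have "\<exists>W0. orth D W0 \<and> (\<forall>k\<in>{()}. \<forall>j<D. rmv D W0 (\<lambda>j. of_bool (j = 0)) j = start j)"
  proof (rule orth_extension)
    have "rip D (\<lambda>j. of_bool (j = 0)) (\<lambda>j. of_bool (j = 0)) = (\<Sum>j\<in>{0}. of_bool (j = 0) * of_bool (j = (0::nat)))"
      unfolding rip_def by (rule sum.mono_neutral_right) (use Dpos in auto)
    then show "rip D (\<lambda>j. of_bool (j = 0)) (\<lambda>j. of_bool (j = 0)) = rip D start start" using start_norm by simp
  qed simp
  then obtain W0 where W0: "orth D W0" "\<And>j. j < D \<Longrightarrow> rmv D W0 (\<lambda>j. of_bool (j = 0)) j = start j" by auto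
  define V where "V = (\<lambda>t. case t of 0 \<Rightarrow> W0 | Suc t \<Rightarrow> W t)"
  define \<psi> where "\<psi> = rstate n m V"
  have \<psi>_0: "\<psi> x 0 = rmv D W0 (\<lambda>j. of_bool (j = 0))" for x
    unfolding \<psi>_def D_def by (simp only: rstate.simps V_def nat.case)
  have \<psi>_Suc: "\<psi> x (Suc k) = rmv D (W k) (\<lambda>j. phase n m x j * \<psi> x k j)" for x k
    unfolding \<psi>_def D_def by (simp only: rstate.simps V_def nat.case)
  \<comment> \<open>The unnormalized run that has the catalyst from the beginning. The actual run
    starts without it; all steps are orthogonal, so the two stay at distance r times the norm of the
    catalyst, and r is small because the amplitude is spread over K slots.\<close>
  define ideal where "ideal = (\<lambda>k x j. r * ((\<Sum>t<K. e (t, if t < k then f x else 0) j) + \<phi> x j))"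
  have phase_e: "phase n m x j * e (t, \<beta>) j = e (t, \<beta>) j" if "t < K" "\<beta> < 2" for x j t \<beta>
    using e_idx(2)[OF that] by (auto simp: e_def phase_def)
  have phase_sq: "phase n m x j * phase n m x j = 1" if "x \<in> cube n" for x j
    using cube_cases[OF that, of "j div m"] by (auto simp: phase_def)
  have ideal_step: "rmv D (W k) (\<lambda>j. phase n m x j * ideal k x j) j = ideal (Suc k) x j" if x: "x \<in> cube n" and k: "k < K" and j: "j < D" for x k j
  proof -
    define E where "E = (\<lambda>k t. e (t, if t < k then f x else 0))"
    have E: "phase n m x j * E k t j = E k t j" if "t < K" for t j using phase_e that fb[OF x] by (simp add: E_def)
    have "phase n m x j * ideal k x j = r * ((\<Sum>t\<in>{..<K} - {k}. E k t j) + (e (k, 0) j + phase n m x j * \<phi> x j))" for j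
    proof -
      have "phase n m x j * ideal k x j = r * ((\<Sum>t<K. phase n m x j * E k t j) + phase n m x j * \<phi> x j)"
        by (simp add: ideal_def E_def sum_distrib_left algebra_simps)
      also have "(\<Sum>t<K. phase n m x j * E k t j) = (\<Sum>t<K. E k t j)" by (intro sum.cong refl E) simp
      also have "\<dots> = E k k j + (\<Sum>t\<in>{..<K} - {k}. E k t j)" using k by (subst sum.remove[of _ k]) auto
      finally show ?thesis by (simp add: E_def)
    qed
    then have "rmv D (W k) (\<lambda>j. phase n m x j * ideal k x j) j =
       r * ((\<Sum>t\<in>{..<K} - {k}. rmv D (W k) (E k t) j) + rmv D (W k) (\<lambda>j. e (k, 0) j + phase n m x j * \<phi> x j) j)"
      by (simp only: rmv_scale rmv_add[of D "W k" "\<lambda>j. \<Sum>t\<in>{..<K} - {k}. E k t j" "\<lambda>j. e (k, 0) j + phase n m x j * \<phi> x j"] rmv_sum)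
    also have "(\<Sum>t\<in>{..<K} - {k}. rmv D (W k) (E k t) j) = (\<Sum>t\<in>{..<K} - {k}. E (Suc k) t j)"
      using k j fb[OF x] by (intro sum.cong refl) (auto simp: E_def We less_Suc_eq)
    also have "rmv D (W k) (\<lambda>j. e (k, 0) j + phase n m x j * \<phi> x j) j = E (Suc k) k j + \<phi> x j"
      using Wx[OF k x j] by (simp add: E_def)
    also have "r * ((\<Sum>t\<in>{..<K} - {k}. E (Suc k) t j) + (E (Suc k) k j + \<phi> x j)) = ideal (Suc k) x j"
    proof -
      have "(\<Sum>t<K. E (Suc k) t j) = E (Suc k) k j + (\<Sum>t\<in>{..<K} - {k}. E (Suc k) t j)"
        by (rule sum.remove) (use k in auto)
      then show ?thesis by (simp add: ideal_def E_def)
    qed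
    finally show ?thesis .
  qed
  have dist: "rip D (\<lambda>j. \<psi> x k j - ideal k x j) (\<lambda>j. \<psi> x k j - ideal k x j) = r * r * rip D (\<phi> x) (\<phi> x)" if x: "x \<in> cube n" and k: "k \<le> K" for x k
    using k
  proof (induction k)
    case 0
    have d0: "\<psi> x 0 j - ideal 0 x j = - r * \<phi> x j" if "j < D" for j
      using W0(2)[OF that] by (simp add: \<psi>_0 ideal_def start_def algebra_simps)
    have "rip D (\<lambda>j. \<psi> x 0 j - ideal 0 x j) (\<lambda>j. \<psi> x 0 j - ideal 0 x j) = rip D (\<lambda>j. - r * \<phi> x j) (\<lambda>j. - r * \<phi> x j)"
      using d0 by (simp add: rip_def)
    also have "\<dots> = r * r * rip D (\<phi> x) (\<phi> x)" by (simp add: rip_def sum_distrib_left ac_simps)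
    finally show ?case .
  next
    case (Suc k)
    then have k: "k < K" by simp
    have "\<psi> x (Suc k) j - ideal (Suc k) x j = rmv D (W k) (\<lambda>j. phase n m x j * (\<psi> x k j - ideal k x j)) j" if "j < D" for j
      using ideal_step[OF x k that] by (simp add: \<psi>_Suc right_diff_distrib rmv_diff)
    then have "rip D (\<lambda>j. \<psi> x (Suc k) j - ideal (Suc k) x j) (\<lambda>j. \<psi> x (Suc k) j - ideal (Suc k) x j) =
       rip D (rmv D (W k) (\<lambda>j. phase n m x j * (\<psi> x k j - ideal k x j))) (rmv D (W k) (\<lambda>j. phase n m x j * (\<psi> x k j - ideal k x j)))"
      by (simp add: rip_def)
    also have "\<dots> = rip D (\<lambda>j. phase n m x j * (\<psi> x k j - ideal k x j)) (\<lambda>j. phase n m x j * (\<psi> x k j - ideal k x j))"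
      by (rule orth_rip[OF W[OF k]])
    also have "\<dots> = rip D (\<lambda>j. \<psi> x k j - ideal k x j) (\<lambda>j. \<psi> x k j - ideal k x j)"
    proof -
      have "(phase n m x j * z) * (phase n m x j * z) = z * z" for j z
      proof -
        have "(phase n m x j * z) * (phase n m x j * z) = (phase n m x j * phase n m x j) * (z * z)" by (simp only: ac_simps)
        then show ?thesis by (simp only: phase_sq[OF x] mult_1)
      qed
      then show ?thesis by (simp only: rip_def)
    qed
    finally show ?case using Suc by simp
  qed
  have \<psi>_norm: "rip D (\<psi> x k) (\<psi> x k) = 1" if x: "x \<in> cube n" and k: "k \<le> K" for x k
    using k
  proof (induction k)
    case 0
    have "rip D (\<psi> x 0) (\<psi> x 0) = rip D start start"
      by (intro rip_cong) (simp_all add: \<psi>_0 W0(2))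
    then show ?case using start_norm by simp
  next
    case (Suc k)
    have "rip D (\<psi> x (Suc k)) (\<psi> x (Suc k)) = rip D (rmv D (W k) (\<lambda>j. phase n m x j * \<psi> x k j)) (rmv D (W k) (\<lambda>j. phase n m x j * \<psi> x k j))"
      by (simp only: \<psi>_Suc)
    also have "\<dots> = rip D (\<lambda>j. phase n m x j * \<psi> x k j) (\<lambda>j. phase n m x j * \<psi> x k j)"
      using Suc.prems by (intro orth_rip W) simp
    also have "\<dots> = rip D (\<psi> x k) (\<psi> x k)"
    proof -
      have "(phase n m x j * z) * (phase n m x j * z) = z * z" for j z
      proof -
        have "(phase n m x j * z) * (phase n m x j * z) = (phase n m x j * phase n m x j) * (z * z)" by (simp only: ac_simps)
        then show ?thesis by (simp only: phase_sq[OF x] mult_1)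
      qed
      then show ?thesis by (simp only: rip_def)
    qed
    finally show ?case using Suc by simp
  qed
  \<comment> \<open>In block n the parity of the offset is the answer bit. The catalyst states get
    some output as well; their weight is covered by the error bound.\<close>
  define out where "out = (\<lambda>j. (j - n * m) mod 2)"
  show ?thesis unfolding quantum_computes_def
  proof (intro exI[of _ m] exI[of _ "\<lambda>t. cmat ((n + 1) * m) (V t)"] exI[of _ out] conjI ballI allI impI)
    fix t assume "t \<le> K"
    then have "orth D (V t)" using W0(1) W by (cases t) (auto simp: V_def)
    then show "unitary_mat ((n + 1) * m) (cmat ((n + 1) * m) (V t))" unfolding D_def by (rule cmat_unitary)
  next
    fix x assume x: "x \<in> cube n"
    let ?G = "{j. j < (n + 1) * m \<and> out j = f x}"
    define \<delta> where "\<delta> = (\<lambda>j. \<psi> x K j - ideal K x j)"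
    have sq: "(cmod (query_state n m (\<lambda>t. cmat ((n + 1) * m) (V t)) x K $ j))\<^sup>2 = (\<psi> x K j)\<^sup>2" if "j < D" for j
      using that unfolding D_def query_state_cvec[OF m] by (simp add: cvec_def \<psi>_def)
    \<comment> \<open>On a wrong outcome the ideal state has only its catalyst part. Together with
      the deviation this gives an error of at most 4 * r^2 * (A / 2) = 2 * A / K.\<close>
    have bad: "(\<psi> x K j)\<^sup>2 \<le> 2 * (\<delta> j)\<^sup>2 + 2 * (r * \<phi> x j)\<^sup>2" if "j < D" "out j \<noteq> f x" for j
    proof -
      have "e (t, f x) j = 0" if "t < K" for t
      proof (rule ccontr)
        assume "e (t, f x) j \<noteq> 0"
        then have "j = n * m + (2 * t + f x)" by (auto simp: e_def split: if_splits)
        then have "out j = f x" using fb[OF x] by (simp add: out_def)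
        then show False using \<open>out j \<noteq> f x\<close> by simp
      qed
      then have "ideal K x j = r * \<phi> x j" by (simp add: ideal_def)
      then have "\<psi> x K j = \<delta> j + r * \<phi> x j" by (simp add: \<delta>_def)
      then have "(\<psi> x K j)\<^sup>2 + (\<delta> j - r * \<phi> x j)\<^sup>2 = 2 * (\<delta> j)\<^sup>2 + 2 * (r * \<phi> x j)\<^sup>2"
        by (simp add: power2_eq_square algebra_simps)
      then show ?thesis using zero_le_power2[of "\<delta> j - r * \<phi> x j"] by linarith
    qed
    have "(\<Sum>j\<in>{..<D} - ?G. (\<psi> x K j)\<^sup>2) \<le> (\<Sum>j\<in>{..<D} - ?G. 2 * (\<delta> j)\<^sup>2 + 2 * (r * \<phi> x j)\<^sup>2)"
      by (intro sum_mono bad) (auto simp: D_def)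
    also have "\<dots> \<le> (\<Sum>j<D. 2 * (\<delta> j)\<^sup>2 + 2 * (r * \<phi> x j)\<^sup>2)"
      by (intro sum_mono2) auto
    also have "\<dots> = 2 * rip D \<delta> \<delta> + 2 * (r * r * rip D (\<phi> x) (\<phi> x))"
      by (simp add: rip_def sum.distrib sum_distrib_left power2_eq_square ac_simps)
    also have "\<dots> = 4 * (r * r) * rip D (\<phi> x) (\<phi> x)" using dist[OF x order_refl] by (simp add: \<delta>_def)
    also have "\<dots> \<le> 4 * (r * r) * (A / 2)" using norm_\<phi>[OF x] by (intro mult_left_mono) auto
    also have "\<dots> = 2 * A / real K" using r K(2) by (simp add: field_simps)
    also have "\<dots> \<le> 1 / 3" using K by (simp add: field_simps)
    finally have b: "(\<Sum>j\<in>{..<D} - ?G. (\<psi> x K j)\<^sup>2) \<le> 1 / 3" .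
    have "?G \<subseteq> {..<D}" by (auto simp: D_def)
    then have "(\<Sum>j\<in>?G. (\<psi> x K j)\<^sup>2) + (\<Sum>j\<in>{..<D} - ?G. (\<psi> x K j)\<^sup>2) = (\<Sum>j<D. (\<psi> x K j)\<^sup>2)"
      by (subst sum.subset_diff[of ?G "{..<D}"]) auto
    also have "\<dots> = 1" using \<psi>_norm[OF x order_refl] by (simp add: rip_def power2_eq_square)
    finally have "(\<Sum>j\<in>?G. (\<psi> x K j)\<^sup>2) \<ge> 1 - 1 / 3" using b by simp
    moreover have "(\<Sum>j\<in>?G. (cmod (query_state n m (\<lambda>t. cmat ((n + 1) * m) (V t)) x K $ j))\<^sup>2) = (\<Sum>j\<in>?G. (\<psi> x K j)\<^sup>2)"
      using sq by (intro sum.cong refl) (simp add: D_def)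
    ultimately show "(\<Sum>j\<in>?G. (cmod (query_state n m (\<lambda>t. cmat ((n + 1) * m) (V t)) x K $ j))\<^sup>2) \<ge> 1 - 1 / 3" by simp
  qed (use m in simp)
qed

section \<open>Quantum queries and sensitivity\<close>

lemma unitary_norm:
  assumes "unitary_mat D U"
  shows "(\<Sum>j<D. (cmod (\<Sum>a<D. U $$ (j, a) * x a))\<^sup>2) = (\<Sum>a<D. (cmod (x a))\<^sup>2)"
proof -
  have U: "U \<in> carrier_mat D D" and UU: "mat_adjoint U * U = 1\<^sub>m D" using assms by (auto simp: unitary_mat_def)
  have col: "(\<Sum>j<D. cnj (U $$ (j, a)) * U $$ (j, b)) = of_bool (a = b)" if "a < D" "b < D" for a b
  proof -
    have "(mat_adjoint U * U) $$ (a, b) = (\<Sum>j<D. cnj (U $$ (j, a)) * U $$ (j, b))"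
      using U that by (auto simp: mat_adjoint_def mat_of_rows_def scalar_prod_def lessThan_atLeast0)
    then show ?thesis using UU that by (auto split: if_splits)
  qed
  have "complex_of_real (\<Sum>j<D. (cmod (\<Sum>a<D. U $$ (j, a) * x a))\<^sup>2) = (\<Sum>j<D. (\<Sum>a<D. U $$ (j, a) * x a) * cnj (\<Sum>a<D. U $$ (j, a) * x a))"
    by (simp only: of_real_sum complex_norm_square[symmetric])
  also have "\<dots> = (\<Sum>j<D. \<Sum>a<D. \<Sum>b<D. x a * cnj (x b) * (cnj (U $$ (j, b)) * U $$ (j, a)))"
    by (simp add: sum_product ac_simps)
  also have "\<dots> = (\<Sum>a<D. \<Sum>b<D. x a * cnj (x b) * (\<Sum>j<D. cnj (U $$ (j, b)) * U $$ (j, a)))"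
    by (subst sum.swap, rule sum.cong[OF refl], subst sum.swap) (simp add: sum_distrib_left)
  also have "\<dots> = (\<Sum>a<D. \<Sum>b<D. if b = a then x a * cnj (x b) else 0)"
    by (intro sum.cong refl) (simp add: col)
  also have "\<dots> = (\<Sum>a<D. x a * cnj (x a))" by simp
  also have "\<dots> = complex_of_real (\<Sum>a<D. (cmod (x a))\<^sup>2)" by (simp only: of_real_sum complex_norm_square[symmetric])
  finally show ?thesis using of_real_eq_iff by blast
qed

lemma query_state_step:
  assumes "U (Suc t) \<in> carrier_mat ((n + 1) * m) ((n + 1) * m)" "query_state n m U x t \<in> carrier_vec ((n + 1) * m)" "j < (n + 1) * m"
  shows "query_state n m U x (Suc t) $ j = (\<Sum>k<(n + 1) * m. U (Suc t) $$ (j, k) * ((if k div m < n then of_int (x (k div m)) else 1) * query_state n m U x t $ k))"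
proof -
  define D where "D = (n + 1) * m"
  have orc: "(query_oracle n m x *\<^sub>v query_state n m U x t) $ k = (if k div m < n then of_int (x (k div m)) else 1) * query_state n m U x t $ k" if k: "k < D" for k
  proof -
    have "(query_oracle n m x *\<^sub>v query_state n m U x t) $ k = (\<Sum>l<D. query_oracle n m x $$ (k, l) * query_state n m U x t $ l)"
      using k assms(2) by (simp add: scalar_prod_def lessThan_atLeast0 query_oracle_def D_def)
    also have "\<dots> = (\<Sum>l\<in>{k}. query_oracle n m x $$ (k, l) * query_state n m U x t $ l)"
      using k by (intro sum.mono_neutral_right) (auto simp: query_oracle_def D_def)
    also have "\<dots> = (if k div m < n then of_int (x (k div m)) else 1) * query_state n m U x t $ k"
      using k by (simp add: query_oracle_def D_def)
    finally show ?thesis .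
  qed
  have "query_state n m U x (Suc t) $ j = (\<Sum>k<D. U (Suc t) $$ (j, k) * (query_oracle n m x *\<^sub>v query_state n m U x t) $ k)"
    using assms(1,3) by (simp add: scalar_prod_def lessThan_atLeast0 query_oracle_def D_def)
  also have "\<dots> = (\<Sum>k<D. U (Suc t) $$ (j, k) * ((if k div m < n then of_int (x (k div m)) else 1) * query_state n m U x t $ k))"
    by (intro sum.cong refl) (simp add: orc)
  finally show ?thesis by (simp only: D_def)
qed

text \<open>A hybrid bound that is only logarithmic in the sensitivity, which suffices for making
  the quantum complexity unbounded. Flipping variable i disturbs the state by the query weight on i,
  the squared disturbance at most doubles with each later query, and at any time the weights of all
  variables sum to at most 1.\<close>

lemma quantum_sensitivity:
  assumes q: "quantum_computes (1/3) n f T" and z: "z \<in> cube n" and I: "I \<subseteq> {..<n}"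
    and flip: "\<And>i. i \<in> I \<Longrightarrow> f (z(i := - z i)) \<noteq> f z"
  shows "card I \<le> 144 * T * 2 ^ T"
proof -
  obtain m U g where m: "m \<ge> 1" and U: "\<And>t. t \<le> T \<Longrightarrow> unitary_mat ((n + 1) * m) (U t)"
    and suc: "\<And>x. x \<in> cube n \<Longrightarrow> (\<Sum>j | j < (n + 1) * m \<and> g j = f x. (cmod (query_state n m U x T $ j))\<^sup>2) \<ge> 1 - 1/3"
    using q unfolding quantum_computes_def by blast
  define D where "D = (n + 1) * m"
  define s where "s = (\<lambda>x t j. query_state n m U x t $ j)"
  define ph where "ph = (\<lambda>x k. if k div m < n then of_int (x (k div m)) else 1 :: complex)"
  have Uc: "U t \<in> carrier_mat D D" if "t \<le> T" for t using U[OF that] by (auto simp: unitary_mat_def D_def)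
  have car: "query_state n m U x t \<in> carrier_vec D" if "t \<le> T" for x t
  proof (cases t)
    case 0
    show ?thesis unfolding 0 query_state.simps by (rule mult_mat_vec_carrier[OF Uc]) (auto simp: D_def)
  next
    case (Suc t')
    have "dim_row (U t) = D" using Uc[OF that] by simp
    then show ?thesis unfolding Suc query_state.simps by (intro carrier_vecI) simp
  qed
  have step: "s x (Suc t) j = (\<Sum>k<D. U (Suc t) $$ (j, k) * (ph x k * s x t k))" if "Suc t \<le> T" "j < D" for x t j
    unfolding s_def ph_def D_def by (rule query_state_step) (use that Uc[of "Suc t"] car[of t x] in \<open>auto simp: D_def\<close>)
  have ph1: "cmod (ph x k) = 1" if "x \<in> cube n" for x k
    using cube_cases[OF that, of "k div m"] by (auto simp: ph_def)
  have nrm: "(\<Sum>j<D. (cmod (s x t j))\<^sup>2) = 1" if x: "x \<in> cube n" and t: "t \<le> T" for x t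
    using t
  proof (induction t)
    case 0
    have Dpos: "0 < D" using m by (simp add: D_def)
    have "s x 0 j = (\<Sum>a<D. U 0 $$ (j, a) * of_bool (a = 0))" if "j < D" for j
    proof -
      have "s x 0 j = (\<Sum>a<D. U 0 $$ (j, a) * unit_vec D 0 $ a)"
        using that Uc[of 0] by (simp add: s_def scalar_prod_def lessThan_atLeast0 D_def)
      also have "\<dots> = (\<Sum>a<D. U 0 $$ (j, a) * of_bool (a = 0))"
        by (intro sum.cong refl) (simp add: unit_vec_def)
      finally show ?thesis .
    qed
    then have "(\<Sum>j<D. (cmod (s x 0 j))\<^sup>2) = (\<Sum>j<D. (cmod (\<Sum>a<D. U 0 $$ (j, a) * of_bool (a = 0)))\<^sup>2)" by simp
    also have "\<dots> = (\<Sum>a<D. (cmod (of_bool (a = 0)))\<^sup>2)" using U[of 0] unfolding D_def by (intro unitary_norm) simp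
    also have "\<dots> = (\<Sum>a\<in>{0::nat}. (cmod (of_bool (a = 0)))\<^sup>2)" using Dpos by (intro sum.mono_neutral_right) (auto simp: of_bool_def)
    finally show ?case by simp
  next
    case (Suc t)
    have "(\<Sum>j<D. (cmod (s x (Suc t) j))\<^sup>2) = (\<Sum>j<D. (cmod (\<Sum>k<D. U (Suc t) $$ (j, k) * (ph x k * s x t k)))\<^sup>2)"
      using step Suc.prems by simp
    also have "\<dots> = (\<Sum>k<D. (cmod (ph x k * s x t k))\<^sup>2)" using U[of "Suc t"] Suc.prems unfolding D_def by (intro unitary_norm) simp
    also have "\<dots> = 1" using Suc by (simp add: norm_mult ph1[OF x])
    finally show ?case .
  qed
  define P where "P = (\<lambda>i t. \<Sum>k<D. of_bool (k div m = i) * (cmod (s z t k))\<^sup>2)"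
  have yc: "z(i := - z i) \<in> cube n" if "i \<in> I" for i
    using z I that cube_cases[OF z, of i] by (auto simp: cube_def PiE_def Pi_def extensional_def)
  define d where "d = (\<lambda>i t. \<Sum>j<D. (cmod (s z t j - s (z(i := - z i)) t j))\<^sup>2)"
  \<comment> \<open>From (a + b)^2 <= 2 a^2 + 2 b^2, where the phase at variable i changes by at
    most 2; hence the factor 8.\<close>
  have dstep: "d i (Suc t) \<le> 2 * d i t + 8 * P i t" if i: "i \<in> I" and t: "Suc t \<le> T" for i t
  proof -
    define y where "y = z(i := - z i)"
    have y: "y \<in> cube n" using yc[OF i] by (simp add: y_def)
    have "d i (Suc t) = (\<Sum>j<D. (cmod (\<Sum>k<D. U (Suc t) $$ (j, k) * (ph z k * s z t k - ph y k * s y t k)))\<^sup>2)"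
      unfolding d_def y_def[symmetric] using step[OF t] by (simp add: sum_subtractf right_diff_distrib)
    also have "\<dots> = (\<Sum>k<D. (cmod (ph z k * s z t k - ph y k * s y t k))\<^sup>2)"
      using U[OF t] unfolding D_def by (intro unitary_norm) simp
    also have "\<dots> \<le> (\<Sum>k<D. 2 * (cmod (s z t k - s y t k))\<^sup>2 + 8 * (of_bool (k div m = i) * (cmod (s z t k))\<^sup>2))"
    proof (rule sum_mono)
      fix k
      have "cmod (ph z k * s z t k - ph y k * s y t k) = cmod (ph y k * (s z t k - s y t k) + (ph z k - ph y k) * s z t k)"
        by (simp add: algebra_simps)
      also have "\<dots> \<le> cmod (s z t k - s y t k) + cmod (ph z k - ph y k) * cmod (s z t k)"
        using norm_triangle_ineq[of "ph y k * (s z t k - s y t k)" "(ph z k - ph y k) * s z t k"] by (simp add: norm_mult ph1[OF y])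
      also have "cmod (ph z k - ph y k) \<le> 2 * of_bool (k div m = i)"
        using cube_cases[OF z, of "k div m"] by (auto simp: ph_def y_def)
      finally have le: "cmod (ph z k * s z t k - ph y k * s y t k) \<le> cmod (s z t k - s y t k) + 2 * of_bool (k div m = i) * cmod (s z t k)"
        by (simp add: mult_right_mono)
      have "(cmod (ph z k * s z t k - ph y k * s y t k))\<^sup>2 \<le> (cmod (s z t k - s y t k) + 2 * of_bool (k div m = i) * cmod (s z t k))\<^sup>2"
        by (rule power_mono[OF le]) simp
      also have "\<dots> \<le> 2 * (cmod (s z t k - s y t k))\<^sup>2 + 2 * (2 * of_bool (k div m = i) * cmod (s z t k))\<^sup>2"
        using zero_le_power2[of "cmod (s z t k - s y t k) - 2 * of_bool (k div m = i) * cmod (s z t k)"]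
        unfolding power2_sum power2_diff by linarith
      also have "(2 * of_bool (k div m = i) * cmod (s z t k))\<^sup>2 = 4 * (of_bool (k div m = i) * (cmod (s z t k))\<^sup>2)"
        by (simp add: power_mult_distrib)
      finally show "(cmod (ph z k * s z t k - ph y k * s y t k))\<^sup>2 \<le> 2 * (cmod (s z t k - s y t k))\<^sup>2 + 8 * (of_bool (k div m = i) * (cmod (s z t k))\<^sup>2)"
        by simp
    qed
    also have "\<dots> = 2 * d i t + 8 * P i t" unfolding d_def P_def y_def sum.distrib sum_distrib_left by (rule refl)
    finally show ?thesis .
  qed
  have P0: "P i t \<ge> 0" for i t unfolding P_def by (intro sum_nonneg) auto
  have dT: "d i t \<le> 8 * 2 ^ t * (\<Sum>t'<t. P i t')" if i: "i \<in> I" and t: "t \<le> T" for i t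
    using t
  proof (induction t)
    case 0
    show ?case by (simp add: d_def s_def)
  next
    case (Suc t)
    have "d i (Suc t) \<le> 2 * (8 * 2 ^ t * (\<Sum>t'<t. P i t')) + 8 * P i t"
      using dstep[OF i Suc.prems] Suc by simp
    also have "8 * P i t \<le> 8 * (2 * 2 ^ t) * P i t"
      using P0[of i t] one_le_power[of "2::real" "Suc t"] by (intro mult_right_mono) auto
    finally show ?case by (simp add: algebra_simps)
  qed
  have fin: "finite I" using I finite_subset by blast
  have Psum: "(\<Sum>i\<in>I. P i t) \<le> 1" if "t \<le> T" for t
  proof -
    have "(\<Sum>i\<in>I. P i t) = (\<Sum>k<D. (\<Sum>i\<in>I. of_bool (k div m = i)) * (cmod (s z t k))\<^sup>2)"
      unfolding P_def by (subst sum.swap) (simp add: sum_distrib_right)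
    also have "\<dots> \<le> (\<Sum>k<D. 1 * (cmod (s z t k))\<^sup>2)"
      using fin by (intro sum_mono mult_right_mono) (auto simp: of_bool_def)
    also have "\<dots> = 1" using nrm[OF z that] by simp
    finally show ?thesis .
  qed
  \<comment> \<open>The outcomes for f z have weight at least 2/3 before and at most 1/3 after the
    flip, and 2/3 <= 3/2 * 1/3 + 3 * d gives d >= 1/18. With the 8 from above this makes
    144.\<close>
  have far: "1 / 18 \<le> d i T" if i: "i \<in> I" for i
  proof -
    define y where "y = z(i := - z i)"
    let ?A = "{j. j < D \<and> g j = f z}" and ?B = "{j. j < D \<and> g j = f y}"
    have y: "y \<in> cube n" using yc[OF i] by (simp add: y_def)
    have A: "2 / 3 \<le> (\<Sum>j\<in>?A. (cmod (s z T j))\<^sup>2)" using suc[OF z] by (simp add: s_def D_def)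
    have B: "2 / 3 \<le> (\<Sum>j\<in>?B. (cmod (s y T j))\<^sup>2)" using suc[OF y] by (simp add: s_def D_def)
    have fz: "f y \<noteq> f z" using flip[OF i] by (simp add: y_def)
    have "(\<Sum>j\<in>?A. (cmod (s y T j))\<^sup>2) + (\<Sum>j\<in>?B. (cmod (s y T j))\<^sup>2) = (\<Sum>j\<in>?A \<union> ?B. (cmod (s y T j))\<^sup>2)"
      using fz by (intro sum.union_disjoint[symmetric]) auto
    also have "\<dots> \<le> (\<Sum>j<D. (cmod (s y T j))\<^sup>2)" by (intro sum_mono2) auto
    also have "\<dots> = 1" by (rule nrm[OF y order_refl])
    finally have C: "(\<Sum>j\<in>?A. (cmod (s y T j))\<^sup>2) \<le> 1 / 3" using B by simp
    have pt: "(cmod a)\<^sup>2 \<le> 3 / 2 * (cmod b)\<^sup>2 + 3 * (cmod (a - b))\<^sup>2" for a b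
    proof -
      have "cmod a \<le> cmod b + cmod (a - b)" using norm_triangle_ineq[of b "a - b"] by simp
      then have "(cmod a)\<^sup>2 \<le> (cmod b + cmod (a - b))\<^sup>2" by (intro power_mono) auto
      moreover have "0 \<le> (cmod b - 2 * cmod (a - b))\<^sup>2" by simp
      ultimately show ?thesis by (simp add: power2_eq_square algebra_simps)
    qed
    have "(\<Sum>j\<in>?A. (cmod (s z T j))\<^sup>2) \<le> (\<Sum>j\<in>?A. 3 / 2 * (cmod (s y T j))\<^sup>2 + 3 * (cmod (s z T j - s y T j))\<^sup>2)"
      by (intro sum_mono pt)
    also have "\<dots> = 3 / 2 * (\<Sum>j\<in>?A. (cmod (s y T j))\<^sup>2) + 3 * (\<Sum>j\<in>?A. (cmod (s z T j - s y T j))\<^sup>2)"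
      by (simp add: sum.distrib sum_distrib_left)
    also have "(\<Sum>j\<in>?A. (cmod (s z T j - s y T j))\<^sup>2) \<le> d i T"
      unfolding d_def y_def by (intro sum_mono2) auto
    finally show ?thesis using A C by simp
  qed
  have "real (card I) * (1 / 18) = (\<Sum>i\<in>I. 1 / 18)" by simp
  also have "\<dots> \<le> (\<Sum>i\<in>I. 8 * 2 ^ T * (\<Sum>t'<T. P i t'))"
    using far dT by (intro sum_mono order_trans[OF far dT]) auto
  also have "\<dots> = 8 * 2 ^ T * (\<Sum>t'<T. \<Sum>i\<in>I. P i t')"
    by (subst sum.swap) (simp add: sum_distrib_left)
  also have "\<dots> \<le> 8 * 2 ^ T * (\<Sum>t'<T. 1)" by (intro mult_left_mono sum_mono Psum) auto
  finally have "real (card I) \<le> real (144 * T * 2 ^ T)" by (simp add: ac_simps)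
  then show ?thesis by (simp only: of_nat_le_iff)
qed

section \<open>Random sign matrices\<close>

text \<open>Injectivity of P keeps the monomials distinct, so the c i are the coefficients of the
  polynomial and no two of them merge.\<close>

lemma bonami_family:
  fixes c :: "'i \<Rightarrow> real"
  assumes V: "finite V" and I: "finite I" and inj: "inj_on P I" and P: "\<And>i. i \<in> I \<Longrightarrow> P i \<subseteq> V"
  shows "av V (\<lambda>x. (\<Sum>i\<in>I. c i * (\<Prod>v\<in>P i. x v)) ^ (2*m)) \<le> (\<Sum>i\<in>I. real (2*m) ^ card (P i) * (c i)\<^sup>2) ^ m"
proof -
  define g where "g = (\<lambda>S. if S \<in> P ` I then c (inv_into I P S) else 0)"
  have red: "(\<Sum>S\<in>Pow V. F S (g S)) = (\<Sum>i\<in>I. F (P i) (c i))" if "\<And>S. F S 0 = 0" for F :: "'a set \<Rightarrow> real \<Rightarrow> real"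
  proof -
    have "(\<Sum>S\<in>Pow V. F S (g S)) = (\<Sum>S\<in>P ` I. F S (g S))"
      using V P that by (intro sum.mono_neutral_right) (auto simp: g_def)
    also have "\<dots> = (\<Sum>i\<in>I. F (P i) (g (P i)))" by (simp add: sum.reindex[OF inj])
    also have "\<dots> = (\<Sum>i\<in>I. F (P i) (c i))"
      by (intro sum.cong refl) (simp add: g_def inv_into_f_f[OF inj])
    finally show ?thesis .
  qed
  have "(\<Sum>S\<in>Pow V. g S * (\<Prod>i\<in>S. x i)) = (\<Sum>i\<in>I. c i * (\<Prod>v\<in>P i. x v))" for x
    by (rule red) simp
  moreover have "(\<Sum>S\<in>Pow V. real (2*m) ^ card S * (g S)\<^sup>2) = (\<Sum>i\<in>I. real (2*m) ^ card (P i) * (c i)\<^sup>2)"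
    by (rule red) simp
  ultimately show ?thesis using bonami[OF V, of g m] by simp
qed

section \<open>Characters and walks on sets\<close>

lemma av_character:
  assumes V: "finite V" and A: "A \<subseteq> V"
  shows "av V (\<lambda>x. \<Prod>i\<in>A. x i) = of_bool (A = {})"
proof (cases "A = {}")
  case True
  then show ?thesis using V by (simp add: av_const)
next
  case False
  then obtain v where v: "v \<in> A" by blast
  have fA: "finite A" using A V finite_subset by blast
  have ins: "insert v (V - {v}) = V" using v A by auto
  have "(\<Prod>i\<in>A. (x(v := s)) i) = s * (\<Prod>i\<in>A - {v}. x i)" for x :: "'a \<Rightarrow> real" and s
    using v fA by (subst prod.remove[of A v]) (auto intro!: arg_cong2[where f = "(*)"] prod.cong)
  then have "av (insert v (V - {v})) (\<lambda>x. \<Prod>i\<in>A. x i) = av (V - {v}) (\<lambda>x. 0)"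
    using V by (subst av_insert) auto
  then show ?thesis using False V unfolding ins by (simp add: av_const)
qed

definition toggle :: "'a \<Rightarrow> 'a set \<Rightarrow> 'a set" where
  "toggle k A = (if k \<in> A then A - {k} else insert k A)"

lemma character_toggle:
  assumes "x \<in> signs V" "A \<subseteq> V" "k \<in> V" "finite V"
  shows "(\<Prod>i\<in>A. x i) * x k = (\<Prod>i\<in>toggle k A. x i)"
proof -
  have fA: "finite A" using assms finite_subset by blast
  have sq: "x k * x k = 1" using signs_cases[OF assms(1,3)] by auto
  show ?thesis
  proof (cases "k \<in> A")
    case True
    then have "(\<Prod>i\<in>A. x i) * x k = (x k * x k) * (\<Prod>i\<in>A - {k}. x i)"
      using fA by (simp add: prod.remove[of A k])
    then show ?thesis using True sq by (simp add: toggle_def)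
  qed (use fA in \<open>simp add: toggle_def\<close>)
qed

lemma toggle_subset: "A \<subseteq> V \<Longrightarrow> k \<in> V \<Longrightarrow> toggle k A \<subseteq> V"
  by (auto simp: toggle_def)

lemma av_character_prod:
  assumes V: "finite V" and A: "A \<subseteq> V" and B: "finite B" and i: "\<And>j. j \<in> B \<Longrightarrow> i j \<in> V"
  shows "av V (\<lambda>x. (\<Prod>k\<in>A. x k) * (\<Prod>j\<in>B. x (i j))) \<in> {0, 1}"
  using B A i
proof (induction B arbitrary: A rule: finite_induct)
  case empty
  then show ?case using av_character[OF V] by simp
next
  case (insert j B)
  have "av V (\<lambda>x. (\<Prod>k\<in>A. x k) * (\<Prod>j\<in>insert j B. x (i j))) = av V (\<lambda>x. (\<Prod>k\<in>toggle (i j) A. x k) * (\<Prod>j\<in>B. x (i j)))"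
    using insert.prems insert.hyps V by (intro av_cong) (simp add: character_toggle[symmetric] mult.assoc)
  then show ?case using insert.IH[of "toggle (i j) A"] insert.prems toggle_subset[of A V "i j"] by simp
qed

text \<open>For A within the index range, the number of sequences of b indices in which exactly the
  elements of A occur an odd number of times.\<close>

definition walks :: "nat \<Rightarrow> nat set \<Rightarrow> nat \<Rightarrow> real" where
  "walks N A b = av {..<N} (\<lambda>x. (\<Prod>i\<in>A. x i) * (\<Sum>k<N. x k) ^ b)"

lemma walks_0: "A \<subseteq> {..<N} \<Longrightarrow> walks N A 0 = of_bool (A = {})"
  using av_character[of "{..<N}" A] by (simp add: walks_def)

lemma walks_Suc:
  assumes "A \<subseteq> {..<N}"
  shows "walks N A (Suc b) = (\<Sum>k<N. walks N (toggle k A) b)"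
proof -
  have "walks N A (Suc b) = av {..<N} (\<lambda>x. \<Sum>k<N. (\<Prod>i\<in>toggle k A. x i) * (\<Sum>k<N. x k) ^ b)"
    unfolding walks_def using assms
    by (intro av_cong) (simp add: character_toggle[symmetric] sum_distrib_left sum_distrib_right ac_simps)
  then show ?thesis by (simp add: av_sum walks_def)
qed

text \<open>The first index of a walk either removes an element of A, in at most Suc b ways, or adds
  a new one, in at most N ways. Each case fits into half of the bound for Suc b. More than b
  elements cannot be cancelled in b steps.\<close>

lemma walks_bound:
  assumes "A \<subseteq> {..<N}"
  shows "if card A \<le> b then walks N A b \<le> 2 ^ b * sqrt (real b) ^ (card A + b) * sqrt (real N) ^ (b - card A) else walks N A b = 0"
  using assms
proof (induction b arbitrary: A)
  case 0
  then have "finite A" using finite_subset by blast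
  then show ?case using walks_0[OF 0] by auto
next
  case (Suc b)
  have fA: "finite A" using Suc.prems finite_subset by blast
  let ?a = "card A"
  have tog: "toggle k A \<subseteq> {..<N}" if "k < N" for k using toggle_subset[OF Suc.prems] that by simp
  have inA: "card (toggle k A) = ?a - 1" "?a > 0" if "k \<in> A" for k using that fA by (auto simp: toggle_def card_gt_0_iff)
  have outA: "card (toggle k A) = ?a + 1" if "k \<notin> A" for k using that fA by (auto simp: toggle_def)
  have split: "walks N A (Suc b) = (\<Sum>k\<in>A. walks N (toggle k A) b) + (\<Sum>k\<in>{..<N} - A. walks N (toggle k A) b)"
    unfolding walks_Suc[OF Suc.prems] using Suc.prems fA by (simp add: sum.subset_diff[of A "{..<N}"])
  show ?case
  proof (cases "?a \<le> Suc b")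
    case False
    have "(\<Sum>k\<in>A. walks N (toggle k A) b) = 0"
    proof (rule sum.neutral, rule ballI)
      fix k assume k: "k \<in> A"
      then have "k < N" using Suc.prems by auto
      then show "walks N (toggle k A) b = 0" using Suc.IH[OF tog] inA[OF k] False by auto
    qed
    moreover have "(\<Sum>k\<in>{..<N} - A. walks N (toggle k A) b) = 0"
    proof (rule sum.neutral, rule ballI)
      fix k assume k: "k \<in> {..<N} - A"
      then show "walks N (toggle k A) b = 0" using Suc.IH[OF tog, of k] outA[of k] False by auto
    qed
    ultimately show ?thesis using False split by simp
  next
    case True
    define s n where "s = sqrt (real (Suc b))" and "n = sqrt (real N)"
    have sb: "sqrt (real b) \<le> s" and nn: "0 \<le> s" "0 \<le> n" by (simp_all add: s_def n_def)
    have s2: "real (Suc b) = s * s" and n2: "real N = n * n" by (simp_all add: s_def n_def)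
    define X where "X = 2 ^ b * s ^ (?a + Suc b) * n ^ (Suc b - ?a)"
    have X0: "X \<ge> 0" using nn by (simp add: X_def)
    have "(\<Sum>k\<in>A. walks N (toggle k A) b) \<le> X"
    proof (cases "?a = 0")
      case True
      then show ?thesis using fA X0 by simp
    next
      case a0: False
      define a where "a = ?a - 1"
      have a: "?a = Suc a" using a0 by (simp add: a_def)
      have ab: "a \<le> b" using True a by simp
      have "(\<Sum>k\<in>A. walks N (toggle k A) b) \<le> (\<Sum>k\<in>A. 2 ^ b * s ^ (a + b) * n ^ (b - a))"
      proof (rule sum_mono)
        fix k assume k: "k \<in> A"
        then have kN: "k < N" using Suc.prems by auto
        have "walks N (toggle k A) b \<le> 2 ^ b * sqrt (real b) ^ (a + b) * n ^ (b - a)"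
          using Suc.IH[OF tog[OF kN]] inA[OF k] ab a by (simp add: n_def)
        also have "\<dots> \<le> 2 ^ b * s ^ (a + b) * n ^ (b - a)"
          by (intro mult_right_mono mult_left_mono power_mono sb) (auto simp: nn)
        finally show "walks N (toggle k A) b \<le> 2 ^ b * s ^ (a + b) * n ^ (b - a)" .
      qed
      also have "\<dots> = real (Suc a) * (2 ^ b * s ^ (a + b) * n ^ (b - a))" using a by simp
      also have "\<dots> \<le> real (Suc b) * (2 ^ b * s ^ (a + b) * n ^ (b - a))"
        using ab nn by (intro mult_right_mono) auto
      also have "\<dots> = X" unfolding X_def a s2 by simp
      finally show ?thesis .
    qed
    moreover have "(\<Sum>k\<in>{..<N} - A. walks N (toggle k A) b) \<le> X"
    proof (cases "?a + 1 \<le> b")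
      case False
      have "(\<Sum>k\<in>{..<N} - A. walks N (toggle k A) b) = 0"
      proof (rule sum.neutral, rule ballI)
        fix k assume k: "k \<in> {..<N} - A"
        then show "walks N (toggle k A) b = 0" using Suc.IH[OF tog, of k] outA[of k] False by auto
      qed
      then show ?thesis using X0 by simp
    next
      case ab: True
      define e where "e = b - (?a + 1)"
      have e: "b - (?a + 1) = e" "Suc b - ?a = Suc (Suc e)" using ab by (auto simp: e_def)
      have "(\<Sum>k\<in>{..<N} - A. walks N (toggle k A) b) \<le> (\<Sum>k\<in>{..<N} - A. 2 ^ b * s ^ (?a + Suc b) * n ^ e)"
      proof (rule sum_mono)
        fix k assume k: "k \<in> {..<N} - A"
        have "walks N (toggle k A) b \<le> 2 ^ b * sqrt (real b) ^ (?a + 1 + b) * n ^ e"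
          using Suc.IH[OF tog, of k] outA[of k] k ab e(1) by (simp add: n_def)
        also have "\<dots> \<le> 2 ^ b * s ^ (?a + 1 + b) * n ^ e"
          by (intro mult_right_mono mult_left_mono power_mono sb) (auto simp: nn)
        finally show "walks N (toggle k A) b \<le> 2 ^ b * s ^ (?a + Suc b) * n ^ e" by simp
      qed
      also have "\<dots> \<le> (\<Sum>k<N. 2 ^ b * s ^ (?a + Suc b) * n ^ e)" using nn by (intro sum_mono2) auto
      also have "\<dots> = real N * (2 ^ b * s ^ (?a + Suc b) * n ^ e)" by simp
      also have "\<dots> = X" unfolding X_def e n2 by simp
      finally show ?thesis .
    qed
    ultimately have "walks N A (Suc b) \<le> 2 * X" using split by simp
    then show ?thesis using True by (simp add: X_def s_def n_def)
  qed
qed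

section \<open>Fourier coefficients of a single link\<close>

definition link_form :: "real \<Rightarrow> nat \<Rightarrow> (nat \<times> nat \<Rightarrow> real) \<Rightarrow> (nat \<Rightarrow> real) \<Rightarrow> nat \<Rightarrow> real" where
  "link_form \<kappa> N S x j = \<kappa> * (\<Sum>i<N. S (i, j) * x i)"

text \<open>The Fourier coefficient of the link density at A on the source vector and at B on the
  target vector, by \<open>link_fourier\<close>. It is studied as a polynomial in the entries of
  S.\<close>

definition link_coeff :: "real \<Rightarrow> nat \<Rightarrow> (nat \<times> nat \<Rightarrow> real) \<Rightarrow> nat set \<Rightarrow> nat set \<Rightarrow> real" where
  "link_coeff \<kappa> N S A B = av {..<N} (\<lambda>x. (\<Prod>i\<in>A. x i) * (\<Prod>j\<in>B. link_form \<kappa> N S x j))"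

text \<open>Expanding the linear forms chooses one source coordinate i j for every j in B. The
  weight w i tells whether the chosen coordinates multiply to the character of A, so the surviving
  choices are counted by walks.\<close>

lemma link_coeff_expand:
  assumes A: "A \<subseteq> {..<N}" and B: "finite B"
  defines "w \<equiv> (\<lambda>i. av {..<N} (\<lambda>x. (\<Prod>k\<in>A. x k) * (\<Prod>j\<in>B. x (i j))))"
  shows "link_coeff \<kappa> N S A B = \<kappa> ^ card B * (\<Sum>i\<in>B \<rightarrow>\<^sub>E {..<N}. w i * (\<Prod>v\<in>(\<lambda>j. (i j, j)) ` B. S v))"
    and "(\<Sum>i\<in>B \<rightarrow>\<^sub>E {..<N}. w i) = walks N A (card B)"
    and "\<And>i. i \<in> B \<rightarrow>\<^sub>E {..<N} \<Longrightarrow> w i \<in> {0, 1}"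
proof -
  have ex: "(\<Prod>j\<in>B. \<Sum>i<N. F j i * x i) = (\<Sum>i\<in>B \<rightarrow>\<^sub>E {..<N}. (\<Prod>j\<in>B. F j (i j)) * (\<Prod>j\<in>B. x (i j)))"
    for F and x :: "nat \<Rightarrow> real"
    using prod_sum_PiE[of B "\<lambda>_. {..<N}" "\<lambda>j i. F j i * x i"] B by (simp add: prod.distrib)
  have gr: "(\<Prod>v\<in>(\<lambda>j. (i j, j)) ` B. S v) = (\<Prod>j\<in>B. S (i j, j))" for i
    by (subst prod.reindex) (auto simp: inj_on_def)
  have "link_coeff \<kappa> N S A B = av {..<N} (\<lambda>x. \<Sum>i\<in>B \<rightarrow>\<^sub>E {..<N}. (\<kappa> ^ card B * (\<Prod>v\<in>(\<lambda>j. (i j, j)) ` B. S v)) * ((\<Prod>k\<in>A. x k) * (\<Prod>j\<in>B. x (i j))))"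
    unfolding link_coeff_def link_form_def prod.distrib ex[of "\<lambda>j i. S (i, j)"] gr
    by (simp add: sum_distrib_left prod_constant ac_simps)
  also have "\<dots> = \<kappa> ^ card B * (\<Sum>i\<in>B \<rightarrow>\<^sub>E {..<N}. w i * (\<Prod>v\<in>(\<lambda>j. (i j, j)) ` B. S v))"
    unfolding av_sum av_cmult w_def sum_distrib_left by (simp add: ac_simps)
  finally show "link_coeff \<kappa> N S A B = \<kappa> ^ card B * (\<Sum>i\<in>B \<rightarrow>\<^sub>E {..<N}. w i * (\<Prod>v\<in>(\<lambda>j. (i j, j)) ` B. S v))" .
  have "walks N A (card B) = av {..<N} (\<lambda>x. (\<Prod>k\<in>A. x k) * (\<Prod>j\<in>B. \<Sum>k<N. 1 * x k))"
    by (simp add: walks_def prod_constant)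
  also have "\<dots> = av {..<N} (\<lambda>x. \<Sum>i\<in>B \<rightarrow>\<^sub>E {..<N}. (\<Prod>k\<in>A. x k) * (\<Prod>j\<in>B. x (i j)))"
    unfolding ex by (simp add: sum_distrib_left)
  finally show "(\<Sum>i\<in>B \<rightarrow>\<^sub>E {..<N}. w i) = walks N A (card B)" by (simp add: av_sum w_def)
  show "w i \<in> {0, 1}" if "i \<in> B \<rightarrow>\<^sub>E {..<N}" for i
    unfolding w_def using that by (intro av_character_prod A B) auto
qed

text \<open>Fewer than card A coordinates never multiply to the character of A. This asymmetry
  between source and target is why the direction of a link matters.\<close>

lemma link_coeff_zero:
  assumes A: "A \<subseteq> {..<N}" and B: "finite B" and lt: "card B < card A"
  shows "link_coeff \<kappa> N S A B = 0"
proof -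
  note e = link_coeff_expand[OF A B]
  let ?w = "\<lambda>i. av {..<N} (\<lambda>x. (\<Prod>k\<in>A. x k) * (\<Prod>j\<in>B. x (i j)))"
  have fin: "finite (B \<rightarrow>\<^sub>E {..<N})" using B by (intro finite_PiE) auto
  have "(\<Sum>i\<in>B \<rightarrow>\<^sub>E {..<N}. ?w i) = 0" using e(2) walks_bound[OF A, of "card B"] lt by simp
  moreover have "0 \<le> ?w i" if "i \<in> B \<rightarrow>\<^sub>E {..<N}" for i using e(3)[OF that] by auto
  ultimately have z: "?w i = 0" if "i \<in> B \<rightarrow>\<^sub>E {..<N}" for i
    using sum_nonneg_0[OF fin, of ?w i] that by simp
  then have "(\<Sum>i\<in>B \<rightarrow>\<^sub>E {..<N}. ?w i * (\<Prod>v\<in>(\<lambda>j. (i j, j)) ` B. S v)) = 0"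
    by (intro sum.neutral) simp
  then show ?thesis unfolding e(1) by simp
qed

text \<open>Different choices i give different monomials in S, all of degree card B and with
  coefficients 0 or 1 up to the common power of \<kappa>, so in \<open>bonami_family\<close> the sum
  of the squared coefficients is a number of walks.\<close>

lemma link_coeff_moment:
  assumes A: "A \<subseteq> {..<N}" and B: "B \<subseteq> {..<N}" and le: "card A \<le> card B"
  shows "av ({..<N} \<times> {..<N}) (\<lambda>S. link_coeff \<kappa> N S A B ^ (2 * m)) \<le>
    (\<kappa>\<^sup>2 ^ card B * (real (2 * m) ^ card B * (2 ^ card B * sqrt (real (card B)) ^ (card A + card B) * sqrt (real N) ^ (card B - card A)))) ^ m"
proof -
  have fB: "finite B" using B finite_subset by blast
  note e = link_coeff_expand[OF A fB]
  let ?w = "\<lambda>i. av {..<N} (\<lambda>x. (\<Prod>k\<in>A. x k) * (\<Prod>j\<in>B. x (i j)))" and ?P = "\<lambda>i. (\<lambda>j. (i j, j)) ` B"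
  have fin: "finite (B \<rightarrow>\<^sub>E {..<N})" using fB by (intro finite_PiE) auto
  have inj: "inj_on ?P (B \<rightarrow>\<^sub>E {..<N})"
  proof (rule inj_onI)
    fix f g assume f: "f \<in> B \<rightarrow>\<^sub>E {..<N}" and g: "g \<in> B \<rightarrow>\<^sub>E {..<N}" and eq: "?P f = ?P g"
    show "f = g"
    proof (rule PiE_ext[OF f g])
      fix j assume "j \<in> B"
      then have "(f j, j) \<in> ?P g" using eq by blast
      then show "f j = g j" by auto
    qed
  qed
  have "av ({..<N} \<times> {..<N}) (\<lambda>S. link_coeff \<kappa> N S A B ^ (2 * m)) = \<kappa> ^ (card B * (2 * m)) * av ({..<N} \<times> {..<N}) (\<lambda>S. (\<Sum>i\<in>B \<rightarrow>\<^sub>E {..<N}. ?w i * (\<Prod>v\<in>?P i. S v)) ^ (2 * m))"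
    unfolding e(1) by (simp add: power_mult_distrib av_cmult power_mult[symmetric])
  also have "\<dots> \<le> \<kappa> ^ (card B * (2 * m)) * (\<Sum>i\<in>B \<rightarrow>\<^sub>E {..<N}. real (2 * m) ^ card (?P i) * (?w i)\<^sup>2) ^ m"
    using B fB by (intro mult_left_mono bonami_family inj fin) (auto simp: power_mult)
  also have "(\<Sum>i\<in>B \<rightarrow>\<^sub>E {..<N}. real (2 * m) ^ card (?P i) * (?w i)\<^sup>2) = (\<Sum>i\<in>B \<rightarrow>\<^sub>E {..<N}. real (2 * m) ^ card B * ?w i)"
  proof (rule sum.cong[OF refl])
    fix i assume i: "i \<in> B \<rightarrow>\<^sub>E {..<N}"
    have "card (?P i) = card B" by (intro card_image) (auto simp: inj_on_def)
    moreover have "(?w i)\<^sup>2 = ?w i" using e(3)[OF i] by auto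
    ultimately show "real (2 * m) ^ card (?P i) * (?w i)\<^sup>2 = real (2 * m) ^ card B * ?w i" by simp
  qed
  also have "\<dots> = real (2 * m) ^ card B * walks N A (card B)" by (simp add: sum_distrib_left[symmetric] e(2))
  also have "\<kappa> ^ (card B * (2 * m)) * (real (2 * m) ^ card B * walks N A (card B)) ^ m = (\<kappa>\<^sup>2 ^ card B * (real (2 * m) ^ card B * walks N A (card B))) ^ m"
    by (simp add: power_mult_distrib power_mult[symmetric] ac_simps)
  also have "\<dots> \<le> (\<kappa>\<^sup>2 ^ card B * (real (2 * m) ^ card B * (2 ^ card B * sqrt (real (card B)) ^ (card A + card B) * sqrt (real N) ^ (card B - card A)))) ^ m"
  proof (rule power_mono)
    have "0 \<le> ?w i" if "i \<in> B \<rightarrow>\<^sub>E {..<N}" for i using e(3)[OF that] by auto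
    then have "0 \<le> walks N A (card B)" unfolding e(2)[symmetric] by (rule sum_nonneg)
    then show "0 \<le> \<kappa>\<^sup>2 ^ card B * (real (2 * m) ^ card B * walks N A (card B))" by simp
    show "\<kappa>\<^sup>2 ^ card B * (real (2 * m) ^ card B * walks N A (card B)) \<le> \<kappa>\<^sup>2 ^ card B * (real (2 * m) ^ card B * (2 ^ card B * sqrt (real (card B)) ^ (card A + card B) * sqrt (real N) ^ (card B - card A)))"
      using walks_bound[OF A, of "card B"] le by (intro mult_left_mono) auto
  qed
  finally show ?thesis .
qed

lemma av_swap: "av V (\<lambda>x. av W (\<lambda>y. f x y)) = av W (\<lambda>y. av V (\<lambda>x. f x y))"
  unfolding av_def by (simp add: sum_divide_distrib[symmetric] sum.swap[of _ "signs V"] mult.commute)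

lemma av_nonneg: "(\<And>x. x \<in> signs V \<Longrightarrow> 0 \<le> f x) \<Longrightarrow> 0 \<le> av V f"
  by (simp add: av_def sum_nonneg)

lemma av_small:
  assumes V: "finite V" and f: "av V f < c"
  shows "\<exists>x\<in>signs V. f x < c"
proof (rule ccontr)
  assume "\<not> ?thesis"
  then have "av V (\<lambda>_. c) \<le> av V f" by (intro av_mono) force
  then show False using f av_const[OF V, of c] by simp
qed

lemma power_le_one_imp: "x ^ m \<le> 1 \<Longrightarrow> m > 0 \<Longrightarrow> (x :: real) \<le> 1"
  using one_less_power[of x m] by linarith

lemma av_indep:
  assumes V: "finite V" and W: "finite W" and "V \<inter> W = {}"
    and f: "\<And>x y. (\<And>v. v \<in> V \<Longrightarrow> x v = y v) \<Longrightarrow> f x = f y"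
    and "\<And>x y. (\<And>v. v \<in> W \<Longrightarrow> x v = y v) \<Longrightarrow> g x = g y"
  shows "av (V \<union> W) (\<lambda>x. f x * g x) = av V f * av W g"
  using W assms(3,5)
proof (induction W arbitrary: g rule: finite_induct)
  case empty
  have g: "g x = g (\<lambda>_. undefined)" for x by (rule empty.prems(2)) simp
  have "av V (\<lambda>x. f x * g x) = av V (\<lambda>x. g (\<lambda>_. undefined) * f x)"
    by (rule av_cong) (subst g, rule mult.commute)
  then show ?case by (simp add: av_cmult)
next
  case (insert w W)
  let ?g = "\<lambda>x. (g (x(w := 1)) + g (x(w := -1))) / 2"
  have fw: "f (x(w := s)) = f x" for x s
    by (rule f) (use insert.prems(1) in auto)
  have "av (V \<union> insert w W) (\<lambda>x. f x * g x) = av (insert w (V \<union> W)) (\<lambda>x. f x * g x)" by simp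
  also have "\<dots> = av (V \<union> W) (\<lambda>x. f x * ?g x)"
    using V insert.hyps insert.prems(1) by (subst av_insert) (auto simp: fw distrib_left)
  also have "\<dots> = av V f * av W ?g"
  proof (rule insert.IH)
    show "V \<inter> W = {}" using insert.prems(1) by auto
    fix x y :: "'a \<Rightarrow> real" assume xy: "\<And>v. v \<in> W \<Longrightarrow> x v = y v"
    have "g (x(w := s)) = g (y(w := s))" for s by (rule insert.prems(2)) (use xy in auto)
    then show "?g x = ?g y" by simp
  qed
  also have "av W ?g = av (insert w W) g" using insert.hyps by (simp add: av_insert)
  finally show ?case .
qed

lemma av_prod_columns:
  assumes J: "finite J"
    and g: "\<And>j x y. (\<And>i. i < N \<Longrightarrow> x (i, j) = y (i, j)) \<Longrightarrow> g j x = g j y"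
  shows "av ({..<N} \<times> J) (\<lambda>S. \<Prod>j\<in>J. g j S) = (\<Prod>j\<in>J. av ({..<N::nat} \<times> {j}) (g j))"
  using J
proof (induction J rule: finite_induct)
  case (insert j J)
  have "av ({..<N} \<times> insert j J) (\<lambda>S. \<Prod>j\<in>insert j J. g j S) = av ({..<N} \<times> {j} \<union> {..<N} \<times> J) (\<lambda>S. g j S * (\<Prod>j\<in>J. g j S))"
    using insert.hyps by (simp add: Sigma_Un_distrib2[symmetric])
  also have "\<dots> = av ({..<N} \<times> {j}) (g j) * av ({..<N} \<times> J) (\<lambda>S. \<Prod>j\<in>J. g j S)"
  proof (rule av_indep)
    fix x y :: "nat \<times> 'a \<Rightarrow> real"
    show "g j x = g j y" if "\<And>v. v \<in> {..<N} \<times> {j} \<Longrightarrow> x v = y v" by (rule g) (use that in auto)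
    show "(\<Prod>j\<in>J. g j x) = (\<Prod>j\<in>J. g j y)" if "\<And>v. v \<in> {..<N} \<times> J \<Longrightarrow> x v = y v"
      by (intro prod.cong refl g) (use that in auto)
  qed (use insert.hyps in auto)
  finally show ?case using insert by simp
qed simp

lemma one_plus_power_le:
  fixes z :: real
  assumes "0 \<le> z" "real n * z \<le> 1 / 2"
  shows "(1 + z) ^ n \<le> 1 + 2 * (real n * z)"
proof -
  have "(1 + z) ^ n \<le> exp z ^ n" using assms by (intro power_mono) auto
  also have "\<dots> = exp (real n * z)" by (simp add: exp_of_nat_mult)
  also have "\<dots> \<le> 1 + 2 * (real n * z)" using exp_bound_lemma[of "real n * z"] assms by simp
  finally show ?thesis .
qed

lemma card_small_subsets: "finite V \<Longrightarrow> card {A. A \<subseteq> V \<and> card A \<le> b} \<le> (card V + 1) ^ b"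
proof (induction b)
  case 0
  have "{A. A \<subseteq> V \<and> card A \<le> 0} = {{}}" using 0 by (auto simp: card_eq_0_iff dest: finite_subset)
  then show ?case by simp
next
  case (Suc b)
  let ?F = "\<lambda>b. {A. A \<subseteq> V \<and> card A \<le> b}"
  have fin: "finite (?F b)" for b using Suc.prems by simp
  have "?F (Suc b) \<subseteq> ?F b \<union> (\<lambda>(k, A). insert k A) ` (V \<times> ?F b)"
  proof
    fix A assume A: "A \<in> ?F (Suc b)"
    show "A \<in> ?F b \<union> (\<lambda>(k, A). insert k A) ` (V \<times> ?F b)"
    proof (cases "A = {}")
      case True then show ?thesis by simp
    next
      case False
      then obtain k where k: "k \<in> A" by blast
      have "finite A" using A Suc.prems finite_subset by blast
      then have "card (A - {k}) \<le> b" using k A by auto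
      then have "(k, A - {k}) \<in> V \<times> ?F b" using A k by auto
      moreover have "A = (\<lambda>(k, A). insert k A) (k, A - {k})" using k by auto
      ultimately show ?thesis by blast
    qed
  qed
  then have "card (?F (Suc b)) \<le> card (?F b \<union> (\<lambda>(k, A). insert k A) ` (V \<times> ?F b))"
    using Suc.prems fin by (intro card_mono) auto
  also have "\<dots> \<le> card (?F b) + card (V \<times> ?F b)"
    using Suc.prems fin by (intro order_trans[OF card_Un_le] add_left_mono card_image_le) auto
  also have "\<dots> = (card V + 1) * card (?F b)" by (simp add: card_cartesian_product)
  also have "\<dots> \<le> (card V + 1) * (card V + 1) ^ b" using Suc by (intro mult_left_mono) auto
  finally show ?case by simp
qed

lemma sum_card_power: "finite V \<Longrightarrow> (\<Sum>B\<in>Pow V. x ^ card B) = (1 + x :: real) ^ card V"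
proof (induction V rule: finite_induct)
  case (insert v V)
  have "(\<Sum>B\<in>Pow (insert v V). x ^ card B) = (\<Sum>B\<in>Pow V. x ^ card B) + (\<Sum>B\<in>insert v ` Pow V. x ^ card B)"
    unfolding Pow_insert using insert.hyps by (intro sum.union_disjoint) auto
  also have "(\<Sum>B\<in>insert v ` Pow V. x ^ card B) = (\<Sum>B\<in>Pow V. x ^ card (insert v B))"
    using insert.hyps by (subst sum.reindex) (auto simp: inj_on_def)
  also have "\<dots> = (\<Sum>B\<in>Pow V. x * x ^ card B)"
  proof (rule sum.cong[OF refl])
    fix B assume "B \<in> Pow V"
    then have "finite B" "v \<notin> B" using insert.hyps finite_subset by auto
    then show "x ^ card (insert v B) = x * x ^ card B" by simp
  qed
  finally show ?case using insert by (simp add: sum_distrib_left[symmetric] algebra_simps)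
qed simp

text \<open>A union bound over all pairs A and B by m-th powers. A normalized squared coefficient
  has m-th moment at most y ^ card B, there are at most (N + 1) ^ card B sets A, and summing over
  all nonempty B leaves (1 + (N + 1) * y) ^ N - 1. So m has to be large enough for y to beat N
  squared.\<close>

lemma av_link_coeffs:
  assumes N: "N > 0" and small: "real N * (real (N + 1) * (4 * real m * (real N * \<kappa>\<^sup>2)) ^ m) \<le> 1 / 8"
  defines "t \<equiv> (\<lambda>A B. (sqrt (real (card B)) / sqrt (real N)) ^ (card A + card B))"
  shows "av ({..<N} \<times> {..<N}) (\<lambda>S. \<Sum>B\<in>Pow {..<N} - {{}}. \<Sum>A | A \<subseteq> {..<N} \<and> card A \<le> card B. ((link_coeff \<kappa> N S A B)\<^sup>2 / t A B) ^ m) \<le> 1 / 4"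
proof -
  define y where "y = (4 * real m * (real N * \<kappa>\<^sup>2)) ^ m"
  have y0: "y \<ge> 0" by (simp add: y_def)
  have one: "av ({..<N} \<times> {..<N}) (\<lambda>S. ((link_coeff \<kappa> N S A B)\<^sup>2 / t A B) ^ m) \<le> y ^ card B"
    if A: "A \<subseteq> {..<N}" and B: "B \<subseteq> {..<N}" "B \<noteq> {}" and le: "card A \<le> card B" for A B
  proof -
    let ?a = "card A" and ?b = "card B"
    have b: "?b > 0" using B(2) finite_subset[OF B(1)] by (simp add: card_gt_0_iff)
    have t0: "t A B > 0" using b N by (simp add: t_def)
    define n where "n = sqrt (real N)"
    have n: "n > 0" "n * n = real N" using N by (simp_all add: n_def)
    have "n ^ (?b - ?a) * n ^ (?a + ?b) = n ^ (2 * ?b)"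
      unfolding power_add[symmetric] using le by (simp add: mult_2)
    also have "\<dots> = real N ^ ?b" unfolding power_mult power2_eq_square n(2) by (rule refl)
    finally have n': "n ^ (?b - ?a) = real N ^ ?b / n ^ (?a + ?b)" using n by (simp add: field_simps)
    have "\<kappa>\<^sup>2 ^ ?b * (real (2 * m) ^ ?b * (2 ^ ?b * sqrt (real ?b) ^ (?a + ?b) * n ^ (?b - ?a))) = (4 * real m * (real N * \<kappa>\<^sup>2)) ^ ?b * t A B"
    proof -
      have "(4 * real m * (real N * \<kappa>\<^sup>2)) ^ ?b = \<kappa>\<^sup>2 ^ ?b * (real (2 * m) ^ ?b * (2 ^ ?b * real N ^ ?b))"
        unfolding power_mult_distrib[symmetric] by (simp add: algebra_simps)
      then show ?thesis unfolding n' t_def n_def[symmetric] by (simp add: power_divide)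
    qed
    then have mom: "av ({..<N} \<times> {..<N}) (\<lambda>S. link_coeff \<kappa> N S A B ^ (2 * m)) \<le> ((4 * real m * (real N * \<kappa>\<^sup>2)) ^ ?b * t A B) ^ m"
      using link_coeff_moment[OF A B(1) le, of \<kappa> m] by (simp add: n_def)
    have "av ({..<N} \<times> {..<N}) (\<lambda>S. ((link_coeff \<kappa> N S A B)\<^sup>2 / t A B) ^ m) = 1 / t A B ^ m * av ({..<N} \<times> {..<N}) (\<lambda>S. link_coeff \<kappa> N S A B ^ (2 * m))"
      unfolding av_cmult[symmetric] by (simp add: power_divide power_mult)
    also have "\<dots> \<le> 1 / t A B ^ m * ((4 * real m * (real N * \<kappa>\<^sup>2)) ^ ?b * t A B) ^ m"
      using t0 by (intro mult_left_mono mom) simp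
    also have "\<dots> = ((4 * real m * (real N * \<kappa>\<^sup>2)) ^ ?b) ^ m" using t0 unfolding power_mult_distrib[of _ "t A B"] by simp
    also have "\<dots> = y ^ ?b" unfolding y_def by (simp only: power_mult[symmetric] mult.commute)
    finally show ?thesis .
  qed
  let ?x = "real (N + 1) * y"
  have "av ({..<N} \<times> {..<N}) (\<lambda>S. \<Sum>B\<in>Pow {..<N} - {{}}. \<Sum>A | A \<subseteq> {..<N} \<and> card A \<le> card B. ((link_coeff \<kappa> N S A B)\<^sup>2 / t A B) ^ m)
    \<le> (\<Sum>B\<in>Pow {..<N} - {{}}. \<Sum>A | A \<subseteq> {..<N} \<and> card A \<le> card B. y ^ card B)"
    unfolding av_sum by (intro sum_mono one) auto
  also have "\<dots> \<le> (\<Sum>B\<in>Pow {..<N} - {{}}. ?x ^ card B)"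
  proof (rule sum_mono)
    fix B assume "B \<in> Pow {..<N} - {{}}"
    have "(\<Sum>A | A \<subseteq> {..<N} \<and> card A \<le> card B. y ^ card B) = real (card {A. A \<subseteq> {..<N} \<and> card A \<le> card B}) * y ^ card B" by simp
    also have "\<dots> \<le> real ((card {..<N} + 1) ^ card B) * y ^ card B"
      unfolding of_nat_le_iff using y0 by (intro mult_right_mono of_nat_mono card_small_subsets) auto
    also have "\<dots> = ?x ^ card B" by (simp add: power_mult_distrib)
    finally show "(\<Sum>A | A \<subseteq> {..<N} \<and> card A \<le> card B. y ^ card B) \<le> ?x ^ card B" .
  qed
  also have "\<dots> = (1 + ?x) ^ N - 1"
    using sum_card_power[of "{..<N}" ?x] by (subst sum_diff) auto
  also have "\<dots> \<le> 2 * (real N * ?x)"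
    using one_plus_power_le[of ?x N] y0 small unfolding y_def[symmetric] by simp
  also have "\<dots> \<le> 1 / 4" using small unfolding y_def[symmetric] by simp
  finally show ?thesis .
qed

lemma av_link_form_power:
  assumes x: "x \<in> signs {..<N}"
  shows "av ({..<N} \<times> {j}) (\<lambda>S. link_form \<kappa> N S x j ^ (2 * r)) \<le> (real (2 * r) * (real N * \<kappa>\<^sup>2)) ^ r"
proof -
  have "av ({..<N} \<times> {j}) (\<lambda>S. (\<Sum>i<N. \<kappa> * x i * (\<Prod>v\<in>{(i, j)}. S v)) ^ (2 * r)) \<le> (\<Sum>i<N. real (2 * r) ^ card {(i, j)} * (\<kappa> * x i)\<^sup>2) ^ r"
    by (rule bonami_family) (auto simp: inj_on_def)
  moreover have "link_form \<kappa> N S x j = (\<Sum>i<N. \<kappa> * x i * (\<Prod>v\<in>{(i, j)}. S v))" for S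
    by (simp add: link_form_def sum_distrib_left ac_simps)
  moreover have "(\<Sum>i<N. real (2 * r) ^ card {(i, j)} * (\<kappa> * x i)\<^sup>2) = real (2 * r) * (real N * \<kappa>\<^sup>2)"
  proof -
    have "(\<kappa> * x i)\<^sup>2 = \<kappa>\<^sup>2" if "i < N" for i using signs_cases[OF x, of i] that by (auto simp: power_mult_distrib)
    then show ?thesis by simp
  qed
  ultimately show ?thesis by simp
qed

text \<open>For a fixed source vector the linear forms of different targets use different columns of
  S, hence are independent, and the average of the product is a product of averages. The product
  bounds the cost of clipping in \<open>link_tv\<close>.\<close>

lemma av_link_clip:
  assumes small: "real N * (2 * (real (2 * r) * (real N * \<kappa>\<^sup>2)) ^ r) \<le> 1 / 2"
  shows "av ({..<N} \<times> {..<N}) (\<lambda>S. av {..<N} (\<lambda>x. \<Prod>j<N. 1 + 2 * link_form \<kappa> N S x j ^ (2 * r))) \<le> 1 + 4 * (real N * (real (2 * r) * (real N * \<kappa>\<^sup>2)) ^ r)"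
proof -
  let ?e = "(real (2 * r) * (real N * \<kappa>\<^sup>2)) ^ r"
  have "av ({..<N} \<times> {..<N}) (\<lambda>S. \<Prod>j<N. 1 + 2 * link_form \<kappa> N S x j ^ (2 * r)) \<le> (1 + 2 * ?e) ^ N" if x: "x \<in> signs {..<N}" for x
  proof -
    have "av ({..<N} \<times> {..<N}) (\<lambda>S. \<Prod>j<N. 1 + 2 * link_form \<kappa> N S x j ^ (2 * r)) = (\<Prod>j<N. av ({..<N} \<times> {j}) (\<lambda>S. 1 + 2 * link_form \<kappa> N S x j ^ (2 * r)))"
      by (rule av_prod_columns) (simp_all add: link_form_def)
    also have "\<dots> \<le> (\<Prod>j<N. 1 + 2 * ?e)"
    proof (rule prod_mono)
      fix j
      have eq: "av ({..<N} \<times> {j}) (\<lambda>S. 1 + 2 * link_form \<kappa> N S x j ^ (2 * r)) = 1 + 2 * av ({..<N} \<times> {j}) (\<lambda>S. link_form \<kappa> N S x j ^ (2 * r))"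
        by (simp add: av_add av_cmult av_const)
      have "0 \<le> av ({..<N} \<times> {j}) (\<lambda>S. link_form \<kappa> N S x j ^ (2 * r))" by (rule av_nonneg) simp
      then show "0 \<le> av ({..<N} \<times> {j}) (\<lambda>S. 1 + 2 * link_form \<kappa> N S x j ^ (2 * r)) \<and>
        av ({..<N} \<times> {j}) (\<lambda>S. 1 + 2 * link_form \<kappa> N S x j ^ (2 * r)) \<le> 1 + 2 * ?e"
        unfolding eq using av_link_form_power[OF x, of j \<kappa> r] by simp
    qed
    finally show ?thesis by simp
  qed
  then have "av {..<N} (\<lambda>x. av ({..<N} \<times> {..<N}) (\<lambda>S. \<Prod>j<N. 1 + 2 * link_form \<kappa> N S x j ^ (2 * r))) \<le> av {..<N} (\<lambda>_. (1 + 2 * ?e) ^ N)"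
    by (rule av_mono)
  also have "\<dots> = (1 + 2 * ?e) ^ N" by (simp add: av_const)
  also have "\<dots> \<le> 1 + 2 * (real N * (2 * ?e))" by (rule one_plus_power_le) (use small in auto)
  finally show ?thesis unfolding av_swap[of "{..<N} \<times> {..<N}"] by simp
qed

section \<open>Operator norm of a random sign matrix\<close>

definition bilin :: "nat \<Rightarrow> (nat \<times> nat \<Rightarrow> real) \<Rightarrow> (nat \<Rightarrow> real) \<Rightarrow> (nat \<Rightarrow> real) \<Rightarrow> real" where
  "bilin N S z w = (\<Sum>i<N. \<Sum>j<N. z i * S (i, j) * w j)"

definition sqn :: "nat \<Rightarrow> (nat \<Rightarrow> real) \<Rightarrow> real" where
  "sqn N z = (\<Sum>i<N. (z i)\<^sup>2)"

lemma sqn_nonneg: "sqn N z \<ge> 0" by (simp add: sqn_def sum_nonneg)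

lemma av_bilin:
  "av ({..<N} \<times> {..<N}) (\<lambda>S. bilin N S z w ^ (2 * m)) \<le> (real (2 * m) * (sqn N z * sqn N w)) ^ m"
proof -
  have "av ({..<N} \<times> {..<N}) (\<lambda>S. (\<Sum>p\<in>{..<N} \<times> {..<N}. z (fst p) * w (snd p) * (\<Prod>v\<in>{p}. S v)) ^ (2 * m))
    \<le> (\<Sum>p\<in>{..<N} \<times> {..<N}. real (2 * m) ^ card {p} * (z (fst p) * w (snd p))\<^sup>2) ^ m"
    by (rule bonami_family) (auto simp: inj_on_def)
  moreover have "bilin N S z w = (\<Sum>p\<in>{..<N} \<times> {..<N}. z (fst p) * w (snd p) * (\<Prod>v\<in>{p}. S v))" for S
    by (simp add: bilin_def sum.cartesian_product case_prod_beta ac_simps)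
  moreover have "(\<Sum>p\<in>{..<N} \<times> {..<N}. real (2 * m) ^ card {p} * (z (fst p) * w (snd p))\<^sup>2) = real (2 * m) * (sqn N z * sqn N w)"
    unfolding sqn_def sum_product sum.cartesian_product by (simp add: case_prod_beta sum_distrib_left power_mult_distrib)
  ultimately show ?thesis by simp
qed

text \<open>Each pair of net points contributes at most 1 / K ^ m, so K ^ m only has to exceed four
  times the number of pairs.\<close>

lemma av_bilin_net:
  assumes Z: "finite Z" and K: "K > 0" and m: "m > 0" and card: "4 * real (card Z) ^ 2 \<le> K ^ m"
  shows "av ({..<N} \<times> {..<N}) (\<lambda>S. \<Sum>z\<in>Z. \<Sum>w\<in>Z. ((bilin N S z w)\<^sup>2 / (real (2 * m) * K * (sqn N z * sqn N w))) ^ m) \<le> 1 / 4"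
proof -
  have one: "av ({..<N} \<times> {..<N}) (\<lambda>S. ((bilin N S z w)\<^sup>2 / (real (2 * m) * K * (sqn N z * sqn N w))) ^ m) \<le> 1 / K ^ m" for z w
  proof -
    let ?s = "real (2 * m) * (sqn N z * sqn N w)"
    have s0: "?s \<ge> 0" by (simp add: sqn_nonneg)
    have "((bilin N S z w)\<^sup>2 / (real (2 * m) * K * (sqn N z * sqn N w))) ^ m = 1 / (?s * K) ^ m * bilin N S z w ^ (2 * m)" for S
      by (simp add: power_divide power_mult[symmetric] power_mult_distrib[symmetric] ac_simps)
    then have "av ({..<N} \<times> {..<N}) (\<lambda>S. ((bilin N S z w)\<^sup>2 / (real (2 * m) * K * (sqn N z * sqn N w))) ^ m) = 1 / (?s * K) ^ m * av ({..<N} \<times> {..<N}) (\<lambda>S. bilin N S z w ^ (2 * m))"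
      by (simp only: av_cmult)
    also have "\<dots> \<le> 1 / (?s * K) ^ m * ?s ^ m"
      using s0 K by (intro mult_left_mono av_bilin) simp
    also have "\<dots> \<le> 1 / K ^ m"
      using s0 K m by (cases "?s = 0") (auto simp: power_mult_distrib zero_power)
    finally show ?thesis .
  qed
  have "av ({..<N} \<times> {..<N}) (\<lambda>S. \<Sum>z\<in>Z. \<Sum>w\<in>Z. ((bilin N S z w)\<^sup>2 / (real (2 * m) * K * (sqn N z * sqn N w))) ^ m) \<le> (\<Sum>z\<in>Z. \<Sum>w\<in>Z. 1 / K ^ m)"
    unfolding av_sum by (intro sum_mono one)
  also have "\<dots> = real (card Z) ^ 2 / K ^ m" by (simp add: power2_eq_square)
  also have "\<dots> \<le> 1 / 4" using card K by (simp add: field_simps)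
  finally show ?thesis .
qed

text \<open>The probabilistic method: three nonnegative quantities with averages at most 1/4 are all
  below 1 for a common S. Where such a quantity is a sum of powers, each single base is then at most
  1.\<close>

theorem good_matrix:
  fixes \<kappa> K :: real
  assumes N: "N > 0" and m: "m > 0" "m' > 0" and \<kappa>: "\<kappa> > 0" and r: "r > 0"
    and small: "real N * (real (N + 1) * (4 * real m * (real N * \<kappa>\<^sup>2)) ^ m) \<le> 1 / 8"
    and clip: "real N * (2 * (real (2 * r) * (real N * \<kappa>\<^sup>2)) ^ r) \<le> 1 / 2"
    and Z: "finite Z" and K: "K > 0" and card: "4 * real (card Z) ^ 2 \<le> K ^ m'"
  obtains S where "S \<in> signs ({..<N} \<times> {..<N})"
    and "\<And>A B. A \<subseteq> {..<N} \<Longrightarrow> B \<subseteq> {..<N} \<Longrightarrow> B \<noteq> {} \<Longrightarrow> (link_coeff \<kappa> N S A B)\<^sup>2 \<le> (sqrt (real (card B)) / sqrt (real N)) ^ (card A + card B)"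
    and "av {..<N} (\<lambda>x. \<Prod>j<N. 1 + 2 * link_form \<kappa> N S x j ^ (2 * r)) \<le> 1 + 16 * (real N * (real (2 * r) * (real N * \<kappa>\<^sup>2)) ^ r)"
    and "\<And>z w. z \<in> Z \<Longrightarrow> w \<in> Z \<Longrightarrow> (bilin N S z w)\<^sup>2 \<le> real (2 * m') * K * (sqn N z * sqn N w)"
proof -
  let ?V = "{..<N} \<times> {..<N}"
  define t where "t = (\<lambda>(A :: nat set) (B :: nat set). (sqrt (real (card B)) / sqrt (real N)) ^ (card A + card B))"
  define v where "v = 4 * (real N * (real (2 * r) * (real N * \<kappa>\<^sup>2)) ^ r)"
  have v: "v > 0" using N \<kappa> r by (simp add: v_def)
  define f1 where "f1 = (\<lambda>S. \<Sum>B\<in>Pow {..<N} - {{}}. \<Sum>A | A \<subseteq> {..<N} \<and> card A \<le> card B. ((link_coeff \<kappa> N S A B)\<^sup>2 / t A B) ^ m)"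
  define Y where "Y = (\<lambda>S. av {..<N} (\<lambda>x. \<Prod>j<N. 1 + 2 * link_form \<kappa> N S x j ^ (2 * r)))"
  define f3 where "f3 = (\<lambda>S. \<Sum>z\<in>Z. \<Sum>w\<in>Z. ((bilin N S z w)\<^sup>2 / (real (2 * m') * K * (sqn N z * sqn N w))) ^ m')"
  have fV: "finite ?V" by simp
  have tp: "t A B > 0" if "B \<subseteq> {..<N}" "B \<noteq> {}" for A B
  proof -
    have "card B > 0" using that finite_subset[OF that(1)] by (simp add: card_gt_0_iff)
    then show "t A B > 0" using N by (simp add: t_def)
  qed
  have Y1: "Y S \<ge> 1" for S
  proof -
    have "av {..<N} (\<lambda>x. 1) \<le> Y S" unfolding Y_def by (intro av_mono prod_ge_1) simp
    then show ?thesis by (simp add: av_const)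
  qed
  have "av ?V f1 \<le> 1 / 4" unfolding f1_def t_def by (rule av_link_coeffs[OF N small])
  moreover have "av ?V f3 \<le> 1 / 4" unfolding f3_def by (rule av_bilin_net[OF Z K m(2) card])
  \<comment> \<open>Y is at least 1, so its excess over 1 serves as the third quantity, scaled to
    have average at most 1/4.\<close>
  moreover have "av ?V (\<lambda>S. 1 / (4 * v) * (Y S + (-1))) \<le> 1 / 4"
  proof -
    have "av ?V Y \<le> 1 + v" unfolding Y_def v_def by (rule av_link_clip[OF clip])
    then show ?thesis unfolding av_cmult av_add av_const[OF fV] using v by (simp add: field_simps)
  qed
  ultimately have "av ?V (\<lambda>S. f1 S + (1 / (4 * v) * (Y S + (-1)) + f3 S)) < 1" unfolding av_add by simp
  then obtain S where S: "S \<in> signs ?V" and lt: "f1 S + (1 / (4 * v) * (Y S + (-1)) + f3 S) < 1"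
    using av_small[OF fV] by blast
  have f1: "f1 S \<ge> 0" unfolding f1_def t_def by (intro sum_nonneg) simp
  have f3: "f3 S \<ge> 0" unfolding f3_def by (intro sum_nonneg) (use K in \<open>simp add: sqn_nonneg\<close>)
  have f2: "1 / (4 * v) * (Y S + (-1)) \<ge> 0" using v Y1[of S] by simp
  show thesis
  proof (rule that[OF S])
    fix A B assume A: "A \<subseteq> {..<N}" and B: "B \<subseteq> {..<N}" "B \<noteq> {}"
    have fB: "finite B" using B finite_subset by blast
    show "(link_coeff \<kappa> N S A B)\<^sup>2 \<le> (sqrt (real (card B)) / sqrt (real N)) ^ (card A + card B)"
    proof (cases "card A \<le> card B")
      case True
      have "((link_coeff \<kappa> N S A B)\<^sup>2 / t A B) ^ m \<le> (\<Sum>A | A \<subseteq> {..<N} \<and> card A \<le> card B. ((link_coeff \<kappa> N S A B)\<^sup>2 / t A B) ^ m)"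
        using A True by (intro member_le_sum) (auto simp: t_def)
      also have "\<dots> \<le> f1 S" unfolding f1_def
        using B by (intro member_le_sum[of B]) (auto simp: t_def intro!: sum_nonneg)
      finally have le: "((link_coeff \<kappa> N S A B)\<^sup>2 / t A B) ^ m \<le> 1" using lt f2 f3 by linarith
      have "(link_coeff \<kappa> N S A B)\<^sup>2 / t A B \<le> 1" by (rule power_le_one_imp[OF le m(1)])
      then have "(link_coeff \<kappa> N S A B)\<^sup>2 \<le> t A B" using tp[OF B, of A] by simp
      then show ?thesis by (simp only: t_def)
    qed (use link_coeff_zero[OF A fB] in simp)
  next
    have "1 / (4 * v) * (Y S + (-1)) < 1" using lt f1 f3 by linarith
    then have "Y S \<le> 1 + 4 * v" using v by (simp add: field_simps)
    then show "av {..<N} (\<lambda>x. \<Prod>j<N. 1 + 2 * link_form \<kappa> N S x j ^ (2 * r)) \<le> 1 + 16 * (real N * (real (2 * r) * (real N * \<kappa>\<^sup>2)) ^ r)"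
      by (simp add: Y_def v_def)
  next
    fix z w assume z: "z \<in> Z" and w: "w \<in> Z"
    let ?q = "real (2 * m') * K * (sqn N z * sqn N w)"
    show "(bilin N S z w)\<^sup>2 \<le> ?q"
    proof (cases "sqn N z * sqn N w = 0")
      case True
      then have "(\<forall>i<N. z i = 0) \<or> (\<forall>j<N. w j = 0)"
        by (auto simp: sqn_def sum_nonneg_eq_0_iff)
      then have "bilin N S z w = 0" by (auto simp: bilin_def)
      then show ?thesis unfolding True by simp
    next
      case False
      have "0 \<le> sqn N z * sqn N w" by (simp add: sqn_nonneg)
      then have "0 < sqn N z * sqn N w" using False by linarith
      then have q: "?q > 0" using K m by simp
      have nn: "0 \<le> ((bilin N S z w)\<^sup>2 / (real (2 * m') * K * (sqn N z * sqn N w))) ^ m'" for z w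
        using K by (simp add: sqn_nonneg)
      have "((bilin N S z w)\<^sup>2 / ?q) ^ m' \<le> (\<Sum>w\<in>Z. ((bilin N S z w)\<^sup>2 / (real (2 * m') * K * (sqn N z * sqn N w))) ^ m')"
        by (rule member_le_sum[OF w nn Z])
      also have "\<dots> \<le> f3 S" unfolding f3_def
        by (rule member_le_sum[OF z sum_nonneg[OF nn] Z])
      finally have le: "((bilin N S z w)\<^sup>2 / ?q) ^ m' \<le> 1" using lt f2 f1 by linarith
      have "(bilin N S z w)\<^sup>2 / ?q \<le> 1" by (rule power_le_one_imp[OF le m(2)])
      then show ?thesis using q by (simp only: pos_divide_le_eq mult_1)
    qed
  qed
qed

lemma bilin_add_left: "bilin N S (\<lambda>i. x i + x' i) y = bilin N S x y + bilin N S x' y"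
  by (simp add: bilin_def algebra_simps sum.distrib)

lemma bilin_add_right: "bilin N S x (\<lambda>i. y i + y' i) = bilin N S x y + bilin N S x y'"
  by (simp add: bilin_def algebra_simps sum.distrib)

lemma bilin_scale_left: "bilin N S (\<lambda>i. c * x i) y = c * bilin N S x y"
  by (simp add: bilin_def sum_distrib_left ac_simps)

lemma bilin_scale_right: "bilin N S x (\<lambda>i. c * y i) = c * bilin N S x y"
  by (simp add: bilin_def sum_distrib_left ac_simps)

lemma bilin_cong: "(\<And>i. i < N \<Longrightarrow> x i = x' i) \<Longrightarrow> (\<And>i. i < N \<Longrightarrow> y i = y' i) \<Longrightarrow> bilin N S x y = bilin N S x' y'"
  by (simp add: bilin_def)

lemma sqn_scale: "sqn N (\<lambda>i. c * x i) = c\<^sup>2 * sqn N x"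
  by (simp add: sqn_def power_mult_distrib sum_distrib_left)

lemma sqn_component: "i < N \<Longrightarrow> (x i)\<^sup>2 \<le> sqn N x"
  unfolding sqn_def by (rule member_le_sum) auto

text \<open>The coordinates are rounded towards zero, so that rounding does not increase the norm.\<close>

lemma round_vector:
  fixes q :: int
  assumes N: "N > 0" and q: "4 * sqrt (real N) \<le> real_of_int q" and x: "sqn N x \<le> 1"
  obtains z r where "z \<in> {..<N} \<rightarrow>\<^sub>E real_of_int ` {-q..q}" "\<And>i. i < N \<Longrightarrow> x i = 1 / (4 * sqrt (real N)) * z i + 1 / 4 * r i"
    "sqn N z \<le> 16 * real N" "sqn N r \<le> 1"
proof -
  \<comment> \<open>On a grid of width 1 / s a coordinate moves by at most 1 / s, so the error
    vector has norm at most sqrt N / s = 1/4.\<close>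
  define s where "s = 4 * sqrt (real N)"
  have s: "s > 0" "s\<^sup>2 = 16 * real N" using N by (simp_all add: s_def power_mult_distrib)
  define t where "t = (\<lambda>u :: real. if u \<ge> 0 then \<lfloor>u\<rfloor> else \<lceil>u\<rceil>)"
  have t_abs: "\<bar>real_of_int (t u)\<bar> \<le> \<bar>u\<bar>" for u
  proof (cases "u \<ge> 0")
    case True
    then show ?thesis by (simp add: t_def)
  next
    case False
    then have "\<lceil>u\<rceil> \<le> 0" by (simp add: ceiling_le_iff)
    then show ?thesis using False le_of_int_ceiling[of u] by (simp add: t_def)
  qed
  have t_near: "\<bar>u - real_of_int (t u)\<bar> \<le> 1" for u
    unfolding t_def by (cases "u \<ge> 0") (simp, linarith)+
  define z where "z = (\<lambda>i\<in>{..<N}. real_of_int (t (s * x i)))"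
  define r where "r = (\<lambda>i. 4 / s * (s * x i - real_of_int (t (s * x i))))"
  have xa: "\<bar>x i\<bar> \<le> 1" if "i < N" for i
    using order_trans[OF sqn_component[OF that] x] by (simp add: abs_square_le_1)
  show thesis
  proof (rule that[of z r])
    show "z \<in> {..<N} \<rightarrow>\<^sub>E real_of_int ` {-q..q}"
      unfolding z_def
    proof (rule restrict_PiE_iff[THEN iffD2], rule ballI)
      fix i assume "i \<in> {..<N}"
      then have "\<bar>s * x i\<bar> \<le> s * 1" using s xa[of i] unfolding abs_mult by (intro mult_mono) auto
      then have "\<bar>real_of_int (t (s * x i))\<bar> \<le> real_of_int q" using t_abs[of "s * x i"] q unfolding s_def by linarith
      then have "t (s * x i) \<in> {-q..q}" by auto
      then show "real_of_int (t (s * x i)) \<in> real_of_int ` {-q..q}" by blast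
    qed
    show "x i = 1 / (4 * sqrt (real N)) * z i + 1 / 4 * r i" if "i < N" for i
      unfolding s_def[symmetric] using that s by (simp add: z_def r_def field_simps)
    have "sqn N z \<le> (\<Sum>i<N. (s * x i)\<^sup>2)" unfolding sqn_def z_def
      using t_abs by (intro sum_mono) (simp add: abs_le_square_iff[symmetric])
    also have "\<dots> = 16 * real N * sqn N x" by (simp add: sqn_def power_mult_distrib s sum_distrib_left)
    also have "\<dots> \<le> 16 * real N * 1" by (intro mult_left_mono x) simp
    finally show "sqn N z \<le> 16 * real N" by simp
    have "sqn N r \<le> (\<Sum>i<N. (4 / s)\<^sup>2)" unfolding sqn_def r_def power_mult_distrib
      using t_near by (intro sum_mono) (simp add: mult_left_le abs_square_le_1)
    also have "\<dots> = 1" using N by (simp add: power_divide s)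
    finally show "sqn N r \<le> 1" .
  qed
qed

text \<open>Let s be the supremum over the unit balls, which is finite by the crude entrywise bound.
  Rounding an argument to the net leaves a remainder of norm at most 1/4 and so a term of at most s
  / 4. Rounding both arguments gives s <= C + s / 2.\<close>

theorem bilin_bound:
  fixes q :: int
  assumes N: "N > 0" and q: "4 * sqrt (real N) \<le> real_of_int q"
    and net: "\<And>z w. z \<in> {..<N} \<rightarrow>\<^sub>E real_of_int ` {-q..q} \<Longrightarrow> w \<in> {..<N} \<rightarrow>\<^sub>E real_of_int ` {-q..q} \<Longrightarrow> (bilin N S z w)\<^sup>2 \<le> C\<^sup>2 * (sqn N z * sqn N w)"
    and C: "C \<ge> 0"
  shows "\<bar>bilin N S x y\<bar> \<le> 2 * C * (sqrt (sqn N x) * sqrt (sqn N y))"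
proof -
  define X where "X = {(x, y). sqn N x \<le> 1 \<and> sqn N y \<le> 1}"
  define s where "s = (SUP (x, y)\<in>X. \<bar>bilin N S x y\<bar>)"
  have bnd: "\<bar>bilin N S x y\<bar> \<le> (\<Sum>i<N. \<Sum>j<N. \<bar>S (i, j)\<bar>)" if "sqn N x \<le> 1" "sqn N y \<le> 1" for x y
    unfolding bilin_def
  proof (rule order_trans[OF sum_abs], rule sum_mono, rule order_trans[OF sum_abs], rule sum_mono)
    fix i j assume "i \<in> {..<N}" "j \<in> {..<N}"
    then have "\<bar>x i\<bar> \<le> 1" "\<bar>y j\<bar> \<le> 1"
      using order_trans[OF sqn_component that(1)] order_trans[OF sqn_component that(2)] by (simp_all add: abs_square_le_1)
    then have "\<bar>x i\<bar> * \<bar>y j\<bar> * \<bar>S (i, j)\<bar> \<le> 1 * 1 * \<bar>S (i, j)\<bar>"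
      by (intro mult_right_mono mult_mono) auto
    then show "\<bar>x i * S (i, j) * y j\<bar> \<le> \<bar>S (i, j)\<bar>" by (simp add: abs_mult ac_simps)
  qed
  have bdd: "bdd_above ((\<lambda>(x, y). \<bar>bilin N S x y\<bar>) ` X)"
    using bnd by (intro bdd_aboveI) (auto simp: X_def)
  have le_s: "\<bar>bilin N S x y\<bar> \<le> s" if "sqn N x \<le> 1" "sqn N y \<le> 1" for x y
    unfolding s_def using cSUP_upper[OF _ bdd, of "(x, y)"] that by (simp add: X_def)
  have s2: "s \<le> 2 * C"
  proof -
    have "\<bar>bilin N S x y\<bar> \<le> C + s / 2" if xy: "sqn N x \<le> 1" "sqn N y \<le> 1" for x y
    proof -
      define c where "c = 1 / (4 * sqrt (real N))"
      have c: "c > 0" "c\<^sup>2 * (16 * real N) = 1" using N by (simp_all add: c_def power_divide power_mult_distrib)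
      obtain z r where z: "z \<in> {..<N} \<rightarrow>\<^sub>E real_of_int ` {-q..q}" and xz: "\<And>i. i < N \<Longrightarrow> x i = c * z i + 1 / 4 * r i"
        and nz: "sqn N z \<le> 16 * real N" and nr: "sqn N r \<le> 1" using round_vector[OF N q xy(1)] unfolding c_def by blast
      obtain w r' where w: "w \<in> {..<N} \<rightarrow>\<^sub>E real_of_int ` {-q..q}" and yw: "\<And>i. i < N \<Longrightarrow> y i = c * w i + 1 / 4 * r' i"
        and nw: "sqn N w \<le> 16 * real N" and nr': "sqn N r' \<le> 1" using round_vector[OF N q xy(2)] unfolding c_def by blast
      have "bilin N S x y = bilin N S (\<lambda>i. c * z i + 1 / 4 * r i) y" using xz by (intro bilin_cong) auto
      also have "\<dots> = bilin N S (\<lambda>i. c * z i) y + 1 / 4 * bilin N S r y" unfolding bilin_add_left bilin_scale_left by (rule refl)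
      also have "bilin N S (\<lambda>i. c * z i) y = bilin N S (\<lambda>i. c * z i) (\<lambda>i. c * w i + 1 / 4 * r' i)" using yw by (intro bilin_cong) auto
      also have "\<dots> = c\<^sup>2 * bilin N S z w + 1 / 4 * bilin N S (\<lambda>i. c * z i) r'"
        unfolding bilin_add_right bilin_scale_right bilin_scale_left by (simp add: power2_eq_square)
      finally have eq: "bilin N S x y = c\<^sup>2 * bilin N S z w + 1 / 4 * bilin N S (\<lambda>i. c * z i) r' + 1 / 4 * bilin N S r y" .
      have "(c\<^sup>2 * bilin N S z w)\<^sup>2 \<le> (c\<^sup>2)\<^sup>2 * (C\<^sup>2 * (sqn N z * sqn N w))"
        unfolding power_mult_distrib[of "c\<^sup>2"] by (intro mult_left_mono net z w) simp
      also have "\<dots> \<le> (c\<^sup>2)\<^sup>2 * (C\<^sup>2 * (16 * real N * (16 * real N)))"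
        by (intro mult_left_mono mult_mono nz nw) (auto simp: sqn_nonneg)
      also have "\<dots> = C\<^sup>2 * (c\<^sup>2 * (16 * real N)) * (c\<^sup>2 * (16 * real N))" by (simp add: power2_eq_square)
      also have "\<dots> = C\<^sup>2" unfolding c(2) by simp
      finally have 1: "\<bar>c\<^sup>2 * bilin N S z w\<bar> \<le> C" using C by (simp only: abs_le_square_iff[symmetric] abs_of_nonneg)
      have "sqn N (\<lambda>i. c * z i) \<le> c\<^sup>2 * (16 * real N)" unfolding sqn_scale by (intro mult_left_mono nz) simp
      then have 2: "\<bar>bilin N S (\<lambda>i. c * z i) r'\<bar> \<le> s" unfolding c(2) by (intro le_s nr')
      have 3: "\<bar>bilin N S r y\<bar> \<le> s" by (intro le_s nr xy)
      show ?thesis using 1 2 3 unfolding eq by linarith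
    qed
    moreover have "(\<lambda>_. 0, \<lambda>_. 0) \<in> X" by (simp add: X_def sqn_def)
    ultimately have "s \<le> C + s / 2" unfolding s_def by (intro cSUP_least) (auto simp: X_def)
    then show ?thesis by simp
  qed
  show ?thesis
  proof (cases "sqn N x = 0 \<or> sqn N y = 0")
    case True
    then have "(\<forall>i<N. x i = 0) \<or> (\<forall>j<N. y j = 0)" by (auto simp: sqn_def sum_nonneg_eq_0_iff)
    then have "bilin N S x y = 0" by (auto simp: bilin_def)
    then show ?thesis using C by (simp add: sqn_nonneg)
  next
    case False
    define a b where "a = sqrt (sqn N x)" and "b = sqrt (sqn N y)"
    have ab: "a > 0" "b > 0" "a\<^sup>2 = sqn N x" "b\<^sup>2 = sqn N y"
      using False sqn_nonneg[of N x] sqn_nonneg[of N y] by (auto simp: a_def b_def)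
    have "\<bar>bilin N S (\<lambda>i. 1 / a * x i) (\<lambda>i. 1 / b * y i)\<bar> \<le> s"
      by (rule le_s) (use ab in \<open>simp_all only: sqn_scale power_divide, simp_all\<close>)
    then have "\<bar>bilin N S x y\<bar> / (a * b) \<le> 2 * C"
      using s2 ab unfolding bilin_scale_left bilin_scale_right by (simp add: abs_mult)
    then show ?thesis unfolding a_def[symmetric] b_def[symmetric] using ab by (simp add: pos_divide_le_eq)
  qed
qed

text \<open>The form is evaluated at the image vector itself, where it equals the squared norm of
  that vector; one factor of the norm cancels.\<close>

lemma sqn_image_bound:
  assumes "\<And>x y. \<bar>bilin N S x y\<bar> \<le> D * (sqrt (sqn N x) * sqrt (sqn N y))"
  shows "sqn N (\<lambda>i. \<Sum>j<N. S (i, j) * y j) \<le> D\<^sup>2 * sqn N y"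
    and "sqn N (\<lambda>j. \<Sum>i<N. S (i, j) * y i) \<le> D\<^sup>2 * sqn N y"
proof -
  have fin: "p \<le> D\<^sup>2 * n" if p: "p \<ge> 0" "n \<ge> 0" and le: "p \<le> D * (sqrt p * sqrt n)" for p n
  proof (cases "p = 0")
    case False
    then have "sqrt p > 0" using p by simp
    moreover have "sqrt p * sqrt p \<le> (D * sqrt n) * sqrt p" using le p by (simp add: ac_simps)
    ultimately have "sqrt p \<le> D * sqrt n" using mult_right_le_imp_le by blast
    then have "(sqrt p)\<^sup>2 \<le> (D * sqrt n)\<^sup>2" using p by (intro power_mono) auto
    then show ?thesis using p by (simp add: power_mult_distrib)
  qed (use p in simp)
  let ?u = "\<lambda>i. \<Sum>j<N. S (i, j) * y j" and ?v = "\<lambda>j. \<Sum>i<N. S (i, j) * y i"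
  have "bilin N S ?u y = sqn N ?u"
    by (simp add: bilin_def sqn_def power2_eq_square sum_distrib_left ac_simps)
  then show "sqn N ?u \<le> D\<^sup>2 * sqn N y" using assms[of ?u y] by (intro fin) (auto simp: sqn_nonneg)
  have "bilin N S y ?v = (\<Sum>j<N. \<Sum>i<N. y i * S (i, j) * ?v j)"
    unfolding bilin_def by (rule sum.swap)
  also have "\<dots> = sqn N ?v"
    unfolding sqn_def power2_eq_square by (intro sum.cong refl) (simp add: sum_distrib_right ac_simps)
  finally show "sqn N ?v \<le> D\<^sup>2 * sqn N y" using assms[of y ?v] by (intro fin) (auto simp: sqn_nonneg ac_simps)
qed

section \<open>Chains of correlated sign vectors\<close>

lemma av_prod_single:
  assumes "finite V"
  shows "av V (\<lambda>x. \<Prod>j\<in>V. g j (x j)) = (\<Prod>j\<in>V. (g j 1 + g j (-1)) / 2)"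
proof -
  have "(\<Sum>x\<in>signs V. \<Prod>j\<in>V. g j (x j)) = (\<Prod>j\<in>V. \<Sum>y\<in>{-1, 1}. g j y)"
    unfolding signs_def using prod_sum_PiE[of V "\<lambda>_. {-1, 1}" g] assms by simp
  then show ?thesis unfolding av_def by (simp add: prod_dividef add.commute)
qed

definition pairs :: "nat \<Rightarrow> ((nat \<Rightarrow> real) \<times> (nat \<Rightarrow> real)) set" where
  "pairs N = signs {..<N} \<times> signs {..<N}"

text \<open>The weight is signed if some linear form exceeds 1; the honest weight below makes such links uniform.\<close>

definition signed_weight :: "real \<Rightarrow> nat \<Rightarrow> (nat \<times> nat \<Rightarrow> real) \<Rightarrow> (nat \<Rightarrow> real) \<times> (nat \<Rightarrow> real) \<Rightarrow> real" where
  "signed_weight k N S e = (\<Prod>j<N. 1 + snd e j * link_form k N S (fst e) j) / 4 ^ N"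

definition honest_weight :: "real \<Rightarrow> nat \<Rightarrow> (nat \<times> nat \<Rightarrow> real) \<Rightarrow> (nat \<Rightarrow> real) \<times> (nat \<Rightarrow> real) \<Rightarrow> real" where
  "honest_weight k N S e = (if \<forall>j<N. \<bar>link_form k N S (fst e) j\<bar> \<le> 1 then signed_weight k N S e else 1 / 4 ^ N)"

lemma sum_pairs: "(\<Sum>e\<in>pairs N. F (fst e) (snd e)) = 4 ^ N * av {..<N} (\<lambda>a. av {..<N} (\<lambda>b. F a b))"
proof -
  have "(\<Sum>e\<in>pairs N. F (fst e) (snd e)) = (\<Sum>a\<in>signs {..<N}. \<Sum>b\<in>signs {..<N}. F a b)"
    unfolding pairs_def by (simp add: sum.cartesian_product case_prod_beta)
  also have "\<dots> = 4 ^ N * av {..<N} (\<lambda>a. av {..<N} (\<lambda>b. F a b))"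
    unfolding av_def by (simp add: sum_divide_distrib[symmetric] power_mult_distrib[symmetric] mult.assoc[symmetric])
  finally show ?thesis .
qed

lemma finite_pairs: "finite (pairs N)"
  by (simp add: pairs_def finite_signs)

text \<open>Averaged over the target vector b, the factor 1 + b j * u j yields u j if j lies in B
  and 1 otherwise.\<close>

lemma link_fourier:
  assumes B: "B \<subseteq> {..<N}"
  shows "(\<Sum>e\<in>pairs N. signed_weight k N S e * ((\<Prod>i\<in>A. fst e i) * (\<Prod>j\<in>B. snd e j))) = link_coeff k N S A B"
proof -
  have inner: "av {..<N} (\<lambda>b. (\<Prod>j<N. 1 + b j * u j) * (\<Prod>j\<in>B. b j)) = (\<Prod>j\<in>B. u j)" for u
  proof -
    have B': "{..<N} \<inter> B = B" using B by auto
    have pB: "(\<Prod>j<N. if j \<in> B then F j else 1) = (\<Prod>j\<in>B. F j)" for F :: "nat \<Rightarrow> real"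
      using prod.inter_restrict[of "{..<N}" F B] by (simp add: B')
    have "av {..<N} (\<lambda>b. (\<Prod>j<N. 1 + b j * u j) * (\<Prod>j\<in>B. b j)) = av {..<N} (\<lambda>b. \<Prod>j<N. (1 + b j * u j) * (if j \<in> B then b j else 1))"
      by (simp add: prod.distrib pB)
    also have "\<dots> = (\<Prod>j<N. ((1 + 1 * u j) * (if j \<in> B then 1 else 1) + (1 + -1 * u j) * (if j \<in> B then -1 else 1)) / 2)"
      by (rule av_prod_single[where g = "\<lambda>j y. (1 + y * u j) * (if j \<in> B then y else 1)"]) simp
    also have "\<dots> = (\<Prod>j<N. if j \<in> B then u j else 1)" by (intro prod.cong refl) auto
    finally show ?thesis by (simp add: pB)
  qed
  have "(\<Sum>e\<in>pairs N. signed_weight k N S e * ((\<Prod>i\<in>A. fst e i) * (\<Prod>j\<in>B. snd e j)))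
    = 4 ^ N * av {..<N} (\<lambda>a. av {..<N} (\<lambda>b. (\<Prod>i\<in>A. a i) / 4 ^ N * ((\<Prod>j<N. 1 + b j * link_form k N S a j) * (\<Prod>j\<in>B. b j))))"
    unfolding signed_weight_def
    by (subst sum_pairs[symmetric]) (simp add: ac_simps)
  also have "\<dots> = 4 ^ N * av {..<N} (\<lambda>a. (\<Prod>i\<in>A. a i) / 4 ^ N * (\<Prod>j\<in>B. link_form k N S a j))"
    unfolding av_cmult inner by (rule refl)
  also have "\<dots> = link_coeff k N S A B"
    unfolding link_coeff_def av_cmult[symmetric] by simp
  finally show ?thesis .
qed

lemma link_coeff_empty: "link_coeff k N S {} {} = 1"
  by (simp add: link_coeff_def av_const)

lemma signed_weight_sum: "(\<Sum>e\<in>pairs N. signed_weight k N S e) = 1"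
  using link_fourier[of "{}" N k S "{}"] by (simp add: link_coeff_empty)

lemma signed_weight_inner:
  "av {..<N} (\<lambda>b. signed_weight k N S (a, b)) = 1 / 4 ^ N"
proof -
  have "av {..<N} (\<lambda>b. \<Prod>j<N. 1 + b j * link_form k N S a j) = 1"
    using av_prod_single[of "{..<N}" "\<lambda>j y. 1 + y * link_form k N S a j"] by simp
  then show ?thesis using av_cmult[of "{..<N}" "1 / 4 ^ N"] by (simp add: signed_weight_def)
qed

text \<open>Clipping acts on one source vector at a time, and for each of them the signed and the
  uniform weight have the same total.\<close>

lemma honest_weight_sum: "(\<Sum>e\<in>pairs N. honest_weight k N S e) = 1"
proof -
  have "av {..<N} (\<lambda>b. honest_weight k N S (a, b)) = 1 / 4 ^ N" for a
  proof (cases "\<forall>j<N. \<bar>link_form k N S a j\<bar> \<le> 1")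
    case True
    then have "honest_weight k N S (a, b) = signed_weight k N S (a, b)" for b by (simp add: honest_weight_def)
    then show ?thesis by (simp add: signed_weight_inner)
  next
    case False
    then have "honest_weight k N S (a, b) = 1 / 4 ^ N" for b by (auto simp: honest_weight_def)
    then show ?thesis by (simp add: av_const)
  qed
  then show ?thesis using sum_pairs[of "\<lambda>a b. honest_weight k N S (a, b)" N] by (simp add: av_const)
qed

lemma honest_weight_nonneg: "e \<in> pairs N \<Longrightarrow> 0 \<le> honest_weight k N S e"
proof -
  assume e: "e \<in> pairs N"
  show ?thesis
  proof (cases "\<forall>j<N. \<bar>link_form k N S (fst e) j\<bar> \<le> 1")
    case True
    have "0 \<le> 1 + snd e j * link_form k N S (fst e) j" if "j < N" for j
    proof -
      have "snd e j = 1 \<or> snd e j = -1" using e that signs_cases[of "snd e" "{..<N}" j] by (auto simp: pairs_def)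
      moreover have "\<bar>link_form k N S (fst e) j\<bar> \<le> 1" using True that by blast
      ultimately show ?thesis by auto
    qed
    then have "0 \<le> signed_weight k N S e" unfolding signed_weight_def by (intro divide_nonneg_nonneg prod_nonneg) auto
    then show ?thesis using True by (simp add: honest_weight_def)
  next
    case False
    then show ?thesis unfolding honest_weight_def if_not_P[OF False] by simp
  qed
qed

text \<open>A bound of the form product minus 1 is nonnegative for every source vector, so it also
  covers those where clipping changes nothing. The factor 2 at the power of u j0 pays for both
  summands on the left.\<close>

lemma clip_factor:
  assumes J: "finite J" and j0: "j0 \<in> J" "\<bar>u j0\<bar> > 1" and r: "r > 0"
  shows "1 + (\<Prod>j\<in>J. max 1 \<bar>u j\<bar>) \<le> (\<Prod>j\<in>J. 1 + 2 * u j ^ (2 * r)) - (1 :: real)"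
proof -
  have pw: "\<bar>v\<bar> \<le> v ^ (2 * r)" if "\<bar>v\<bar> \<ge> 1" for v :: real
  proof -
    have "\<bar>v\<bar> ^ 1 \<le> \<bar>v\<bar> ^ (2 * r)" using that r by (intro power_increasing) auto
    then show ?thesis by (simp add: power_even_abs)
  qed
  have f: "max 1 \<bar>u j\<bar> \<le> 1 + 2 * u j ^ (2 * r)" for j
  proof (cases "\<bar>u j\<bar> \<le> 1")
    case False
    then show ?thesis using pw[of "u j"] by auto
  qed (simp add: power_mult)
  let ?X = "\<Prod>j\<in>J - {j0}. max 1 \<bar>u j\<bar>"
  have X1: "1 \<le> ?X" by (intro prod_ge_1) auto
  have "(1 + 2 * \<bar>u j0\<bar>) * ?X \<le> (1 + 2 * u j0 ^ (2 * r)) * (\<Prod>j\<in>J - {j0}. 1 + 2 * u j ^ (2 * r))"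
    using pw[of "u j0"] j0 f by (intro mult_mono prod_mono) (auto intro!: prod_nonneg add_nonneg_nonneg simp: power_mult)
  also have "\<dots> = (\<Prod>j\<in>J. 1 + 2 * u j ^ (2 * r))" using J j0 by (simp add: prod.remove)
  finally have 1: "(1 + 2 * \<bar>u j0\<bar>) * ?X \<le> (\<Prod>j\<in>J. 1 + 2 * u j ^ (2 * r))" .
  have 2: "(\<Prod>j\<in>J. max 1 \<bar>u j\<bar>) = \<bar>u j0\<bar> * ?X" using J j0 by (simp add: prod.remove[of J j0])
  have "1 * 1 \<le> \<bar>u j0\<bar> * ?X" using X1 j0 by (intro mult_mono) auto
  then show ?thesis using 1 X1 unfolding 2 by (simp add: algebra_simps)
qed

text \<open>Where some form is large, the cost is at most 1 plus the average of the absolute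
  product, and the average of |1 + b * u| over both signs b is max 1 |u|.\<close>

lemma link_tv:
  assumes r: "r > 0"
  shows "(\<Sum>e\<in>pairs N. \<bar>signed_weight k N S e - honest_weight k N S e\<bar>) \<le> av {..<N} (\<lambda>a. \<Prod>j<N. 1 + 2 * link_form k N S a j ^ (2 * r)) - 1"
proof -
  have one: "4 ^ N * av {..<N} (\<lambda>b. \<bar>signed_weight k N S (a, b) - honest_weight k N S (a, b)\<bar>) \<le> (\<Prod>j<N. 1 + 2 * link_form k N S a j ^ (2 * r)) - 1" for a
  proof (cases "\<forall>j<N. \<bar>link_form k N S a j\<bar> \<le> 1")
    case True
    have "1 \<le> (\<Prod>j<N. 1 + 2 * link_form k N S a j ^ (2 * r))" by (intro prod_ge_1) (simp add: power_mult)
    then show ?thesis using True by (simp add: honest_weight_def av_const)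
  next
    case False
    let ?u = "link_form k N S a"
    obtain j0 where j0: "j0 \<in> {..<N}" "\<bar>?u j0\<bar> > 1" using False by auto
    have nh: "honest_weight k N S (a, b) = 1 / 4 ^ N" for b using False by (auto simp: honest_weight_def)
    have "4 ^ N * av {..<N} (\<lambda>b. \<bar>signed_weight k N S (a, b) - honest_weight k N S (a, b)\<bar>) \<le> av {..<N} (\<lambda>b. 1 + (\<Prod>j<N. \<bar>1 + b j * ?u j\<bar>))"
      unfolding nh av_cmult[symmetric]
    proof (rule av_mono)
      fix b
      have "4 ^ N * \<bar>signed_weight k N S (a, b) - 1 / 4 ^ N\<bar> = \<bar>4 ^ N * (signed_weight k N S (a, b) - 1 / 4 ^ N)\<bar>"
        by (simp only: abs_mult) simp
      also have "4 ^ N * (signed_weight k N S (a, b) - 1 / 4 ^ N) = (\<Prod>j<N. 1 + b j * ?u j) - 1"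
        by (simp add: signed_weight_def right_diff_distrib)
      also have "\<bar>(\<Prod>j<N. 1 + b j * ?u j) - 1\<bar> \<le> \<bar>\<Prod>j<N. 1 + b j * ?u j\<bar> + \<bar>1\<bar>" by (rule abs_triangle_ineq4)
      finally show "4 ^ N * \<bar>signed_weight k N S (a, b) - 1 / 4 ^ N\<bar> \<le> 1 + (\<Prod>j<N. \<bar>1 + b j * ?u j\<bar>)" by (simp add: abs_prod)
    qed
    also have "\<dots> = 1 + (\<Prod>j<N. (\<bar>1 + 1 * ?u j\<bar> + \<bar>1 + -1 * ?u j\<bar>) / 2)"
      unfolding av_add using av_prod_single[of "{..<N}" "\<lambda>j y. \<bar>1 + y * ?u j\<bar>"] by (simp add: av_const)
    also have "(\<Prod>j<N. (\<bar>1 + 1 * ?u j\<bar> + \<bar>1 + -1 * ?u j\<bar>) / 2) = (\<Prod>j<N. max 1 \<bar>?u j\<bar>)"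
      by (intro prod.cong refl) (auto simp: max_def abs_if)
    also have "1 + \<dots> \<le> (\<Prod>j<N. 1 + 2 * ?u j ^ (2 * r)) - 1" using j0 r by (intro clip_factor) auto
    finally show ?thesis .
  qed
  have "(\<Sum>e\<in>pairs N. \<bar>signed_weight k N S e - honest_weight k N S e\<bar>) = av {..<N} (\<lambda>a. 4 ^ N * av {..<N} (\<lambda>b. \<bar>signed_weight k N S (a, b) - honest_weight k N S (a, b)\<bar>))"
    unfolding av_cmult using sum_pairs[of "\<lambda>a b. \<bar>signed_weight k N S (a, b) - honest_weight k N S (a, b)\<bar>" N] by simp
  also have "\<dots> \<le> av {..<N} (\<lambda>a. (\<Prod>j<N. 1 + 2 * link_form k N S a j ^ (2 * r)) + (-1))" using one by (intro av_mono) simp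
  finally show ?thesis unfolding av_add by (simp add: av_const)
qed

lemma prod_perturb:
  fixes x y :: "'i \<Rightarrow> real"
  assumes "finite I" "\<And>i. i \<in> I \<Longrightarrow> 0 \<le> x i"
  shows "\<bar>(\<Prod>i\<in>I. y i) - (\<Prod>i\<in>I. x i)\<bar> \<le> (\<Prod>i\<in>I. x i + \<bar>y i - x i\<bar>) - (\<Prod>i\<in>I. x i)"
  using assms
proof (induction I rule: finite_induct)
  case (insert i I)
  let ?X = "\<Prod>i\<in>I. x i" and ?Y = "\<Prod>i\<in>I. y i" and ?Z = "\<Prod>i\<in>I. x i + \<bar>y i - x i\<bar>"
  have IH: "\<bar>?Y - ?X\<bar> \<le> ?Z - ?X" using insert by auto
  have Y: "\<bar>?Y\<bar> \<le> ?Z" unfolding abs_prod using insert.prems by (intro prod_mono) force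
  have "y i * ?Y - x i * ?X = (y i - x i) * ?Y + x i * (?Y - ?X)" by (simp add: algebra_simps)
  also have "\<bar>\<dots>\<bar> \<le> \<bar>y i - x i\<bar> * \<bar>?Y\<bar> + x i * \<bar>?Y - ?X\<bar>"
    using insert.prems by (intro order_trans[OF abs_triangle_ineq]) (simp add: abs_mult)
  also have "\<dots> \<le> \<bar>y i - x i\<bar> * ?Z + x i * (?Z - ?X)"
    using insert.prems by (intro add_mono mult_left_mono Y IH) auto
  also have "\<dots> = (x i + \<bar>y i - x i\<bar>) * ?Z - x i * ?X" by (simp add: algebra_simps)
  finally show ?case using insert.hyps by simp
qed simp

text \<open>The absolute mass of a signed f may exceed 1, so the errors of the factors compound
  instead of adding up.\<close>

lemma prod_tv:
  fixes f g :: "'e \<Rightarrow> real"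
  assumes I: "finite I" and E: "finite E" and g: "\<And>e. e \<in> E \<Longrightarrow> 0 \<le> g e" "(\<Sum>e\<in>E. g e) = 1"
    and tv: "(\<Sum>e\<in>E. \<bar>f e - g e\<bar>) \<le> \<tau>"
  shows "(\<Sum>w\<in>I \<rightarrow>\<^sub>E E. \<bar>(\<Prod>i\<in>I. f (w i)) - (\<Prod>i\<in>I. g (w i))\<bar>) \<le> (1 + \<tau>) ^ card I - 1"
proof -
  have "(\<Sum>w\<in>I \<rightarrow>\<^sub>E E. \<bar>(\<Prod>i\<in>I. f (w i)) - (\<Prod>i\<in>I. g (w i))\<bar>) \<le> (\<Sum>w\<in>I \<rightarrow>\<^sub>E E. (\<Prod>i\<in>I. g (w i) + \<bar>f (w i) - g (w i)\<bar>) - (\<Prod>i\<in>I. g (w i)))"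
    using I g by (intro sum_mono prod_perturb) auto
  also have "\<dots> = (\<Prod>i\<in>I. \<Sum>e\<in>E. g e + \<bar>f e - g e\<bar>) - (\<Prod>i\<in>I. \<Sum>e\<in>E. g e)"
    using prod_sum_PiE[of I "\<lambda>_. E" "\<lambda>_ e. g e + \<bar>f e - g e\<bar>"] prod_sum_PiE[of I "\<lambda>_. E" "\<lambda>_. g"] I E by (simp add: sum_subtractf)
  also have "\<dots> = (1 + (\<Sum>e\<in>E. \<bar>f e - g e\<bar>)) ^ card I - 1" by (simp add: sum.distrib g prod_constant)
  also have "\<dots> \<le> (1 + \<tau>) ^ card I - 1" using tv by (intro diff_right_mono power_mono) (auto intro!: add_nonneg_nonneg sum_nonneg)
  finally show ?thesis .
qed

section \<open>Splicing links into a chain\<close>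

definition lend :: "nat \<Rightarrow> nat \<Rightarrow> 'a \<times> 'a \<Rightarrow> 'a" where "lend h i e = (if i < h then fst e else snd e)"
definition rend :: "nat \<Rightarrow> nat \<Rightarrow> 'a \<times> 'a \<Rightarrow> 'a" where "rend h i e = (if i < h then snd e else fst e)"

text \<open>Block t is the entrywise product of the facing ends of the links t - 1 and t; the
  outermost blocks have one end only. The links are independent and both ends at a block are tested
  on the same index set, so the Fourier coefficients of the chain are products of link
  coefficients.\<close>

definition block :: "nat \<Rightarrow> (nat \<Rightarrow> (nat \<Rightarrow> real) \<times> (nat \<Rightarrow> real)) \<Rightarrow> nat \<Rightarrow> nat \<Rightarrow> real" where
  "block h w t j = (if t = 0 then 1 else rend h (t - 1) (w (t - 1)) j) * (if t = 2 * h then 1 else lend h t (w t) j)"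

text \<open>Both halves of the chain point towards the middle block h.\<close>

definition oriented :: "nat \<Rightarrow> nat \<Rightarrow> ('a \<Rightarrow> 'a \<Rightarrow> 'b) \<Rightarrow> 'a \<Rightarrow> 'a \<Rightarrow> 'b" where
  "oriented h i F A B = (if i < h then F A B else F B A)"

lemma prod_block:
  "(\<Prod>t\<le>2 * h. \<Prod>j\<in>T t. block h w t j) = (\<Prod>i<2 * h. (\<Prod>j\<in>T i. lend h i (w i) j) * (\<Prod>j\<in>T (Suc i). rend h i (w i) j))"
proof -
  have 1: "(\<Prod>t\<le>n. if t = 0 then 1 else f (t - 1)) = (\<Prod>i<n. f i)" for f :: "nat \<Rightarrow> real" and n
    by (induction n) auto
  have 2: "(\<Prod>t\<le>n. if t = n then 1 else f t) = (\<Prod>i<n. f i)" for f :: "nat \<Rightarrow> real" and n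
  proof -
    have "(\<Prod>t\<le>n. if t = n then 1 else f t) = (\<Prod>t<n. if t = n then 1 else f t)"
      by (simp add: lessThan_Suc_atMost[symmetric])
    also have "\<dots> = (\<Prod>i<n. f i)" by (intro prod.cong refl) auto
    finally show ?thesis .
  qed
  have "(\<Prod>j\<in>T t. block h w t j) = (if t = 0 then 1 else \<Prod>j\<in>T (Suc (t - 1)). rend h (t - 1) (w (t - 1)) j) * (if t = 2 * h then 1 else \<Prod>j\<in>T t. lend h t (w t) j)" for t
    unfolding block_def prod.distrib by (cases t) auto
  then have "(\<Prod>t\<le>2 * h. \<Prod>j\<in>T t. block h w t j) = (\<Prod>i<2 * h. \<Prod>j\<in>T (Suc i). rend h i (w i) j) * (\<Prod>i<2 * h. \<Prod>j\<in>T i. lend h i (w i) j)"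
    using 1[of "\<lambda>i. \<Prod>j\<in>T (Suc i). rend h i (w i) j" "2 * h"] 2[of "2 * h" "\<lambda>i. \<Prod>j\<in>T i. lend h i (w i) j"] by (simp add: prod.distrib)
  then show ?thesis by (simp add: prod.distrib mult.commute)
qed

lemma chain_fourier:
  assumes T: "\<And>t. T t \<subseteq> {..<N}"
  shows "(\<Sum>w\<in>{..<2 * h} \<rightarrow>\<^sub>E pairs N. (\<Prod>i<2 * h. signed_weight k N S (w i)) * (\<Prod>t\<le>2 * h. \<Prod>j\<in>T t. block h w t j))
    = (\<Prod>i<2 * h. oriented h i (link_coeff k N S) (T i) (T (Suc i)))"
proof -
  have "(\<Sum>w\<in>{..<2 * h} \<rightarrow>\<^sub>E pairs N. (\<Prod>i<2 * h. signed_weight k N S (w i)) * (\<Prod>t\<le>2 * h. \<Prod>j\<in>T t. block h w t j))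
    = (\<Sum>w\<in>{..<2 * h} \<rightarrow>\<^sub>E pairs N. \<Prod>i<2 * h. signed_weight k N S (w i) * ((\<Prod>j\<in>T i. lend h i (w i) j) * (\<Prod>j\<in>T (Suc i). rend h i (w i) j)))"
    unfolding prod_block by (simp add: prod.distrib)
  also have "\<dots> = (\<Prod>i<2 * h. \<Sum>e\<in>pairs N. signed_weight k N S e * ((\<Prod>j\<in>T i. lend h i e j) * (\<Prod>j\<in>T (Suc i). rend h i e j)))"
    using prod_sum_PiE[of "{..<2 * h}" "\<lambda>_. pairs N" "\<lambda>i e. signed_weight k N S e * ((\<Prod>j\<in>T i. lend h i e j) * (\<Prod>j\<in>T (Suc i). rend h i e j))"]
    by (simp add: finite_pairs)
  also have "\<dots> = (\<Prod>i<2 * h. oriented h i (link_coeff k N S) (T i) (T (Suc i)))"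
  proof (rule prod.cong[OF refl])
    fix i
    show "(\<Sum>e\<in>pairs N. signed_weight k N S e * ((\<Prod>j\<in>T i. lend h i e j) * (\<Prod>j\<in>T (Suc i). rend h i e j))) = oriented h i (link_coeff k N S) (T i) (T (Suc i))"
    proof (cases "i < h")
      case True
      then show ?thesis using link_fourier[OF T[of "Suc i"], of k S "T i"] by (simp add: lend_def rend_def oriented_def)
    next
      case False
      then show ?thesis using link_fourier[OF T[of i], of k S "T (Suc i)"]
        by (simp add: lend_def rend_def oriented_def mult.commute[of "\<Prod>j\<in>T i. _ j"])
    qed
  qed
  finally show ?thesis .
qed

text \<open>The sum over links counts the two outermost blocks once and all others twice. Sizes grow
  towards the middle, so an outermost size is at most the average over the h + 1 blocks of its half,
  and the ends lose at most the fraction 1 / (h + 1) of the double count.\<close>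

lemma weight_exponent:
  fixes s :: "nat \<Rightarrow> nat"
  assumes up: "\<And>i. i < h \<Longrightarrow> s i \<le> s (Suc i)" and down: "\<And>i. h \<le> i \<Longrightarrow> i < 2 * h \<Longrightarrow> s (Suc i) \<le> s i"
  shows "2 * h * (\<Sum>t\<le>2 * h. s t) \<le> (h + 1) * (\<Sum>i<2 * h. s i + s (Suc i))"
proof -
  have U: "s 0 \<le> s t" if "t \<le> h" for t
    using that
  proof (induction t)
    case (Suc t)
    then show ?case using up[of t] by simp
  qed simp
  have D: "s (2 * h) \<le> s (2 * h - t)" if "t \<le> h" for t
    using that
  proof (induction t)
    case (Suc t)
    then have "2 * h - t = Suc (2 * h - Suc t)" by simp
    then have "s (2 * h - t) \<le> s (2 * h - Suc t)" using down[of "2 * h - Suc t"] Suc.prems by simp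
    then show ?case using Suc by simp
  qed simp
  have D': "s (2 * h) \<le> s t" if "h \<le> t" "t \<le> 2 * h" for t using D[of "2 * h - t"] that by simp
  have a: "(h + 1) * s 0 \<le> (\<Sum>t\<le>h. s t)"
    using sum_mono[of "{..h}" "\<lambda>_. s 0" s] U by simp
  have b: "(h + 1) * s (2 * h) \<le> (\<Sum>t\<in>{h..2 * h}. s t)"
    using sum_mono[of "{h..2 * h}" "\<lambda>_. s (2 * h)" s] D' by simp
  have sub: "(\<Sum>t\<le>h. s t) \<le> (\<Sum>t\<le>2 * h. s t)" "(\<Sum>t\<in>{h..2 * h}. s t) \<le> (\<Sum>t\<le>2 * h. s t)"
    by (auto intro!: sum_mono2)
  have eq: "(\<Sum>i<n. s i + s (Suc i)) + s 0 + s n = 2 * (\<Sum>t\<le>n. s t)" for n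
    by (induction n) auto
  have "(h + 1) * (\<Sum>i<2 * h. s i + s (Suc i)) + ((h + 1) * s 0 + (h + 1) * s (2 * h)) = 2 * (h + 1) * (\<Sum>t\<le>2 * h. s t)"
    using arg_cong[OF eq[of "2 * h"], of "\<lambda>x. (h + 1) * x"] by (simp add: algebra_simps)
  then show ?thesis using a b sub by (simp add: algebra_simps)
qed

text \<open>If the product is nonzero, every link coefficient is, and then the set sizes grow
  towards the middle as \<open>weight_exponent\<close> requires. The power h + 1 on the left avoids
  the fractional exponent h / (h + 1).\<close>

lemma chain_coeff_bound:
  assumes F: "\<And>A B. A \<subseteq> {..<N} \<Longrightarrow> B \<subseteq> {..<N} \<Longrightarrow> B \<noteq> {} \<Longrightarrow> (link_coeff k N S A B)\<^sup>2 \<le> (sqrt (real (card B)) / sqrt (real N)) ^ (card A + card B)"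
    and T: "\<And>t. T t \<subseteq> {..<N}" and l: "(\<Sum>t\<le>2 * h. card (T t)) \<le> l" "l \<le> N"
  shows "((\<Prod>i<2 * h. oriented h i (link_coeff k N S) (T i) (T (Suc i)))\<^sup>2) ^ (h + 1) \<le> (real l / real N) ^ (h * (\<Sum>t\<le>2 * h. card (T t)))"
proof (cases "(\<Prod>i<2 * h. oriented h i (link_coeff k N S) (T i) (T (Suc i))) = 0")
  case True
  show ?thesis unfolding True by simp
next
  case False
  let ?s = "\<lambda>t. card (T t)" and ?q = "sqrt (real l) / sqrt (real N)"
  have nz: "oriented h i (link_coeff k N S) (T i) (T (Suc i)) \<noteq> 0" if "i < 2 * h" for i
    using False that by auto
  have fT: "finite (T t)" for t using T finite_subset by blast
  have mono: "card A \<le> card B" if "link_coeff k N S A B \<noteq> 0" "A \<subseteq> {..<N}" "finite B" for A B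
    using link_coeff_zero[OF that(2,3), of k S] that(1) by linarith
  have up: "?s i \<le> ?s (Suc i)" if "i < h" for i
    using nz[of i] that mono[OF _ T fT] by (simp add: oriented_def)
  have down: "?s (Suc i) \<le> ?s i" if "h \<le> i" "i < 2 * h" for i
    using nz[of i] that mono[OF _ T fT] by (simp add: oriented_def)
  have q: "0 \<le> ?q" "?q \<le> 1" using l by (auto simp: divide_le_eq)
  have link: "(link_coeff k N S A B)\<^sup>2 \<le> ?q ^ (card A + card B)"
    if A: "A \<subseteq> {..<N}" and B: "B \<subseteq> {..<N}" and c: "card B \<le> l" and n0: "link_coeff k N S A B \<noteq> 0" for A B
  proof (cases "B = {}")
    case True
    have "finite A" using A finite_subset by blast
    then have "A = {}" using mono[OF n0 A] True by simp
    then show ?thesis using True by (simp add: link_coeff_empty)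
  next
    case False
    have "(link_coeff k N S A B)\<^sup>2 \<le> (sqrt (real (card B)) / sqrt (real N)) ^ (card A + card B)" by (rule F[OF A B False])
    also have "\<dots> \<le> ?q ^ (card A + card B)" using c by (intro power_mono divide_right_mono) auto
    finally show ?thesis .
  qed
  have cl: "?s t \<le> l" if "t \<le> 2 * h" for t
    using member_le_sum[of t "{..2 * h}" ?s] that l by simp
  have fac: "(oriented h i (link_coeff k N S) (T i) (T (Suc i)))\<^sup>2 \<le> ?q ^ (?s i + ?s (Suc i))" if i: "i < 2 * h" for i
  proof (cases "i < h")
    case True
    then show ?thesis using link[OF T T, of "Suc i" i] nz[OF i] cl[of "Suc i"] by (simp add: oriented_def)
  next
    case False
    then show ?thesis using link[OF T T, of i "Suc i"] nz[OF i] cl[of i] i by (simp add: oriented_def add.commute)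
  qed
  have "(\<Prod>i<2 * h. oriented h i (link_coeff k N S) (T i) (T (Suc i)))\<^sup>2 = (\<Prod>i<2 * h. (oriented h i (link_coeff k N S) (T i) (T (Suc i)))\<^sup>2)"
    by (rule prod_power_distrib)
  also have "\<dots> \<le> (\<Prod>i<2 * h. ?q ^ (?s i + ?s (Suc i)))" using fac by (intro prod_mono) auto
  also have "\<dots> = ?q ^ (\<Sum>i<2 * h. ?s i + ?s (Suc i))" by (rule power_sum[symmetric])
  finally have "((\<Prod>i<2 * h. oriented h i (link_coeff k N S) (T i) (T (Suc i)))\<^sup>2) ^ (h + 1) \<le> (?q ^ (\<Sum>i<2 * h. ?s i + ?s (Suc i))) ^ (h + 1)"
    by (intro power_mono) auto
  also have "\<dots> = ?q ^ ((h + 1) * (\<Sum>i<2 * h. ?s i + ?s (Suc i)))" by (simp only: power_mult[symmetric] mult.commute)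
  also have "\<dots> \<le> ?q ^ (2 * h * (\<Sum>t\<le>2 * h. ?s t))"
    by (rule power_decreasing[OF weight_exponent q]) (use up down in auto)
  also have "\<dots> = (?q\<^sup>2) ^ (h * (\<Sum>t\<le>2 * h. ?s t))" by (simp only: power_mult[symmetric] mult.assoc)
  also have "?q\<^sup>2 = real l / real N" by (simp add: power_divide)
  finally show ?thesis .
qed

section \<open>Path sums along a chain and their dual adversary solution\<close>

lemma sum_PiE_Suc:
  "(\<Sum>p\<in>{..Suc t} \<rightarrow>\<^sub>E J. g p) = (\<Sum>p\<in>{..t} \<rightarrow>\<^sub>E J. \<Sum>j\<in>J. g (p(Suc t := j)))"
proof -
  have "{..Suc t} - {Suc t} = {..t}" by auto
  then show ?thesis by (subst sum_PiE_upd[of "Suc t"]) auto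
qed

text \<open>Transfer vectors of the path sum: \<open>lvec\<close> collects the paths that arrive at
  block t from the left and \<open>rvec\<close> those that leave it to the right, in both cases
  without the sign at block t.\<close>

primrec lvec :: "nat \<Rightarrow> (nat \<Rightarrow> nat \<Rightarrow> nat \<Rightarrow> real) \<Rightarrow> (nat \<Rightarrow> nat \<Rightarrow> real) \<Rightarrow> nat \<Rightarrow> nat \<Rightarrow> real" where
  "lvec N C a 0 = (\<lambda>j. 1)"
| "lvec N C a (Suc t) = (\<lambda>k. \<Sum>j<N. (lvec N C a t j * a t j) * C t j k)"

primrec rvec :: "nat \<Rightarrow> (nat \<Rightarrow> nat \<Rightarrow> nat \<Rightarrow> real) \<Rightarrow> (nat \<Rightarrow> nat \<Rightarrow> real) \<Rightarrow> nat \<Rightarrow> nat \<Rightarrow> nat \<Rightarrow> real" where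
  "rvec N C a 0 = (\<lambda>t j. 1)"
| "rvec N C a (Suc s) = (\<lambda>t j. \<Sum>k<N. C t j k * (a (Suc t) k * rvec N C a s (Suc t) k))"

definition phi :: "nat \<Rightarrow> nat \<Rightarrow> (nat \<Rightarrow> nat \<Rightarrow> nat \<Rightarrow> real) \<Rightarrow> (nat \<Rightarrow> nat \<Rightarrow> real) \<Rightarrow> real" where
  "phi N n C a = (\<Sum>j<N. lvec N C a n j * a n j) / real N"

lemma path_sum:
  "(\<Sum>p\<in>{..t} \<rightarrow>\<^sub>E {..<N}. (\<Prod>i\<le>t. a i (p i)) * (\<Prod>i<t. C i (p i) (p (Suc i))) * f (p t)) = (\<Sum>j<N. (lvec N C a t j * a t j) * f j)"
proof (induction t arbitrary: f)
  case 0
  have "({..0} - {0} :: nat set) = {}" by auto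
  then show ?case using sum_PiE_upd[of "0::nat" "{..0}" "\<lambda>p. a 0 (p 0) * f (p 0)" "{..<N}"] by simp
next
  case (Suc t)
  have "(\<Sum>p\<in>{..Suc t} \<rightarrow>\<^sub>E {..<N}. (\<Prod>i\<le>Suc t. a i (p i)) * (\<Prod>i<Suc t. C i (p i) (p (Suc i))) * f (p (Suc t)))
    = (\<Sum>p\<in>{..t} \<rightarrow>\<^sub>E {..<N}. \<Sum>k<N. (\<Prod>i\<le>t. a i (p i)) * (\<Prod>i<t. C i (p i) (p (Suc i))) * (a (Suc t) k * f k * C t (p t) k))"
    unfolding sum_PiE_Suc by (intro sum.cong refl) (simp add: ac_simps)
  also have "\<dots> = (\<Sum>k<N. \<Sum>p\<in>{..t} \<rightarrow>\<^sub>E {..<N}. (\<Prod>i\<le>t. a i (p i)) * (\<Prod>i<t. C i (p i) (p (Suc i))) * (a (Suc t) k * f k * C t (p t) k))"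
    by (rule sum.swap)
  also have "\<dots> = (\<Sum>k<N. \<Sum>j<N. (lvec N C a t j * a t j) * (a (Suc t) k * f k * C t j k))"
    by (intro sum.cong refl Suc)
  also have "\<dots> = (\<Sum>k<N. (lvec N C a (Suc t) k * a (Suc t) k) * f k)"
    by (intro sum.cong refl) (simp add: sum_distrib_left ac_simps)
  finally show ?case .
qed

lemma phi_paths:
  "phi N n C a = (\<Sum>p\<in>{..n} \<rightarrow>\<^sub>E {..<N}. (\<Prod>i\<le>n. a i (p i)) * (\<Prod>i<n. C i (p i) (p (Suc i)))) / real N"
  using path_sum[where f = "\<lambda>_. 1" and t = n and a = a and C = C and N = N] by (simp add: phi_def)

lemma sqn_signs: "(\<And>j. j < N \<Longrightarrow> a j = 1 \<or> a j = -1) \<Longrightarrow> sqn N (\<lambda>j. v j * a j) = sqn N v"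
  unfolding sqn_def
proof (rule sum.cong[OF refl])
  fix j assume a: "\<And>j. j < N \<Longrightarrow> a j = 1 \<or> a j = -1" and "j \<in> {..<N}"
  then have "a j = 1 \<or> a j = -1" using a[of j] by simp
  then show "(v j * a j)\<^sup>2 = (v j)\<^sup>2" by (elim disjE) (simp_all add: power_mult_distrib)
qed

lemma phi_telescope:
  assumes n: "n = n'"
  shows "phi N n C x - phi N n C y = (\<Sum>t\<le>n. \<Sum>j<N. lvec N C x t j * (x t j - y t j) * rvec N C y (n - t) t j) / real N"
proof -
  \<comment> \<open>H and K are path sums for hybrid inputs: the blocks before t, for K also block t
    itself, come from x and the later ones from y. So K at t is H at Suc t, and the differences
    telescope.\<close>
  define H where "H = (\<lambda>x y t. \<Sum>j<N. lvec N C x t j * y t j * rvec N C y (n - t) t j)"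
  define K where "K = (\<lambda>x y t. \<Sum>j<N. lvec N C x t j * x t j * rvec N C y (n - t) t j)"
  have KH: "K x y t = H x y (Suc t)" if "t < n" for x y t
  proof -
    have s: "n - t = Suc (n - Suc t)" using that by simp
    have "K x y t = (\<Sum>j<N. \<Sum>k<N. (lvec N C x t j * x t j) * C t j k * (y (Suc t) k * rvec N C y (n - Suc t) (Suc t) k))"
      unfolding K_def s by (simp add: sum_distrib_left mult.assoc)
    also have "\<dots> = H x y (Suc t)"
      unfolding H_def by (subst sum.swap) (simp add: sum_distrib_right sum_distrib_left mult.assoc)
    finally show ?thesis .
  qed
  have tel: "K x y n - H x y 0 = (\<Sum>t\<le>n. K x y t - H x y t)" for x y
  proof -
    have "(\<Sum>t\<le>k. K x y t - H x y t) = K x y k - H x y 0" if "k \<le> n" for k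
      using that by (induction k) (auto simp: KH)
    then show ?thesis by simp
  qed
  have Kn: "K x y n = real N * phi N n C x" for x y by (simp add: K_def phi_def)
  have "K y y n - H y y 0 = 0" unfolding tel by (simp add: K_def H_def)
  moreover have "H y y 0 = H x y 0" by (simp add: H_def)
  ultimately have "K x y n - H x y 0 = real N * (phi N n C x - phi N n C y)" by (simp add: Kn algebra_simps)
  moreover have "K x y t - H x y t = (\<Sum>j<N. lvec N C x t j * (x t j - y t j) * rvec N C y (n - t) t j)" for t
    by (simp add: K_def H_def sum_subtractf algebra_simps)
  ultimately have "real N * (phi N n C x - phi N n C y) = (\<Sum>t\<le>n. \<Sum>j<N. lvec N C x t j * (x t j - y t j) * rvec N C y (n - t) t j)"
    unfolding tel by simp
  then show ?thesis by (cases "N = 0") (auto simp: field_simps phi_def)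
qed

locale contractions =
  fixes N n :: nat and C :: "nat \<Rightarrow> nat \<Rightarrow> nat \<Rightarrow> real"
  assumes N: "N > 0"
    and fwd: "\<And>t v. sqn N (\<lambda>k. \<Sum>j<N. v j * C t j k) \<le> sqn N v"
    and bwd: "\<And>t v. sqn N (\<lambda>j. \<Sum>k<N. C t j k * v k) \<le> sqn N v"
begin

lemma sqn_lvec:
  assumes a: "\<And>t j. t \<le> n \<Longrightarrow> j < N \<Longrightarrow> a t j = 1 \<or> a t j = -1"
  shows "t \<le> n \<Longrightarrow> sqn N (lvec N C a t) \<le> real N"
proof (induction t)
  case 0
  show ?case by (simp add: sqn_def)
next
  case (Suc t)
  have "sqn N (lvec N C a (Suc t)) \<le> sqn N (\<lambda>j. lvec N C a t j * a t j)"
    unfolding lvec.simps by (rule fwd)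
  also have "\<dots> = sqn N (lvec N C a t)" using a Suc.prems by (intro sqn_signs) auto
  finally show ?case using Suc by simp
qed

lemma sqn_rvec:
  assumes a: "\<And>t j. t \<le> n \<Longrightarrow> j < N \<Longrightarrow> a t j = 1 \<or> a t j = -1"
  shows "s + t \<le> n \<Longrightarrow> sqn N (rvec N C a s t) \<le> real N"
proof (induction s arbitrary: t)
  case 0
  show ?case by (simp add: sqn_def)
next
  case (Suc s)
  have "sqn N (rvec N C a (Suc s) t) \<le> sqn N (\<lambda>k. a (Suc t) k * rvec N C a s (Suc t) k)"
    unfolding rvec.simps by (rule bwd)
  also have "\<dots> = sqn N (\<lambda>k. rvec N C a s (Suc t) k * a (Suc t) k)" by (simp add: mult.commute)
  also have "\<dots> = sqn N (rvec N C a s (Suc t))" using a Suc.prems by (intro sqn_signs) auto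
  finally show ?case using Suc.IH[of "Suc t"] Suc.prems by simp
qed

lemma phi_abs:
  assumes a: "\<And>t j. t \<le> n \<Longrightarrow> j < N \<Longrightarrow> a t j = 1 \<or> a t j = -1"
  shows "\<bar>phi N n C a\<bar> \<le> 1"
proof -
  have "(\<Sum>j<N. lvec N C a n j * a n j)\<^sup>2 \<le> (\<Sum>j<N. (lvec N C a n j)\<^sup>2) * (\<Sum>j<N. (a n j)\<^sup>2)"
    by (rule Cauchy_Schwarz_ineq_sum)
  also have "(\<Sum>j<N. (a n j)\<^sup>2) = (\<Sum>j<N. 1)"
    using a[of n] by (intro sum.cong refl) (metis lessThan_iff one_power2 order_refl power2_minus)
  also have "(\<Sum>j<N. (lvec N C a n j)\<^sup>2) * (\<Sum>j<N. 1) \<le> real N * real N"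
    using sqn_lvec[OF a order_refl] by (simp add: sqn_def mult_right_mono)
  finally have "(\<Sum>j<N. lvec N C a n j * a n j)\<^sup>2 \<le> (real N)\<^sup>2" by (simp add: power2_eq_square)
  then have "\<bar>\<Sum>j<N. lvec N C a n j * a n j\<bar> \<le> real N" by (simp add: abs_le_square_iff[symmetric])
  then show ?thesis using N by (simp add: phi_def)
qed

end

definition Phi :: "nat \<Rightarrow> nat \<Rightarrow> nat \<Rightarrow> (nat \<Rightarrow> nat \<Rightarrow> nat \<Rightarrow> real) \<Rightarrow> (nat \<times> nat \<times> nat \<Rightarrow> real) \<Rightarrow> real" where
  "Phi N n L C x = (\<Sum>l<L. phi N n C (\<lambda>t j. x (l, t, j))) / real L"

text \<open>The telescoped difference already has the form of a dual adversary solution: left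
  vectors of x against right vectors of y, summed over the differing entries. Contractions keep both
  at squared norm N, so after division by L * N the bound depends on the number of blocks alone. The
  4 is the square of the factor in x - y = 2 * x at a differing entry.\<close>

lemma (in contractions) gam_Phi:
  assumes L: "L > 0"
  defines "W \<equiv> {..<L} \<times> {..n} \<times> {..<N}"
  defines "A \<equiv> 4 * real (n + 1)"
  shows "gam W (signs W) (signs W) A A (\<lambda>x y. Phi N n L C x - Phi N n L C y)"
proof (rule gamI[where D = "{()}" and u = "\<lambda>x (l, t, j) _. 2 / sqrt (real L * real N) * (lvec N C (\<lambda>t j. x (l, t, j)) t j * x (l, t, j))"
      and v = "\<lambda>y (l, t, j) _. 1 / sqrt (real L * real N) * rvec N C (\<lambda>t j. y (l, t, j)) (n - t) t j"])
  have W: "(\<Sum>i\<in>W. F i) = (\<Sum>l<L. \<Sum>t\<le>n. \<Sum>j<N. F (l, t, j))" for F :: "_ \<Rightarrow> real"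
    unfolding W_def by (simp add: sum.cartesian_product)
  have x1: "x (l, t, j) = 1 \<or> x (l, t, j) = -1" if "x \<in> signs W" "l < L" "t \<le> n" "j < N" for x l t j
    using signs_cases[OF that(1), of "(l, t, j)"] that by (simp add: W_def)
  have LN: "real L * real N > 0" using L N by simp
  {
    fix x assume x: "x \<in> signs W"
    have "(\<Sum>i\<in>W. \<Sum>a\<in>{()}. ((case i of (l, t, j) \<Rightarrow> \<lambda>_. 2 / sqrt (real L * real N) * (lvec N C (\<lambda>t j. x (l, t, j)) t j * x (l, t, j))) a)\<^sup>2) =
      (\<Sum>l<L. \<Sum>t\<le>n. 4 / (real L * real N) * sqn N (\<lambda>j. lvec N C (\<lambda>t j. x (l, t, j)) t j * x (l, t, j)))"
      unfolding W using LN by (simp add: sqn_def sum_distrib_left power_mult_distrib power_divide)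
    also have "\<dots> \<le> (\<Sum>l<L. \<Sum>t\<le>n. 4 / (real L * real N) * real N)"
    proof (intro sum_mono mult_left_mono)
      fix l t assume lt: "l \<in> {..<L}" "t \<in> {..n}"
      have "sqn N (\<lambda>j. lvec N C (\<lambda>t j. x (l, t, j)) t j * x (l, t, j)) = sqn N (lvec N C (\<lambda>t j. x (l, t, j)) t)"
        using x1[OF x] lt by (intro sqn_signs) auto
      also have "\<dots> \<le> real N" using x1[OF x] lt by (intro sqn_lvec) auto
      finally show "sqn N (\<lambda>j. lvec N C (\<lambda>t j. x (l, t, j)) t j * x (l, t, j)) \<le> real N" .
    qed (use LN in simp)
    also have "\<dots> = A" using L N by (simp add: A_def field_simps)
    finally show "(\<Sum>i\<in>W. \<Sum>a\<in>{()}. ((case i of (l, t, j) \<Rightarrow> \<lambda>_. 2 / sqrt (real L * real N) * (lvec N C (\<lambda>t j. x (l, t, j)) t j * x (l, t, j))) a)\<^sup>2) \<le> A" .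
  next
    fix y assume y: "y \<in> signs W"
    have "(\<Sum>i\<in>W. \<Sum>a\<in>{()}. ((case i of (l, t, j) \<Rightarrow> \<lambda>_. 1 / sqrt (real L * real N) * rvec N C (\<lambda>t j. y (l, t, j)) (n - t) t j) a)\<^sup>2) =
      (\<Sum>l<L. \<Sum>t\<le>n. 1 / (real L * real N) * sqn N (rvec N C (\<lambda>t j. y (l, t, j)) (n - t) t))"
      unfolding W using LN by (simp add: sqn_def sum_distrib_left power_mult_distrib power_divide)
    also have "\<dots> \<le> (\<Sum>l<L. \<Sum>t\<le>n. 4 / (real L * real N) * real N)"
    proof (intro sum_mono mult_mono)
      fix l t assume lt: "l \<in> {..<L}" "t \<in> {..n}"
      then show "sqn N (rvec N C (\<lambda>t j. y (l, t, j)) (n - t) t) \<le> real N" using x1[OF y] by (intro sqn_rvec) auto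
    qed (use LN in \<open>auto simp: sqn_nonneg divide_right_mono\<close>)
    also have "\<dots> = A" using L N by (simp add: A_def field_simps)
    finally show "(\<Sum>i\<in>W. \<Sum>a\<in>{()}. ((case i of (l, t, j) \<Rightarrow> \<lambda>_. 1 / sqrt (real L * real N) * rvec N C (\<lambda>t j. y (l, t, j)) (n - t) t j) a)\<^sup>2) \<le> A" .
  next
    fix x y assume x: "x \<in> signs W" and y: "y \<in> signs W"
    have d: "x (l, t, j) - y (l, t, j) = dif x y (l, t, j) * (2 * x (l, t, j))" if "l < L" "t \<le> n" "j < N" for l t j
      using x1[OF x that] x1[OF y that] by (auto simp: dif_def)
    have "Phi N n L C x - Phi N n L C y = (\<Sum>l<L. phi N n C (\<lambda>t j. x (l, t, j)) - phi N n C (\<lambda>t j. y (l, t, j))) / real L"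
      by (simp add: Phi_def sum_subtractf diff_divide_distrib)
    also have "\<dots> = (\<Sum>l<L. \<Sum>t\<le>n. \<Sum>j<N. 1 / (real L * real N) * (lvec N C (\<lambda>t j. x (l, t, j)) t j * (x (l, t, j) - y (l, t, j)) * rvec N C (\<lambda>t j. y (l, t, j)) (n - t) t j))"
      unfolding phi_telescope[OF refl] by (simp add: sum_divide_distrib mult.commute[of "real L"])
    also have "\<dots> = (\<Sum>l<L. \<Sum>t\<le>n. \<Sum>j<N. dif x y (l, t, j) * ((2 / sqrt (real L * real N) * (lvec N C (\<lambda>t j. x (l, t, j)) t j * x (l, t, j))) * (1 / sqrt (real L * real N) * rvec N C (\<lambda>t j. y (l, t, j)) (n - t) t j)))"
      using LN by (intro sum.cong refl) (auto simp: d)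
    finally show "Phi N n L C x - Phi N n L C y = (\<Sum>i\<in>W. \<Sum>a\<in>{()}. dif x y i *
      ((case i of (l, t, j) \<Rightarrow> \<lambda>_. 2 / sqrt (real L * real N) * (lvec N C (\<lambda>t j. x (l, t, j)) t j * x (l, t, j))) a *
       (case i of (l, t, j) \<Rightarrow> \<lambda>_. 1 / sqrt (real L * real N) * rvec N C (\<lambda>t j. y (l, t, j)) (n - t) t j) a))"
      unfolding W by simp
  }
qed simp

section \<open>Independent copies of the chain\<close>

definition outcomes :: "nat \<Rightarrow> nat \<Rightarrow> (nat \<Rightarrow> (nat \<Rightarrow> real) \<times> (nat \<Rightarrow> real)) set" where
  "outcomes N h = {..<2 * h} \<rightarrow>\<^sub>E pairs N"

definition positions :: "nat \<Rightarrow> nat \<Rightarrow> nat \<Rightarrow> (nat \<times> nat \<times> nat) set" where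
  "positions N h L = {..<L} \<times> {..2 * h} \<times> {..<N}"

definition input :: "nat \<Rightarrow> nat \<Rightarrow> nat \<Rightarrow> (nat \<Rightarrow> nat \<Rightarrow> (nat \<Rightarrow> real) \<times> (nat \<Rightarrow> real)) \<Rightarrow> nat \<times> nat \<times> nat \<Rightarrow> real" where
  "input N h L w = (\<lambda>(l, t, j)\<in>positions N h L. block h (w l) t j)"

lemma finite_outcomes: "finite (outcomes N h)"
  unfolding outcomes_def by (intro finite_PiE finite_pairs) auto

lemma block_signs:
  assumes w: "w \<in> outcomes N h" and t: "t \<le> 2 * h" and j: "j < N"
  shows "block h w t j = 1 \<or> block h w t j = -1"
proof -
  have e: "fst (w i) j = 1 \<or> fst (w i) j = -1" "snd (w i) j = 1 \<or> snd (w i) j = -1" if "i < 2 * h" for i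
  proof -
    have "w i \<in> pairs N" using w that by (auto simp: outcomes_def)
    then have "fst (w i) \<in> signs {..<N}" "snd (w i) \<in> signs {..<N}" by (auto simp: pairs_def)
    then show "fst (w i) j = 1 \<or> fst (w i) j = -1" "snd (w i) j = 1 \<or> snd (w i) j = -1"
      using signs_cases[of "fst (w i)" "{..<N}" j] signs_cases[of "snd (w i)" "{..<N}" j] j by simp_all
  qed
  have "lend h i (w i) j = 1 \<or> lend h i (w i) j = -1" "rend h i (w i) j = 1 \<or> rend h i (w i) j = -1" if "i < 2 * h" for i
    using e[OF that] by (auto simp: lend_def rend_def)
  then have "rend h (t - 1) (w (t - 1)) j = 1 \<or> rend h (t - 1) (w (t - 1)) j = -1" if "t \<noteq> 0"
    using that t by auto
  moreover have "lend h t (w t) j = 1 \<or> lend h t (w t) j = -1" if "t \<noteq> 2 * h"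
    using \<open>\<And>i. i < 2 * h \<Longrightarrow> lend h i (w i) j = 1 \<or> lend h i (w i) j = -1\<close>[of t] that t by simp
  ultimately show ?thesis unfolding block_def by (cases "t = 0"; cases "t = 2 * h") auto
qed

lemma input_signs:
  assumes w: "w \<in> {..<L} \<rightarrow>\<^sub>E outcomes N h"
  shows "input N h L w \<in> signs (positions N h L)"
  unfolding input_def
proof (rule signs_restrictI)
  fix v assume v: "v \<in> positions N h L"
  obtain l t j where v': "v = (l, t, j)" by (cases v) auto
  have "w l \<in> outcomes N h" "t \<le> 2 * h" "j < N" using v w by (auto simp: positions_def v')
  then show "(case v of (l, t, j) \<Rightarrow> block h (w l) t j) = 1 \<or> (case v of (l, t, j) \<Rightarrow> block h (w l) t j) = -1"
    using block_signs by (simp add: v')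
qed

lemma copies_fourier:
  assumes T: "T \<subseteq> positions N h L"
  defines "U \<equiv> \<lambda>l t. {j. (l, t, j) \<in> T}"
  shows "(\<Sum>w\<in>{..<L} \<rightarrow>\<^sub>E outcomes N h. (\<Prod>l<L. \<Prod>i<2 * h. signed_weight k N S (w l i)) * (\<Prod>v\<in>T. input N h L w v))
    = (\<Prod>l<L. \<Prod>i<2 * h. oriented h i (link_coeff k N S) (U l i) (U l (Suc i)))"
    and "card T = (\<Sum>l<L. \<Sum>t\<le>2 * h. card (U l t))"
proof -
  have UN: "U l t \<subseteq> {..<N}" for l t using T by (auto simp: U_def positions_def)
  then have fU: "finite (U l t)" for l t using finite_subset by blast
  have TU: "T = (SIGMA l:{..<L}. SIGMA t:{..2 * h}. U l t)" using T by (auto simp: U_def positions_def)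
  have pT: "(\<Prod>v\<in>T. f v) = (\<Prod>l<L. \<Prod>t\<le>2 * h. \<Prod>j\<in>U l t. f (l, t, j))" for f :: "_ \<Rightarrow> real"
  proof -
    have "(\<Prod>l<L. \<Prod>t\<le>2 * h. \<Prod>j\<in>U l t. f (l, t, j)) = (\<Prod>l<L. \<Prod>(t, j)\<in>(SIGMA t:{..2 * h}. U l t). f (l, t, j))"
      using fU by (intro prod.cong refl prod.Sigma) auto
    also have "\<dots> = (\<Prod>(l, y)\<in>T. case y of (t, j) \<Rightarrow> f (l, t, j))"
      unfolding TU using fU by (intro prod.Sigma) auto
    finally show ?thesis by (simp add: case_prod_beta)
  qed
  show "card T = (\<Sum>l<L. \<Sum>t\<le>2 * h. card (U l t))"
    unfolding TU using fU by (simp add: card_SigmaI)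
  have inp: "input N h L w (l, t, j) = block h (w l) t j" if "l < L" "t \<le> 2 * h" "j \<in> U l t" for w l t j
    using that UN[of l t] by (auto simp: input_def positions_def)
  have "(\<Prod>v\<in>T. input N h L w v) = (\<Prod>l<L. \<Prod>t\<le>2 * h. \<Prod>j\<in>U l t. block h (w l) t j)" for w
    unfolding pT by (intro prod.cong refl inp) auto
  then have "(\<Sum>w\<in>{..<L} \<rightarrow>\<^sub>E outcomes N h. (\<Prod>l<L. \<Prod>i<2 * h. signed_weight k N S (w l i)) * (\<Prod>v\<in>T. input N h L w v))
    = (\<Sum>w\<in>{..<L} \<rightarrow>\<^sub>E outcomes N h. \<Prod>l<L. (\<Prod>i<2 * h. signed_weight k N S (w l i)) * (\<Prod>t\<le>2 * h. \<Prod>j\<in>U l t. block h (w l) t j))"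
    by (simp add: prod.distrib)
  also have "\<dots> = (\<Prod>l<L. \<Sum>w\<in>outcomes N h. (\<Prod>i<2 * h. signed_weight k N S (w i)) * (\<Prod>t\<le>2 * h. \<Prod>j\<in>U l t. block h w t j))"
    using prod_sum_PiE[of "{..<L}" "\<lambda>_. outcomes N h" "\<lambda>l w. (\<Prod>i<2 * h. signed_weight k N S (w i)) * (\<Prod>t\<le>2 * h. \<Prod>j\<in>U l t. block h w t j)"]
    by (simp add: finite_outcomes)
  also have "\<dots> = (\<Prod>l<L. \<Prod>i<2 * h. oriented h i (link_coeff k N S) (U l i) (U l (Suc i)))"
    unfolding outcomes_def by (intro prod.cong refl chain_fourier UN)
  finally show "(\<Sum>w\<in>{..<L} \<rightarrow>\<^sub>E outcomes N h. (\<Prod>l<L. \<Prod>i<2 * h. signed_weight k N S (w l i)) * (\<Prod>v\<in>T. input N h L w v))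
    = (\<Prod>l<L. \<Prod>i<2 * h. oriented h i (link_coeff k N S) (U l i) (U l (Suc i)))" .
qed

text \<open>\<open>G\<close> plays the role of \<open>N\<close> to the power \<open>h / (h + 1)\<close>.\<close>

lemma copies_bound:
  assumes F: "\<And>A B. A \<subseteq> {..<N} \<Longrightarrow> B \<subseteq> {..<N} \<Longrightarrow> B \<noteq> {} \<Longrightarrow> (link_coeff k N S A B)\<^sup>2 \<le> (sqrt (real (card B)) / sqrt (real N)) ^ (card A + card B)"
    and T: "T \<subseteq> positions N h L" "T \<noteq> {}" "card T \<le> N"
    and G: "G > 0" "G ^ (h + 1) \<le> real N ^ h"
  shows "\<bar>\<Sum>w\<in>{..<L} \<rightarrow>\<^sub>E outcomes N h. (\<Prod>l<L. \<Prod>i<2 * h. signed_weight k N S (w l i)) * (\<Prod>v\<in>T. input N h L w v)\<bar>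
    \<le> sqrt ((real (card T) / G) ^ card T)"
proof -
  define U where "U = (\<lambda>l t. {j. (l, t, j) \<in> T})"
  have UN: "U l t \<subseteq> {..<N}" for l t using T(1) by (auto simp: U_def positions_def)
  let ?l = "card T"
  have fT: "finite T" using finite_subset[OF T(1)] by (simp add: positions_def)
  have l0: "?l > 0" using T(2) fT by (simp add: card_gt_0_iff)
  have lN: "real N > 0" using l0 T(3) by simp
  have cT: "?l = (\<Sum>l<L. \<Sum>t\<le>2 * h. card (U l t))" unfolding U_def by (rule copies_fourier(2)[OF T(1)])
  let ?P = "\<lambda>l. \<Prod>i<2 * h. oriented h i (link_coeff k N S) (U l i) (U l (Suc i))"
  have "((\<Prod>l<L. ?P l)\<^sup>2) ^ (h + 1) = (\<Prod>l<L. ((?P l)\<^sup>2) ^ (h + 1))" unfolding prod_power_distrib by (rule refl)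
  also have "\<dots> \<le> (\<Prod>l<L. (real ?l / real N) ^ (h * (\<Sum>t\<le>2 * h. card (U l t))))"
  proof (rule prod_mono, rule conjI)
    fix l assume "l \<in> {..<L}"
    then have "(\<Sum>t\<le>2 * h. card (U l t)) \<le> ?l" unfolding cT by (intro member_le_sum) auto
    then show "((?P l)\<^sup>2) ^ (h + 1) \<le> (real ?l / real N) ^ (h * (\<Sum>t\<le>2 * h. card (U l t)))"
      by (intro chain_coeff_bound F UN T(3)) auto
  qed simp
  also have "\<dots> = (real ?l / real N) ^ (\<Sum>l<L. h * (\<Sum>t\<le>2 * h. card (U l t)))" by (rule power_sum[symmetric])
  also have "(\<Sum>l<L. h * (\<Sum>t\<le>2 * h. card (U l t))) = h * ?l" unfolding cT sum_distrib_left by (rule refl)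
  also have "(real ?l / real N) ^ (h * ?l) = (real ?l ^ h / real N ^ h) ^ ?l" by (simp add: power_mult power_divide)
  \<comment> \<open>As l is at least 1, its exponent may be raised from h to h + 1; then the whole
    bound is a power with exponent h + 1, and a root can be taken.\<close>
  also have "\<dots> \<le> (real ?l ^ (h + 1) / G ^ (h + 1)) ^ ?l"
    using l0 lN G by (intro power_mono frac_le power_increasing) auto
  also have "\<dots> = ((real ?l / G) ^ ?l) ^ (h + 1)" by (simp only: power_divide[symmetric] power_mult[symmetric] mult.commute)
  finally have "((\<Prod>l<L. ?P l)\<^sup>2) ^ (h + 1) \<le> ((real ?l / G) ^ ?l) ^ (h + 1)" .
  then have "(\<Prod>l<L. ?P l)\<^sup>2 \<le> (real ?l / G) ^ ?l"
    using G by (simp only: Suc_eq_plus1[symmetric]) (rule power_le_imp_le_base, assumption, simp)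
  then have "\<bar>\<Prod>l<L. ?P l\<bar> \<le> sqrt ((real ?l / G) ^ ?l)" using real_le_rsqrt by fastforce
  then show ?thesis unfolding copies_fourier(1)[OF T(1)] U_def .
qed

lemma outcomes_weight:
  assumes w: "\<And>e. e \<in> pairs N \<Longrightarrow> 0 \<le> f e" "(\<Sum>e\<in>pairs N. f e) = (1 :: real)"
  shows "\<And>w. w \<in> outcomes N h \<Longrightarrow> 0 \<le> (\<Prod>i<2 * h. f (w i))" "(\<Sum>w\<in>outcomes N h. \<Prod>i<2 * h. f (w i)) = 1"
proof -
  show "0 \<le> (\<Prod>i<2 * h. f (w i))" if "w \<in> outcomes N h" for w
    using that by (intro prod_nonneg ballI w(1)) (auto simp: outcomes_def)
  show "(\<Sum>w\<in>outcomes N h. \<Prod>i<2 * h. f (w i)) = 1"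
    using prod_sum_PiE[of "{..<2 * h}" "\<lambda>_. pairs N" "\<lambda>_. f"] w(2) by (simp add: outcomes_def finite_pairs)
qed

lemma copies_tv:
  assumes tv: "(\<Sum>e\<in>pairs N. \<bar>signed_weight k N S e - honest_weight k N S e\<bar>) \<le> \<tau>"
  shows "(\<Sum>w\<in>{..<L} \<rightarrow>\<^sub>E outcomes N h. \<bar>(\<Prod>l<L. \<Prod>i<2 * h. signed_weight k N S (w l i)) - (\<Prod>l<L. \<Prod>i<2 * h. honest_weight k N S (w l i))\<bar>) \<le> (1 + \<tau>) ^ (2 * h * L) - 1"
proof -
  let ?f = "\<lambda>w. \<Prod>i<2 * h. signed_weight k N S (w i)" and ?g = "\<lambda>w. \<Prod>i<2 * h. honest_weight k N S (w i)"
  have inner: "(\<Sum>w\<in>outcomes N h. \<bar>?f w - ?g w\<bar>) \<le> (1 + \<tau>) ^ card {..<2 * h} - 1"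
    unfolding outcomes_def by (rule prod_tv) (simp_all add: finite_pairs honest_weight_nonneg honest_weight_sum tv)
  have "(\<Sum>w\<in>{..<L} \<rightarrow>\<^sub>E outcomes N h. \<bar>(\<Prod>l<L. ?f (w l)) - (\<Prod>l<L. ?g (w l))\<bar>) \<le> (1 + ((1 + \<tau>) ^ card {..<2 * h} - 1)) ^ card {..<L} - 1"
  proof (rule prod_tv[OF _ finite_outcomes _ _ inner])
    show "0 \<le> ?g w" if "w \<in> outcomes N h" for w
      using that by (intro outcomes_weight(1)[of N "honest_weight k N S"] honest_weight_nonneg honest_weight_sum)
    show "(\<Sum>w\<in>outcomes N h. ?g w) = 1"
      by (intro outcomes_weight(2)[of N "honest_weight k N S"] honest_weight_nonneg honest_weight_sum)
  qed simp
  then show ?thesis by (simp add: power_mult)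
qed

definition push :: "'w set \<Rightarrow> ('w \<Rightarrow> real) \<Rightarrow> ('w \<Rightarrow> 'x) \<Rightarrow> 'x \<Rightarrow> real" where
  "push \<Omega> wt X x = (\<Sum>w\<in>\<Omega>. if X w = x then wt w else 0)"

lemma push_sum:
  assumes V: "finite V" and X: "\<And>w. w \<in> \<Omega> \<Longrightarrow> X w \<in> signs V"
  shows "(\<Sum>x\<in>signs V. push \<Omega> wt X x * g x) = (\<Sum>w\<in>\<Omega>. wt w * g (X w))"
proof -
  have "(\<Sum>x\<in>signs V. push \<Omega> wt X x * g x) = (\<Sum>w\<in>\<Omega>. \<Sum>x\<in>signs V. (if X w = x then wt w else 0) * g x)"
    unfolding push_def sum_distrib_right by (rule sum.swap)
  also have "\<dots> = (\<Sum>w\<in>\<Omega>. \<Sum>x\<in>signs V. if x = X w then wt w * g (X w) else 0)"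
    by (intro sum.cong refl) auto
  also have "\<dots> = (\<Sum>w\<in>\<Omega>. wt w * g (X w))" using X finite_signs[OF V] by simp
  finally show ?thesis .
qed

lemma push_distr:
  assumes "finite V" "\<And>w. w \<in> \<Omega> \<Longrightarrow> X w \<in> signs V" "\<And>w. w \<in> \<Omega> \<Longrightarrow> 0 \<le> wt w" "(\<Sum>w\<in>\<Omega>. wt w) = 1"
  shows "distr_on V (push \<Omega> wt X)"
  using push_sum[OF assms(1,2), where g = "\<lambda>_. 1" and wt = wt] assms(3,4)
  by (auto simp: distr_on_def push_def intro!: sum_nonneg)

text \<open>The induction rests on (1 + 1 / l) ^ l <= e <= 3. The bound lets the factorial in a
  binomial coefficient absorb the l ^ l of the Fourier bound.\<close>

lemma power_self_le: "real l ^ l \<le> 3 ^ l * fact l"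
proof (induction l)
  case (Suc l)
  have "real (Suc l) ^ l \<le> 3 * real l ^ l"
  proof (cases "l = 0")
    case False
    have "real (Suc l) = (1 + 1 / real l) * real l" using False by (simp add: field_simps)
    then have "real (Suc l) ^ l = ((1 + 1 / real l) * real l) ^ l" by (rule arg_cong)
    also have "\<dots> = (1 + 1 / real l) ^ l * real l ^ l" by (rule power_mult_distrib)
    also have "\<dots> \<le> 3 * real l ^ l"
      using exp_ge_one_plus_x_over_n_power_n[of l 1] False exp_le by (intro mult_right_mono) (auto intro: order_trans)
    finally show ?thesis .
  qed simp
  then have "real (Suc l) * real (Suc l) ^ l \<le> real (Suc l) * (3 * (3 ^ l * fact l))"
    using Suc by (intro mult_left_mono) auto
  then show ?case by (simp add: algebra_simps)
qed simp

text \<open>Since (d choose l) * l ^ l <= (3 * d) ^ l, the l-th term is at most \<rho> ^ l and the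
  sum is a geometric series.\<close>

lemma fourier_tail:
  fixes c G \<rho> :: real
  assumes c: "c > 0" and G: "G > 0" and \<rho>: "3 * c * real d / G \<le> \<rho>\<^sup>2" "0 \<le> \<rho>" "\<rho> \<le> 1 / 2"
  shows "(\<Sum>l=1..d. sqrt ((real l / G) ^ l) * sqrt (c ^ l * real (d choose l))) \<le> 2 * \<rho>"
proof -
  have le: "sqrt ((real l / G) ^ l) * sqrt (c ^ l * real (d choose l)) \<le> \<rho> ^ l" if l: "l \<ge> 1" for l
  proof -
    have "real (d choose l) * fact l \<le> real d ^ l"
      using binomial_fact_pow[of d l] by (metis of_nat_fact of_nat_le_iff of_nat_mult of_nat_power)
    then have "real (d choose l) * (3 ^ l * fact l) \<le> (3 * real d) ^ l" by (simp add: power_mult_distrib)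
    moreover have "real (d choose l) * real l ^ l \<le> real (d choose l) * (3 ^ l * fact l)" by (intro mult_left_mono power_self_le) simp
    ultimately have b: "real (d choose l) * real l ^ l \<le> (3 * real d) ^ l" by linarith
    have "(real l / G) ^ l * (c ^ l * real (d choose l)) = (c / G) ^ l * (real (d choose l) * real l ^ l)"
      by (simp add: power_divide)
    also have "\<dots> \<le> (c / G) ^ l * (3 * real d) ^ l" using c G by (intro mult_left_mono b) simp
    also have "\<dots> = (3 * c * real d / G) ^ l" unfolding power_mult_distrib[symmetric] by (simp add: ac_simps)
    also have "\<dots> \<le> (\<rho>\<^sup>2) ^ l" using c G by (intro power_mono \<rho>) auto
    also have "\<dots> = (\<rho> ^ l)\<^sup>2" by (simp add: power_mult[symmetric] mult.commute)
    finally show ?thesis unfolding real_sqrt_mult[symmetric] using \<rho> by (intro real_le_lsqrt) auto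
  qed
  have "(\<Sum>l=1..d. sqrt ((real l / G) ^ l) * sqrt (c ^ l * real (d choose l))) \<le> (\<Sum>l=1..d. \<rho> ^ l)"
    using le by (intro sum_mono) auto
  also have "\<dots> \<le> 2 * \<rho> - 2 * (\<rho> ^ d * \<rho>)"
  proof (induction d)
    case (Suc d)
    have "\<rho> ^ d * \<rho> * \<rho> \<le> \<rho> ^ d * \<rho> * (1 / 2)" using \<rho> by (intro mult_left_mono) auto
    then show ?case using Suc by (simp add: algebra_simps)
  qed (use \<rho> in simp)
  also have "\<dots> \<le> 2 * \<rho>" using \<rho> by simp
  finally show ?thesis .
qed

lemma dep_prune: "dep (prune t A) \<le> dep t"
proof (induction t arbitrary: A)
  case (Qr v l r)
  show ?case
  proof (cases "A v")
    case None
    show ?thesis unfolding prune.simps None option.case dep.simps Suc_le_mono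
      using Qr(1)[of "A(v \<mapsto> -1)"] Qr(2)[of "A(v \<mapsto> 1)"] by (rule max.mono)
  next
    case (Some c)
    then show ?thesis using Qr(1)[of A] Qr(2)[of A] by auto
  qed
qed simp

definition copies_distr :: "real \<Rightarrow> nat \<Rightarrow> (nat \<times> nat \<Rightarrow> real) \<Rightarrow> nat \<Rightarrow> nat \<Rightarrow> (nat \<times> nat \<times> nat \<Rightarrow> real) \<Rightarrow> real" where
  "copies_distr k N S h L = push ({..<L} \<rightarrow>\<^sub>E outcomes N h) (\<lambda>w. \<Prod>l<L. \<Prod>i<2 * h. honest_weight k N S (w l i)) (input N h L)"

lemma finite_positions: "finite (positions N h L)"
  by (simp add: positions_def)

lemma card_positions: "card (positions N h L) = L * (2 * h + 1) * N"
  unfolding positions_def card_cartesian_product by (simp add: algebra_simps)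

lemma finite_copies: "finite ({..<L :: nat} \<rightarrow>\<^sub>E outcomes N h)"
  by (rule finite_PiE[OF finite_lessThan finite_outcomes])

lemma honest_outcome_nonneg: "w \<in> outcomes N h \<Longrightarrow> 0 \<le> (\<Prod>i<2 * h. honest_weight k N S (w i))"
  by (rule outcomes_weight(1)[of N "honest_weight k N S"]) (simp_all add: honest_weight_nonneg honest_weight_sum)

lemma honest_outcome_sum: "(\<Sum>w\<in>outcomes N h. \<Prod>i<2 * h. honest_weight k N S (w i)) = 1"
  by (rule outcomes_weight(2)[of N "honest_weight k N S"]) (simp_all add: honest_weight_nonneg honest_weight_sum)

lemma copies_weight_nonneg: "w \<in> {..<L} \<rightarrow>\<^sub>E outcomes N h \<Longrightarrow> 0 \<le> (\<Prod>l<L. \<Prod>i<2 * h. honest_weight k N S (w l i))"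
  by (intro prod_nonneg ballI honest_outcome_nonneg) auto

lemma copies_sum:
  fixes L :: nat
  assumes "(\<Sum>w\<in>outcomes N h. f w) = (1 :: real)"
  shows "(\<Sum>w\<in>{..<L} \<rightarrow>\<^sub>E outcomes N h. \<Prod>l<L. f (w l)) = 1"
  using prod_sum_PiE[of "{..<L}" "\<lambda>_. outcomes N h" "\<lambda>_. f"] assms by (simp add: finite_outcomes)

lemma copies_distr_on: "distr_on (positions N h L) (copies_distr k N S h L)"
  unfolding copies_distr_def
  by (rule push_distr) (simp_all add: finite_positions input_signs copies_weight_nonneg copies_sum[OF honest_outcome_sum])

text \<open>The comparison value depends on the tree and not on k, so distributions for two values
  of k are both close to it and hence to each other. The Fourier bound is used for the signed
  weights; the last term pays for the passage to the honest ones.\<close>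

lemma copies_accept:
  assumes F: "\<And>A B. A \<subseteq> {..<N} \<Longrightarrow> B \<subseteq> {..<N} \<Longrightarrow> B \<noteq> {} \<Longrightarrow> (link_coeff k N S A B)\<^sup>2 \<le> (sqrt (real (card B)) / sqrt (real N)) ^ (card A + card B)"
    and tv: "(\<Sum>e\<in>pairs N. \<bar>signed_weight k N S e - honest_weight k N S e\<bar>) \<le> \<tau>"
    and t: "trvars t \<subseteq> positions N h L" "dep t \<le> d" and dN: "d \<le> N"
    and m: "m > 0" and c: "c > 0" "real (2*m) ^ m * real (card (positions N h L)) \<le> c ^ m"
    and G: "G > 0" "G ^ (h + 1) \<le> real N ^ h"
    and \<rho>: "3 * c * real d / G \<le> \<rho>\<^sup>2" "0 \<le> \<rho>" "\<rho> \<le> 1 / 2"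
  shows "\<bar>accept (positions N h L) (copies_distr k N S h L) t - hist_av d (\<lambda>h. case node (prune t Map.empty) h of Lf b \<Rightarrow> of_bool (b = 1) | _ \<Rightarrow> 0)\<bar>
    \<le> 2 * \<rho> + ((1 + \<tau>) ^ (2 * h * L) - 1)"
proof -
  let ?\<Omega> = "{..<L} \<rightarrow>\<^sub>E outcomes N h" and ?V = "positions N h L" and ?p = "prune t Map.empty"
  let ?wh = "\<lambda>w. \<Prod>l<L. \<Prod>i<2 * h. honest_weight k N S (w l i)" and ?ws = "\<lambda>w. \<Prod>l<L. \<Prod>i<2 * h. signed_weight k N S (w l i)"
  let ?g = "\<lambda>b :: nat. of_bool (b = 1) :: real"
  have sig: "input N h L w \<in> signs ?V" if "w \<in> ?\<Omega>" for w by (rule input_signs[OF that])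
  have sc: "input N h L w i = 1 \<or> input N h L w i = -1" if "w \<in> ?\<Omega>" "i \<in> ?V" for w i
    by (rule signs_cases[OF sig[OF that(1)] that(2)])
  have acc: "accept ?V (copies_distr k N S h L) t = (\<Sum>w\<in>?\<Omega>. ?wh w * ?g (ev t (input N h L w)))"
    unfolding accept_def copies_distr_def by (rule push_sum[OF finite_positions sig])
  have pv: "ev ?p (input N h L w) = ev t (input N h L w)" if "w \<in> ?\<Omega>" for w
    using prune_ev[of Map.empty "input N h L w" t] signs_cases[OF sig[OF that]] t(1) by auto
  have pt: "read_once ?p" "trvars ?p \<subseteq> ?V" using prune_read_once[of t Map.empty] t(1) by auto
  have pd: "dep ?p \<le> d" using dep_prune[of t Map.empty] t(2) by simp
  have s1: "(\<Sum>w\<in>outcomes N h. \<Prod>i<2 * h. signed_weight k N S (w i)) = 1"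
    using prod_sum_PiE[of "{..<2 * h}" "\<lambda>_. pairs N" "\<lambda>_. signed_weight k N S"] by (simp add: outcomes_def finite_pairs signed_weight_sum)
  have "\<bar>(\<Sum>w\<in>?\<Omega>. ?ws w * ?g (ev ?p (input N h L w))) - hist_av d (\<lambda>h. case node ?p h of Lf b \<Rightarrow> ?g b | _ \<Rightarrow> 0)\<bar>
    \<le> (\<Sum>l=1..d. sqrt ((real l / G) ^ l) * sqrt (c ^ l * real (d choose l)))"
  proof (rule tree_fourier_bound[OF finite_positions pt(2) m c pt(1) pd finite_copies])
    fix T assume T: "T \<subseteq> ?V" "T \<noteq> {}" "card T \<le> d"
    then show "\<bar>\<Sum>w\<in>?\<Omega>. ?ws w * (\<Prod>i\<in>T. input N h L w i)\<bar> \<le> sqrt ((real (card T) / G) ^ card T)"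
      using dN by (intro copies_bound F G) auto
  next
    fix l :: nat show "sqrt ((real l / G) ^ l) > 0" using G by (cases "l = 0") auto
  qed (simp_all add: sc copies_sum[OF s1])
  also have "\<dots> \<le> 2 * \<rho>" by (rule fourier_tail[OF c(1) G(1) \<rho>])
  finally have 1: "\<bar>(\<Sum>w\<in>?\<Omega>. ?ws w * ?g (ev ?p (input N h L w))) - hist_av d (\<lambda>h. case node ?p h of Lf b \<Rightarrow> ?g b | _ \<Rightarrow> 0)\<bar> \<le> 2 * \<rho>" .
  have "\<bar>(\<Sum>w\<in>?\<Omega>. ?wh w * ?g (ev t (input N h L w))) - (\<Sum>w\<in>?\<Omega>. ?ws w * ?g (ev ?p (input N h L w)))\<bar>
    = \<bar>\<Sum>w\<in>?\<Omega>. (?wh w - ?ws w) * ?g (ev t (input N h L w))\<bar>"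
  proof -
    have "(\<Sum>w\<in>?\<Omega>. ?ws w * ?g (ev ?p (input N h L w))) = (\<Sum>w\<in>?\<Omega>. ?ws w * ?g (ev t (input N h L w)))"
      by (intro sum.cong refl) (simp only: pv)
    then show ?thesis by (simp only: sum_subtractf left_diff_distrib)
  qed
  also have "\<dots> \<le> (\<Sum>w\<in>?\<Omega>. \<bar>?ws w - ?wh w\<bar>)"
  proof (rule order_trans[OF sum_abs], rule sum_mono)
    fix w
    have "\<bar>(?wh w - ?ws w) * ?g b\<bar> \<le> \<bar>?ws w - ?wh w\<bar>" for b by (cases "b = 1") (simp_all add: abs_minus_commute)
    then show "\<bar>(?wh w - ?ws w) * ?g (ev t (input N h L w))\<bar> \<le> \<bar>?ws w - ?wh w\<bar>" .
  qed
  also have "\<dots> \<le> (1 + \<tau>) ^ (2 * h * L) - 1" by (rule copies_tv[OF tv])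
  finally show ?thesis using 1 unfolding acc by linarith
qed

section \<open>Mean and concentration of the averaged path sum\<close>

lemma chebyshev_average:
  fixes \<nu> f :: "'z \<Rightarrow> real"
  assumes \<Omega>: "finite \<Omega>" and \<nu>: "\<And>z. z \<in> \<Omega> \<Longrightarrow> 0 \<le> \<nu> z" "(\<Sum>z\<in>\<Omega>. \<nu> z) = 1" and f: "\<And>z. z \<in> \<Omega> \<Longrightarrow> \<bar>f z\<bar> \<le> 1"
    and \<mu>: "(\<Sum>z\<in>\<Omega>. \<nu> z * f z) = \<mu>" and s: "s > 0" and L: "L > 0"
  shows "(\<Sum>w\<in>{..<L} \<rightarrow>\<^sub>E \<Omega>. (\<Prod>l<L. \<nu> (w l)) * of_bool (\<bar>(\<Sum>l<L. f (w l)) / real L - \<mu>\<bar> \<ge> s)) \<le> 1 / (real L * s\<^sup>2)"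
proof -
  define g where "g = (\<lambda>z. f z - \<mu>)"
  have g0: "(\<Sum>z\<in>\<Omega>. \<nu> z * g z) = 0" using \<mu> \<nu>(2) by (simp add: g_def right_diff_distrib sum_subtractf sum_distrib_right[symmetric])
  have g2: "(\<Sum>z\<in>\<Omega>. \<nu> z * (g z)\<^sup>2) \<le> 1"
  proof -
    have "(\<Sum>z\<in>\<Omega>. \<nu> z * (g z)\<^sup>2) = (\<Sum>z\<in>\<Omega>. \<nu> z * (f z)\<^sup>2 - 2 * \<mu> * (\<nu> z * f z) + \<mu>\<^sup>2 * \<nu> z)"
      by (intro sum.cong refl) (simp add: g_def power2_eq_square algebra_simps)
    also have "\<dots> = (\<Sum>z\<in>\<Omega>. \<nu> z * (f z)\<^sup>2) - \<mu>\<^sup>2"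
      using \<mu> \<nu>(2) by (simp add: sum.distrib sum_subtractf sum_distrib_left[symmetric] power2_eq_square)
    also have "\<dots> \<le> (\<Sum>z\<in>\<Omega>. \<nu> z * 1)"
    proof -
      have "(\<Sum>z\<in>\<Omega>. \<nu> z * (f z)\<^sup>2) \<le> (\<Sum>z\<in>\<Omega>. \<nu> z * 1)"
        using \<nu>(1) f by (intro sum_mono mult_left_mono) (auto simp: abs_square_le_1)
      then show ?thesis using zero_le_power2[of \<mu>] by linarith
    qed
    finally show ?thesis using \<nu>(2) by simp
  qed
  have cov: "(\<Sum>w\<in>{..<L} \<rightarrow>\<^sub>E \<Omega>. (\<Prod>l<L. \<nu> (w l)) * (g (w a) * g (w b))) = (if a = b then \<Sum>z\<in>\<Omega>. \<nu> z * (g z)\<^sup>2 else 0)"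
    if a: "a < L" and b: "b < L" for a b
  proof -
    have "(\<Sum>w\<in>{..<L} \<rightarrow>\<^sub>E \<Omega>. (\<Prod>l<L. \<nu> (w l)) * (g (w a) * g (w b)))
      = (\<Sum>w\<in>{..<L} \<rightarrow>\<^sub>E \<Omega>. \<Prod>l<L. \<nu> (w l) * ((if l = a then g (w l) else 1) * (if l = b then g (w l) else 1)))"
      using a b by (simp add: prod.distrib)
    also have "\<dots> = (\<Prod>l<L. \<Sum>z\<in>\<Omega>. \<nu> z * ((if l = a then g z else 1) * (if l = b then g z else 1)))"
      using prod_sum_PiE[of "{..<L}" "\<lambda>_. \<Omega>" "\<lambda>l z. \<nu> z * ((if l = a then g z else 1) * (if l = b then g z else 1))"] \<Omega> by simp
    also have "\<dots> = (if a = b then \<Sum>z\<in>\<Omega>. \<nu> z * (g z)\<^sup>2 else 0)"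
    proof (cases "a = b")
      case True
      have "(\<Prod>l<L. \<Sum>z\<in>\<Omega>. \<nu> z * ((if l = a then g z else 1) * (if l = b then g z else 1))) = (\<Prod>l<L. if l = a then \<Sum>z\<in>\<Omega>. \<nu> z * (g z)\<^sup>2 else 1)"
        using True \<nu>(2) by (intro prod.cong refl) (auto simp: power2_eq_square)
      then show ?thesis using True a by simp
    next
      case False
      then have "(\<Sum>z\<in>\<Omega>. \<nu> z * ((if a = a then g z else 1) * (if a = b then g z else 1))) = 0" using g0 by simp
      then have "(\<Prod>l<L. \<Sum>z\<in>\<Omega>. \<nu> z * ((if l = a then g z else 1) * (if l = b then g z else 1))) = 0"
        using a by (intro prod_zero bexI[of _ a]) auto
      then show ?thesis using False by simp
    qed
    finally show ?thesis .
  qed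
  have "(\<Sum>w\<in>{..<L} \<rightarrow>\<^sub>E \<Omega>. (\<Prod>l<L. \<nu> (w l)) * of_bool (\<bar>(\<Sum>l<L. f (w l)) / real L - \<mu>\<bar> \<ge> s))
    \<le> (\<Sum>w\<in>{..<L} \<rightarrow>\<^sub>E \<Omega>. (\<Prod>l<L. \<nu> (w l)) * ((\<Sum>l<L. g (w l))\<^sup>2 / (real L * s)\<^sup>2))"
  proof (rule sum_mono, rule mult_left_mono)
    fix w assume w: "w \<in> {..<L} \<rightarrow>\<^sub>E \<Omega>"
    then show "0 \<le> (\<Prod>l<L. \<nu> (w l))" using \<nu>(1) by (intro prod_nonneg) auto
    have e: "(\<Sum>l<L. g (w l)) = real L * ((\<Sum>l<L. f (w l)) / real L - \<mu>)" using L by (simp add: g_def sum_subtractf right_diff_distrib)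
    show "of_bool (\<bar>(\<Sum>l<L. f (w l)) / real L - \<mu>\<bar> \<ge> s) \<le> (\<Sum>l<L. g (w l))\<^sup>2 / (real L * s)\<^sup>2"
    proof (cases "\<bar>(\<Sum>l<L. f (w l)) / real L - \<mu>\<bar> \<ge> s")
      case True
      then have "(real L * s)\<^sup>2 \<le> (\<Sum>l<L. g (w l))\<^sup>2" unfolding e power_mult_distrib
        using s by (intro mult_left_mono) (auto simp: abs_le_square_iff[symmetric])
      then show ?thesis using True s L by simp
    qed simp
  qed
  also have "\<dots> = (\<Sum>w\<in>{..<L} \<rightarrow>\<^sub>E \<Omega>. \<Sum>a<L. \<Sum>b<L. (\<Prod>l<L. \<nu> (w l)) * (g (w a) * g (w b))) / (real L * s)\<^sup>2"
    unfolding power2_eq_square[of "\<Sum>l<L. g (_ l)"] sum_product by (simp add: sum_divide_distrib sum_distrib_left)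
  also have "(\<Sum>w\<in>{..<L} \<rightarrow>\<^sub>E \<Omega>. \<Sum>a<L. \<Sum>b<L. (\<Prod>l<L. \<nu> (w l)) * (g (w a) * g (w b)))
    = (\<Sum>a<L. \<Sum>b<L. \<Sum>w\<in>{..<L} \<rightarrow>\<^sub>E \<Omega>. (\<Prod>l<L. \<nu> (w l)) * (g (w a) * g (w b)))"
    by (subst sum.swap, rule sum.cong[OF refl], rule sum.swap)
  also have "\<dots> = (\<Sum>a<L. \<Sum>b<L. if a = b then \<Sum>z\<in>\<Omega>. \<nu> z * (g z)\<^sup>2 else 0)"
    by (intro sum.cong refl cov) auto
  also have "\<dots> = real L * (\<Sum>z\<in>\<Omega>. \<nu> z * (g z)\<^sup>2)" by simp
  also have "\<dots> / (real L * s)\<^sup>2 \<le> real L * 1 / (real L * s)\<^sup>2"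
    using g2 by (intro divide_right_mono mult_left_mono) auto
  also have "\<dots> = 1 / (real L * s\<^sup>2)" using L s by (simp add: power2_eq_square)
  finally show ?thesis .
qed

text \<open>The scale \<kappa> makes S a contraction. It is kept apart from the strength k of the
  links, because the same path sum is evaluated on correlated chains and on uniform ones, where k is
  0.\<close>

definition chain_mat :: "real \<Rightarrow> (nat \<times> nat \<Rightarrow> real) \<Rightarrow> nat \<Rightarrow> nat \<Rightarrow> nat \<Rightarrow> nat \<Rightarrow> real" where
  "chain_mat \<kappa> S h i j k = \<kappa> * oriented h i (\<lambda>a b. S (a, b)) j k"

lemma link_coeff_single:
  assumes a: "a < N"
  shows "link_coeff k N S {a} {b} = k * S (a, b)"
proof -
  have "av {..<N} (\<lambda>x. x a * x i) = of_bool (i = a)" if "i < N" for i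
  proof (cases "i = a")
    case True
    have "av {..<N} (\<lambda>x. x a * x i) = av {..<N} (\<lambda>x. 1)"
    proof (rule av_cong)
      fix x :: "nat \<Rightarrow> real" assume "x \<in> signs {..<N}"
      then show "x a * x i = 1" using signs_cases[of x "{..<N}" a] a True by auto
    qed
    then show ?thesis using True by (simp add: av_const)
  next
    case False
    then show ?thesis using av_character[of "{..<N}" "{a, i}"] a that by simp
  qed
  then have "(\<Sum>i<N. k * S (i, b) * av {..<N} (\<lambda>x. x a * x i)) = (\<Sum>i<N. if i = a then k * S (i, b) else 0)"
    by (intro sum.cong refl) auto
  also have "\<dots> = k * S (a, b)" using a by simp
  finally have "(\<Sum>i<N. k * S (i, b) * av {..<N} (\<lambda>x. x a * x i)) = k * S (a, b)" .
  moreover have "link_coeff k N S {a} {b} = (\<Sum>i<N. k * S (i, b) * av {..<N} (\<lambda>x. x a * x i))"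
    unfolding av_cmult[symmetric] av_sum[symmetric]
    by (simp add: link_coeff_def link_form_def sum_distrib_left ac_simps)
  ultimately show ?thesis by simp
qed

text \<open>Along one path all index sets are singletons, and each link coefficient is k times an
  entry of S, which meets the same entry in the chain matrix and squares to 1. All N ^ (2 * h + 1)
  paths contribute equally.\<close>

lemma signed_mean:
  assumes S: "S \<in> signs ({..<N} \<times> {..<N})" and N: "N > 0"
  shows "(\<Sum>w\<in>outcomes N h. (\<Prod>i<2 * h. signed_weight k N S (w i)) * phi N (2 * h) (chain_mat \<kappa> S h) (block h w)) = (real N * (\<kappa> * k)) ^ (2 * h)"
proof -
  let ?P = "{..2 * h} \<rightarrow>\<^sub>E {..<N}" and ?C = "chain_mat \<kappa> S h" and ?W = "\<lambda>w. \<Prod>i<2 * h. signed_weight k N S (w i)"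
  have one: "(\<Sum>w\<in>outcomes N h. ?W w * ((\<Prod>i\<le>2 * h. block h w i (p i)) * (\<Prod>i<2 * h. ?C i (p i) (p (Suc i))))) = (\<kappa> * k) ^ (2 * h)"
    if p: "p \<in> ?P" for p
  proof -
    define T where "T = (\<lambda>t. if t \<le> 2 * h then {p t} else {})"
    have pN: "p i < N" if "i \<le> 2 * h" for i using p that by auto
    then have TN: "T t \<subseteq> {..<N}" for t by (auto simp: T_def)
    have "(\<Sum>w\<in>outcomes N h. ?W w * (\<Prod>t\<le>2 * h. \<Prod>j\<in>T t. block h w t j)) = (\<Prod>i<2 * h. oriented h i (link_coeff k N S) (T i) (T (Suc i)))"
      unfolding outcomes_def by (rule chain_fourier[OF TN])
    moreover have "(\<Prod>t\<le>2 * h. \<Prod>j\<in>T t. block h w t j) = (\<Prod>i\<le>2 * h. block h w i (p i))" for w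
      by (intro prod.cong refl) (simp add: T_def)
    ultimately have "(\<Sum>w\<in>outcomes N h. ?W w * (\<Prod>i\<le>2 * h. block h w i (p i))) = (\<Prod>i<2 * h. oriented h i (link_coeff k N S) (T i) (T (Suc i)))" by simp
    then have "(\<Sum>w\<in>outcomes N h. ?W w * ((\<Prod>i\<le>2 * h. block h w i (p i)) * (\<Prod>i<2 * h. ?C i (p i) (p (Suc i)))))
      = (\<Prod>i<2 * h. oriented h i (link_coeff k N S) (T i) (T (Suc i)) * ?C i (p i) (p (Suc i)))"
      by (simp add: prod.distrib sum_distrib_right[symmetric] mult.assoc[symmetric])
    also have "\<dots> = (\<Prod>i<2 * h. \<kappa> * k)"
    proof (rule prod.cong[OF refl])
      fix i assume "i \<in> {..<2 * h}"
      then have i: "i \<le> 2 * h" "Suc i \<le> 2 * h" by auto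
      have sq: "S (a, b) * S (a, b) = 1" if "a < N" "b < N" for a b
        using signs_cases[OF S, of "(a, b)"] that by auto
      show "oriented h i (link_coeff k N S) (T i) (T (Suc i)) * ?C i (p i) (p (Suc i)) = \<kappa> * k"
      proof (cases "i < h")
        case True
        then show ?thesis using i sq[OF pN[OF i(1)] pN[OF i(2)]] link_coeff_single[OF pN[OF i(1)], of k S "p (Suc i)"]
          by (simp add: oriented_def chain_mat_def T_def)
      next
        case False
        then show ?thesis using i sq[OF pN[OF i(2)] pN[OF i(1)]] link_coeff_single[OF pN[OF i(2)], of k S "p i"]
          by (simp add: oriented_def chain_mat_def T_def)
      qed
    qed
    finally show ?thesis by simp
  qed
  have "(\<Sum>w\<in>outcomes N h. ?W w * phi N (2 * h) ?C (block h w))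
    = (\<Sum>w\<in>outcomes N h. \<Sum>p\<in>?P. ?W w * ((\<Prod>i\<le>2 * h. block h w i (p i)) * (\<Prod>i<2 * h. ?C i (p i) (p (Suc i))))) / real N"
    unfolding phi_paths by (simp add: sum_distrib_left sum_divide_distrib)
  also have "(\<Sum>w\<in>outcomes N h. \<Sum>p\<in>?P. ?W w * ((\<Prod>i\<le>2 * h. block h w i (p i)) * (\<Prod>i<2 * h. ?C i (p i) (p (Suc i)))))
    = (\<Sum>p\<in>?P. \<Sum>w\<in>outcomes N h. ?W w * ((\<Prod>i\<le>2 * h. block h w i (p i)) * (\<Prod>i<2 * h. ?C i (p i) (p (Suc i)))))" by (rule sum.swap)
  also have "\<dots> = (\<Sum>p\<in>?P. (\<kappa> * k) ^ (2 * h))" by (intro sum.cong refl one)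
  also have "\<dots> = real N * real N ^ (2 * h) * (\<kappa> * k) ^ (2 * h)" by (simp add: card_PiE)
  finally show ?thesis using N by (simp add: power_mult_distrib)
qed

lemma phi_cong:
  assumes "\<And>t j. t \<le> n \<Longrightarrow> j < N \<Longrightarrow> a t j = a' t j"
  shows "phi N n C a = phi N n C a'"
proof -
  have "(\<Prod>i\<le>n. a i (p i)) = (\<Prod>i\<le>n. a' i (p i))" if "p \<in> {..n} \<rightarrow>\<^sub>E {..<N}" for p
    using that by (intro prod.cong refl assms) auto
  then show ?thesis by (simp add: phi_paths)
qed

text \<open>One s is spent on the distance between the honest and the signed mean, the other one on
  the deviation of the average over L independent copies.\<close>

lemma copies_concentration:
  assumes S: "S \<in> signs ({..<N} \<times> {..<N})" and C: "contractions N (chain_mat \<kappa> S h)"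
    and tv: "(\<Sum>e\<in>pairs N. \<bar>signed_weight k N S e - honest_weight k N S e\<bar>) \<le> \<tau>"
    and s: "(1 + \<tau>) ^ (2 * h) - 1 \<le> s" "s > 0" and L: "L > 0"
  shows "(\<Sum>x\<in>signs (positions N h L). copies_distr k N S h L x * of_bool (\<bar>Phi N (2 * h) L (chain_mat \<kappa> S h) x - (real N * (\<kappa> * k)) ^ (2 * h)\<bar> \<ge> 2 * s)) \<le> 1 / (real L * s\<^sup>2)"
proof -
  interpret contractions N "2 * h" "chain_mat \<kappa> S h" by (rule C)
  let ?C = "chain_mat \<kappa> S h" and ?\<mu> = "(real N * (\<kappa> * k)) ^ (2 * h)"
  let ?wh = "\<lambda>w. \<Prod>i<2 * h. honest_weight k N S (w i)" and ?ws = "\<lambda>w. \<Prod>i<2 * h. signed_weight k N S (w i)"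
  let ?f = "\<lambda>w. phi N (2 * h) ?C (block h w)"
  have f: "\<bar>?f w\<bar> \<le> 1" if "w \<in> outcomes N h" for w using that by (intro phi_abs block_signs)
  define m where "m = (\<Sum>w\<in>outcomes N h. ?wh w * ?f w)"
  have "\<bar>?\<mu> - m\<bar> = \<bar>\<Sum>w\<in>outcomes N h. (?ws w - ?wh w) * ?f w\<bar>"
    unfolding signed_mean[OF S N, symmetric] m_def by (simp add: left_diff_distrib sum_subtractf)
  also have "\<dots> \<le> (\<Sum>w\<in>outcomes N h. \<bar>?ws w - ?wh w\<bar>)"
    by (rule order_trans[OF sum_abs]) (rule sum_mono, simp add: abs_mult mult_left_le f)
  also have "\<dots> \<le> (1 + \<tau>) ^ card {..<2 * h} - 1"
    unfolding outcomes_def by (rule prod_tv) (simp_all add: finite_pairs honest_weight_nonneg honest_weight_sum tv)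
  finally have close: "\<bar>?\<mu> - m\<bar> \<le> s" using s by simp
  have Phi: "Phi N (2 * h) L ?C (input N h L w) = (\<Sum>l<L. ?f (w l)) / real L" for w
  proof -
    have "phi N (2 * h) ?C (\<lambda>t j. input N h L w (l, t, j)) = ?f (w l)" if "l < L" for l
      using that by (intro phi_cong) (simp add: input_def positions_def)
    then show ?thesis by (simp add: Phi_def)
  qed
  have "(\<Sum>x\<in>signs (positions N h L). copies_distr k N S h L x * of_bool (\<bar>Phi N (2 * h) L ?C x - ?\<mu>\<bar> \<ge> 2 * s))
    = (\<Sum>w\<in>{..<L} \<rightarrow>\<^sub>E outcomes N h. (\<Prod>l<L. ?wh (w l)) * of_bool (\<bar>(\<Sum>l<L. ?f (w l)) / real L - ?\<mu>\<bar> \<ge> 2 * s))"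
    unfolding copies_distr_def by (subst push_sum[OF finite_positions input_signs]) (simp_all add: Phi)
  also have "\<dots> \<le> (\<Sum>w\<in>{..<L} \<rightarrow>\<^sub>E outcomes N h. (\<Prod>l<L. ?wh (w l)) * of_bool (\<bar>(\<Sum>l<L. ?f (w l)) / real L - m\<bar> \<ge> s))"
  proof (rule sum_mono, rule mult_left_mono)
    fix w assume w: "w \<in> {..<L} \<rightarrow>\<^sub>E outcomes N h"
    show "0 \<le> (\<Prod>l<L. ?wh (w l))" by (rule copies_weight_nonneg[OF w])
    let ?A = "(\<Sum>l<L. ?f (w l)) / real L"
    have "\<bar>?A - m\<bar> \<ge> s" if "\<bar>?A - ?\<mu>\<bar> \<ge> 2 * s" using that close by linarith
    then show "of_bool (\<bar>?A - ?\<mu>\<bar> \<ge> 2 * s) \<le> (of_bool (\<bar>?A - m\<bar> \<ge> s) :: real)" by (simp add: of_bool_def)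
  qed
  also have "\<dots> \<le> 1 / (real L * s\<^sup>2)"
    using chebyshev_average[of "outcomes N h" ?wh ?f m s L, OF finite_outcomes honest_outcome_nonneg honest_outcome_sum f m_def[symmetric] s(2) L] .
  finally show ?thesis .
qed

section \<open>The hard distributions\<close>

text \<open>With x = M, the choice of \<kappa> makes N * \<kappa>^2 = 1 / x^2, so the path sum has
  mean V = x ^ (-4 * h) on correlated chains and 0 on uniform ones. The threshold V / 2 and the gap
  V / 4 leave V / 4 for deviations on either side. Chebyshev's inequality asks for L of order 1 /
  V^2 = x ^ (8 * h); the remaining factor x ^ h of L gives the failure probability.\<close>

theorem hard_distribution:
  fixes h M :: nat
  assumes h: "h \<ge> 2" and M: "1000 * h * (4 * (8 * h^2 + 9 * h + 1)) ^ (8 * h^2 + 9 * h + 1) \<le> M"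
  defines "W \<equiv> positions (M ^ (8 * h^2)) h (M ^ (9 * h))" and "V \<equiv> 1 / real M ^ (4 * h)"
  obtains \<Phi> D U where
    "gam W (signs W) (signs W) (4 * real (2 * h + 1)) (4 * real (2 * h + 1)) (\<lambda>x y. \<Phi> x - \<Phi> y)"
    "distr_on W D" "distr_on W U" "indist W (M ^ (8 * h^2 - 16 * h)) (5 / real M ^ h) D U"
    "(\<Sum>x\<in>signs W. D x * of_bool (\<not> \<Phi> x \<ge> V / 2 + V / 4)) \<le> 64 / real M ^ h"
    "(\<Sum>x\<in>signs W. U x * of_bool (\<not> \<Phi> x \<le> V / 2 - V / 4)) \<le> 64 / real M ^ h"
proof -
  define x where "x = real M"
  \<comment> \<open>The moment exponent for which (x^2) ^ m = N^2 * x^2, enough for the union bound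
    over about N^2 terms; also x ^ m = N * x, which beats the size of the net per coordinate
    pair.\<close>
  define m where "m = 8 * h^2 + 1"
  \<comment> \<open>The moment exponent for the tree bound: x ^ m2 exceeds the number of positions,
    so their union bound costs only a factor x in c.\<close>
  define m2 where "m2 = 8 * h^2 + 9 * h + 1"
  define X where "X = real ((4 * m2) ^ m2)"
  have mm: "m \<le> m2" "m \<ge> 1" "m2 \<ge> 1" by (auto simp: m_def m2_def)
  have X1: "real ((4 * m) ^ m) \<le> X"
  proof -
    have "(4 * m) ^ m \<le> (4 * m2) ^ m" using mm by (intro power_mono) auto
    also have "\<dots> \<le> (4 * m2) ^ m2" using mm by (intro power_increasing) auto
    finally show ?thesis unfolding X_def of_nat_le_iff .
  qed
  have "(4 * m2) ^ 1 \<le> (4 * m2) ^ m2" using mm by (intro power_increasing) auto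
  then have X2: "4 * real m2 \<le> X" unfolding X_def using of_nat_mono[of "(4 * m2) ^ 1" "(4 * m2) ^ m2"] by simp
  have X3: "real ((2 * m) ^ m) \<le> X"
  proof -
    have "(2 * m) ^ m \<le> (4 * m) ^ m" by (intro power_mono) auto
    then show ?thesis using X1 by (simp only: of_nat_le_iff[symmetric, where 'a = real])
  qed
  have X0: "X \<ge> 4" using X2 mm by linarith
  have "real (1000 * h * (4 * m2) ^ m2) \<le> real M" using M unfolding m2_def of_nat_le_iff .
  then have xX: "1000 * real h * X \<le> x" by (simp add: X_def x_def)
  have hX: "2 * X \<le> real h * X" using h X0 by (intro mult_right_mono) auto
  have xX': "2000 * X \<le> x" using xX hX by linarith
  have hx: "4000 * real h \<le> x"
  proof -
    have "real h * 4 \<le> real h * X" using X0 by (intro mult_left_mono) auto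
    then show ?thesis using xX by linarith
  qed
  have x1: "x \<ge> 324" "x \<ge> 1" "x > 0" using xX' X0 by linarith+
  have xx: "x \<le> x\<^sup>2" using x1 mult_left_mono[of 1 x x] by (simp add: power2_eq_square)
  have Mpos: "M > 0" using x1 by (simp add: x_def)
  define N where "N = M ^ (8 * h^2)"
  define L where "L = M ^ (9 * h)"
  define a where "a = x ^ (4 * h^2)"
  have a1: "a \<ge> 1" using x1 by (simp add: a_def)
  have Na: "real N = a * a" unfolding N_def a_def x_def of_nat_power power_add[symmetric] by (rule arg_cong[where f = "\<lambda>n. _ ^ n"]) simp
  have Nx: "real N = x ^ (8 * h^2)" by (simp add: N_def x_def)
  have Npos: "N > 0" using Mpos by (simp add: N_def)
  have Lpos: "L > 0" using Mpos by (simp add: L_def)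
  have N1: "real N \<ge> 1" using Npos by simp
  \<comment> \<open>Smaller than 1 / sqrt N by the factor x: then \<kappa> times S is a contraction
    and the linear forms rarely exceed 1.\<close>
  define \<kappa> where "\<kappa> = 1 / (a * x)"
  have \<kappa>: "\<kappa> > 0" using a1 x1 by (simp add: \<kappa>_def)
  have N\<kappa>: "real N * \<kappa>\<^sup>2 = 1 / x\<^sup>2" using a1 x1 by (simp add: Na \<kappa>_def power_divide power_mult_distrib power2_eq_square)
  have x2m: "(x\<^sup>2) ^ m = real N * real N * x\<^sup>2"
    unfolding Nx power_mult[symmetric] power_add[symmetric] by (rule arg_cong[where f = "\<lambda>n. x ^ n"]) (simp add: m_def)
  have pw: "(y * (1 / x\<^sup>2)) ^ m = y ^ m / (real N * real N * x\<^sup>2)" for y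
    by (simp add: power_divide x2m)
  have small: "real N * (real (N + 1) * (4 * real m * (real N * \<kappa>\<^sup>2)) ^ m) \<le> 1 / 8"
  proof -
    have "real N * (real (N + 1) * (4 * real m * (real N * \<kappa>\<^sup>2)) ^ m) = (1 + 1 / real N) * (4 * real m) ^ m / x\<^sup>2"
      unfolding N\<kappa> pw using Npos x1 by (simp add: field_simps)
    also have "\<dots> \<le> 2 * X / x\<^sup>2"
      using X1 N1 by (intro divide_right_mono mult_mono) auto
    also have "\<dots> \<le> 2 * X / x" using xx x1 X0 by (intro divide_left_mono) auto
    also have "\<dots> \<le> 1 / 8" using xX' x1 by (simp add: field_simps)
    finally show ?thesis .
  qed
  define \<tau> where "\<tau> = 16 * (real N * (real (2 * m) * (real N * \<kappa>\<^sup>2)) ^ m)"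
  have \<tau>_eq: "\<tau> = 16 * (real ((2 * m) ^ m) / (real N * x\<^sup>2))"
    unfolding \<tau>_def N\<kappa> pw using Npos by simp
  have \<tau>0: "\<tau> \<ge> 0" by (simp add: \<tau>_eq)
  have \<tau>_le: "real N * \<tau> \<le> 16 * X / x\<^sup>2"
  proof -
    have "real N * \<tau> = 16 * real ((2 * m) ^ m) / x\<^sup>2" unfolding \<tau>_eq using Npos by simp
    also have "\<dots> \<le> 16 * X / x\<^sup>2" using X3 by (intro divide_right_mono) auto
    finally show ?thesis .
  qed
  have clip: "real N * (2 * (real (2 * m) * (real N * \<kappa>\<^sup>2)) ^ m) \<le> 1 / 2"
  proof -
    have "real N * (2 * (real (2 * m) * (real N * \<kappa>\<^sup>2)) ^ m) = \<tau> / 8" by (simp add: \<tau>_def)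
    also have "\<dots> \<le> real N * \<tau> / 8" using N1 \<tau>0 mult_right_mono[of 1 "real N" \<tau>] by simp
    also have "\<dots> \<le> 16 * X / x\<^sup>2 / 8" using \<tau>_le by (intro divide_right_mono) auto
    also have "\<dots> \<le> 16 * X / x / 8" using xx x1 X0 by (intro divide_right_mono divide_left_mono) auto
    also have "\<dots> \<le> 1 / 2" using xX' x1 by (simp add: field_simps)
    finally show ?thesis .
  qed
  define q where "q = 4 * int (M ^ (4 * h^2))"
  have qa: "real_of_int q = 4 * a" by (simp add: q_def a_def x_def)
  define Z where "Z = {..<N} \<rightarrow>\<^sub>E real_of_int ` {-q..q}"
  have fZ: "finite Z" unfolding Z_def by (intro finite_PiE) auto
  have cZ: "4 * real (card Z) ^ 2 \<le> x ^ (m * N)"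
  proof -
    have q0: "q \<ge> 0" by (simp add: q_def)
    have "card (real_of_int ` {-q..q}) = nat (2 * q + 1)" by (subst card_image) (auto simp: inj_on_def)
    then have "real (card Z) = (2 * real_of_int q + 1) ^ N" using q0 by (simp add: Z_def card_PiE)
    also have "\<dots> \<le> (9 * a) ^ N" using a1 unfolding qa by (intro power_mono) auto
    finally have "real (card Z) ^ 2 \<le> ((9 * a) ^ N) ^ 2" by (intro power_mono) auto
    also have "\<dots> = (81 * real N) ^ N" unfolding Na power_mult[symmetric] mult.commute[of N] unfolding power_mult
      by (simp add: power2_eq_square)
    finally have "4 * real (card Z) ^ 2 \<le> 4 ^ N * (81 * real N) ^ N"
      using power_increasing[of 1 N "4::real"] Npos by (intro mult_mono) auto
    also have "\<dots> = (324 * real N) ^ N" unfolding power_mult_distrib[symmetric] by simp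
    also have "\<dots> \<le> (x * real N) ^ N" using x1 by (intro power_mono mult_right_mono) auto
    also have "x * real N = x ^ m" unfolding Nx m_def by simp
    finally show ?thesis by (simp add: power_mult)
  qed
  have mN: "m > 0" "m * N > 0" using mm Npos by auto
  obtain S where S: "S \<in> signs ({..<N} \<times> {..<N})"
    and F: "\<And>A B. A \<subseteq> {..<N} \<Longrightarrow> B \<subseteq> {..<N} \<Longrightarrow> B \<noteq> {} \<Longrightarrow> (link_coeff \<kappa> N S A B)\<^sup>2 \<le> (sqrt (real (card B)) / sqrt (real N)) ^ (card A + card B)"
    and Y: "av {..<N} (\<lambda>x. \<Prod>j<N. 1 + 2 * link_form \<kappa> N S x j ^ (2 * m)) \<le> 1 + 16 * (real N * (real (2 * m) * (real N * \<kappa>\<^sup>2)) ^ m)"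
    and net: "\<And>z w. z \<in> Z \<Longrightarrow> w \<in> Z \<Longrightarrow> (bilin N S z w)\<^sup>2 \<le> real (2 * (m * N)) * x * (sqn N z * sqn N w)"
  proof (rule good_matrix[OF Npos mN(1) mN(2) \<kappa> mN(1) small clip fZ x1(3) cZ], goal_cases)
    case (1 S)
    from 1(2-) show ?case by (rule 1(1))
  qed
  define c0 where "c0 = sqrt (real (2 * (m * N)) * x)"
  have c0: "c0 \<ge> 0" "c0\<^sup>2 = real (2 * (m * N)) * x" using x1 by (simp_all add: c0_def)
  have bil: "\<bar>bilin N S u v\<bar> \<le> 2 * c0 * (sqrt (sqn N u) * sqrt (sqn N v))" for u v
  proof (rule bilin_bound[OF Npos _ _ c0(1)])
    show "4 * sqrt (real N) \<le> real_of_int q" unfolding qa Na using a1 by simp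
    show "(bilin N S z w)\<^sup>2 \<le> c0\<^sup>2 * (sqn N z * sqn N w)" if "z \<in> {..<N} \<rightarrow>\<^sub>E real_of_int ` {-q..q}" "w \<in> {..<N} \<rightarrow>\<^sub>E real_of_int ` {-q..q}" for z w
      unfolding c0(2) using that by (intro net) (simp_all only: Z_def)
  qed
  have \<kappa>D: "\<kappa>\<^sup>2 * (2 * c0)\<^sup>2 \<le> 1"
  proof -
    have "\<kappa>\<^sup>2 * (2 * c0)\<^sup>2 = 8 * real m * x * (real N * \<kappa>\<^sup>2)" by (simp add: power_mult_distrib c0)
    also have "\<dots> = 8 * real m / x" unfolding N\<kappa> using x1 by (simp add: power2_eq_square)
    also have "\<dots> \<le> 1"
    proof -
      have "real m \<le> real m2" using mm by simp
      then have "8 * real m \<le> x" using X2 xX' mm by linarith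
      then show ?thesis using x1 by (simp add: divide_le_eq)
    qed
    finally show ?thesis .
  qed
  let ?C = "chain_mat \<kappa> S h"
  have con: "contractions N ?C"
  proof
    show "N > 0" by (rule Npos)
    have fin: "sqn N (\<lambda>i. \<kappa> * u i) \<le> sqn N v" if "sqn N u \<le> (2 * c0)\<^sup>2 * sqn N v" for u v
    proof -
      have "sqn N (\<lambda>i. \<kappa> * u i) \<le> \<kappa>\<^sup>2 * ((2 * c0)\<^sup>2 * sqn N v)" unfolding sqn_scale by (intro mult_left_mono that) simp
      also have "\<dots> = (\<kappa>\<^sup>2 * (2 * c0)\<^sup>2) * sqn N v" by simp
      also have "\<dots> \<le> 1 * sqn N v" by (intro mult_right_mono \<kappa>D sqn_nonneg)
      finally show ?thesis by simp
    qed
    show "sqn N (\<lambda>k. \<Sum>j<N. v j * ?C t j k) \<le> sqn N v" for t v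
    proof -
      have "(\<lambda>k. \<Sum>j<N. v j * ?C t j k) = (\<lambda>k. \<kappa> * (if t < h then \<Sum>j<N. S (j, k) * v j else \<Sum>j<N. S (k, j) * v j))"
        by (rule ext) (simp add: chain_mat_def oriented_def sum_distrib_left ac_simps)
      moreover have "sqn N (\<lambda>k. if t < h then \<Sum>j<N. S (j, k) * v j else \<Sum>j<N. S (k, j) * v j) \<le> (2 * c0)\<^sup>2 * sqn N v"
        using sqn_image_bound[of N S "2 * c0" v, OF bil] by (cases "t < h") simp_all
      ultimately show ?thesis using fin by simp
    qed
    show "sqn N (\<lambda>j. \<Sum>k<N. ?C t j k * v k) \<le> sqn N v" for t v
    proof -
      have "(\<lambda>j. \<Sum>k<N. ?C t j k * v k) = (\<lambda>j. \<kappa> * (if t < h then \<Sum>k<N. S (j, k) * v k else \<Sum>k<N. S (k, j) * v k))"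
        by (rule ext) (simp add: chain_mat_def oriented_def sum_distrib_left ac_simps)
      moreover have "sqn N (\<lambda>j. if t < h then \<Sum>k<N. S (j, k) * v k else \<Sum>k<N. S (k, j) * v k) \<le> (2 * c0)\<^sup>2 * sqn N v"
        using sqn_image_bound[of N S "2 * c0" v, OF bil] by (cases "t < h") simp_all
      ultimately show ?thesis using fin by simp
    qed
  qed
  \<comment> \<open>The uniform distribution is the chain of strength 0, all of whose coefficients
    with nonempty B vanish.\<close>
  have F0: "(link_coeff 0 N S A B)\<^sup>2 \<le> (sqrt (real (card B)) / sqrt (real N)) ^ (card A + card B)" if "B \<subseteq> {..<N}" "B \<noteq> {}" for A B
  proof -
    have "finite B" using that(1) finite_subset by blast
    then have "(\<Prod>j\<in>B. link_form 0 N S x j) = 0" for x using that(2) by (auto simp: link_form_def)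
    then have "link_coeff 0 N S A B = 0" by (simp add: link_coeff_def av_const)
    then show ?thesis by simp
  qed
  have tv: "(\<Sum>e\<in>pairs N. \<bar>signed_weight \<kappa> N S e - honest_weight \<kappa> N S e\<bar>) \<le> \<tau>"
    using link_tv[OF mN(1), where N = N and k = \<kappa> and S = S] Y unfolding \<tau>_def by linarith
  have tv0: "(\<Sum>e\<in>pairs N. \<bar>signed_weight 0 N S e - honest_weight 0 N S e\<bar>) \<le> \<tau>"
    using \<tau>0 by (simp add: honest_weight_def link_form_def)
  have Vx: "V = 1 / x ^ (4 * h)" by (simp add: V_def x_def)
  have V0: "V > 0" using x1 by (simp add: Vx)
  have Lx: "real L = x ^ (9 * h)" by (simp add: L_def x_def)
  have h2: "16 * h \<le> 8 * h^2" using h by (simp add: power2_eq_square)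
  have LV: "real L \<le> real N * V"
  proof -
    have "x ^ (9 * h) * x ^ (4 * h) = x ^ (13 * h)" by (simp add: power_add[symmetric])
    also have "\<dots> \<le> x ^ (8 * h^2)" using x1(2) h2 by (intro power_increasing) auto
    finally show ?thesis unfolding Vx Lx Nx using x1 by (simp add: field_simps)
  qed
  have hL\<tau>: "2 * (2 * real h * real L * \<tau>) \<le> V / 8"
  proof -
    have "real L * \<tau> \<le> (real N * V) * \<tau>" by (intro mult_right_mono LV \<tau>0)
    then have "4 * real h * (real L * \<tau>) \<le> 4 * real h * ((real N * V) * \<tau>)" by (intro mult_left_mono) auto
    then have "2 * (2 * real h * real L * \<tau>) \<le> 4 * real h * ((real N * V) * \<tau>)" by (simp add: mult.assoc)
    also have "\<dots> = 4 * real h * V * (real N * \<tau>)" by simp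
    also have "\<dots> \<le> 4 * real h * V * (16 * X / x\<^sup>2)" using V0 by (intro mult_left_mono \<tau>_le) auto
    also have "\<dots> = (64 * real h * X / x\<^sup>2) * V" by simp
    also have "\<dots> \<le> (1 / 8) * V"
    proof (rule mult_right_mono)
      have "0 \<le> real h * X" using X0 by simp
      then have "64 * real h * X * 8 \<le> x\<^sup>2" using xX xx by linarith
      then show "64 * real h * X / x\<^sup>2 \<le> 1 / 8" using x1 by (simp add: field_simps)
    qed (use V0 in simp)
    finally show ?thesis by simp
  qed
  have V1: "V \<le> 1 / x ^ h" unfolding Vx using x1 by (intro divide_left_mono power_increasing) auto
  have Vle1: "V \<le> 1" using x1 by (simp add: Vx)
  have tvL: "(1 + \<tau>) ^ (2 * h * L) - 1 \<le> V / 8"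
  proof -
    have "(1 + \<tau>) ^ (2 * h * L) \<le> 1 + 2 * (real (2 * h * L) * \<tau>)"
      by (rule one_plus_power_le) (use \<tau>0 hL\<tau> Vle1 in auto)
    then show ?thesis using hL\<tau> by simp
  qed
  have tvs: "(1 + \<tau>) ^ (2 * h) - 1 \<le> V / 8"
  proof -
    have "(1 + \<tau>) ^ (2 * h) \<le> (1 + \<tau>) ^ (2 * h * L)" using \<tau>0 Lpos by (intro power_increasing) auto
    then show ?thesis using tvL by linarith
  qed
  have W: "W = positions N h L" by (simp add: W_def N_def L_def)
  define D where "D = copies_distr \<kappa> N S h L"
  define U where "U = copies_distr 0 N S h L"
  \<comment> \<open>This is below G by the factor x ^ (8 * h), which absorbs 3 * c and still leaves
    \<rho>^2 = x ^ (-2 * h).\<close>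
  define d where "d = M ^ (8 * h^2 - 16 * h)"
  define c where "c = 2 * real m2 * x"
  \<comment> \<open>A power of x just below N to the power h / (h + 1); the comparison comes down to
    (h - 1) * (h + 1) <= h^2.\<close>
  define G where "G = x ^ (8 * h^2 - 8 * h)"
  define \<rho> where "\<rho> = 1 / x ^ h"
  have dN: "d \<le> N" unfolding d_def N_def using Mpos by (intro power_increasing) auto
  have m2: "m2 > 0" using mm by simp
  have c: "c > 0" "real (2 * m2) ^ m2 * real (card (positions N h L)) \<le> c ^ m2"
  proof -
    show "c > 0" using m2 x1 by (simp add: c_def)
    have "real (card (positions N h L)) = x ^ (9 * h) * real (2 * h + 1) * x ^ (8 * h^2)"
      unfolding card_positions of_nat_mult Lx Nx by simp
    also have "\<dots> \<le> x ^ (9 * h) * x * x ^ (8 * h^2)" using hx x1 h by (intro mult_right_mono mult_left_mono) auto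
    also have "\<dots> = x ^ m2" unfolding m2_def by (simp add: power_add)
    finally have le: "real (card (positions N h L)) \<le> x ^ m2" .
    have "c = real (2 * m2) * x" by (simp add: c_def)
    then have cm: "c ^ m2 = real (2 * m2) ^ m2 * x ^ m2" by (simp only: power_mult_distrib)
    show "real (2 * m2) ^ m2 * real (card (positions N h L)) \<le> c ^ m2"
      unfolding cm by (rule mult_left_mono[OF le]) simp
  qed
  have G: "G > 0" "G ^ (h + 1) \<le> real N ^ h"
  proof -
    show "G > 0" using x1 by (simp add: G_def)
    have "(8 * h^2 - 8 * h) * (h + 1) \<le> 8 * h^2 * h"
    proof -
      have "8 * h^2 - 8 * h = 8 * h * (h - 1)" by (simp add: power2_eq_square diff_mult_distrib2)
      then have "(8 * h^2 - 8 * h) * (h + 1) = 8 * h * ((h - 1) * (h + 1))" by (simp only: mult.assoc)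
      also have "(h - 1) * (h + 1) \<le> h * h" using h by (simp add: algebra_simps)
      finally show ?thesis by (simp add: power2_eq_square mult.assoc)
    qed
    then show "G ^ (h + 1) \<le> real N ^ h" unfolding G_def Nx power_mult[symmetric] using x1 by (intro power_increasing) auto
  qed
  have \<rho>: "3 * c * real d / G \<le> \<rho>\<^sup>2" "0 \<le> \<rho>" "\<rho> \<le> 1 / 2"
  proof -
    have e: "8 * h^2 - 8 * h = (8 * h^2 - 16 * h) + 8 * h" using h2 by simp
    have Gd: "G = real d * x ^ (8 * h)" unfolding G_def e power_add d_def x_def by simp
    have d0: "real d > 0" using Mpos by (simp add: d_def)
    have "3 * c * real d / G = 6 * real m2 * x / x ^ (8 * h)" unfolding Gd c_def using d0 by simp
    also have "\<dots> \<le> x * x / x ^ (8 * h)"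
      using X2 xX' x1 by (intro divide_right_mono mult_right_mono) auto
    also have "\<dots> \<le> 1 / (x ^ h)\<^sup>2"
    proof -
      have "x * x * (x ^ h)\<^sup>2 = x ^ (2 + h * 2)" by (simp add: power_add power_mult power2_eq_square)
      also have "\<dots> \<le> x ^ (8 * h)" using x1 h by (intro power_increasing) auto
      finally show ?thesis using x1 by (simp add: field_simps)
    qed
    finally show "3 * c * real d / G \<le> \<rho>\<^sup>2" by (simp add: \<rho>_def power_divide)
    show "0 \<le> \<rho>" using x1 by (simp add: \<rho>_def)
    have "x ^ 1 \<le> x ^ h" using x1 h by (intro power_increasing) auto
    then have "2 \<le> x ^ h" using x1 by simp
    then show "\<rho> \<le> 1 / 2" by (simp add: \<rho>_def divide_le_eq)
  qed
  have ind: "indist W d (5 / x ^ h) D U"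
    unfolding indist_def
  proof (intro allI impI)
    fix t :: "(nat \<times> nat \<times> nat) tr" assume t: "trvars t \<subseteq> W" "dep t \<le> d"
    note t' = t(1)[unfolded W]
    have "\<bar>accept W D t - hist_av d (\<lambda>h. case node (prune t Map.empty) h of Lf b \<Rightarrow> of_bool (b = 1) | _ \<Rightarrow> 0)\<bar> \<le> 2 * \<rho> + ((1 + \<tau>) ^ (2 * h * L) - 1)"
      unfolding D_def W by (rule copies_accept[OF F tv t' t(2) dN m2 c G \<rho>])
    moreover have "\<bar>accept W U t - hist_av d (\<lambda>h. case node (prune t Map.empty) h of Lf b \<Rightarrow> of_bool (b = 1) | _ \<Rightarrow> 0)\<bar> \<le> 2 * \<rho> + ((1 + \<tau>) ^ (2 * h * L) - 1)"
      unfolding U_def W by (rule copies_accept[OF F0 tv0 t' t(2) dN m2 c G \<rho>])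
    ultimately have "\<bar>accept W D t - accept W U t\<bar> \<le> 4 * \<rho> + V / 4" using tvL by linarith
    moreover have "5 / x ^ h = 5 * \<rho>" "V \<le> \<rho>" using V1 by (simp_all add: \<rho>_def)
    ultimately show "\<bar>accept W D t - accept W U t\<bar> \<le> 5 / x ^ h" using \<rho>(2) by linarith
  qed
  let ?\<Phi> = "Phi N (2 * h) L ?C"
  have \<eta>: "1 / (real L * (V / 8)\<^sup>2) = 64 / x ^ h"
  proof -
    have "real L = x ^ h * (x ^ (4 * h))\<^sup>2" unfolding Lx power_mult[symmetric] power_add[symmetric] by (rule arg_cong[where f = "\<lambda>n. x ^ n"]) simp
    then show ?thesis unfolding Vx using x1 by (simp add: power_divide)
  qed
  have s: "V / 8 > 0" using V0 by simp
  have nn: "0 \<le> D y" "0 \<le> U y" for y using copies_distr_on[of N h L] unfolding D_def U_def distr_on_def by blast+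
  have muD: "(real N * (\<kappa> * \<kappa>)) ^ (2 * h) = V"
    using N\<kappa> unfolding Vx by (simp add: power2_eq_square[symmetric] power_divide power_mult[symmetric])
  have muU: "(real N * (\<kappa> * 0)) ^ (2 * h) = 0" using h by simp
  have cD: "(\<Sum>y\<in>signs W. D y * of_bool (\<not> ?\<Phi> y \<ge> V / 2 + V / 4)) \<le> 64 / x ^ h"
  proof -
    have "(\<Sum>y\<in>signs W. D y * of_bool (\<not> ?\<Phi> y \<ge> V / 2 + V / 4)) \<le> (\<Sum>y\<in>signs W. D y * of_bool (\<bar>?\<Phi> y - V\<bar> \<ge> 2 * (V / 8)))"
    proof (rule sum_mono, rule mult_left_mono[OF _ nn(1)])
      fix y
      have "\<bar>?\<Phi> y - V\<bar> \<ge> 2 * (V / 8)" if "\<not> ?\<Phi> y \<ge> V / 2 + V / 4" using that by linarith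
      then show "of_bool (\<not> ?\<Phi> y \<ge> V / 2 + V / 4) \<le> (of_bool (\<bar>?\<Phi> y - V\<bar> \<ge> 2 * (V / 8)) :: real)" by (simp only: of_bool_def split: if_split) simp
    qed
    also have "\<dots> \<le> 64 / x ^ h"
      using copies_concentration[OF S con tv tvs s Lpos] unfolding W D_def muD \<eta> .
    finally show ?thesis .
  qed
  have cU: "(\<Sum>y\<in>signs W. U y * of_bool (\<not> ?\<Phi> y \<le> V / 2 - V / 4)) \<le> 64 / x ^ h"
  proof -
    have "(\<Sum>y\<in>signs W. U y * of_bool (\<not> ?\<Phi> y \<le> V / 2 - V / 4)) \<le> (\<Sum>y\<in>signs W. U y * of_bool (\<bar>?\<Phi> y - 0\<bar> \<ge> 2 * (V / 8)))"
    proof (rule sum_mono, rule mult_left_mono[OF _ nn(2)])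
      fix y
      have "\<bar>?\<Phi> y - 0\<bar> \<ge> 2 * (V / 8)" if "\<not> ?\<Phi> y \<le> V / 2 - V / 4" using that by linarith
      then show "of_bool (\<not> ?\<Phi> y \<le> V / 2 - V / 4) \<le> (of_bool (\<bar>?\<Phi> y - 0\<bar> \<ge> 2 * (V / 8)) :: real)" by (simp only: of_bool_def split: if_split) simp
    qed
    also have "\<dots> \<le> 64 / x ^ h"
      using copies_concentration[OF S con tv0 tvs s Lpos] unfolding W U_def muU \<eta> .
    finally show ?thesis .
  qed
  have g: "gam W (signs W) (signs W) (4 * real (2 * h + 1)) (4 * real (2 * h + 1)) (\<lambda>x y. ?\<Phi> x - ?\<Phi> y)"
    unfolding W positions_def by (rule contractions.gam_Phi[OF con Lpos])
  show thesis
    by (rule that[of ?\<Phi> D U]) (use g ind cD cU copies_distr_on in \<open>simp_all only: W D_def U_def x_def d_def\<close>)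
qed

section \<open>The separation\<close>

lemma gam_reindex:
  assumes e: "bij_betw e I V" and X: "\<And>x. x \<in> X' \<Longrightarrow> F x \<in> X" and Y: "\<And>y. y \<in> Y' \<Longrightarrow> F y \<in> Y"
    and F: "\<And>x i. i \<in> I \<Longrightarrow> F x (e i) = x i" and g: "gam V X Y A B (\<lambda>_ _. 1)"
  shows "gam I X' Y' A B (\<lambda>_ _. 1)"
proof -
  obtain d :: nat and u v where
    uv: "\<forall>x\<in>X. (\<Sum>i\<in>V. \<Sum>a<d. (u x i a)\<^sup>2) \<le> A" "\<forall>y\<in>Y. (\<Sum>i\<in>V. \<Sum>a<d. (v y i a)\<^sup>2) \<le> B"
      "\<forall>x\<in>X. \<forall>y\<in>Y. 1 = (\<Sum>i\<in>V. \<Sum>a<d. dif x y i * (u x i a * v y i a))"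
    using g unfolding gam_def by (elim exE conjE) rule
  have re: "(\<Sum>i\<in>I. H (e i)) = (\<Sum>i\<in>V. H i)" for H :: "_ \<Rightarrow> real" by (rule sum.reindex_bij_betw[OF e])
  show ?thesis
  proof (rule gamI[where D = "{..<d}" and u = "\<lambda>x i a. u (F x) (e i) a" and v = "\<lambda>y i a. v (F y) (e i) a"])
    show "(\<Sum>i\<in>I. \<Sum>a<d. (u (F x) (e i) a)\<^sup>2) \<le> A" if "x \<in> X'" for x
      using bspec[OF uv(1) X[OF that]] re[of "\<lambda>i. \<Sum>a<d. (u (F x) i a)\<^sup>2"] by simp
    show "(\<Sum>i\<in>I. \<Sum>a<d. (v (F y) (e i) a)\<^sup>2) \<le> B" if "y \<in> Y'" for y
      using bspec[OF uv(2) Y[OF that]] re[of "\<lambda>i. \<Sum>a<d. (v (F y) i a)\<^sup>2"] by simp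
    show "1 = (\<Sum>i\<in>I. \<Sum>a<d. dif x y i * (u (F x) (e i) a * v (F y) (e i) a))" if "x \<in> X'" "y \<in> Y'" for x y
    proof -
      have "(\<Sum>i\<in>I. \<Sum>a<d. dif x y i * (u (F x) (e i) a * v (F y) (e i) a)) = (\<Sum>i\<in>I. \<Sum>a<d. dif (F x) (F y) (e i) * (u (F x) (e i) a * v (F y) (e i) a))"
        by (intro sum.cong refl) (simp add: dif_def F)
      then show ?thesis using bspec[OF bspec[OF uv(3) X[OF that(1)]] Y[OF that(2)]] re[of "\<lambda>i. \<Sum>a<d. dif (F x) (F y) i * (u (F x) i a * v (F y) i a)"] by simp
    qed
  qed simp
qed

section \<open>Sensitivity of the cheat sheet function and numbering of its variables\<close>

context cheat
begin

lemma address_subset: "address Z \<subseteq> {..<c}"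
  by (auto simp: address_def)

text \<open>All instances equal w, and the cell at the resulting address is filled. Flipping any of
  the 2 ^ b entries that certify one outer bit falsifies this certificate, and if the flip moves the
  address, it leads to a cell whose flag is still -1.\<close>

lemma sensitive_input:
  assumes w: "w \<in> signs W" "\<Phi> w \<ge> \<theta> + \<gamma>" and c: "c > 0" and W: "W \<noteq> {}"
  obtains Z I where "Z \<in> signs VS" "total_fun Z = 1" "I \<subseteq> VS" "card I = 2 ^ b" "\<And>v. v \<in> I \<Longrightarrow> total_fun (Z(v := - Z v)) = 0"
proof -
  define z where "z = hide_in (W \<times> R) R (-1) (hide_in W R 1 w (\<lambda>_\<in>W. {})) (\<lambda>_\<in>W \<times> R. {})"
  have z: "z \<in> signs V3" unfolding z_def by (intro hide_in_signs w) auto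
  have dz: "decode z = w" unfolding z_def by (rule decode_hide[OF w(1)]) (auto simp: empty_R)
  define Z0 where "Z0 = blank (\<lambda>_. z)"
  have Z0: "Z0 \<in> signs VS" unfolding Z0_def by (rule blank_signs[OF z])
  have out0: "outer Z0 \<tau> = w" if "\<tau> < c" for \<tau> unfolding Z0_def by (simp add: outer_blank[OF that] dz)
  define e where "e = address Z0"
  define Z where "Z = filled e Z0"
  have Z: "Z \<in> signs VS" unfolding Z_def by (rule filled_signs[OF Z0])
  have ec: "e \<subseteq> {..<c}" unfolding e_def by (rule address_subset)
  have ad: "address Z = e" unfolding e_def by (simp add: address_def Z_def outer_filled[OF Z0])
  have val: "valid Z e" unfolding Z_def
    by (rule filled_valid[OF Z0 ec]) (use out0 w(2) in \<open>simp add: promised_def\<close>)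
  have flag: "Z (Flag e') = -1" if "e' \<subseteq> {..<c}" "e' \<noteq> e" for e'
  proof -
    have "Z (Flag e') = Z0 (Flag e')" unfolding Z_def by (rule filled_other[OF Z0]) (use that in \<open>auto simp: cell_def\<close>)
    also have "\<dots> = -1" using that by (simp add: Z0_def blank_def VS_def)
    finally show ?thesis .
  qed
  obtain i where i: "i \<in> W" using W by blast
  define I where "I = (if Z (Claim e 0 i) = 1 then (\<lambda>r. Inp 0 i r (pointer Z e 0 i r)) ` R else (\<lambda>j. Inp 0 i (pointer Z e 0 i {}) j) ` R)"
  have cert: "certified Z e 0 i" using val c i by (simp add: valid_def)
  have "card I = card R"
    unfolding I_def by (cases "Z (Claim e 0 i) = 1") (simp_all add: card_image inj_on_def)
  then have cI: "card I = 2 ^ b" by (simp add: card_R)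
  have inV: "Inp 0 i r j \<in> VS" if "r \<in> R" "j \<in> R" for r j using that c i by (simp add: VS_def)
  have IV: "I \<subseteq> VS"
  proof (cases "Z (Claim e 0 i) = 1")
    case True
    then have I: "I = (\<lambda>r. Inp 0 i r (pointer Z e 0 i r)) ` R" by (simp add: I_def)
    show ?thesis unfolding I by (rule image_subsetI) (rule inV[OF _ pointer_R])
  next
    case False
    then have I: "I = (\<lambda>j. Inp 0 i (pointer Z e 0 i {}) j) ` R" by (simp add: I_def)
    show ?thesis unfolding I by (rule image_subsetI) (rule inV[OF pointer_R])
  qed
  have "total_fun (Z(v := - Z v)) = 0" if v: "v \<in> I" for v
  proof (rule ccontr)
    let ?Y = "Z(v := - Z v)"
    assume "total_fun ?Y \<noteq> 0"
    then have vY: "valid ?Y (address ?Y)" by (simp add: total_fun_def split: if_splits)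
    obtain i' r' j' where vi: "v = Inp 0 i' r' j'" using v by (auto simp: I_def split: if_splits)
    have fl: "?Y (Flag e') = Z (Flag e')" and cl: "?Y (Claim e' \<tau> k) = Z (Claim e' \<tau> k)" and pt: "pointer ?Y e' \<tau> k r = pointer Z e' \<tau> k r" for e' \<tau> k r
      by (simp_all add: vi pointer_def)
    have "?Y (Flag (address ?Y)) = 1" using vY by (simp add: valid_def)
    then have "Z (Flag (address ?Y)) = 1" by (simp only: fl)
    moreover have "Z (Flag (address ?Y)) = -1" if "address ?Y \<noteq> e" by (rule flag[OF address_subset that])
    ultimately have ade: "address ?Y = e" by (cases "address ?Y = e") simp_all
    have cY: "certified ?Y e 0 i" using vY c i unfolding ade by (simp add: valid_def)
    show False
    proof (cases "Z (Claim e 0 i) = 1")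
      case True
      then obtain r where r: "r \<in> R" "v = Inp 0 i r (pointer Z e 0 i r)" using v by (auto simp: I_def)
      have "Z v = 1" using cert True r by (simp add: certified_def)
      moreover have "?Y (Inp 0 i r (pointer Z e 0 i r)) = 1" using cY True r(1) unfolding certified_def cl pt by simp
      ultimately show False using r(2) by simp
    next
      case False
      then obtain j where j: "j \<in> R" "v = Inp 0 i (pointer Z e 0 i {}) j" using v by (auto simp: I_def)
      have "Z v = -1" using cert False j by (simp add: certified_def)
      moreover have "?Y (Inp 0 i (pointer Z e 0 i {}) j) = -1" using cY False j(1) unfolding certified_def cl pt by simp
      ultimately show False using j(2) by simp
    qed
  qed
  note fl = this
  have "total_fun Z = 1" using val ad by (simp add: total_fun_def)
  then show thesis by (rule that[OF Z _ IV cI fl])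
qed

text \<open>The variables are numbered because query complexity is defined for functions on
  \<open>cube n\<close>.\<close>

definition enum :: "nat \<Rightarrow> 'o var" where
  "enum = (SOME e. bij_betw e {..<card VS} VS)"

definition rank :: "'o var \<Rightarrow> nat" where
  "rank = inv_into {..<card VS} enum"

definition encode :: "(nat \<Rightarrow> real) \<Rightarrow> 'o var \<Rightarrow> real" where
  "encode y = (\<lambda>v\<in>VS. y (rank v))"

definition decode_nat :: "('o var \<Rightarrow> real) \<Rightarrow> nat \<Rightarrow> int" where
  "decode_nat Z = (\<lambda>i\<in>{..<card VS}. if Z (enum i) = -1 then -1 else 1)"

definition nat_fun :: "(nat \<Rightarrow> int) \<Rightarrow> nat" where
  "nat_fun x = total_fun (encode (\<lambda>i. real_of_int (x i)))"

lemma enum: "bij_betw enum {..<card VS} VS"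
  unfolding enum_def using someI_ex[OF ex_bij_betw_nat_finite[OF finite_VS]] by (simp add: atLeast0LessThan)

lemma enum_VS: "i < card VS \<Longrightarrow> enum i \<in> VS"
  using bij_betw_apply[OF enum] by simp

lemma rank_less: "v \<in> VS \<Longrightarrow> rank v < card VS"
  unfolding rank_def using inv_into_into[of v enum "{..<card VS}"] bij_betw_imp_surj_on[OF enum] by simp

lemma enum_rank: "v \<in> VS \<Longrightarrow> enum (rank v) = v"
  unfolding rank_def using bij_betw_inv_into_right[OF enum] by simp

lemma rank_enum: "i < card VS \<Longrightarrow> rank (enum i) = i"
  unfolding rank_def using bij_betw_inv_into_left[OF enum] by simp

lemma encode_enum: "i < card VS \<Longrightarrow> encode y (enum i) = y i"
  by (simp add: encode_def enum_VS rank_enum)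

lemma encode_cong: "(\<And>i. i < card VS \<Longrightarrow> y i = y' i) \<Longrightarrow> encode y = encode y'"
  unfolding encode_def by (intro restrict_ext) (simp add: rank_less)

lemma encode_signs: "x \<in> cube (card VS) \<Longrightarrow> encode (\<lambda>i. real_of_int (x i)) \<in> signs VS"
  unfolding encode_def
proof (rule signs_restrictI)
  fix v assume x: "x \<in> cube (card VS)" and "v \<in> VS"
  then show "real_of_int (x (rank v)) = 1 \<or> real_of_int (x (rank v)) = -1"
    using cube_cases[OF x rank_less[of v]] by auto
qed

lemma decode_nat_cube: "decode_nat Z \<in> cube (card VS)"
  by (auto simp: decode_nat_def cube_def)

lemma encode_decode: "Z \<in> signs VS \<Longrightarrow> encode (\<lambda>i. real_of_int (decode_nat Z i)) = Z"
proof
  fix v assume Z: "Z \<in> signs VS"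
  show "encode (\<lambda>i. real_of_int (decode_nat Z i)) v = Z v"
  proof (cases "v \<in> VS")
    case True
    then show ?thesis using signs_cases[OF Z True] by (auto simp: encode_def decode_nat_def rank_less enum_rank)
  next
    case False
    then show ?thesis using Z by (auto simp: encode_def signs_def)
  qed
qed

lemma nat_fun_decode: "Z \<in> signs VS \<Longrightarrow> nat_fun (decode_nat Z) = total_fun Z"
  by (simp add: nat_fun_def encode_decode)

lemma nat_fun_range: "nat_fun \<in> cube (card VS) \<rightarrow> {0, 1}"
  by (auto simp: nat_fun_def total_fun_def)

lemma gam_nat:
  assumes "gam VS ones zeros Q Q (\<lambda>_ _. 1)"
  defines "n \<equiv> card VS"
  shows "gam {..<n} (sgn_of n ` {x\<in>cube n. nat_fun x = 1}) (sgn_of n ` {x\<in>cube n. nat_fun x = 0}) Q Q (\<lambda>_ _. 1)"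
proof (rule gam_reindex[OF enum[folded n_def] _ _ _ assms(1), where F = encode])
  have e: "encode (sgn_of n x) = encode (\<lambda>i. real_of_int (x i))" for x
    by (rule encode_cong) (simp add: sgn_of_def n_def)
  show "encode y \<in> ones" if y: "y \<in> sgn_of n ` {x\<in>cube n. nat_fun x = 1}" for y
  proof -
    obtain x where x: "x \<in> cube n" "nat_fun x = 1" "y = sgn_of n x" using y by blast
    have "encode y = encode (\<lambda>i. real_of_int (x i))" unfolding x(3) by (rule e)
    then show ?thesis using encode_signs[of x] x(1,2) by (simp add: ones_def nat_fun_def n_def)
  qed
  show "encode y \<in> zeros" if y: "y \<in> sgn_of n ` {x\<in>cube n. nat_fun x = 0}" for y
  proof -
    obtain x where x: "x \<in> cube n" "nat_fun x = 0" "y = sgn_of n x" using y by blast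
    have "encode y = encode (\<lambda>i. real_of_int (x i))" unfolding x(3) by (rule e)
    then show ?thesis using encode_signs[of x] x(1,2) by (simp add: zeros_def nat_fun_def n_def)
  qed
  show "encode y (enum i) = y i" if "i \<in> {..<n}" for y i using that encode_enum by (simp add: n_def)
qed

primrec relabel :: "dtree \<Rightarrow> 'o var tr" where
  "relabel (dtree.Leaf a) = Lf a"
| "relabel (Query i l r) = Qr (enum i) (relabel l) (relabel r)"

lemma relabel_vars: "dtree_vars t \<subseteq> {..<card VS} \<Longrightarrow> trvars (relabel t) \<subseteq> VS"
  by (induction t) (auto simp: enum_VS)

lemma relabel_dep: "dep (relabel t) = dtree_depth t"
  by (induction t) auto

lemma relabel_ev: "dtree_vars t \<subseteq> {..<card VS} \<Longrightarrow> ev (relabel t) Z = dtree_eval t (decode_nat Z)"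
  by (induction t) (auto simp: decode_nat_def)

lemma randomized_transfer:
  assumes "randomized_computes (1/3) (card VS) nat_fun T"
  obtains p where "\<And>t. t \<in> set_pmf p \<Longrightarrow> trvars t \<subseteq> VS \<and> dep t \<le> T"
    "\<And>Z. Z \<in> signs VS \<Longrightarrow> measure_pmf.prob p {t. ev t Z = total_fun Z} \<ge> 2/3"
proof -
  obtain p where pp: "(\<forall>t\<in>set_pmf p. dtree_vars t \<subseteq> {..<card VS} \<and> dtree_depth t \<le> T) \<and>
      (\<forall>x\<in>cube (card VS). measure_pmf.prob p {t. dtree_eval t x = nat_fun x} \<ge> 1 - 1/3)"
    using assms unfolding randomized_computes_def by (rule exE)
  have p: "dtree_vars t \<subseteq> {..<card VS} \<and> dtree_depth t \<le> T" if "t \<in> set_pmf p" for t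
    using pp that by blast
  have pr: "measure_pmf.prob p {t. dtree_eval t x = nat_fun x} \<ge> 1 - 1/3" if "x \<in> cube (card VS)" for x
    using pp that by blast
  show thesis
  proof (rule that[of "map_pmf relabel p"])
    show "trvars t \<subseteq> VS \<and> dep t \<le> T" if mem: "t \<in> set_pmf (map_pmf relabel p)" for t
    proof -
      obtain s where s: "s \<in> set_pmf p" "t = relabel s" using mem by auto
      show ?thesis using p[OF s(1)] relabel_vars[of s] relabel_dep[of s] unfolding s(2) by simp
    qed
    fix Z assume Z: "Z \<in> signs VS"
    have "measure_pmf.prob (map_pmf relabel p) {t. ev t Z = total_fun Z} = measure_pmf.prob p {t. ev (relabel t) Z = total_fun Z}"
      by (simp add: measure_map_pmf vimage_def)
    also have "\<dots> = measure_pmf.prob p {t. dtree_eval t (decode_nat Z) = nat_fun (decode_nat Z)}"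
    proof -
      have re: "ev (relabel t) Z = dtree_eval t (decode_nat Z)" if "t \<in> set_pmf p" for t
        using relabel_ev[of t Z] p[OF that] by simp
      have "{t. ev (relabel t) Z = total_fun Z} \<inter> set_pmf p = {t. dtree_eval t (decode_nat Z) = nat_fun (decode_nat Z)} \<inter> set_pmf p"
        unfolding nat_fun_decode[OF Z] by (rule Set.set_eqI) (use re in auto)
      then show ?thesis
        using measure_Int_set_pmf[of p "{t. ev (relabel t) Z = total_fun Z}"] measure_Int_set_pmf[of p "{t. dtree_eval t (decode_nat Z) = nat_fun (decode_nat Z)}"] by simp
    qed
    finally show "measure_pmf.prob (map_pmf relabel p) {t. ev t Z = total_fun Z} \<ge> 2/3" using pr[OF decode_nat_cube] by simp
  qed
qed

text \<open>The first bound forces the quantum complexity to be large, the second one the number of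
  variables.\<close>

lemma sensitive_nat:
  assumes w: "w \<in> signs W" "\<Phi> w \<ge> \<theta> + \<gamma>" and c: "c > 0" and W: "W \<noteq> {}"
    and q: "quantum_computes (1/3) (card VS) nat_fun K"
  shows "2 ^ b \<le> 144 * K * 2 ^ K" and "2 ^ b \<le> card VS"
proof -
  obtain Z I where Z: "Z \<in> signs VS" "total_fun Z = 1" and I: "I \<subseteq> VS" "card I = 2 ^ b"
    and fl: "\<And>v. v \<in> I \<Longrightarrow> total_fun (Z(v := - Z v)) = 0"
  proof (rule sensitive_input[OF w c W], goal_cases)
    case (1 Z I)
    from 1(2-) show ?case by (rule 1(1))
  qed
  have inj: "inj_on rank I"
  proof (rule inj_onI)
    fix u v assume uv: "u \<in> I" "v \<in> I" "rank u = rank v"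
    have "u = enum (rank u)" by (rule enum_rank[OF subsetD[OF I(1) uv(1)], symmetric])
    also have "\<dots> = enum (rank v)" using uv(3) by (rule arg_cong)
    also have "\<dots> = v" by (rule enum_rank[OF subsetD[OF I(1) uv(2)]])
    finally show "u = v" .
  qed
  show "2 ^ b \<le> card VS" using card_mono[OF finite_VS I(1)] I(2) by simp
  have "card (rank ` I) \<le> 144 * K * 2 ^ K"
  proof (rule quantum_sensitivity[OF q decode_nat_cube[of Z]])
    show "rank ` I \<subseteq> {..<card VS}" using I rank_less by auto
    fix i assume "i \<in> rank ` I"
    then obtain v where v: "v \<in> I" "i = rank v" by blast
    have vV: "v \<in> VS" using v I by blast
    let ?Y = "Z(v := - Z v)"
    have "- Z v \<in> {-1, 1}" using signs_cases[OF Z(1) vV] by auto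
    then have "?Y \<in> insert v VS \<rightarrow>\<^sub>E {-1, 1}" using Z(1) unfolding signs_def by (rule PiE_fun_upd)
    then have Y: "?Y \<in> signs VS" using vV by (simp add: signs_def insert_absorb)
    have "(decode_nat Z)(i := - decode_nat Z i) = decode_nat ?Y"
    proof
      fix k
      have ei: "enum i = v" "i < card VS" using v(2) enum_rank[OF vV] rank_less[OF vV] by simp_all
      show "((decode_nat Z)(i := - decode_nat Z i)) k = decode_nat ?Y k"
      proof (cases "k = i")
        case True
        show ?thesis using signs_cases[OF Z(1) vV] unfolding True
          by (elim disjE) (simp_all add: decode_nat_def ei)
      next
        case False
        have "enum k \<noteq> v" if "k < card VS"
        proof
          assume "enum k = v"
          then have "k = i" using rank_enum[OF that] v(2) by simp
          then show False using False by simp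
        qed
        then show ?thesis using False by (cases "k < card VS") (simp_all add: decode_nat_def)
      qed
    qed
    then show "nat_fun ((decode_nat Z)(i := - decode_nat Z i)) \<noteq> nat_fun (decode_nat Z)"
      using fl[OF v(1)] Z by (simp add: nat_fun_decode Y)
  qed
  then show "2 ^ b \<le> 144 * K * 2 ^ K" using I(2) card_image[OF inj] by simp
qed

end

text \<open>Induction on the number k of unread variables, with the answers of the others recorded
  in z. At k = n it shows that the minimum in \<open>R_err\<close> exists.\<close>

lemma full_tree:
  "k \<le> n \<Longrightarrow> \<exists>t. dtree_vars t \<subseteq> {..<n} \<and> (\<forall>y\<in>cube n. (\<forall>i. k \<le> i \<longrightarrow> i < n \<longrightarrow> y i = z i) \<longrightarrow> dtree_eval t y = f y)"
proof (induction k arbitrary: z)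
  case 0
  have "y = (\<lambda>i\<in>{..<n}. z i)" if "y \<in> cube n" "\<forall>i. 0 \<le> i \<longrightarrow> i < n \<longrightarrow> y i = z i" for y
    by (rule ext) (use that in \<open>auto simp: cube_def PiE_def extensional_def\<close>)
  then show ?case by (intro exI[of _ "dtree.Leaf (f (\<lambda>i\<in>{..<n}. z i))"]) auto
next
  case (Suc k)
  then have k: "k < n" by simp
  obtain l where l: "dtree_vars l \<subseteq> {..<n}" "\<And>y. y \<in> cube n \<Longrightarrow> (\<forall>i. k \<le> i \<longrightarrow> i < n \<longrightarrow> y i = (z(k := -1)) i) \<Longrightarrow> dtree_eval l y = f y"
    using Suc.IH[of "z(k := -1)"] k by auto
  obtain r where r: "dtree_vars r \<subseteq> {..<n}" "\<And>y. y \<in> cube n \<Longrightarrow> (\<forall>i. k \<le> i \<longrightarrow> i < n \<longrightarrow> y i = (z(k := 1)) i) \<Longrightarrow> dtree_eval r y = f y"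
    using Suc.IH[of "z(k := 1)"] k by auto
  have "dtree_eval (Query k l r) y = f y" if y: "y \<in> cube n" and a: "\<forall>i. Suc k \<le> i \<longrightarrow> i < n \<longrightarrow> y i = z i" for y
  proof (cases "y k = -1")
    case True
    have "y i = (z(k := -1)) i" if "k \<le> i" "i < n" for i using a that True by (cases "i = k") auto
    then show ?thesis using True l(2)[OF y] by simp
  next
    case False
    then have "y k = 1" using cube_cases[OF y k] by simp
    then have "y i = (z(k := 1)) i" if "k \<le> i" "i < n" for i using a that by (cases "i = k") auto
    then show ?thesis using False r(2)[OF y] by simp
  qed
  then show ?case using l(1) r(1) k by (intro exI[of _ "Query k l r"]) auto
qed

lemma randomized_R_err: "randomized_computes (1/3) n f (R_err (1/3) n f)"
proof -
  obtain t where t: "dtree_vars t \<subseteq> {..<n}" "\<And>y. y \<in> cube n \<Longrightarrow> dtree_eval t y = f y"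
    using full_tree[of n n "\<lambda>_. 0" f] by auto
  have "randomized_computes (1/3) n f (dtree_depth t)"
    unfolding randomized_computes_def by (intro exI[of _ "return_pmf t"]) (simp add: t)
  then show ?thesis unfolding R_err_def by (rule LeastI)
qed

text \<open>With P = 8 * h^2 the construction has quantum complexity at most x ^ (P + 14 * h) and
  randomized complexity at least x ^ (3 * P - 18 * h). Now (P + 14 * h) * (3 - 8 / h) = 24 * h^2 -
  22 * h - 112, which does not exceed 3 * P - 18 * h; this is where 8 / h comes from.\<close>

theorem separation:
  fixes h B :: nat
  assumes h: "h \<ge> 3"
  shows "\<exists>n f. B < n \<and> f \<in> cube n \<rightarrow> {0, 1} \<and> B \<le> Q_err (1/3) n f \<and>
    real (Q_err (1/3) n f) powr (3 - 8 / real h) \<le> real (R_err (1/3) n f)"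
proof -
  define P where "P = 8 * h^2"
  define m3 where "m3 = 8 * h^2 + 9 * h + 1"
  define A where "A = 4 * real (2 * h + 1)"
  define k where "k = 24 * real (h^2)"
  define K0 where "K0 = 1000 * h * (4 * m3) ^ m3"
  define B0 where "B0 = real (144 * B * 2 ^ B + B + 1)"
  define k1 where "k1 = 16 * A * k + 1 + k + k * (real m3 + 1)"
  \<comment> \<open>A common bound for all constants that x has to dominate. Some of them come
    multiplied by q or q^2 through the sizes of b and c, hence the square in the choice of
    q.\<close>
  define C1 where "C1 = real K0 + B0 + 640 * k + 7 * k1 + 10"
  have h1: "real h \<ge> 3" using h by simp
  have pos: "A \<ge> 1" "k \<ge> 1"
  proof -
    show "A \<ge> 1" by (simp add: A_def)
    have "real (h^2) \<ge> real (3^2)" unfolding of_nat_le_iff using h by (intro power_mono) auto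
    then show "k \<ge> 1" by (simp add: k_def)
  qed
  have k1: "k1 \<ge> 0" using pos by (simp add: k1_def)
  have B0: "B0 \<ge> 0" by (simp only: B0_def of_nat_0_le_iff)
  have parts: "640 * k \<le> C1" "7 * k1 \<le> C1" "real K0 \<le> C1" "B0 \<le> C1" "10 \<le> C1"
    unfolding C1_def using pos k1 B0 of_nat_0_le_iff[of K0, where 'a = real] by linarith+
  have C1: "C1 > 0" using parts(5) by linarith
  have "\<forall>\<^sub>F q in sequentially. C1 * (real q + 1)^2 \<le> 2 ^ q" using C1 by real_asymp
  then have "\<forall>\<^sub>F q in sequentially. C1 * (real q + 1)^2 \<le> 2 ^ q \<and> q \<ge> 1"
    using eventually_ge_at_top[of 1] by (rule eventually_conj)
  then obtain q where q: "C1 * (real q + 1)^2 \<le> 2 ^ q" "q \<ge> 1"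
    unfolding eventually_sequentially by blast
  \<comment> \<open>A power of 2, so that 2 ^ b and 2 ^ c are exact powers of x.\<close>
  define M where "M = (2::nat) ^ q"
  define x where "x = real M"
  have x2: "x = 2 ^ q" by (simp add: x_def M_def)
  let ?y = "(real q + 1)^2"
  have y: "real q \<le> ?y" "1 \<le> ?y" "real q * (real q * real m3 + 1) \<le> (real m3 + 1) * ?y"
    using zero_le_power2[of "real q"] by (simp_all add: power2_eq_square algebra_simps)
  have scale: "u * ?y \<le> x" if "u \<le> C1" for u
  proof -
    have "u * ?y \<le> C1 * ?y" by (rule mult_right_mono[OF that]) simp
    then show ?thesis using q(1) unfolding x2 by linarith
  qed
  have "C1 * 1 \<le> C1 * ?y" using y C1 by (intro mult_left_mono) auto
  then have xC: "C1 \<le> x" using q(1) unfolding x2 by simp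
  have xK: "real K0 \<le> x" "real (144 * B * 2 ^ B + B + 1) \<le> x" "10 \<le> x"
    using xC parts unfolding B0_def by linarith+
  have x1: "x \<ge> 1" "x > 0" using xK(3) by auto
  have hM: "1000 * h * (4 * (8 * h^2 + 9 * h + 1)) ^ (8 * h^2 + 9 * h + 1) \<le> M"
    using xK(1) unfolding x_def K0_def m3_def of_nat_le_iff .
  define N where "N = M ^ (8 * h^2)"
  define L where "L = M ^ (9 * h)"
  define W where "W = positions N h L"
  define V where "V = 1 / x ^ (4 * h)"
  have h2: "h \<ge> 2" using h by simp
  obtain \<Phi> D U where
    g: "gam W (signs W) (signs W) A A (\<lambda>x y. \<Phi> x - \<Phi> y)"
    and D: "distr_on W D" and U: "distr_on W U" and ind: "indist W (M ^ (8 * h^2 - 16 * h)) (5 / x ^ h) D U"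
    and \<eta>D: "(\<Sum>x\<in>signs W. D x * of_bool (\<not> \<Phi> x \<ge> V / 2 + V / 4)) \<le> 64 / x ^ h"
    and \<eta>U: "(\<Sum>x\<in>signs W. U x * of_bool (\<not> \<Phi> x \<le> V / 2 - V / 4)) \<le> 64 / x ^ h"
    unfolding W_def V_def N_def L_def A_def x_def
  proof (rule hard_distribution[OF h2 hM], goal_cases)
    case (1 \<Phi> D U)
    from 1(2-) show ?case by (rule 1(1))
  qed
  \<comment> \<open>The grid side x ^ m3 is at least the number of outer bits and only slightly
    larger than N.\<close>
  define b where "b = q * m3"
  \<comment> \<open>There are x ^ (3 * P) cells, more than the number of queries to be
    excluded.\<close>
  define c where "c = q * (3 * P)"
  have bz: "(2::real) ^ b = x ^ m3" by (simp add: b_def x2 power_mult)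
  have cz: "(2::real) ^ c = x ^ (3 * P)" by (simp add: c_def x2 power_mult)
  have V0: "V / 4 > 0" using x1 by (simp add: V_def)
  have fW: "finite W" by (simp add: W_def finite_positions)
  interpret cheat W c b \<Phi> "V / 2" "V / 4" by unfold_locales (fact fW, fact V0)
  have Npos: "N > 0" "L > 0" by (simp_all add: N_def L_def M_def)
  have W0: "W \<noteq> {}" using Npos by (auto simp: W_def positions_def)
  have c0: "c > 0" using q(2) h by (simp add: c_def P_def)
  have ck: "real c = k * real q" by (simp add: c_def P_def k_def)
  have cW: "real (card W) \<le> x ^ m3"
  proof -
    have "real (2 * h + 1) \<le> real K0"
    proof -
      have "1 \<le> (4 * m3) ^ m3" by (rule one_le_power) (simp add: m3_def)
      then have "1000 * h * 1 \<le> K0" unfolding K0_def by (intro mult_left_mono) auto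
      then show ?thesis using h by simp
    qed
    then have l: "real (2 * h + 1) \<le> x" using xK(1) by linarith
    have "real (card W) = x ^ (9 * h) * real (2 * h + 1) * x ^ (8 * h^2)"
      unfolding W_def card_positions of_nat_mult N_def L_def x_def by simp
    also have "\<dots> \<le> x ^ (9 * h) * x * x ^ (8 * h^2)" using l x1 by (intro mult_right_mono mult_left_mono) auto
    also have "\<dots> = x ^ m3" unfolding m3_def by (simp add: power_add)
    finally show ?thesis .
  qed
  have xh: "x \<le> x ^ h" using power_increasing[of 1 h x] h x1 by simp
  have ch: "640 * real c \<le> x"
  proof -
    have "640 * real c \<le> (640 * k) * ?y" using y pos unfolding ck by simp
    also have "\<dots> \<le> x" by (rule scale[OF parts(1)])
    finally show ?thesis .
  qed
  \<comment> \<open>D has mass 1, and less than 1 of it misses the upper threshold, so some w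
    reaches it; w is the starting point for the sensitive input.\<close>
  obtain w where w: "w \<in> signs W" "\<Phi> w \<ge> V / 2 + V / 4"
  proof (rule ccontr)
    note wit = that
    assume nt: "\<not> thesis"
    have "\<not> \<Phi> w \<ge> V / 2 + V / 4" if w: "w \<in> signs W" for w
      using wit[OF w] nt by blast
    then have "(\<Sum>x\<in>signs W. D x * of_bool (\<not> \<Phi> x \<ge> V / 2 + V / 4)) = (\<Sum>x\<in>signs W. D x)"
      by (intro sum.cong refl) simp
    then have "1 \<le> 64 / x ^ h" using \<eta>D D by (simp add: distr_on_def)
    moreover have "real c \<ge> 1" using c0 by simp
    ultimately show False using ch xh x1 by (simp add: field_simps)
  qed
  define n where "n = card VS"
  define Qv where "Qv = real c * (2 * (A * (2 * 2 ^ b) / (V / 4))) + ((1 + real c * real (card W)) + sqrt (real c * real (card W) * 2 ^ b * (real b + 1) * (real b + 1)))"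
  have "gam VS ones zeros Qv Qv (\<lambda>_ _. 1)"
    unfolding Qv_def by (rule gam_total[OF _ g c0 W0]) (use pos in simp)
  then have gn: "gam {..<n} (sgn_of n ` {x\<in>cube n. nat_fun x = 1}) (sgn_of n ` {x\<in>cube n. nat_fun x = 0}) Qv Qv (\<lambda>_ _. 1)"
    unfolding n_def by (rule gam_nat)
  \<comment> \<open>The main term z * v is 2 ^ b divided by V. The remaining factors, polynomial in
    q, are collected in E and cost one further x.\<close>
  have Qle: "6 * Qv + 1 \<le> x ^ (P + 14 * h)" and Q0: "Qv > 0"
  proof -
    define z where "z = x ^ m3"
    have z1: "z \<ge> 1" using x1 by (simp add: z_def)
    define v where "v = x ^ (4 * h)"
    have v1: "v \<ge> 1" using x1 by (simp add: v_def)
    have c1: "real c \<ge> 1" using c0 by simp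
    have nz: "real (card W) \<le> z" using cW by (simp add: z_def)
    have "real c * real (card W) * z * (real b + 1) * (real b + 1) \<le> (real c * z * (real b + 1))\<^sup>2"
    proof -
      have "real c * real (card W) * (z * (real b + 1) * (real b + 1)) \<le> real c * (real c * z) * (z * (real b + 1) * (real b + 1))"
      proof (rule mult_right_mono, rule mult_left_mono)
        show "real (card W) \<le> real c * z" using nz c1 z1 mult_right_mono[of 1 "real c" z] by linarith
      qed (use z1 in auto)
      then show ?thesis by (simp add: power2_eq_square ac_simps)
    qed
    then have sq: "sqrt (real c * real (card W) * z * (real b + 1) * (real b + 1)) \<le> real c * z * (real b + 1)"
      using c1 z1 by (intro real_le_lsqrt) auto
    have first: "real c * (2 * (A * (2 * z) / (V / 4))) = 16 * A * real c * (z * v)"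
      using x1 by (simp add: V_def v_def)
    have zv: "z \<le> z * v" "1 \<le> z * v"
    proof -
      show "z \<le> z * v" using z1 v1 mult_left_mono[of 1 v z] by simp
      then show "1 \<le> z * v" using z1 by linarith
    qed
    have cn: "real c * real (card W) \<le> real c * (z * v)" using nz zv c1 by (intro mult_left_mono) auto
    have cb: "real c * z * (real b + 1) \<le> real c * (real b + 1) * (z * v)"
    proof -
      have "real c * (real b + 1) * z \<le> real c * (real b + 1) * (z * v)" using zv c1 by (intro mult_left_mono) auto
      then show ?thesis by (simp add: ac_simps)
    qed
    define E where "E = 16 * A * real c + 1 + real c + real c * (real b + 1)"
    have QE: "Qv \<le> E * (z * v)"
      unfolding Qv_def bz z_def[symmetric] first E_def using sq cn cb zv by (simp add: algebra_simps)
    have E7: "7 * E \<le> x"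
    proof -
      have bq: "real c * (real b + 1) = k * (real q * (real q * real m3 + 1))" by (simp add: ck b_def)
      have "k * (real q * (real q * real m3 + 1)) \<le> k * ((real m3 + 1) * ?y)" using y pos by (intro mult_left_mono) auto
      moreover have "16 * A * (k * real q) \<le> 16 * A * (k * ?y)" using y pos by (intro mult_left_mono) auto
      moreover have "k * real q \<le> k * ?y" using y pos by (intro mult_left_mono) auto
      ultimately have "E \<le> 16 * A * (k * ?y) + ?y + k * ?y + k * ((real m3 + 1) * ?y)"
        unfolding E_def bq unfolding ck using y(2) by linarith
      also have "\<dots> = k1 * ?y" unfolding k1_def by (simp only: distrib_right mult.assoc mult_1)
      finally have "7 * E \<le> (7 * k1) * ?y" by simp
      also have "\<dots> \<le> x" by (rule scale[OF parts(2)])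
      finally show ?thesis .
    qed
    have E1: "E \<ge> 1" using c1 pos by (simp add: E_def)
    have "1 * 1 \<le> E * (z * v)" using E1 zv by (intro mult_mono) auto
    then have "6 * Qv + 1 \<le> (7 * E) * (z * v)" using QE by simp
    also have "\<dots> \<le> x * (z * v)" using E7 zv by (intro mult_right_mono) auto
    also have "\<dots> = x ^ (1 + m3 + 4 * h)" by (simp add: z_def v_def power_add)
    also have "\<dots> \<le> x ^ (P + 14 * h)" using x1 h by (intro power_increasing) (auto simp: m3_def P_def)
    finally show "6 * Qv + 1 \<le> x ^ (P + 14 * h)" .
    have "0 \<le> sqrt (real c * real (card W) * z * (real b + 1) * (real b + 1))" using z1 by (intro real_sqrt_ge_zero) auto
    moreover have "0 \<le> 16 * A * real c * (z * v)" using pos zv by simp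
    ultimately show "Qv > 0" unfolding Qv_def bz z_def[symmetric] first by (simp add: add_nonneg_pos add_pos_nonneg)
  qed
  define K where "K = nat \<lceil>6 * Qv\<rceil>"
  have K: "real K \<ge> 6 * Qv" "K > 0" "real K \<le> 6 * Qv + 1"
  proof -
    show "real K \<ge> 6 * Qv" unfolding K_def by (rule real_nat_ceiling_ge)
    then show "K > 0" using Q0 by (cases "K = 0") auto
    have "0 \<le> \<lceil>6 * Qv\<rceil>" using Q0 by simp
    then show "real K \<le> 6 * Qv + 1" unfolding K_def using ceiling_correct[of "6 * Qv"] by simp
  qed
  have "quantum_computes (1/3) n nat_fun K"
    by (rule quantum_of_gam[OF nat_fun_range[folded n_def] gn K(1) K(2)])
  then have qc: "quantum_computes (1/3) n nat_fun (Q_err (1/3) n nat_fun)" and QK: "Q_err (1/3) n nat_fun \<le> K"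
    unfolding Q_err_def by (rule LeastI, rule Least_le)
  have s: "2 ^ b \<le> 144 * Q_err (1/3) n nat_fun * 2 ^ Q_err (1/3) n nat_fun" "2 ^ b \<le> n"
    using sensitive_nat[OF w c0 W0 qc[unfolded n_def]] unfolding n_def by auto
  have bB: "144 * B * 2 ^ B + B + 1 \<le> 2 ^ b"
  proof -
    have "x ^ 1 \<le> x ^ m3" using x1 by (intro power_increasing) (auto simp: m3_def)
    then have "real (144 * B * 2 ^ B + B + 1) \<le> real (2 ^ b)" using xK(2) bz by simp
    then show ?thesis unfolding of_nat_le_iff .
  qed
  have nB: "B < n" using bB s(2) by simp
  have QB: "B \<le> Q_err (1/3) n nat_fun"
  proof (rule ccontr)
    assume "\<not> ?thesis"
    then have l: "Q_err (1/3) n nat_fun \<le> B" by simp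
    have "144 * Q_err (1/3) n nat_fun * 2 ^ Q_err (1/3) n nat_fun \<le> 144 * B * 2 ^ B"
      using l by (intro mult_mono power_increasing) auto
    then show False using s(1) bB by simp
  qed
  have Rlow: "x ^ (3 * P - 18 * h) \<le> real (R_err (1/3) n nat_fun)"
  proof (rule ccontr)
    let ?T = "R_err (1/3) n nat_fun"
    assume "\<not> ?thesis"
    then have T: "real ?T \<le> x ^ (3 * P - 18 * h)" by simp
    obtain p where p: "\<And>t. t \<in> set_pmf p \<Longrightarrow> trvars t \<subseteq> VS \<and> dep t \<le> ?T"
      and pr: "\<And>Z. Z \<in> signs VS \<Longrightarrow> measure_pmf.prob p {t. ev t Z = total_fun Z} \<ge> 2/3"
    proof (rule randomized_transfer[OF randomized_R_err], goal_cases)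
      case (1 p)
      show ?case by (rule 1(1)) (use 1(2,3) in \<open>simp_all only: n_def\<close>)
    qed
    \<comment> \<open>The intermediate depth, counted in row bits. Each layer of hiding raises the
      depth by the factor x ^ (P - h), where the x ^ h given up keeps its error at 4 / x ^
      h.\<close>
    define d1 where "d1 = M ^ (2 * P - 17 * h)"
    define d where "d = M ^ (8 * h^2 - 16 * h)"
    define \<delta> where "\<delta> = 5 / x ^ h + 4 * real d1 / (2 ^ b * real (Suc d)) + 4 * real ?T / (2 ^ b * real (Suc d1))"
    have i: "indist V3 ?T \<delta> (bury D) (bury U)"
      unfolding \<delta>_def d_def by (rule bury_indist[OF D U ind])
    have \<delta>0: "\<delta> \<ge> 0" using x1 by (simp add: \<delta>_def)
    have hh: "9 * h \<le> 3 * h^2" using h by (simp add: power2_eq_square)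
    then have hP: "24 * h \<le> P" unfolding P_def by simp
    have xd: "real d = x ^ (P - 16 * h)" "real d1 = x ^ (2 * P - 17 * h)" by (simp_all add: d_def d1_def x_def P_def)
    have frac: "4 * u / (2 ^ b * real (Suc e)) \<le> 4 / x ^ h" if "0 \<le> u" "u \<le> x ^ i" "real e = x ^ j" "i + h \<le> m3 + j" for u e i j
    proof -
      have "u * x ^ h \<le> x ^ i * x ^ h" using that(2) x1 by (intro mult_right_mono) auto
      also have "\<dots> \<le> x ^ (m3 + j)" unfolding power_add[symmetric] using x1 that(4) by (intro power_increasing) auto
      also have "\<dots> \<le> 2 ^ b * real (Suc e)" unfolding bz power_add using that(3) x1 by (intro mult_left_mono) auto
      finally have le: "u * x ^ h \<le> 2 ^ b * real (Suc e)" .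
      define s where "s = 2 ^ b * real (Suc e)"
      have s: "s > 0" by (simp add: s_def del: of_nat_Suc)
      have "u \<le> s / x ^ h" using le x1 unfolding s_def[symmetric] by (simp add: pos_le_divide_eq)
      then have "4 * u \<le> 4 / x ^ h * s" by simp
      then show ?thesis unfolding s_def[symmetric] pos_divide_le_eq[OF s] .
    qed
    have "4 * real d1 / (2 ^ b * real (Suc d)) \<le> 4 / x ^ h"
      by (rule frac[where i = "2 * P - 17 * h" and j = "P - 16 * h"]) (use xd hP in \<open>auto simp: m3_def P_def\<close>)
    moreover have "4 * real ?T / (2 ^ b * real (Suc d1)) \<le> 4 / x ^ h"
      by (rule frac[where i = "3 * P - 18 * h" and j = "2 * P - 17 * h"]) (use xd hP T in \<open>auto simp: m3_def P_def\<close>)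
    ultimately have \<delta>le: "\<delta> \<le> 13 / x ^ h" unfolding \<delta>_def by simp
    have m1: "2 ^ c * (1 - real c * (64 / x ^ h)) / 3 \<le> real ?T + 2 ^ c * (real c * \<delta>)"
      using randomized_lower[OF D U i \<eta>D \<eta>U \<delta>0 p pr] by (simp only: mult.assoc)
    have c10: "real c * (64 / x ^ h) \<le> 1 / 10"
    proof -
      have "real c * 640 \<le> x ^ h" using ch xh by linarith
      then show ?thesis using x1 by (simp add: field_simps)
    qed
    have c\<delta>: "real c * \<delta> \<le> 1 / 10"
    proof -
      have "13 / x ^ h \<le> 64 / x ^ h" using x1 by (intro divide_right_mono) auto
      then have "\<delta> \<le> 64 / x ^ h" using \<delta>le by linarith
      then have "real c * \<delta> \<le> real c * (64 / x ^ h)" by (rule mult_left_mono) simp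
      then show ?thesis using c10 by linarith
    qed
    have m2: "real ?T \<le> 2 ^ c / 10"
    proof -
      have "x ^ (3 * P - 18 * h) * 10 \<le> x ^ (3 * P - 18 * h) * x" using xK(3) x1 by (intro mult_left_mono) auto
      also have "\<dots> = x ^ Suc (3 * P - 18 * h)" by simp
      also have "\<dots> \<le> x ^ (3 * P)" using x1 hP h by (intro power_increasing) auto
      finally show ?thesis using T unfolding cz by simp
    qed
    define t where "t = (2::real) ^ c"
    have t: "t > 0" by (simp add: t_def)
    have m3: "t * (real c * \<delta>) \<le> t * (1 / 10)" by (rule mult_left_mono[OF c\<delta>]) (use t in simp)
    have "9 / 10 \<le> 1 - real c * (64 / x ^ h)" using c10 by linarith
    then have m4: "t * (9 / 10) \<le> t * (1 - real c * (64 / x ^ h))" by (rule mult_left_mono) (use t in simp)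
    \<comment> \<open>In units of 2 ^ c, at least 3/10 stands on the left of \<open>m1\<close> and
      at most 1/10 + 1/10 on the right.\<close>
    show False using m1 m2 m3 m4 t unfolding t_def[symmetric] by linarith
  qed
  have "real (Q_err (1/3) n nat_fun) \<le> x ^ (P + 14 * h)"
  proof -
    have "real (Q_err (1/3) n nat_fun) \<le> real K" using QK by simp
    then show ?thesis using K(3) Qle by linarith
  qed
  then have "real (Q_err (1/3) n nat_fun) powr (3 - 8 / real h) \<le> (x ^ (P + 14 * h)) powr (3 - 8 / real h)"
    using h1 by (intro powr_mono2) (auto simp: field_simps)
  also have "\<dots> = x powr (real (P + 14 * h) * (3 - 8 / real h))"
    using x1 by (simp add: powr_realpow[symmetric] powr_powr)
  also have "\<dots> \<le> x powr (real (3 * P - 18 * h))"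
  proof (rule powr_mono)
    have "18 * h \<le> 3 * P" using h by (simp add: P_def power2_eq_square)
    then have "real (3 * P - 18 * h) = 24 * (real h * real h) - 18 * real h" by (simp add: of_nat_diff P_def power2_eq_square)
    moreover have "real (P + 14 * h) * (3 - 8 / real h) = 24 * (real h * real h) - 22 * real h - 112"
      using h1 by (simp add: P_def power2_eq_square field_simps)
    ultimately show "real (P + 14 * h) * (3 - 8 / real h) \<le> real (3 * P - 18 * h)" using h1 by simp
  qed (use x1 in simp)
  also have "\<dots> = x ^ (3 * P - 18 * h)" using x1 by (simp add: powr_realpow)
  finally have "real (Q_err (1/3) n nat_fun) powr (3 - 8 / real h) \<le> real (R_err (1/3) n nat_fun)" using Rlow by linarith
  then show ?thesis using nB QB nat_fun_range[folded n_def] by blast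
qed

text \<open>The m-th function uses h = m + 3, and B in \<open>separation\<close> does two things: it
  makes the numbers of variables increase strictly and the quantum complexity at least m. That the
  latter is unbounded belongs to the claim, since a family with quantum complexity 1 and positive
  randomized complexity would satisfy the inequality trivially.\<close>

theorem theorem1p4:
  shows "\<exists>(N :: nat set) (f :: nat \<Rightarrow> (nat \<Rightarrow> int) \<Rightarrow> nat) (\<delta> :: nat \<Rightarrow> real).
    infinite N \<and>
    (\<forall>n\<in>N. f n \<in> cube n \<rightarrow> {0, 1}) \<and>
    filterlim (\<lambda>n. Q_err (1/3) n (f n)) at_top (inf at_top (principal N)) \<and>
    \<delta> \<in> o(\<lambda>_. 1) \<and>
    (\<forall>n\<in>N. real (R_err (1/3) n (f n)) \<ge> real (Q_err (1/3) n (f n)) powr (3 - \<delta> n))"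
proof -
  define P where "P = (\<lambda>m (n, f). f \<in> cube n \<rightarrow> {0, 1} \<and> m \<le> Q_err (1/3) n f \<and>
    real (Q_err (1/3) n f) powr (3 - 8 / real (m + 3)) \<le> real (R_err (1/3) n f))"
  have ex: "\<exists>nf. P m nf \<and> B < fst nf" for m B
  proof -
    obtain n f where nf: "max B m < n" "f \<in> cube n \<rightarrow> {0, 1}" "max B m \<le> Q_err (1/3) n f"
      "real (Q_err (1/3) n f) powr (3 - 8 / real (m + 3)) \<le> real (R_err (1/3) n f)"
      using separation[of "m + 3" "max B m"] by auto
    then show ?thesis by (intro exI[of _ "(n, f)"]) (simp add: P_def)
  qed
  have "\<exists>g. \<forall>m. P m (g m) \<and> fst (g m) < fst (g (Suc m))"
  proof (rule dependent_nat_choice)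
    show "\<exists>nf. P 0 nf" using ex[of 0 0] by (elim exE conjE) (rule exI)
    show "\<exists>nf'. P (Suc m) nf' \<and> fst nf < fst nf'" for nf m by (rule ex)
  qed
  then obtain g where gg: "\<forall>m. P m (g m) \<and> fst (g m) < fst (g (Suc m))" by (rule exE)
  have g: "P m (g m)" "fst (g m) < fst (g (Suc m))" for m using gg by simp_all
  define n where "n = (\<lambda>m. fst (g m))"
  have mono: "strict_mono n" unfolding n_def by (rule strict_monoI_Suc) (rule g)
  then have inj: "inj n" by (rule strict_mono_imp_inj_on)
  define N where "N = range n"
  define f where "f = (\<lambda>j. snd (g (inv_into UNIV n j)))"
  \<comment> \<open>The value 0 outside of N makes \<delta> vanish along all numbers, as the o(1)
    statement requires.\<close>
  define \<delta> where "\<delta> = (\<lambda>j. if j \<in> N then 8 / real (inv_into UNIV n j + 3) else 0)"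
  have fn: "f (n m) = snd (g m)" and \<delta>n: "\<delta> (n m) = 8 / real (m + 3)" for m
    by (simp_all add: f_def \<delta>_def N_def inv_f_f[OF inj])
  have props: "f (n m) \<in> cube (n m) \<rightarrow> {0, 1}" "m \<le> Q_err (1/3) (n m) (f (n m))"
    "real (Q_err (1/3) (n m) (f (n m))) powr (3 - \<delta> (n m)) \<le> real (R_err (1/3) (n m) (f (n m)))" for m
    using g(1)[of m] unfolding fn \<delta>n by (simp_all add: P_def n_def case_prod_beta)
  have late: "m \<le> m'" if "n m \<le> n m'" for m m' using that mono by (simp add: strict_mono_less_eq)
  have "filterlim (\<lambda>j. Q_err (1/3) j (f j)) at_top (inf at_top (principal N))"
    unfolding filterlim_at_top eventually_inf_principal
  proof
    fix Z
    show "\<forall>\<^sub>F j in sequentially. j \<in> N \<longrightarrow> Z \<le> Q_err (1/3) j (f j)"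
      unfolding eventually_sequentially
    proof (intro exI[of _ "n Z"] allI impI)
      fix j assume j: "n Z \<le> j" "j \<in> N"
      then obtain m where m: "j = n m" by (auto simp: N_def)
      then show "Z \<le> Q_err (1/3) j (f j)" using late[of Z m] props(2)[of m] j by simp
    qed
  qed
  moreover have "\<delta> \<in> o(\<lambda>_. 1)"
  proof (rule smalloI_tendsto)
    have "\<delta> \<longlonglongrightarrow> 0"
    proof (rule LIMSEQ_I)
      fix r :: real assume r: "r > 0"
      obtain Z :: nat where Z: "8 / r < real Z" using reals_Archimedean2 by blast
      show "\<exists>no. \<forall>j\<ge>no. norm (\<delta> j - 0) < r"
      proof (intro exI[of _ "n Z"] allI impI)
        fix j assume j: "n Z \<le> j"
        show "norm (\<delta> j - 0) < r"
        proof (cases "j \<in> N")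
          case True
          then obtain m where m: "j = n m" by (auto simp: N_def)
          then have "8 / r < real (m + 3)" using late[of Z m] j Z by simp
          then show ?thesis unfolding m \<delta>n using r by (simp add: field_simps)
        next
          case False
          then have "\<delta> j = 0" by (simp only: \<delta>_def if_False)
          then show ?thesis using r by simp
        qed
      qed
    qed
    then show "((\<lambda>j. \<delta> j / 1) \<longlongrightarrow> 0) at_top" by (simp only: div_by_1)
    show "\<forall>\<^sub>F j in at_top. (1 :: real) \<noteq> 0" by (rule always_eventually) simp
  qed
  moreover have "infinite N" unfolding N_def using inj by (rule range_inj_infinite)
  moreover have "\<forall>j\<in>N. f j \<in> cube j \<rightarrow> {0, 1}" unfolding N_def by (rule ballI, erule rangeE, hypsubst, rule props(1))
  moreover have "\<forall>j\<in>N. real (R_err (1/3) j (f j)) \<ge> real (Q_err (1/3) j (f j)) powr (3 - \<delta> j)"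
    unfolding N_def by (rule ballI, erule rangeE, hypsubst, rule props(3))
  ultimately show ?thesis by (intro exI[of _ N] exI[of _ f] exI[of _ \<delta>] conjI)
qed

end
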